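(* Let $k\ge 1$ and $n\ge 5k+3$ be integers. If $\Delta_n^k$ embeds into a $2k$-manifold $M$, then $$\beta_k(M)\ \ge\ \frac{(n-4k-2)^2}{2^k(k+1)^2}.$$ In particular, $\beta_k(M)\gtrsim \frac{n^2}{2^k(k+1)^2}$ as $n\to\infty$ for fixed $k\ge1$.
   Context: $\Delta_n^k$ denotes the union of the $k$-dimensional faces of the $n$-dimensional simplex. Manifolds are piecewise linear (PL) and may have non-empty boundary; embeddings are PL. For a $2k$-manifold $M$, $\beta_k(M):=\dim_{\mathbb{Z}_2} H_k(M;\mathbb{Z}_2)$. *)

theory Defs
  imports "HOL-Analysis.Analysis" "HOL-Homology.Homology" "HOL-Library.Extended_Real"
begin

section \<open>Piecewise linear maps between subsets of coordinate space\<close>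

text \<open>
  As in HOL-Homology, points of real coordinate space (of any finite dimension) are functions
  \<^typ>\<open>nat \<Rightarrow> real\<close> that vanish from some index on.
\<close>

definition lin_comb :: "('b \<Rightarrow> real) \<Rightarrow> 'b set \<Rightarrow> ('b \<Rightarrow> nat \<Rightarrow> real) \<Rightarrow> nat \<Rightarrow> real"
  where "lin_comb u V g = (\<lambda>i. \<Sum>v\<in>V. u v * g v i)"

definition convex_weights :: "'b set \<Rightarrow> ('b \<Rightarrow> real) \<Rightarrow> bool"
  where "convex_weights V u \<longleftrightarrow> (\<forall>v\<in>V. 0 \<le> u v) \<and> sum u V = 1"

definition pl_polytope :: "(nat \<Rightarrow> real) set \<Rightarrow> (nat \<Rightarrow> real) set"
  where "pl_polytope V = {lin_comb u V (\<lambda>v. v) | u. convex_weights V u}"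

definition affine_on_polytope ::
    "(nat \<Rightarrow> real) set \<Rightarrow> ((nat \<Rightarrow> real) \<Rightarrow> nat \<Rightarrow> real) \<Rightarrow> bool"
  where "affine_on_polytope V f \<longleftrightarrow>
    (\<forall>u. convex_weights V u \<longrightarrow> f (lin_comb u V (\<lambda>v. v)) = lin_comb u V f)"

text \<open>
  \<open>pl_on S f\<close>: every point of \<open>S\<close> has a neighbourhood in \<open>S\<close> that is covered by finitely many
  compact convex polytopes lying in \<open>S\<close>, on each of which \<open>f\<close> is affine.
  This forces \<open>S\<close> to be a (not necessarily compact) polyhedron and \<open>f\<close> to be continuous on \<open>S\<close>.
\<close>

definition pl_on :: "(nat \<Rightarrow> real) set \<Rightarrow> ((nat \<Rightarrow> real) \<Rightarrow> nat \<Rightarrow> real) \<Rightarrow> bool"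
  where "pl_on S f \<longleftrightarrow>
    (\<forall>x\<in>S. \<exists>\<C> N. finite \<C>
       \<and> (\<forall>V\<in>\<C>. finite V \<and> pl_polytope V \<subseteq> S \<and> affine_on_polytope V f)
       \<and> openin (subtopology (powertop_real UNIV) S) N
       \<and> x \<in> N \<and> N \<subseteq> (\<Union>V\<in>\<C>. pl_polytope V))"


section \<open>PL manifolds, possibly with boundary\<close>

definition half_space :: "nat \<Rightarrow> (nat \<Rightarrow> real) topology"
  where "half_space d = subtopology (Euclidean_space d) {x. 0 \<le> x 0}"

type_synonym 'a chart = "'a set \<times> ('a \<Rightarrow> nat \<Rightarrow> real)"

definition manifold_chart :: "nat \<Rightarrow> 'a topology \<Rightarrow> 'a chart \<Rightarrow> bool"
  where "manifold_chart d X = (\<lambda>(U, \<phi>).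
    openin X U \<and> openin (half_space d) (\<phi> ` U) \<and>
    homeomorphic_map (subtopology X U) (subtopology (half_space d) (\<phi> ` U)) \<phi>)"

definition pl_atlas :: "nat \<Rightarrow> 'a topology \<Rightarrow> 'a chart set \<Rightarrow> bool"
  where "pl_atlas d X \<A> \<longleftrightarrow>
    (\<forall>c\<in>\<A>. manifold_chart d X c) \<and>
    (\<Union>(U, \<phi>)\<in>\<A>. U) = topspace X \<and>
    (\<forall>(U, \<phi>)\<in>\<A>. \<forall>(V, \<psi>)\<in>\<A>. pl_on (\<phi> ` (U \<inter> V)) (\<lambda>y. \<psi> (inv_into U \<phi> y)))"

text \<open>
  The atlas need not be maximal: passing to the maximal one does not change which maps into
  the manifold are PL.  The manifold need be neither compact nor connected.
\<close>

definition pl_manifold :: "nat \<Rightarrow> 'a topology \<Rightarrow> 'a chart set \<Rightarrow> bool"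
  where "pl_manifold d X \<A> \<longleftrightarrow> Hausdorff_space X \<and> second_countable X \<and> pl_atlas d X \<A>"

definition pl_embedding ::
    "(nat \<Rightarrow> real) set \<Rightarrow> 'a topology \<Rightarrow> 'a chart set \<Rightarrow> ((nat \<Rightarrow> real) \<Rightarrow> 'a) \<Rightarrow> bool"
  where "pl_embedding S X \<A> f \<longleftrightarrow>
    embedding_map (subtopology (powertop_real UNIV) S) X f \<and>
    (\<forall>(U, \<phi>)\<in>\<A>. pl_on {x \<in> S. f x \<in> U} (\<lambda>x. \<phi> (f x)))"

definition pl_embeds :: "(nat \<Rightarrow> real) set \<Rightarrow> 'a topology \<Rightarrow> 'a chart set \<Rightarrow> bool"
  where "pl_embeds S X \<A> \<longleftrightarrow> (\<exists>f. pl_embedding S X \<A> f)"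


section \<open>The union of the \<open>k\<close>-dimensional faces of the \<open>n\<close>-simplex\<close>

definition simplex_skeleton :: "nat \<Rightarrow> nat \<Rightarrow> (nat \<Rightarrow> real) set"
  where "simplex_skeleton n k =
    (\<Union>I\<in>{I. I \<subseteq> {..n} \<and> card I = Suc k}. {x \<in> standard_simplex n. \<forall>i. i \<notin> I \<longrightarrow> x i = 0})"


section \<open>Singular homology with coefficients in the field of two elements\<close>

text \<open>
  The homology of the complex \<open>C / 2C\<close>, where \<open>C\<close> is the complex of integral singular chains.
  Classes in \<open>C / 2C\<close> are handled through integral representatives, in the same way as
  \<^const>\<open>relative_homology_group\<close> handles classes of chains modulo those of a subspace: a mod 2 cycle
  has its boundary in \<open>2C\<close>, and a mod 2 boundary is a boundary up to an element of \<open>2C\<close>.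
\<close>

definition mod2_cycle :: "nat \<Rightarrow> 'a topology \<Rightarrow> 'a chain \<Rightarrow> bool"
  where "mod2_cycle p X c \<longleftrightarrow> singular_chain p X c \<and>
    (\<exists>e. singular_chain (p - 1) X e \<and> chain_boundary p c = frag_cmul 2 e)"

definition mod2_boundary :: "nat \<Rightarrow> 'a topology \<Rightarrow> 'a chain \<Rightarrow> bool"
  where "mod2_boundary p X c \<longleftrightarrow>
    (\<exists>d e. singular_chain (Suc p) X d \<and> singular_chain p X e \<and>
           c = chain_boundary (Suc p) d + frag_cmul 2 e)"

definition mod2_cycle_group :: "nat \<Rightarrow> 'a topology \<Rightarrow> 'a chain monoid"
  where "mod2_cycle_group p X =
    subgroup_generated (chain_group p X) (Collect (mod2_cycle p X))"

definition mod2_homology_group :: "nat \<Rightarrow> 'a topology \<Rightarrow> 'a chain set monoid"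
  where "mod2_homology_group p X = mod2_cycle_group p X Mod Collect (mod2_boundary p X)"

text \<open>
  An abelian group of exponent two is a vector space over the field of two elements in exactly
  one way, and the nonzero linear combinations of a finite set are the products (sums, in additive
  notation) of its nonempty subsets.  The dimension takes the value \<open>\<infinity>\<close> if there are arbitrarily
  large finite independent sets; this can happen for the homology of a noncompact manifold.
\<close>

definition Z2_independent :: "('g, 'h) monoid_scheme \<Rightarrow> 'g set \<Rightarrow> bool"
  where "Z2_independent G S \<longleftrightarrow> finite S \<and> S \<subseteq> carrier G \<and>
    (\<forall>T\<subseteq>S. finprod G (\<lambda>x. x) T = \<one>\<^bsub>G\<^esub> \<longrightarrow> T = {})"

definition Z2_dim :: "('g, 'h) monoid_scheme \<Rightarrow> enat"
  where "Z2_dim G = (SUP S\<in>Collect (Z2_independent G). enat (card S))"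

definition mod2_betti :: "nat \<Rightarrow> 'a topology \<Rightarrow> enat"
  where "mod2_betti p X = Z2_dim (mod2_homology_group p X)"

lemma frag_cmul_uminus: "frag_cmul n (- e) = - frag_cmul n e"
  by (intro poly_mapping_eqI) simp

lemma mod2_cycle_subgroup: "subgroup (Collect (mod2_cycle p X)) (chain_group p X)"
proof
  show "Collect (mod2_cycle p X) \<subseteq> carrier (chain_group p X)"
    by (auto simp: mod2_cycle_def)
  show "x \<otimes>\<^bsub>chain_group p X\<^esub> y \<in> Collect (mod2_cycle p X)"
    if "x \<in> Collect (mod2_cycle p X)" "y \<in> Collect (mod2_cycle p X)" for x y
    using that unfolding mod2_cycle_def mem_Collect_eq mult_chain_group
    by (metis chain_boundary_add frag_cmul_distrib2 singular_chain_add)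
  show "\<one>\<^bsub>chain_group p X\<^esub> \<in> Collect (mod2_cycle p X)"
    by (auto simp: mod2_cycle_def intro: exI [of _ 0])
  show "inv\<^bsub>chain_group p X\<^esub> x \<in> Collect (mod2_cycle p X)"
    if x: "x \<in> Collect (mod2_cycle p X)" for x
  proof -
    obtain e where e: "singular_chain p X x" "singular_chain (p - 1) X e"
        "chain_boundary p x = frag_cmul 2 e"
      using x by (auto simp: mod2_cycle_def)
    then have "inv\<^bsub>chain_group p X\<^esub> x = - x"
      by (simp add: singular_chain_def)
    moreover have "chain_boundary p (- x) = frag_cmul 2 (- e)"
      using e by (simp add: chain_boundary_minus frag_cmul_uminus)
    ultimately show ?thesis
      using e(1,2) unfolding mod2_cycle_def mem_Collect_eq by (metis singular_chain_minus)
  qed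
qed

lemma carrier_mod2_cycle_group [simp]:
  "carrier (mod2_cycle_group p X) = Collect (mod2_cycle p X)"
  unfolding mod2_cycle_group_def
  by (rule subgroup.carrier_subgroup_generated_subgroup [OF mod2_cycle_subgroup])

lemma mult_mod2_cycle_group [simp]: "(\<otimes>\<^bsub>mod2_cycle_group p X\<^esub>) = (+)"
  by (simp add: mod2_cycle_group_def)

lemma comm_group_mod2_cycle_group: "comm_group (mod2_cycle_group p X)"
  unfolding mod2_cycle_group_def
  by (rule group.abelian_subgroup_generated [OF group_chain_group abelian_chain_group])

lemma mod2_boundary_imp_cycle:
  assumes "mod2_boundary p X c"
  shows "mod2_cycle p X c"
proof -
  obtain d e where de: "singular_chain (Suc p) X d" "singular_chain p X e"
      "c = chain_boundary (Suc p) d + frag_cmul 2 e"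
    using assms by (auto simp: mod2_boundary_def)
  have "chain_boundary p c = frag_cmul 2 (chain_boundary p e)"
    unfolding de(3) chain_boundary_add chain_boundary_cmul chain_boundary_boundary_alt [OF de(1)]
    by simp
  moreover have "singular_chain p X c"
    unfolding de(3)
    by (intro singular_chain_add singular_chain_boundary_alt singular_chain_cmul de)
  moreover have "singular_chain (p - 1) X (chain_boundary p e)"
    using singular_chain_boundary [OF de(2)] by simp
  ultimately show ?thesis
    unfolding mod2_cycle_def by blast
qed

lemma mod2_boundary_subgroup: "subgroup (Collect (mod2_boundary p X)) (mod2_cycle_group p X)"
proof -
  have "subgroup (Collect (mod2_boundary p X)) (chain_group p X)"
  proof
    show "Collect (mod2_boundary p X) \<subseteq> carrier (chain_group p X)"
      using mod2_boundary_imp_cycle by (auto simp: mod2_cycle_def)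
    show "x \<otimes>\<^bsub>chain_group p X\<^esub> y \<in> Collect (mod2_boundary p X)"
      if xy: "x \<in> Collect (mod2_boundary p X)" "y \<in> Collect (mod2_boundary p X)" for x y
    proof -
      obtain d e d' e' where "singular_chain (Suc p) X d" "singular_chain p X e"
          "x = chain_boundary (Suc p) d + frag_cmul 2 e"
          "singular_chain (Suc p) X d'" "singular_chain p X e'"
          "y = chain_boundary (Suc p) d' + frag_cmul 2 e'"
        using xy by (auto simp: mod2_boundary_def)
      then have "singular_chain (Suc p) X (d + d')" "singular_chain p X (e + e')"
          "x + y = chain_boundary (Suc p) (d + d') + frag_cmul 2 (e + e')"
        by (auto simp: singular_chain_add chain_boundary_add frag_cmul_distrib2)
      then show ?thesis
        unfolding mod2_boundary_def mem_Collect_eq mult_chain_group by blast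
    qed
    show "\<one>\<^bsub>chain_group p X\<^esub> \<in> Collect (mod2_boundary p X)"
      unfolding mod2_boundary_def by (force intro: exI [of _ 0])
    show "inv\<^bsub>chain_group p X\<^esub> x \<in> Collect (mod2_boundary p X)"
      if x: "x \<in> Collect (mod2_boundary p X)" for x
    proof -
      obtain d e where "singular_chain (Suc p) X d" "singular_chain p X e"
          "x = chain_boundary (Suc p) d + frag_cmul 2 e"
        using x by (auto simp: mod2_boundary_def)
      then have "singular_chain (Suc p) X (- d)" "singular_chain p X (- e)"
          "- x = chain_boundary (Suc p) (- d) + frag_cmul 2 (- e)"
        by (auto simp: singular_chain_minus chain_boundary_minus frag_cmul_uminus)
      moreover have "inv\<^bsub>chain_group p X\<^esub> x = - x"
        using x mod2_boundary_imp_cycle [of p X x] by (simp add: mod2_cycle_def singular_chain_def)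
      ultimately show ?thesis
        unfolding mod2_boundary_def mem_Collect_eq by metis
    qed
  qed
  moreover have "Collect (mod2_boundary p X) \<subseteq> Collect (mod2_cycle p X)"
    using mod2_boundary_imp_cycle by blast
  ultimately show ?thesis
    unfolding mod2_cycle_group_def by (intro group.subgroup_of_subgroup_generated group_chain_group)
qed

lemma comm_group_mod2_homology_group: "comm_group (mod2_homology_group p X)"
  unfolding mod2_homology_group_def
  by (intro comm_group.abelian_FactGroup comm_group_mod2_cycle_group mod2_boundary_subgroup)

lemma mod2_homology_group_exponent:
  assumes "x \<in> carrier (mod2_homology_group p X)"
  shows "x \<otimes>\<^bsub>mod2_homology_group p X\<^esub> x = \<one>\<^bsub>mod2_homology_group p X\<^esub>"
proof -
  interpret G: comm_group "mod2_cycle_group p X"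
    by (rule comm_group_mod2_cycle_group)
  interpret N: normal "Collect (mod2_boundary p X)" "mod2_cycle_group p X"
    using G.normal_iff_subgroup mod2_boundary_subgroup by blast
  obtain c where c: "mod2_cycle p X c"
      "x = Collect (mod2_boundary p X) #>\<^bsub>mod2_cycle_group p X\<^esub> c"
    using assms by (auto simp: mod2_homology_group_def FactGroup_def RCOSETS_def)
  have "c + c = chain_boundary (Suc p) 0 + frag_cmul 2 c"
    by (simp add: frag_cmul_distrib [of 1 1, simplified])
  then have "mod2_boundary p X (c + c)"
    unfolding mod2_boundary_def using c(1) mod2_cycle_def singular_chain_0 by blast
  then have "Collect (mod2_boundary p X) #>\<^bsub>mod2_cycle_group p X\<^esub> (c + c) = Collect (mod2_boundary p X)"
    using mod2_boundary_imp_cycle N.is_subgroup by (intro G.coset_join2) auto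
  moreover have "x <#>\<^bsub>mod2_cycle_group p X\<^esub> x = Collect (mod2_boundary p X) #>\<^bsub>mod2_cycle_group p X\<^esub> (c + c)"
    using N.rcos_sum [of c c] c(1) unfolding c(2) by simp
  ultimately show ?thesis
    by (simp only: mod2_homology_group_def mult_FactGroup one_FactGroup)
qed

end

theory Submission
  imports Defs "HOL-Library.Z2"
begin

text \<open>
  Let \<open>\<Delta>\<close> be the skeleton.  The mod 2 intersection numbers of \<open>k\<close>-cycles of \<open>\<Delta>\<close> in \<open>M\<close> form a matrix that
  factors through \<open>H\<^sub>k(M)\<close>, so that the Betti number bounds its rank.  No duality is needed: pushing \<open>\<Delta>\<close> into
  the interior of \<open>M\<close> and pulling back a mod 2 Thom class of the diagonal to \<open>M \<times> \<Delta>\<close> gives a functional \<open>\<theta>\<close>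
  on \<open>2k\<close>-chains of \<open>\<Delta> \<times> \<Delta>\<close> with boundary off the diagonal.  It vanishes on products of disjoint simplices,
  and it is \<open>1\<close> on the join of a vertex pair \<open>(x, x)\<close> with the deleted joins of \<open>k\<close> triples of vertices:
  after contraction towards \<open>x\<close> this is Borsuk's theorem in a chart.

  The cycles are joins of \<open>k + 1\<close> pairs of vertices: two successive ones of a sequence, a base vertex and
  another vertex, and two vertices from each of \<open>k - 1\<close> triples.  Summing over the choices in the triples
  yields a matrix \<open>B\<close> that vanishes above its diagonal blocks except at equal second pairs, and in each diagonal
  block \<open>B + B\<^sup>T\<close> agrees off the diagonal with the all-ones matrix up to rank two.  Schur complements remove the
  exceptional entries, whence the rank of \<open>B\<close> is at least about half of its size.
\<close>

text \<open>A single intersection number of two cycles depends on the embedding. Forced values exist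
  only for combinations of products whose part on the diagonal is the join of one vertex pair with
  \<open>k\<close> hexagons. This is why \<open>B\<close> is paired with its transpose: symmetrizing
  completes the last hexagon, at the price of doubling the rank. Each of the other
  \<open>k - 1\<close> hexagons is a sum of just two products of an \<open>X\<close>-cycle and a
  \<open>Y\<close>-cycle, so \<open>B\<close> is a sum of \<open>2 ^ (k - 1)\<close> matrices of
  rank at most the Betti number \<open>b\<close>. Both effects together give the factor
  \<open>2 ^ k\<close>.

  With \<open>m\<close> pairs in the sequence and \<open>l\<close> partners of the base vertices the
  outcome is \<open>m * l \<le> 2 ^ k * b + 2 * m\<close>, and
  \<open>m + 4 + l + 3 * (k - 1)\<close> vertices are used. Balancing \<open>m\<close> and
  \<open>l\<close> yields about \<open>s ^ 2 / 4 \<le> 2 ^ k * b\<close> with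
  \<open>s = n - 3 * k - 2\<close>; the stated bound follows from \<open>1 \<le> k\<close> and
  \<open>4 \<le> (k + 1) ^ 2\<close>.

  Taking \<open>M \<times> \<Delta>\<close> rather than \<open>M \<times> M\<close> turns the
  diagonal into a section over a compact space, so that finitely many charts suffice.\<close>

declare add_bit_eq_xor [simp del] mult_bit_eq_and [simp del]

section \<open>Chains with coefficients in the field of two elements, and their subdivision\<close>

section \<open>Groups of exponent two\<close>

text \<open>A common class for coefficients, chains and formal sums of cells: signs never arise, and
  equal summands cancel everywhere by the same simp rules.\<close>

class char_two = ab_group_add +
  assumes add_self [simp]: "x + x = 0"
begin

lemma add_left_self [simp]: "x + (x + y) = y"
  by (metis add_assoc add_self add_0_left)

lemma minus_char_two: "- x = x"
  by (metis add_eq_0_iff add_self)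

lemma diff_char_two: "x - y = x + y"
  by (metis add_uminus_conv_diff minus_char_two)

lemma add_eq_0_char_two: "x + y = 0 \<longleftrightarrow> x = y"
  by (metis add_left_self add_0_right add_self)

lemma eq_add_char_two: "x = y + z \<longleftrightarrow> x + z = y"
  by (metis add_left_self add_commute)

end

instance bit :: char_two
  by standard (metis bit_2_eq_0 mult_2 mult_zero_left)

instance poly_mapping :: (type, char_two) char_two
  by standard (simp add: poly_mapping_eqI lookup_add)

section \<open>Finite formal sums with coefficients in the field of two elements\<close>

abbreviation keys where "keys \<equiv> Poly_Mapping.keys"
abbreviation lookup where "lookup \<equiv> Poly_Mapping.lookup"

type_synonym 'a sum2 = "'a \<Rightarrow>\<^sub>0 bit"

abbreviation unit2 :: "'a \<Rightarrow> 'a sum2"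
  where "unit2 s \<equiv> Poly_Mapping.single s 1"

text \<open>Linear extension from generators: a nonzero coefficient is \<open>1\<close>, so summing
  over the support suffices. It is additive only into groups of exponent two.\<close>

definition ext2 :: "('a \<Rightarrow> 'b::comm_monoid_add) \<Rightarrow> 'a sum2 \<Rightarrow> 'b"
  where "ext2 g c = sum g (keys c)"

lemma ext2_0 [simp]: "ext2 g 0 = 0"
  by (simp add: ext2_def)

lemma ext2_unit [simp]: "ext2 g (unit2 s) = g s"
  by (simp add: ext2_def)

lemma lookup_bit_keys: "lookup c s = of_bool (s \<in> keys (c :: 'a sum2))"
  by (simp add: in_keys_iff)

lemma keys_add_bit: "keys (a + b) = (keys a - keys b) \<union> (keys b - keys (a :: 'a sum2))"
proof -
  have "lookup a s + lookup b s = 0 \<longleftrightarrow> lookup a s = lookup b s" for s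
    by (rule add_eq_0_char_two)
  then show ?thesis
    by (auto simp: in_keys_iff lookup_add)
qed

lemma ext2_add [simp]: "ext2 g (a + b) = ext2 g a + (ext2 g b :: 'b::char_two)"
proof -
  have "sum g (keys a) = sum g (keys a - keys b) + sum g (keys a \<inter> keys b)"
    by (metis finite_keys sum.Int_Diff add.commute)
  moreover have "sum g (keys b) = sum g (keys b - keys a) + sum g (keys a \<inter> keys b)"
    by (metis finite_keys sum.Int_Diff add.commute Int_commute)
  moreover have "sum g (keys (a + b)) = sum g (keys a - keys b) + sum g (keys b - keys a)"
    unfolding keys_add_bit by (subst sum.union_disjoint) auto
  ultimately show ?thesis
    by (simp add: ext2_def ac_simps)
qed

lemma sum2_eq_sum_units: "c = sum unit2 (keys (c :: 'a sum2))"
proof (rule poly_mapping_eqI)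
  fix k
  have "lookup (sum unit2 (keys c)) k = (\<Sum>s\<in>keys c. if s = k then 1 else 0)"
    by (simp add: lookup_sum lookup_single when_def)
  also have "\<dots> = of_bool (k \<in> keys c)"
    by (simp add: sum.delta)
  finally show "lookup c k = lookup (sum unit2 (keys c)) k"
    by (simp only: lookup_bit_keys [of c])
qed

lemma sum2_induct [consumes 1, case_names zero unit add]:
  assumes "keys c \<subseteq> S" "P 0" "\<And>s. s \<in> S \<Longrightarrow> P (unit2 s)"
    "\<And>a b. keys a \<subseteq> S \<Longrightarrow> keys b \<subseteq> S \<Longrightarrow> P a \<Longrightarrow> P b \<Longrightarrow> P (a + b)"
  shows "P c"
proof -
  have "P (sum unit2 A) \<and> keys (sum unit2 A) \<subseteq> S" if "finite A" "A \<subseteq> S" for A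
    using that
  proof (induction A rule: finite_induct)
    case (insert x A)
    then have "keys (unit2 x + sum unit2 A) \<subseteq> S"
      by (subst keys_add_bit) auto
    with insert show ?case
      by (auto intro!: assms(4) assms(3))
  qed (auto simp: assms)
  then show ?thesis
    using sum2_eq_sum_units [of c] assms(1) by (metis finite_keys)
qed

lemma ext2_sum: "ext2 g (sum f A) = (\<Sum>x\<in>A. ext2 g (f x) :: 'b::char_two)"
  by (induction A rule: infinite_finite_induct) auto

lemma ext2_cong: "(\<And>s. s \<in> keys c \<Longrightarrow> f s = g s) \<Longrightarrow> ext2 f c = ext2 g c"
  by (simp add: ext2_def)

lemma ext2_fun_add: "ext2 (\<lambda>s. f s + g s) c = ext2 f c + ext2 g c"
  by (simp add: ext2_def sum.distrib)

lemma ext2_fun_0 [simp]: "ext2 (\<lambda>s. 0) c = 0"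
  by (simp add: ext2_def)

lemma additive_ext2:
  fixes F :: "'b::char_two \<Rightarrow> 'c::char_two"
  assumes "\<And>x y. F (x + y) = F x + F y"
  shows "F (ext2 g c) = ext2 (\<lambda>s. F (g s)) c"
proof -
  have "F 0 = 0"
    by (metis assms add_self)
  then have "F (sum g A) = (\<Sum>s\<in>A. F (g s))" for A
    by (induction A rule: infinite_finite_induct) (auto simp: assms)
  then show ?thesis
    by (simp add: ext2_def)
qed

lemma ext2_ext2:
  "ext2 f (ext2 g c) = ext2 (\<lambda>s. ext2 f (g s)) (c :: 'a sum2)" for f :: "'b \<Rightarrow> 'c::char_two"
  by (rule additive_ext2) simp

lemma ext2_unit_id [simp]: "ext2 unit2 c = c"
  using sum2_eq_sum_units [of c] by (simp add: ext2_def)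

lemma keys_ext2: "keys (ext2 g c) \<subseteq> (\<Union>s\<in>keys c. keys (g s :: 'b sum2))"
  unfolding ext2_def by (rule keys_sum)

section \<open>Singular chains mod 2\<close>

type_synonym 'a chain2 = "((nat \<Rightarrow> real) \<Rightarrow> 'a) sum2"

text \<open>Subspaces are given as sets of points, which need not lie in \<open>topspace T\<close>.
  A chain thus keeps its type and can be viewed in several subspaces at once.\<close>

definition chn :: "nat \<Rightarrow> 'a topology \<Rightarrow> 'a set \<Rightarrow> 'a chain2 \<Rightarrow> bool"
  where "chn p T A c \<longleftrightarrow> (\<forall>s\<in>keys c. singular_simplex p T s \<and> s ` standard_simplex p \<subseteq> A)"

text \<open>The convention for \<open>p = 0\<close> fits truncated subtraction: boundaries have
  degree \<open>p - 1\<close> without case distinction.\<close>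

definition bd :: "nat \<Rightarrow> 'a chain2 \<Rightarrow> 'a chain2"
  where "bd p c = (if p = 0 then 0 else ext2 (\<lambda>s. \<Sum>k\<le>p. unit2 (singular_face p k s)) c)"

lemma bd_0 [simp]: "bd p 0 = 0" and bd_0_left [simp]: "bd 0 c = 0"
  by (simp_all add: bd_def)

lemma bd_add [simp]: "bd p (a + b) = bd p a + bd p b"
  by (simp add: bd_def)

lemma bd_sum: "bd p (sum f A) = (\<Sum>x\<in>A. bd p (f x))"
  by (simp add: bd_def ext2_sum)

lemma chn_0 [simp]: "chn p T A 0"
  by (simp add: chn_def)

lemma chn_add [intro]: "chn p T A a \<Longrightarrow> chn p T A b \<Longrightarrow> chn p T A (a + b)"
  unfolding chn_def keys_add_bit by blast

lemma chn_sum: "(\<And>x. x \<in> I \<Longrightarrow> chn p T A (f x)) \<Longrightarrow> chn p T A (sum f I)"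
  by (induction I rule: infinite_finite_induct) auto

lemma chn_ext2:
  assumes "\<And>s. s \<in> keys c \<Longrightarrow> chn p T A (g s)"
  shows "chn p T A (ext2 g c)"
  using assms by (simp add: ext2_def chn_sum)

lemma chn_unit: "chn p T A (unit2 s) \<longleftrightarrow> singular_simplex p T s \<and> s ` standard_simplex p \<subseteq> A"
  by (simp add: chn_def)

lemma chn_Int: "chn p T (A \<inter> B) c \<longleftrightarrow> chn p T A c \<and> chn p T B c"
  unfolding chn_def by blast

lemma chn_mono: "chn p T A c \<Longrightarrow> A \<subseteq> B \<Longrightarrow> chn p T B c"
  unfolding chn_def by blast

lemma chn_empty: "chn p T {} c \<longleftrightarrow> c = 0"
  by (auto simp: chn_def nonempty_standard_simplex)

lemma chn_topspace: "chn p T (topspace T \<inter> A) c \<longleftrightarrow> chn p T A c"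
proof -
  have "s ` standard_simplex p \<subseteq> topspace T" if "singular_simplex p T s" for s
    using that by (auto simp: singular_simplex_def continuous_map_def)
  then show ?thesis
    unfolding chn_def by blast
qed

lemma chn_subtopology: "chn p (subtopology T S) A c \<longleftrightarrow> chn p T (S \<inter> A) c"
  unfolding chn_def singular_simplex_subtopology by blast

lemma chn_bd:
  assumes "chn p T A c"
  shows "chn (p - 1) T A (bd p c)"
proof (cases "p = 0")
  case False
  have "chn (p - 1) T A (unit2 (singular_face p k s))"
    if s: "singular_simplex p T s" "s ` standard_simplex p \<subseteq> A" and k: "k \<le> p" for k s
  proof -
    have "singular_simplex p (subtopology T A) s"
      using s by (simp add: singular_simplex_subtopology)
    then have "singular_simplex (p - 1) (subtopology T A) (singular_face p k s)"
      using singular_simplex_singular_face [of p _ s k] False k by simp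
    then show ?thesis
      by (simp add: singular_simplex_subtopology chn_unit)
  qed
  then show ?thesis
    using assms False unfolding bd_def chn_def [of p]
    by (auto intro!: chn_ext2 chn_sum)
qed auto

lemma chn_bd_Suc: "chn (Suc p) T A c \<Longrightarrow> chn p T A (bd (Suc p) c)"
  using chn_bd [of "Suc p"] by simp

subsection \<open>Reduction of integral chains\<close>

definition red2 :: "('a \<Rightarrow>\<^sub>0 int) \<Rightarrow> 'a sum2"
  where "red2 c = (\<Sum>s\<in>keys c. Poly_Mapping.single s (of_int (lookup c s)))"

lemma lookup_red2: "lookup (red2 c) s = of_int (lookup c s)"
  by (auto simp: red2_def lookup_sum lookup_single when_def if_distrib sum.delta in_keys_iff cong: if_cong)

lemma red2_0 [simp]: "red2 0 = 0"
  by (simp add: red2_def)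

lemma red2_add: "red2 (a + b) = red2 a + red2 b"
  by (rule poly_mapping_eqI) (simp add: lookup_red2 lookup_add)

lemma red2_diff: "red2 (a - b) = red2 a + red2 b"
  by (rule poly_mapping_eqI) (simp only: lookup_red2 lookup_minus lookup_add of_int_diff diff_char_two)

lemma red2_cmul: "red2 (frag_cmul n a) = (if even n then 0 else red2 a)"
proof (rule poly_mapping_eqI)
  fix k
  have "(of_int n :: bit) = of_bool (odd n)"
    by (auto elim!: oddE evenE)
  then show "lookup (red2 (frag_cmul n a)) k = lookup (if even n then 0 else red2 a) k"
    by (simp add: lookup_red2)
qed

lemma red2_of [simp]: "red2 (frag_of s) = unit2 s"
  by (rule poly_mapping_eqI) (simp add: lookup_red2 lookup_frag_of lookup_single when_def)

lemma red2_sum: "red2 (sum f A) = (\<Sum>x\<in>A. red2 (f x))"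
  by (induction A rule: infinite_finite_induct) (auto simp: red2_add)

lemma red2_extend: "red2 (frag_extend g c) = ext2 (\<lambda>s. red2 (g s)) (red2 c)"
proof -
  have "keys c \<subseteq> UNIV" by simp
  then show ?thesis
  proof (induction rule: frag_induction)
    case (diff a b)
    then show ?case
      by (simp only: frag_extend_diff red2_diff ext2_add)
  qed simp_all
qed

lemma red2_boundary: "red2 (chain_boundary p c) = bd p (red2 c)"
  by (simp add: chain_boundary_def bd_def red2_extend red2_sum red2_cmul)

lemma keys_red2: "keys (red2 c) \<subseteq> keys c"
  by (auto simp: in_keys_iff lookup_red2)

lemma chn_red2: "singular_chain p T c \<Longrightarrow> chn p T (topspace T) (red2 c)"
  using keys_red2 [of c] by (fastforce simp: chn_def singular_chain_def singular_simplex_def continuous_map_def)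

text \<open>A section of \<open>red2\<close>, not additive. Facts on integral chains are transferred
  by lifting, applying them, and reducing again.\<close>

definition lift2 :: "'a sum2 \<Rightarrow> ('a \<Rightarrow>\<^sub>0 int)"
  where "lift2 c = (\<Sum>s\<in>keys c. frag_of s)"

lemma red2_lift2 [simp]: "red2 (lift2 c) = c"
  by (simp add: lift2_def red2_sum flip: sum2_eq_sum_units)

lemma keys_lift2 [simp]: "keys (lift2 c) = keys c"
proof -
  have "lookup (lift2 c) s = of_bool (s \<in> keys c)" for s
    by (simp add: lift2_def lookup_sum lookup_frag_of sum.delta)
  then show ?thesis
    by (auto simp: in_keys_iff)
qed

lemma singular_chain_lift2: "chn p T A c \<longleftrightarrow> singular_chain p (subtopology T A) (lift2 c)"
  unfolding chn_def singular_chain_def singular_simplex_subtopology by auto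

text \<open>The control of the support ensures that half of a chain is again a chain in the same
  space.\<close>

lemma red2_eq_0_iff: "red2 c = 0 \<longleftrightarrow> (\<exists>e. c = frag_cmul 2 e \<and> keys e \<subseteq> keys c)"
proof
  assume c: "red2 c = 0"
  have "even (lookup c s)" for s
  proof (rule ccontr)
    assume "odd (lookup c s)"
    then have "(of_int (lookup c s) :: bit) = 1"
      by (auto elim!: oddE)
    then show False
      using c lookup_red2 [of c s] by simp
  qed
  then have *: "lookup c s = 2 * (lookup c s div 2)" for s
    by simp
  define e where "e = (\<Sum>s\<in>keys c. frag_cmul (lookup c s div 2) (frag_of s))"
  have "lookup e s = lookup c s div 2" for s
    by (auto simp: e_def lookup_sum lookup_frag_of if_distrib sum.delta in_keys_iff cong: if_cong)
  then have "c = frag_cmul 2 e"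
    by (intro poly_mapping_eqI) (use * in auto)
  moreover have "keys e \<subseteq> keys c"
    using \<open>\<And>s. lookup e s = lookup c s div 2\<close> by (auto simp: in_keys_iff)
  ultimately show "\<exists>e. c = frag_cmul 2 e \<and> keys e \<subseteq> keys c"
    by blast
qed (auto simp: red2_cmul)

lemma bd_bd:
  assumes "chn p T A c"
  shows "bd (p - 1) (bd p c) = 0"
proof -
  have "singular_chain p (subtopology T A) (lift2 c)"
    using assms by (simp add: singular_chain_lift2)
  from chain_boundary_boundary [OF this]
  have "red2 (chain_boundary (p - 1) (chain_boundary p (lift2 c))) = 0"
    by simp
  then show ?thesis
    by (simp add: red2_boundary)
qed

lemma bd_bd_Suc: "chn (Suc p) T A c \<Longrightarrow> bd p (bd (Suc p) c) = 0"
  using bd_bd [of "Suc p"] by simp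

subsection \<open>Induced maps\<close>

definition push :: "nat \<Rightarrow> ('a \<Rightarrow> 'b) \<Rightarrow> 'a chain2 \<Rightarrow> 'b chain2"
  where "push p g c = ext2 (\<lambda>s. unit2 (simplex_map p g s)) c"

lemma push_0 [simp]: "push p g 0 = 0"
  by (simp add: push_def)

lemma push_add [simp]: "push p g (a + b) = push p g a + push p g b"
  by (simp add: push_def)

lemma push_sum: "push p g (sum f I) = (\<Sum>x\<in>I. push p g (f x))"
  by (simp add: push_def ext2_sum)

lemma push_unit [simp]: "push p g (unit2 s) = unit2 (simplex_map p g s)"
  by (simp add: push_def)

lemma chn_push:
  assumes "chn p T A c" "continuous_map (subtopology T A) T' g" "g \<in> (topspace T \<inter> A) \<rightarrow> A'"
  shows "chn p T' A' (push p g c)"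
proof -
  have "continuous_map (subtopology T A) (subtopology T' A') g"
    using assms(2,3) by (auto simp: continuous_map_in_subtopology)
  then have "singular_simplex p (subtopology T' A') (simplex_map p g s)"
    if "singular_simplex p (subtopology T A) s" for s
    using that singular_simplex_simplex_map by blast
  then show ?thesis
    using assms(1) unfolding push_def
    by (intro chn_ext2) (auto simp: chn_def singular_simplex_subtopology)
qed

lemma bd_push:
  assumes "chn p T A c"
  shows "bd p (push p g c) = push (p - 1) g (bd p c)"
proof (cases "p = 0")
  case False
  have "singular_face p k (simplex_map p g s) = simplex_map (p - 1) g (singular_face p k s)" if "k \<le> p" for k s
    using that False by (simp add: singular_face_simplex_map)
      (force simp: simplex_map_def singular_face_def simplical_face_in_standard_simplex)
  then show ?thesis
    using False by (simp add: bd_def push_def ext2_ext2 ext2_sum)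
qed auto

lemma push_compose: "push p g (push p f c) = push p (g \<circ> f) c"
  by (simp add: push_def ext2_ext2 simplex_map_compose)

lemma push_id_gen:
  assumes "chn p T A c" "\<And>x. x \<in> topspace T \<Longrightarrow> x \<in> A \<Longrightarrow> f x = x"
  shows "push p f c = c"
proof -
  have "push p f c = ext2 unit2 c"
    unfolding push_def
  proof (rule ext2_cong)
    fix s assume "s \<in> keys c"
    then have "singular_simplex p (subtopology T A) s"
      using assms(1) by (auto simp: chn_def singular_simplex_subtopology)
    then show "unit2 (simplex_map p f s) = unit2 s"
      using assms(2) by (subst simplex_map_id_gen [of p "subtopology T A" s f]) auto
  qed
  then show ?thesis by simp
qed

subsection \<open>Subdivision\<close>

definition sd :: "nat \<Rightarrow> nat \<Rightarrow> 'a chain2 \<Rightarrow> 'a chain2"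
  where "sd n p c = ext2 (\<lambda>s. red2 ((singular_subdivision p ^^ n) (frag_of s))) c"

lemma sd_add [simp]: "sd n p (a + b) = sd n p a + sd n p b"
  by (simp add: sd_def)

lemma additive_red2:
  assumes "\<And>a b. F (a - b) = F a - (F b :: ('b \<Rightarrow>\<^sub>0 int))"
  shows "red2 (F c) = ext2 (\<lambda>s. red2 (F (frag_of s))) (red2 c)"
proof -
  have "keys c \<subseteq> UNIV" by simp
  moreover have "F 0 = 0"
    using assms [of 0 0] by simp
  ultimately show ?thesis
    by (induction rule: frag_induction) (auto simp: assms red2_diff)
qed

lemma red2_sd: "red2 ((singular_subdivision p ^^ n) c) = sd n p (red2 c)"
  unfolding sd_def by (rule additive_red2) (rule singular_subdivision_power_diff)

lemma bd_sd:
  assumes "chn p T A c"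
  shows "bd p (sd n p c) = sd n (p - 1) (bd p c)"
proof -
  have ch: "singular_chain p (subtopology T A) (lift2 c)"
    using assms by (simp add: singular_chain_lift2)
  have "singular_chain p (subtopology T A) ((singular_subdivision p ^^ n) (lift2 c)) \<and>
        chain_boundary p ((singular_subdivision p ^^ n) (lift2 c)) =
        (singular_subdivision (p - 1) ^^ n) (chain_boundary p (lift2 c))" for n
    by (induction n) (auto simp: ch singular_chain_singular_subdivision chain_boundary_singular_subdivision)
  then have "red2 (chain_boundary p ((singular_subdivision p ^^ n) (lift2 c))) =
     red2 ((singular_subdivision (p - 1) ^^ n) (chain_boundary p (lift2 c)))"
    by metis
  then show ?thesis
    by (simp add: red2_sd red2_boundary)
qed

lemma singular_chain_subdivision_power:
  "singular_chain p T c \<Longrightarrow> singular_chain p T ((singular_subdivision p ^^ n) c)"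
  by (induction n) (auto simp: singular_chain_singular_subdivision)

lemma chn_sd:
  assumes "chn p T A c"
  shows "chn p T A (sd n p c)"
proof -
  have "singular_chain p (subtopology T A) (lift2 c)"
    using assms by (simp add: singular_chain_lift2)
  then have "chn p (subtopology T A) (topspace (subtopology T A)) (red2 ((singular_subdivision p ^^ n) (lift2 c)))"
    by (intro chn_red2 singular_chain_subdivision_power)
  then show ?thesis
    by (auto simp: red2_sd chn_subtopology chn_Int)
qed

lemma sd_homotopy:
  obtains h :: "nat \<Rightarrow> 'a chain2 \<Rightarrow> 'a chain2" where
    "\<And>p a b. h p (a + b) = h p a + h p b"
    "\<And>p T A c. chn p T A c \<Longrightarrow> chn (Suc p) T A (h p c)"
    "\<And>p T A c. chn p T A c \<Longrightarrow> bd (Suc p) (h p c) + h (p - 1) (bd p c) = sd n p c + c"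
proof -
  obtain h where h:
        "\<And>p. h p 0 = (0 :: 'a chain)"
        "\<And>p c1 c2. h p (c1-c2) = h p c1 - h p c2"
        "\<And>p X c. singular_chain p X c \<Longrightarrow> singular_chain (Suc p) X (h p c)"
        "\<And>p X c. singular_chain p X c
                 \<Longrightarrow> chain_boundary (Suc p) (h p c) + h (p - Suc 0) (chain_boundary p c)
                   = (singular_subdivision p ^^ n) c - c"
    by (rule chain_homotopic_iterated_singular_subdivision) blast
  define g where "g = (\<lambda>p c. ext2 (\<lambda>s. red2 (h p (frag_of s))) (c :: 'a chain2))"
  have g: "red2 (h p c) = g p (red2 c)" for p c
    unfolding g_def by (rule additive_red2) (rule h)
  show ?thesis
  proof
    show "g p (a + b) = g p a + g p b" for p a b
      by (simp add: g_def)
    show "chn (Suc p) T A (g p c)" if "chn p T A c" for p T A c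
    proof -
      have "singular_chain (Suc p) (subtopology T A) (h p (lift2 c))"
        using that by (simp add: singular_chain_lift2 h)
      then have "chn (Suc p) (subtopology T A) (topspace (subtopology T A)) (red2 (h p (lift2 c)))"
        by (rule chn_red2)
      then show ?thesis
        by (auto simp: g chn_subtopology chn_Int)
    qed
    show "bd (Suc p) (g p c) + g (p - 1) (bd p c) = sd n p c + c" if "chn p T A c" for p T A c
    proof -
      have "singular_chain p (subtopology T A) (lift2 c)"
        using that by (simp add: singular_chain_lift2 h)
      from arg_cong [OF h(4) [OF this], of red2] show ?thesis
        by (simp add: red2_add red2_diff red2_boundary red2_sd g)
    qed
  qed
qed

text \<open>Small simplices: every simplex of a fine enough subdivision lies in one of the two open
  sets, and sorting the simplices splits the chain.\<close>

lemma sd_split: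
  assumes "chn p T (A \<union> B) c" "openin T A" "openin T B"
  obtains N where "\<And>n. n \<ge> N \<Longrightarrow> \<exists>a b. chn p T A a \<and> chn p T B b \<and> sd n p c = a + b"
proof -
  let ?X = "subtopology T (A \<union> B)"
  have *: "singular_chain p ?X (lift2 c)"
    using assms(1) by (simp add: singular_chain_lift2)
  obtain N where N: "\<And>m f. \<lbrakk>N \<le> m; f \<in> keys ((singular_subdivision p ^^ m) (lift2 c))\<rbrakk>
                      \<Longrightarrow> \<exists>V \<in> {A,B}. f \<in> (standard_simplex p) \<rightarrow> V"
  proof (rule sufficient_iterated_singular_subdivision_exists [of "{A,B}" ?X p "lift2 c"])
    show "openin ?X U" if "U \<in> {A, B}" for U
      using that assms(2,3) by (auto simp: openin_subtopology intro: exI [of _ A] exI [of _ B])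
  qed (use * in auto)
  have "\<exists>a b. chn p T A a \<and> chn p T B b \<and> sd n p c = a + b" if n: "n \<ge> N" for n
  proof -
    define K where "K = keys (sd n p c)"
    have "K \<subseteq> keys ((singular_subdivision p ^^ n) (lift2 c))"
      using keys_red2 [of "(singular_subdivision p ^^ n) (lift2 c)"] by (simp add: red2_sd K_def)
    then have 1: "s ` standard_simplex p \<subseteq> A \<or> s ` standard_simplex p \<subseteq> B" if "s \<in> K" for s
      using N [OF n, of s] that by blast
    have 2: "singular_simplex p T s" if "s \<in> K" for s
      using chn_sd [OF assms(1), of n] that by (auto simp: chn_def K_def)
    define KA where "KA = {s \<in> K. s ` standard_simplex p \<subseteq> A}"
    have "finite K"
      by (simp add: K_def)
    then have "sum unit2 K = sum unit2 KA + sum unit2 (K - KA)"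
      by (subst sum.subset_diff [of KA K]) (auto simp: KA_def ac_simps)
    then have "sd n p c = sum unit2 KA + sum unit2 (K - KA)"
      using sum2_eq_sum_units [of "sd n p c"] by (simp add: K_def)
    moreover have "chn p T A (sum unit2 KA)" "chn p T B (sum unit2 (K - KA))"
      using 1 2 unfolding KA_def by (intro chn_sum; simp add: chn_unit; blast)+
    ultimately show ?thesis
      by blast
  qed
  then show ?thesis
    using that by blast
qed

section \<open>Products, homotopies and excision on the level of chains\<close>

section \<open>Cross products of singular chains\<close>

subsection \<open>Lists with one entry deleted\<close>

definition del :: "nat \<Rightarrow> 'a list \<Rightarrow> 'a list"
  where "del m L = take m L @ drop (Suc m) L"

lemma length_del: "m < length L \<Longrightarrow> length (del m L) = length L - 1"
  by (simp add: del_def)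

lemma nth_del: "m < length L \<Longrightarrow> j < length L - 1 \<Longrightarrow> del m L ! j = (if j < m then L ! j else L ! Suc j)"
  by (auto simp: del_def nth_append min_def)

lemma del_map: "del m (map f L) = map f (del m L)"
  by (simp add: del_def take_map drop_map)

lemma del_Cons_Suc: "del (Suc m) (x # L) = x # del m L"
  by (simp add: del_def)

lemma del_Cons_0: "del 0 (x # L) = L"
  by (simp add: del_def)

definition lcons :: "'a \<Rightarrow> 'a list sum2 \<Rightarrow> 'a list sum2"
  where "lcons x P = ext2 (\<lambda>L. unit2 (x # L)) P"

lemma lcons_add [simp]: "lcons x (P + Q) = lcons x P + lcons x Q"
  and lcons_0 [simp]: "lcons x 0 = 0"
  and lcons_unit [simp]: "lcons x (unit2 L) = unit2 (x # L)"
  by (simp_all add: lcons_def)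

lemma lcons_ext2: "lcons x (ext2 g c) = ext2 (\<lambda>s. lcons x (g s)) c"
  by (simp add: lcons_def ext2_ext2)

lemma ext2_lcons: "ext2 g (lcons x P) = ext2 (\<lambda>L. g (x # L)) P" for g :: "_ \<Rightarrow> 'b::char_two"
  by (simp add: lcons_def ext2_ext2)

lemma keys_lcons: "L \<in> keys (lcons x P) \<Longrightarrow> \<exists>M\<in>keys P. L = x # M"
  using keys_ext2 [of "\<lambda>L. unit2 (x # L)" P] by (auto simp: lcons_def)

primrec ldel :: "'a list \<Rightarrow> 'a list sum2"
  where "ldel [] = 0"
  | "ldel (x # L) = unit2 L + lcons x (ldel L)"

lemma ldel_eq_sum: "ldel L = (\<Sum>m<length L. unit2 (del m L))"
proof (induction L)
  case (Cons x L)
  have "lcons x (sum f A) = (\<Sum>m\<in>A. lcons x (f m))" for f and A :: "nat set"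
    by (simp add: lcons_def ext2_sum)
  then show ?case
    using Cons by (simp add: sum.lessThan_Suc_shift del_Cons_Suc del_Cons_0 del: sum.lessThan_Suc)
qed simp

lemma keys_ldel: "M \<in> keys (ldel L) \<Longrightarrow> Suc (length M) = length L \<and> set M \<subseteq> set L"
proof -
  assume "M \<in> keys (ldel L)"
  then obtain m where "m < length L" "M = del m L"
    using keys_sum [of "\<lambda>m. unit2 (del m L)" "{..<length L}"] by (auto simp: ldel_eq_sum)
  then show ?thesis
    by (auto simp: length_del del_def dest: in_set_takeD in_set_dropD)
qed

subsection \<open>Staircases\<close>

text \<open>The Eilenberg-Zilber triangulation of a product of simplices: all monotone lattice paths
  from the first pair of vertices to the last. \<open>unit2 []\<close> ends a path, and an empty
  list admits none.\<close>

fun stair :: "'a list \<Rightarrow> 'b list \<Rightarrow> ('a \<times> 'b) list sum2"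
  where "stair [] B = 0"
  | "stair A [] = 0"
  | "stair (a # A) (b # B) = lcons (a, b)
       (stair A (b # B) + stair (a # A) B + (if A = [] \<and> B = [] then unit2 [] else 0))"

lemma stair_Nil2 [simp]: "stair A [] = 0"
  by (cases A) auto

lemma keys_stair:
  "L \<in> keys (stair A B) \<Longrightarrow> Suc (length L) = length A + length B \<and> set L \<subseteq> set A \<times> set B"
proof (induction A B arbitrary: L rule: stair.induct)
  case (3 a A b B)
  then obtain M where M: "L = (a, b) # M"
      "M \<in> keys (stair A (b # B) + stair (a # A) B + (if A = [] \<and> B = [] then unit2 [] else 0))"
    using keys_lcons by (metis stair.simps(3))
  then consider "M \<in> keys (stair A (b # B))" | "M \<in> keys (stair (a # A) B)" | "A = []" "B = []" "M = []"
    by (auto simp: keys_add_bit split: if_splits)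
  then show ?case
  proof cases
    case 1
    show ?thesis using "3.IH"(1) [OF 1] M(1) by auto
  next
    case 2
    show ?thesis using "3.IH"(2) [OF 2] M(1) by auto
  next
    case 3
    then show ?thesis using M(1) by auto
  qed
qed auto

lemma stair_map: "stair (map f A) (map g B) = ext2 (\<lambda>L. unit2 (map (map_prod f g) L)) (stair A B)"
proof (induction A B rule: stair.induct)
  case (3 a A b B)
  have "lcons (f a, g b) (ext2 (\<lambda>L. unit2 (map (map_prod f g) L)) P) =
      ext2 (\<lambda>L. unit2 (map (map_prod f g) L)) (lcons (a, b) P)" for P
    by (simp add: ext2_lcons lcons_ext2)
  then show ?case
    using 3 by simp
qed auto

lemma stair_swap: "stair B A = ext2 (\<lambda>L. unit2 (map prod.swap L)) (stair A B)"
proof (induction A B rule: stair.induct)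
  case (3 a A b B)
  have "lcons (b, a) (ext2 (\<lambda>L. unit2 (map prod.swap L)) P) =
      ext2 (\<lambda>L. unit2 (map prod.swap L)) (lcons (a, b) P)" for P
    by (simp add: ext2_lcons lcons_ext2)
  then show ?case
    using 3 by (simp add: ac_simps)
qed auto

lemma ldel_singleton:
  "ext2 (\<lambda>A'. if A' = [] then unit2 [] else 0) (ldel A) = (if length A = 1 then unit2 [] else 0)"
proof (cases A)
  case (Cons a A')
  then show ?thesis
    by (cases A') (auto simp: ext2_lcons)
qed simp

text \<open>The Leibniz rule: deleting a corner of a path gives the same list as deleting the
  opposite corner of the flipped path, so interior faces cancel. The last summand is the empty list
  left over from the product of two points; \<open>rl\<close> sends it to \<open>0\<close>.\<close>

lemma ldel_stair:
  assumes "A \<noteq> []" "B \<noteq> []"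
  shows "ext2 ldel (stair A B) = ext2 (\<lambda>A'. stair A' B) (ldel A) + ext2 (stair A) (ldel B)
     + (if length A = 1 \<and> length B = 1 then unit2 [] else 0)"
  using assms
proof (induction A B rule: stair.induct)
  case (3 a A b B)
  let ?e = "\<lambda>A B. if A = [] \<and> B = [] then unit2 [] else 0"
  let ?X = "stair A (b # B) + stair (a # A) B + ?e A B"
  \<comment> \<open>The flipped corners appear as the summand \<open>stair A B\<close>, which occurs
    in both induction hypotheses and cancels.\<close>
  have IH1: "ext2 ldel (stair A (b # B)) = ext2 (\<lambda>A'. stair A' (b # B)) (ldel A) + stair A B
     + ext2 (\<lambda>B'. stair A (b # B')) (ldel B) + (if length A = 1 \<and> B = [] then unit2 [] else 0)"
    using "3.IH"(1) by (cases "A = []") (simp_all add: ext2_lcons ac_simps)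
  have IH2: "ext2 ldel (stair (a # A) B) = stair A B + ext2 (\<lambda>A'. stair (a # A') B) (ldel A)
     + ext2 (\<lambda>B'. stair (a # A) B') (ldel B) + (if A = [] \<and> length B = 1 then unit2 [] else 0)"
    using "3.IH"(2) by (cases "B = []") (simp_all add: ext2_lcons ac_simps)
  have L: "ext2 ldel (stair (a # A) (b # B)) = ?X + lcons (a,b) (ext2 ldel ?X)"
    by (simp add: ext2_lcons ext2_fun_add lcons_ext2)
  have e: "ext2 (\<lambda>A'. ?e A' B) (ldel A) = (if length A = 1 \<and> B = [] then unit2 [] else 0)"
    "ext2 (\<lambda>B'. ?e A B') (ldel B) = (if A = [] \<and> length B = 1 then unit2 [] else 0)"
    using ldel_singleton [of A] ldel_singleton [of B] by (cases "A = []"; cases "B = []"; simp)+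
  have R1: "ext2 (\<lambda>A'. stair A' (b # B)) (ldel (a # A)) = stair A (b # B) +
     lcons (a,b) (ext2 (\<lambda>A'. stair A' (b # B)) (ldel A) + ext2 (\<lambda>A'. stair (a # A') B) (ldel A)
       + (if length A = 1 \<and> B = [] then unit2 [] else 0))"
    by (simp add: ext2_lcons ext2_fun_add e flip: lcons_ext2)
  have R2: "ext2 (stair (a # A)) (ldel (b # B)) = stair (a # A) B +
     lcons (a,b) (ext2 (\<lambda>B'. stair A (b # B')) (ldel B) + ext2 (\<lambda>B'. stair (a # A) B') (ldel B)
       + (if A = [] \<and> length B = 1 then unit2 [] else 0))"
    by (simp add: ext2_lcons ext2_fun_add e flip: lcons_ext2)
  have "ext2 ldel (?e A B) = 0"
    by simp
  then have "ext2 ldel ?X = ext2 ldel (stair A (b # B)) + ext2 ldel (stair (a # A) B)"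
    by simp
  then show ?case
    unfolding L R1 R2 by (simp add: IH1 IH2 ac_simps)
qed auto

subsection \<open>Monotone vertex maps between simplices\<close>

text \<open>The affine map of standard simplices that sends vertex \<open>m\<close> to vertex
  \<open>K ! m\<close>.\<close>

definition amap :: "nat list \<Rightarrow> (nat \<Rightarrow> real) \<Rightarrow> nat \<Rightarrow> real"
  where "amap K x = (\<lambda>r. \<Sum>m\<le>length K - 1. if K ! m = r then x m else 0)"

lemma amap_in_standard_simplex:
  assumes x: "x \<in> standard_simplex (length K - 1)" and K: "K \<noteq> []" "set K \<subseteq> {..p}"
  shows "amap K x \<in> standard_simplex p"
proof -
  have nn: "0 \<le> x m" for m
    using x by (simp add: standard_simplex_def)
  have total: "(\<Sum>m\<le>length K - 1. x m) = 1"
    using x by (simp add: standard_simplex_def)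
  have lt: "K ! m \<le> p" if "m \<le> length K - 1" for m
    using that K nth_mem [of m K] by (cases K) (auto simp del: nth_mem)
  have "amap K x i \<le> (\<Sum>m\<le>length K - 1. x m)" for i
    unfolding amap_def by (intro sum_mono) (auto simp: nn)
  moreover have "0 \<le> amap K x i" for i
    unfolding amap_def by (intro sum_nonneg) (auto simp: nn)
  moreover have "amap K x i = 0" if "i > p" for i
    unfolding amap_def using lt that by (intro sum.neutral) fastforce
  moreover have "(\<Sum>i\<le>p. amap K x i) = (\<Sum>m\<le>length K - 1. x m)"
    unfolding amap_def by (subst sum.swap, intro sum.cong) (auto simp: lt)
  ultimately show ?thesis
    using total by (auto simp: standard_simplex_def)
qed

lemma continuous_map_amap: "continuous_map (powertop_real UNIV) (powertop_real UNIV) (amap K)"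
  unfolding continuous_map_componentwise_UNIV amap_def
  by (intro allI continuous_map_sum) (auto intro!: continuous_map_product_projection)

lemma continuous_map_amap_simplex:
  assumes "K \<noteq> []" "set K \<subseteq> {..p}"
  shows "continuous_map (subtopology (powertop_real UNIV) (standard_simplex (length K - 1)))
     (subtopology (powertop_real UNIV) (standard_simplex p)) (amap K)"
  using amap_in_standard_simplex [OF _ assms]
  by (auto simp: continuous_map_in_subtopology intro: continuous_map_from_subtopology continuous_map_amap)

lemma amap_simplical_face:
  assumes "m < length K" "length K \<ge> 2"
  shows "amap K (simplical_face m x) = amap (del m K) x"
proof
  fix r
  let ?n = "length K - 1"
  have "amap K (simplical_face m x) r =
      (\<Sum>j\<le>?n. if j < m then (if K ! j = r then x j else 0) else if j = m then 0
               else (if K ! Suc (j - Suc 0) = r then x (j - Suc 0) else 0))"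
    unfolding amap_def simplical_face_def by (intro sum.cong) auto
  also have "\<dots> = (\<Sum>j\<le>?n - Suc 0. if j < m then (if K ! j = r then x j else 0)
       else (if K ! Suc j = r then x j else 0))"
    by (rule sum.zero_middle) (use assms in auto)
  also have "\<dots> = amap (del m K) x r"
    unfolding amap_def using assms by (intro sum.cong) (auto simp: length_del nth_del)
  finally show "amap K (simplical_face m x) r = amap (del m K) x r" .
qed

definition shift :: "nat \<Rightarrow> nat \<Rightarrow> nat"
  where "shift r i = (if i < r then i else Suc i)"

lemma simplical_face_amap:
  assumes "K \<noteq> []"
  shows "simplical_face r (amap K x) = amap (map (shift r) K) x"
proof
  fix i
  have "m < length K" if "m \<le> length K - 1" for m
    using that assms by (cases K) auto
  then have "amap (map (shift r) K) x i = (\<Sum>m\<le>length K - 1. if shift r (K ! m) = i then x m else 0)"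
    unfolding amap_def by (intro sum.cong) auto
  also have "\<dots> = simplical_face r (amap K x) i"
    by (cases i) (auto simp: simplical_face_def amap_def shift_def intro!: sum.cong sum.neutral)
  finally show "simplical_face r (amap K x) i = amap (map (shift r) K) x i" ..
qed

lemma amap_upt:
  assumes "x \<in> standard_simplex p"
  shows "amap [0..<Suc p] x = x"
proof
  fix r
  have "amap [0..<Suc p] x r = (\<Sum>m\<le>p. if m = r then x m else 0)"
    unfolding amap_def by (intro sum.cong) (auto simp del: upt_Suc)
  also have "\<dots> = x r"
    using assms by (auto simp: standard_simplex_def)
  finally show "amap [0..<Suc p] x r = x r" .
qed

lemma ldel_upt: "ldel [0..<Suc p] = (\<Sum>m\<le>p. unit2 (map (shift m) [0..<p]))"
proof -
  have "del m [0..<Suc p] = map (shift m) [0..<p]" if "m \<le> p" for m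
    using that by (intro nth_equalityI) (auto simp: length_del nth_del shift_def simp del: upt_Suc)
  then show ?thesis
    by (simp add: ldel_eq_sum lessThan_Suc_atMost del: upt_Suc)
qed

subsection \<open>The cross product\<close>

definition cs :: "((nat \<Rightarrow> real) \<Rightarrow> 'a) \<Rightarrow> ((nat \<Rightarrow> real) \<Rightarrow> 'b) \<Rightarrow> (nat \<times> nat) list \<Rightarrow> (nat \<Rightarrow> real) \<Rightarrow> 'a \<times> 'b"
  where "cs s t L = (\<lambda>x\<in>standard_simplex (length L - 1). (s (amap (map fst L) x), t (amap (map snd L) x)))"

definition rl :: "((nat \<Rightarrow> real) \<Rightarrow> 'a) \<Rightarrow> ((nat \<Rightarrow> real) \<Rightarrow> 'b) \<Rightarrow> (nat \<times> nat) list sum2 \<Rightarrow> ('a \<times> 'b) chain2"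
  where "rl s t P = ext2 (\<lambda>L. if L = [] then 0 else unit2 (cs s t L)) P"

lemma rl_add [simp]: "rl s t (P + Q) = rl s t P + rl s t Q"
  and rl_0 [simp]: "rl s t 0 = 0"
  by (simp_all add: rl_def)

definition cr :: "nat \<Rightarrow> nat \<Rightarrow> 'a chain2 \<Rightarrow> 'b chain2 \<Rightarrow> ('a \<times> 'b) chain2"
  where "cr p q a b = ext2 (\<lambda>s. ext2 (\<lambda>t. rl s t (stair [0..<Suc p] [0..<Suc q])) b) a"

lemma cr_add_left [simp]: "cr p q (a + a') b = cr p q a b + cr p q a' b"
  and cr_0_left [simp]: "cr p q 0 b = 0"
  by (simp_all add: cr_def)

lemma cr_add_right [simp]: "cr p q a (b + b') = cr p q a b + cr p q a b'"
  and cr_0_right [simp]: "cr p q a 0 = 0"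
  by (simp_all add: cr_def ext2_fun_add)

lemma cr_unit [simp]: "cr p q (unit2 s) (unit2 t) = rl s t (stair [0..<Suc p] [0..<Suc q])"
  by (simp add: cr_def del: upt_Suc)

lemma cr_ext2_left: "cr p q (ext2 g a) b = ext2 (\<lambda>s. cr p q (g s) b) a"
  by (rule additive_ext2) simp

lemma cr_ext2_right: "cr p q a (ext2 g b) = ext2 (\<lambda>s. cr p q a (g s)) b"
  by (rule additive_ext2) simp

lemma cr_sum_left: "cr p q (sum g I) b = (\<Sum>x\<in>I. cr p q (g x) b)"
  by (induction I rule: infinite_finite_induct) auto

lemma cr_sum_right: "cr p q a (sum g I) = (\<Sum>x\<in>I. cr p q a (g x))"
  by (induction I rule: infinite_finite_induct) auto

lemma cr_induct:
  assumes "keys a \<subseteq> S" "keys b \<subseteq> S'"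
    and "\<And>s t. s \<in> S \<Longrightarrow> t \<in> S' \<Longrightarrow> F (unit2 s) (unit2 t) = (G (unit2 s) (unit2 t) :: 'c::char_two)"
    and "\<And>a a' b. F (a + a') b = F a b + F a' b" "\<And>a b b'. F a (b + b') = F a b + F a b'"
    and "\<And>a a' b. G (a + a') b = G a b + G a' b" "\<And>a b b'. G a (b + b') = G a b + G a b'"
  shows "F a b = G a b"
proof -
  have 0: "F 0 b = 0" "F a 0 = 0" "G 0 b = 0" "G a 0 = 0" for a b
    using assms(4) [of 0 0] assms(5) [of _ 0 0] assms(6) [of 0 0] assms(7) [of _ 0 0]
    by (simp_all add: eq_add_char_two)
  have "F (unit2 s) b = G (unit2 s) b" if "s \<in> S" for s
    using assms(2) by (induction b rule: sum2_induct) (auto simp: assms 0 that)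
  with assms(1) show ?thesis
    by (induction a rule: sum2_induct) (auto simp: assms 0)
qed

lemma keys_stair_upt:
  assumes "L \<in> keys (stair [0..<Suc p] [0..<Suc q])"
  shows "length L = Suc (p + q)" "L \<noteq> []" "set (map fst L) \<subseteq> {..p}" "set (map snd L) \<subseteq> {..q}"
  using keys_stair [OF assms] by (fastforce simp: image_iff simp del: upt_Suc)+

lemma singular_simplex_cs:
  assumes s: "singular_simplex p T s" and t: "singular_simplex q U t"
    and L: "L \<noteq> []" "set (map fst L) \<subseteq> {..p}" "set (map snd L) \<subseteq> {..q}"
  shows "singular_simplex (length L - 1) (prod_topology T U) (cs s t L)"
proof -
  let ?D = "subtopology (powertop_real UNIV) (standard_simplex (length L - 1))"
  have "continuous_map ?D T (s \<circ> amap (map fst L))"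
    using continuous_map_amap_simplex [of "map fst L" p] s L
    by (intro continuous_map_compose) (auto simp: singular_simplex_def)
  moreover have "continuous_map ?D U (t \<circ> amap (map snd L))"
    using continuous_map_amap_simplex [of "map snd L" q] t L
    by (intro continuous_map_compose) (auto simp: singular_simplex_def)
  ultimately have "continuous_map ?D (prod_topology T U) (\<lambda>x. (s (amap (map fst L) x), t (amap (map snd L) x)))"
    by (simp add: continuous_map_pairwise o_def)
  then show ?thesis
    unfolding singular_simplex_def cs_def
    by (auto intro: continuous_map_eq)
qed

lemma chn_cr:
  assumes a: "chn p T A a" and b: "chn q U B b"
  shows "chn (p + q) (prod_topology T U) (A \<times> B) (cr p q a b)"
proof -
  have "chn (p + q) (prod_topology T U) (A \<times> B) (rl s t (stair [0..<Suc p] [0..<Suc q]))"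
    if s: "s \<in> keys a" and t: "t \<in> keys b" for s t
    unfolding rl_def
  proof (rule chn_ext2)
    fix L assume "L \<in> keys (stair [0..<Suc p] [0..<Suc q])"
    note L = keys_stair_upt [OF this]
    have ss: "singular_simplex p T s" "singular_simplex q U t" "s ` standard_simplex p \<subseteq> A" "t ` standard_simplex q \<subseteq> B"
      using a b s t by (auto simp: chn_def)
    have "amap (map fst L) x \<in> standard_simplex p" "amap (map snd L) x \<in> standard_simplex q"
      if "x \<in> standard_simplex (p + q)" for x
      using amap_in_standard_simplex [of x "map fst L" p] amap_in_standard_simplex [of x "map snd L" q] L that by auto
    then show "chn (p + q) (prod_topology T U) (A \<times> B) (if L = [] then 0 else unit2 (cs s t L))"
      using singular_simplex_cs [OF ss(1,2) L(2-4)] L ss(3,4)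
      by (auto simp: chn_unit cs_def)
  qed
  then show ?thesis
    unfolding cr_def by (intro chn_ext2)
qed

lemma bd_rl:
  assumes "\<And>L. L \<in> keys P \<Longrightarrow> length L = Suc n"
  shows "bd n (rl s t P) = rl s t (ext2 ldel P)"
proof -
  have 1: "bd n (unit2 (cs s t L)) = rl s t (ldel L)" if L: "length L = Suc n" for L
  proof (cases "n = 0")
    case True
    with L show ?thesis
      by (cases L) (auto simp: rl_def)
  next
    case False
    have "singular_face n k (cs s t L) = cs s t (del k L)" if k: "k \<le> n" for k
    proof
      fix x
      show "singular_face n k (cs s t L) x = cs s t (del k L) x"
      proof (cases "x \<in> standard_simplex (n - 1)")
        case True
        then have "simplical_face k x \<in> standard_simplex n"
          using False k by (simp add: simplical_face_in_standard_simplex)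
        then show ?thesis
          using True False k L
          by (simp add: singular_face_def cs_def length_del amap_simplical_face flip: del_map)
      qed (use False k L in \<open>auto simp: singular_face_def cs_def length_del\<close>)
    qed
    moreover have "del k L \<noteq> []" if "k \<le> n" for k
      using length_del [of k L] that L False by force
    ultimately show ?thesis
      using False L by (simp add: bd_def rl_def ldel_eq_sum ext2_sum lessThan_Suc_atMost)
  qed
  have "bd n (rl s t P) = ext2 (\<lambda>L. bd n (if L = [] then 0 else unit2 (cs s t L))) P"
    unfolding rl_def by (rule additive_ext2) simp
  also have "\<dots> = ext2 (\<lambda>L. rl s t (ldel L)) P"
    using assms 1 by (intro ext2_cong) auto
  also have "\<dots> = rl s t (ext2 ldel P)"
    by (rule additive_ext2 [symmetric]) simp
  finally show ?thesis .
qed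

lemma rl_stair_shift:
  assumes "p > 0" "m \<le> p"
  shows "rl s t (stair (map (shift m) [0..<p]) [0..<Suc q]) = rl (singular_face p m s) t (stair [0..<p] [0..<Suc q])"
    and "rl t s (stair [0..<Suc q] (map (shift m) [0..<p])) = rl t (singular_face p m s) (stair [0..<Suc q] [0..<p])"
proof -
  have p: "[0..<p] = [0..<Suc (p - 1)]"
    using assms by simp
  have "cs s t (map (map_prod (shift m) id) L) = cs (singular_face p m s) t L"
    if "L \<in> keys (stair [0..<p] [0..<Suc q])" for L
  proof -
    note L = keys_stair_upt [OF that [unfolded p]]
    have "amap (map fst L) x \<in> standard_simplex (p - 1)" if "x \<in> standard_simplex (length L - 1)" for x
      using amap_in_standard_simplex [of x "map fst L" "p - 1"] L that by auto
    moreover have "map fst (map (map_prod (shift m) id) L) = map (shift m) (map fst L)"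
      "map snd (map (map_prod (shift m) id) L) = map snd L"
      by auto
    ultimately show ?thesis
      using simplical_face_amap [of "map fst L" m] L
      unfolding cs_def length_map by (intro restrict_ext) (simp add: singular_face_def del: map_map)
  qed
  then show "rl s t (stair (map (shift m) [0..<p]) [0..<Suc q]) = rl (singular_face p m s) t (stair [0..<p] [0..<Suc q])"
    using stair_map [of "shift m" "[0..<p]" id "[0..<Suc q]"]
    by (auto simp: rl_def ext2_ext2 intro!: ext2_cong simp del: upt_Suc)
  have "cs t s (map (map_prod id (shift m)) L) = cs t (singular_face p m s) L"
    if "L \<in> keys (stair [0..<Suc q] [0..<p])" for L
  proof -
    note L = keys_stair_upt [OF that [unfolded p]]
    have "amap (map snd L) x \<in> standard_simplex (p - 1)" if "x \<in> standard_simplex (length L - 1)" for x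
      using amap_in_standard_simplex [of x "map snd L" "p - 1"] L that by auto
    moreover have "map snd (map (map_prod id (shift m)) L) = map (shift m) (map snd L)"
      "map fst (map (map_prod id (shift m)) L) = map fst L"
      by auto
    ultimately show ?thesis
      using simplical_face_amap [of "map snd L" m] L
      unfolding cs_def length_map by (intro restrict_ext) (simp add: singular_face_def del: map_map)
  qed
  then show "rl t s (stair [0..<Suc q] (map (shift m) [0..<p])) = rl t (singular_face p m s) (stair [0..<Suc q] [0..<p])"
    using stair_map [of id "[0..<Suc q]" "shift m" "[0..<p]"]
    by (auto simp: rl_def ext2_ext2 intro!: ext2_cong simp del: upt_Suc)
qed

text \<open>For \<open>p = 0\<close> or \<open>q = 0\<close> the truncated degrees do no harm, since
  the boundary in that factor is \<open>0\<close>.\<close>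

theorem bd_cr:
  fixes a :: "'a chain2" and b :: "'b chain2"
  shows "bd (p + q) (cr p q a b) = cr (p - 1) q (bd p a) b + cr p (q - 1) a (bd q b)"
proof (rule cr_induct [of a UNIV b UNIV "\<lambda>a b. bd (p + q) (cr p q a b)" "\<lambda>a b. cr (p - 1) q (bd p a) b + cr p (q - 1) a (bd q b)"])
  fix s :: "(nat \<Rightarrow> real) \<Rightarrow> 'a" and t :: "(nat \<Rightarrow> real) \<Rightarrow> 'b"
  let ?A = "[0..<Suc p]" and ?B = "[0..<Suc q]"
  have rl_sum: "rl s t (sum g I) = (\<Sum>x\<in>I. rl s t (g x))" for g and I :: "nat set"
    by (induction I rule: infinite_finite_induct) auto
  have rl_ext2: "rl s t (ext2 g c) = ext2 (\<lambda>x. rl s t (g x)) c" for g and c :: "'z sum2"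
    by (rule additive_ext2) simp
  have "bd (p + q) (cr p q (unit2 s) (unit2 t)) = rl s t (ext2 ldel (stair ?A ?B))"
    unfolding cr_unit by (rule bd_rl) (rule keys_stair_upt)
  also have "\<dots> = rl s t (ext2 (\<lambda>A'. stair A' ?B) (ldel ?A)) + rl s t (ext2 (stair ?A) (ldel ?B))"
    by (subst ldel_stair) (auto simp: rl_def)
  also have "rl s t (ext2 (\<lambda>A'. stair A' ?B) (ldel ?A)) = (\<Sum>m\<le>p. rl s t (stair (map (shift m) [0..<p]) ?B))"
    by (simp add: rl_ext2 rl_sum ldel_upt ext2_sum del: upt_Suc)
  also have "\<dots> = cr (p - 1) q (bd p (unit2 s)) (unit2 t)"
    by (cases p) (simp_all add: bd_def cr_sum_left rl_stair_shift del: upt_Suc sum.atMost_Suc)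
  also have "rl s t (ext2 (stair ?A) (ldel ?B)) = (\<Sum>m\<le>q. rl s t (stair ?A (map (shift m) [0..<q])))"
    by (simp add: rl_ext2 rl_sum ldel_upt ext2_sum del: upt_Suc)
  also have "\<dots> = cr p (q - 1) (unit2 s) (bd q (unit2 t))"
    by (cases q) (simp_all add: bd_def cr_sum_right rl_stair_shift del: upt_Suc sum.atMost_Suc)
  finally show "bd (p + q) (cr p q (unit2 s) (unit2 t)) =
    cr (p - 1) q (bd p (unit2 s)) (unit2 t) + cr p (q - 1) (unit2 s) (bd q (unit2 t))" .
qed (simp_all add: ac_simps)

lemma push_cr: "push (p + q) (map_prod f g) (cr p q a b) = cr p q (push p f a) (push q g b)"
proof (rule cr_induct [of a UNIV b UNIV "\<lambda>a b. push (p + q) (map_prod f g) (cr p q a b)" "\<lambda>a b. cr p q (push p f a) (push q g b)"])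
  fix s t
  have "simplex_map (p + q) (map_prod f g) (cs s t L) = cs (simplex_map p f s) (simplex_map q g t) L"
    if "L \<in> keys (stair [0..<Suc p] [0..<Suc q])" for L
  proof -
    note L = keys_stair_upt [OF that]
    have "amap (map fst L) x \<in> standard_simplex p" "amap (map snd L) x \<in> standard_simplex q"
      if "x \<in> standard_simplex (p + q)" for x
      using amap_in_standard_simplex [of x "map fst L" p] amap_in_standard_simplex [of x "map snd L" q] L that by auto
    then show ?thesis
      using L by (auto simp: simplex_map_def cs_def fun_eq_iff)
  qed
  then show "push (p + q) (map_prod f g) (cr p q (unit2 s) (unit2 t)) = cr p q (push p f (unit2 s)) (push q g (unit2 t))"
    by (auto simp: rl_def push_def ext2_ext2 keys_stair_upt intro!: ext2_cong simp del: upt_Suc)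
qed auto

text \<open>Swapping the coordinates permutes the lattice paths, and there are no signs mod 2. The
  cross product is therefore commutative on chains, not only up to homotopy, and the swap becomes an
  honest involution of formal cells.\<close>

lemma push_swap_cr: "push (p + q) prod.swap (cr p q a b) = cr q p b a"
proof (rule cr_induct [of a UNIV b UNIV "\<lambda>a b. push (p + q) prod.swap (cr p q a b)" "\<lambda>a b. cr q p b a"])
  fix s t
  have "simplex_map (p + q) prod.swap (cs s t L) = cs t s (map prod.swap L)"
    if "L \<in> keys (stair [0..<Suc p] [0..<Suc q])" for L
    using keys_stair_upt [OF that] by (auto simp: simplex_map_def cs_def fun_eq_iff o_def)
  then show "push (p + q) prod.swap (cr p q (unit2 s) (unit2 t)) = cr q p (unit2 t) (unit2 s)"
    unfolding cr_unit stair_swap [of "[0..<Suc q]"]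
    by (auto simp: rl_def push_def ext2_ext2 keys_stair_upt intro!: ext2_cong simp del: upt_Suc)
qed auto

section \<open>Relative cycles, boundaries, and homotopy invariance\<close>

text \<open>Homology groups are not formed here: two relative cycles \<open>a\<close> and
  \<open>b\<close> are homologous when \<open>rb p T A B (a + b)\<close> holds.\<close>

definition rz :: "nat \<Rightarrow> 'a topology \<Rightarrow> 'a set \<Rightarrow> 'a set \<Rightarrow> 'a chain2 \<Rightarrow> bool"
  where "rz p T A B c \<longleftrightarrow> chn p T A c \<and> chn (p - 1) T B (bd p c)"

definition rb :: "nat \<Rightarrow> 'a topology \<Rightarrow> 'a set \<Rightarrow> 'a set \<Rightarrow> 'a chain2 \<Rightarrow> bool"
  where "rb p T A B c \<longleftrightarrow> (\<exists>u r. chn (Suc p) T A u \<and> chn p T B r \<and> c = bd (Suc p) u + r)"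

lemma rz_0 [simp]: "rz p T A B 0"
  by (simp add: rz_def)

lemma rz_add: "rz p T A B a \<Longrightarrow> rz p T A B b \<Longrightarrow> rz p T A B (a + b)"
  by (auto simp: rz_def)

lemma rb_0 [simp]: "rb p T A B 0"
  unfolding rb_def by (intro exI [of _ 0]) auto

lemma rb_add:
  assumes "rb p T A B a" "rb p T A B b"
  shows "rb p T A B (a + b)"
proof -
  obtain u r v s where "chn (Suc p) T A u" "chn p T B r" "a = bd (Suc p) u + r"
      "chn (Suc p) T A v" "chn p T B s" "b = bd (Suc p) v + s"
    using assms by (auto simp: rb_def)
  then have "chn (Suc p) T A (u + v)" "chn p T B (r + s)" "a + b = bd (Suc p) (u + v) + (r + s)"
    by (auto simp: ac_simps)
  then show ?thesis
    unfolding rb_def by blast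
qed

lemma rz_mono: "rz p T A B c \<Longrightarrow> A \<subseteq> A' \<Longrightarrow> B \<subseteq> B' \<Longrightarrow> rz p T A' B' c"
  by (auto simp: rz_def intro: chn_mono)

lemma rb_mono: "rb p T A B c \<Longrightarrow> A \<subseteq> A' \<Longrightarrow> B \<subseteq> B' \<Longrightarrow> rb p T A' B' c"
  unfolding rb_def by (blast intro: chn_mono)

lemma rb_trans: "rb p T A B (a + b) \<Longrightarrow> rb p T A B (b + c) \<Longrightarrow> rb p T A B (a + c)"
  using rb_add [of p T A B "a + b" "b + c"] by (simp add: ac_simps)

lemma chn_imp_rb: "chn p T B c \<Longrightarrow> rb p T A B c"
  unfolding rb_def by (intro exI [of _ 0] exI [of _ c]) auto

lemma bd_imp_rb: "chn (Suc p) T A u \<Longrightarrow> rb p T A B (bd (Suc p) u)"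
  unfolding rb_def by (intro exI [of _ u] exI [of _ 0]) auto

lemma chn_imp_rz: "chn p T B c \<Longrightarrow> B \<subseteq> A \<Longrightarrow> rz p T A B c"
  by (auto simp: rz_def intro: chn_mono chn_bd [simplified])

lemma rb_imp_rz:
  assumes "rb p T A B c" "B \<subseteq> A"
  shows "rz p T A B c"
proof -
  obtain u r where ur: "chn (Suc p) T A u" "chn p T B r" "c = bd (Suc p) u + r"
    using assms by (auto simp: rb_def)
  then have "bd p c = bd p r"
    by (simp add: bd_bd_Suc)
  then show ?thesis
    using ur assms(2) by (auto simp: rz_def intro!: chn_bd [simplified] chn_bd_Suc intro: chn_mono)
qed

lemma rz_push:
  assumes "rz p T A B c" "continuous_map (subtopology T A) T' g"
    "g \<in> topspace T \<inter> A \<rightarrow> A'" "g \<in> topspace T \<inter> B \<rightarrow> B'" "B \<subseteq> A"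
  shows "rz p T' A' B' (push p g c)"
proof -
  have "continuous_map (subtopology T B) T' g"
    using assms(2,5) by (metis continuous_map_from_subtopology_mono)
  then show ?thesis
    using assms bd_push [of p T A c g] by (auto simp: rz_def intro!: chn_push)
qed

lemma rb_push:
  assumes "rb p T A B c" "continuous_map (subtopology T A) T' g"
    "g \<in> topspace T \<inter> A \<rightarrow> A'" "g \<in> topspace T \<inter> B \<rightarrow> B'" "B \<subseteq> A"
  shows "rb p T' A' B' (push p g c)"
proof -
  have cB: "continuous_map (subtopology T B) T' g"
    using assms(2,5) by (metis continuous_map_from_subtopology_mono)
  obtain u r where ur: "chn (Suc p) T A u" "chn p T B r" "c = bd (Suc p) u + r"
    using assms by (auto simp: rb_def)
  have "chn (Suc p) T' A' (push (Suc p) g u)" "chn p T' B' (push p g r)"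
    using ur assms cB by (auto intro: chn_push)
  moreover have "push p g c = bd (Suc p) (push (Suc p) g u) + push p g r"
    using bd_push [OF ur(1), of g] by (simp add: ur(3))
  ultimately show ?thesis
    unfolding rb_def by blast
qed

text \<open>The prism operator is the cross product with the fundamental chain \<open>i\<close> of
  the unit interval. By the Leibniz rule its boundary consists of the two ends and the prism over
  the boundary of \<open>c\<close>, which is mapped into \<open>B'\<close>.\<close>

lemma homotopy_rb:
  assumes h: "continuous_map (prod_topology (top_of_set {0..1::real}) (subtopology T A)) T' h"
    and hA: "\<And>t x. 0 \<le> t \<Longrightarrow> t \<le> 1 \<Longrightarrow> x \<in> topspace T \<Longrightarrow> x \<in> A \<Longrightarrow> h (t, x) \<in> A'"
    and hB: "\<And>t x. 0 \<le> t \<Longrightarrow> t \<le> 1 \<Longrightarrow> x \<in> topspace T \<Longrightarrow> x \<in> B \<Longrightarrow> h (t, x) \<in> B'"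
    and c: "rz p T A B c" and "B \<subseteq> A"
  shows "rb p T' A' B' (push p (\<lambda>x. h (0, x)) c + push p (\<lambda>x. h (1, x)) c)"
proof -
  let ?I = "top_of_set {0..1::real}"
  define e where "e = (\<lambda>t::real. unit2 (\<lambda>x\<in>standard_simplex 0. t))"
  define i where "i = unit2 (\<lambda>x\<in>standard_simplex 1. x 1 :: real)"
  have ci: "chn 1 ?I {0..1} i"
  proof -
    have "continuous_map (subtopology (powertop_real UNIV) (standard_simplex 1)) euclideanreal (\<lambda>x. x (1::nat))"
      by (intro continuous_map_from_subtopology continuous_map_product_projection) auto
    then have "continuous_map (subtopology (powertop_real UNIV) (standard_simplex 1)) euclideanreal (\<lambda>x\<in>standard_simplex 1. x (1::nat))"
      by (rule continuous_map_eq) auto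
    then show ?thesis
      by (auto simp: i_def chn_unit singular_simplex_def continuous_map_in_subtopology standard_simplex_def)
  qed
  have "simplical_face 0 x 1 = (1::real)" "simplical_face 1 x 1 = (0::real)" if "x \<in> standard_simplex 0" for x
    using that by (auto simp: standard_simplex_0 simplical_face_def)
  moreover have "simplical_face k x \<in> standard_simplex 1" if "x \<in> standard_simplex 0" "k \<le> 1" for k and x :: "nat \<Rightarrow> real"
    using that simplical_face_in_standard_simplex [of 1 k x] by simp
  ultimately have "singular_face 1 0 (\<lambda>x\<in>standard_simplex 1. x 1 :: real) = (\<lambda>x\<in>standard_simplex 0. 1)"
    "singular_face 1 1 (\<lambda>x\<in>standard_simplex 1. x 1 :: real) = (\<lambda>x\<in>standard_simplex 0. 0)"
    by (auto simp: singular_face_def fun_eq_iff)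
  then have bi: "bd 1 i = e 0 + e 1"
    by (simp add: bd_def i_def e_def ac_simps)
  \<comment> \<open>A product with a point has only one lattice path, which is the simplex
    itself.\<close>
  have ce: "push p h (cr 0 p (e t) c) = push p (\<lambda>x. h (t, x)) c" for t
  proof -
    have "stair [0::nat] [m..<Suc n] = unit2 (map (Pair 0) [m..<Suc n])" if "m \<le> n" for m n :: nat
      using that
    proof (induction "n - m" arbitrary: m)
      case 0
      then have "[m..<Suc n] = [n]" by simp
      then show ?case by simp
    next
      case (Suc k)
      have "stair [0::nat] [Suc m..<Suc n] = unit2 (map (Pair 0) [Suc m..<Suc n])"
        by (rule Suc(1)) (use Suc(2,3) in auto)
      moreover have "[Suc m..<Suc n] \<noteq> []"
        using Suc by simp
      moreover have "[m..<Suc n] = m # [Suc m..<Suc n]"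
        using Suc by (simp add: upt_conv_Cons del: upt_Suc)
      ultimately show ?case
        by (simp del: upt_Suc)
    qed
    from this [of 0 p] have st: "stair [0..<Suc 0] [0..<Suc p] = unit2 (map (Pair 0) [0..<Suc p])"
      by simp
    have "simplex_map p h (cs (\<lambda>x\<in>standard_simplex 0. t) s (map (Pair 0) [0..<Suc p])) = simplex_map p (\<lambda>x. h (t, x)) s" for s
    proof
      fix x
      have "amap (map (\<lambda>_. 0) [0..<Suc p]) x \<in> standard_simplex 0" if "x \<in> standard_simplex p"
        using that amap_in_standard_simplex [of x "map (\<lambda>_. 0) [0..<Suc p]" 0] by (auto simp del: upt_Suc)
      then show "simplex_map p h (cs (\<lambda>x\<in>standard_simplex 0. t) s (map (Pair 0) [0..<Suc p])) x = simplex_map p (\<lambda>x. h (t, x)) s x"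
        using amap_upt [of x p] by (auto simp: simplex_map_def cs_def o_def simp del: upt_Suc)
    qed
    then have "push p h (rl (\<lambda>x\<in>standard_simplex 0. t) s (stair [0..<Suc 0] [0..<Suc p])) = unit2 (simplex_map p (\<lambda>x. h (t, x)) s)" for s
      unfolding st by (simp add: rl_def del: upt_Suc)
    moreover have "push p h (ext2 g c) = ext2 (\<lambda>s. push p h (g s)) c" for g :: "_ \<Rightarrow> (real \<times> 'a) chain2"
      by (rule additive_ext2) simp
    ultimately show ?thesis
      by (simp add: cr_def e_def push_def [of p "\<lambda>x. h (t, x)"] del: upt_Suc)
  qed
  have chA: "chn p T A c" and chB: "chn (p - 1) T B (bd p c)"
    using c by (auto simp: rz_def)
  have hc: "continuous_map (subtopology (prod_topology ?I T) ({0..1} \<times> C)) T' h" if "C \<subseteq> A" for C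
  proof -
    have "prod_topology ?I (subtopology T A) = subtopology (prod_topology ?I T) ({0..1} \<times> A)"
      by (metis subtopology_Times subtopology_topspace topspace_euclidean_subtopology)
    then show ?thesis
      using h that by (metis continuous_map_from_subtopology_mono order_refl Sigma_mono)
  qed
  have crA: "chn (1 + p) (prod_topology ?I T) ({0..1} \<times> A) (cr 1 p i c)"
    by (rule chn_cr [OF ci chA])
  have "bd (1 + p) (cr 1 p i c) = cr 0 p (e 0 + e 1) c + cr 1 (p - 1) i (bd p c)"
    using bd_cr [of 1 p i c] by (simp add: bi [simplified])
  then have "bd (Suc p) (push (Suc p) h (cr 1 p i c)) =
     push p (\<lambda>x. h (0, x)) c + push p (\<lambda>x. h (1, x)) c + push p h (cr 1 (p - 1) i (bd p c))"
    using bd_push [OF crA, of h] by (simp add: ce)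
  then have eq: "push p (\<lambda>x. h (0, x)) c + push p (\<lambda>x. h (1, x)) c =
     bd (Suc p) (push (Suc p) h (cr 1 p i c)) + push p h (cr 1 (p - 1) i (bd p c))"
    by (simp add: ac_simps)
  have "chn (1 + p) T' A' (push (1 + p) h (cr 1 p i c))"
    by (rule chn_push [OF crA hc [OF order_refl]]) (use hA in auto)
  then have "chn (Suc p) T' A' (push (Suc p) h (cr 1 p i c))"
    by simp
  moreover have "chn p T' B' (push p h (cr 1 (p - 1) i (bd p c)))"
  proof (cases "p = 0")
    case False
    then have "chn p (prod_topology ?I T) ({0..1} \<times> B) (cr 1 (p - 1) i (bd p c))"
      using chn_cr [OF ci chB] by simp
    then show ?thesis
      by (rule chn_push [OF _ hc [OF \<open>B \<subseteq> A\<close>]]) (use hB in auto)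
  qed simp
  ultimately show ?thesis
    unfolding rb_def using eq by blast
qed

section \<open>Excision\<close>

lemma rb_cancel: "rb p T A B (a + b) \<Longrightarrow> rb p T A B b \<Longrightarrow> rb p T A B a"
  by (drule (1) rb_add) (simp add: ac_simps)

lemma sd_rb:
  assumes "rz p T A B c"
  shows "rb p T A B (c + sd n p c)"
proof -
  obtain h :: "nat \<Rightarrow> 'a chain2 \<Rightarrow> 'a chain2" where h:
    "\<And>p a b. h p (a + b) = h p a + h p b"
    "\<And>p T A c. chn p T A c \<Longrightarrow> chn (Suc p) T A (h p c)"
    "\<And>p T A c. chn p T A c \<Longrightarrow> bd (Suc p) (h p c) + h (p - 1) (bd p c) = sd n p c + c"
    by (rule sd_homotopy [of n]) blast
  have c: "chn p T A c" "chn (p - 1) T B (bd p c)"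
    using assms by (auto simp: rz_def)
  have "chn p T B (h (p - 1) (bd p c))"
  proof (cases "p = 0")
    case True
    then show ?thesis
      using h(1) [of 0 0 0] by simp
  next
    case False
    then show ?thesis
      using h(2) [OF c(2)] by simp
  qed
  moreover have "c + sd n p c = bd (Suc p) (h p c) + h (p - 1) (bd p c)"
    using h(3) [OF c(1)] by (simp add: ac_simps)
  ultimately show ?thesis
    unfolding rb_def using h(2) [OF c(1)] by blast
qed

lemma sd_split1:
  assumes "chn p T (A \<union> B) c" "openin T A" "openin T B"
  obtains n a b where "chn p T A a" "chn p T B b" "sd n p c = a + b"
proof -
  obtain N where "\<And>n. n \<ge> N \<Longrightarrow> \<exists>a b. chn p T A a \<and> chn p T B b \<and> sd n p c = a + b"
    by (rule sd_split [OF assms]) blast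
  from this [OF order_refl] show ?thesis
    using that by blast
qed

lemma sd_split_within:
  assumes c: "chn p T (C \<inter> (A \<union> B)) c" and "openin T A" "openin T B"
  obtains n a b where "chn p T (C \<inter> A) a" "chn p T (C \<inter> B) b" "sd n p c = a + b"
proof -
  have 1: "chn p (subtopology T C) ((C \<inter> A) \<union> (C \<inter> B)) c"
    using c by (simp add: chn_subtopology Int_Un_distrib)
  have 2: "openin (subtopology T C) (C \<inter> A)" "openin (subtopology T C) (C \<inter> B)"
    using assms by (simp_all add: openin_subtopology_Int2)
  obtain n a b where "chn p (subtopology T C) (C \<inter> A) a" "chn p (subtopology T C) (C \<inter> B) b" "sd n p c = a + b"
    by (rule sd_split1 [OF 1 2])
  then show ?thesis
    using that by (simp add: chn_subtopology)
qed

lemma excision_surj: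
  assumes c: "rz p T (Q \<union> S) S c" and "openin T Q" "openin T S"
  shows "\<exists>c'. rz p T Q (Q \<inter> S) c' \<and> rb p T (Q \<union> S) S (c + c')"
proof -
  have c1: "chn p T (Q \<union> S) c" "chn (p - 1) T S (bd p c)"
    using c by (auto simp: rz_def)
  obtain n a b where ab: "chn p T Q a" "chn p T S b" "sd n p c = a + b"
    by (rule sd_split1 [OF c1(1) assms(2,3)])
  have "chn (p - 1) T S (bd p (sd n p c) + bd p b)"
    unfolding bd_sd [OF c1(1)] by (intro chn_add chn_sd c1 chn_bd ab)
  moreover have "bd p (sd n p c) + bd p b = bd p a"
    unfolding ab(3) by (simp add: add.assoc)
  ultimately have "rz p T Q (Q \<inter> S) a"
    using ab(1) chn_bd [OF ab(1)] by (simp add: rz_def chn_Int)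
  moreover have "rb p T (Q \<union> S) S (c + a)"
  proof -
    have "rb p T (Q \<union> S) S ((c + sd n p c) + b)"
      by (intro rb_add sd_rb c chn_imp_rb ab)
    then show ?thesis
      by (simp add: ab ac_simps)
  qed
  ultimately show ?thesis
    by blast
qed

lemma excision_inj:
  assumes c: "rz p T Q (Q \<inter> S) c" and b: "rb p T (Q \<union> S) S c" and "openin T Q" "openin T S"
  shows "rb p T Q (Q \<inter> S) c"
proof -
  obtain u r where ur: "chn (Suc p) T (Q \<union> S) u" "chn p T S r" "c = bd (Suc p) u + r"
    using b by (auto simp: rb_def)
  obtain n u1 u2 where u: "chn (Suc p) T Q u1" "chn (Suc p) T S u2" "sd n (Suc p) u = u1 + u2"
    by (rule sd_split1 [OF ur(1) assms(3,4)])
  have "sd n p c = bd (Suc p) u1 + bd (Suc p) u2 + sd n p r"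
    using bd_sd [OF ur(1), of n] u(3) by (simp add: ur(3))
  \<comment> \<open>The left side is supported in \<open>Q\<close> and the right side in
    \<open>S\<close>, so both lie in the intersection.\<close>
  then have eq: "sd n p c + bd (Suc p) u1 = bd (Suc p) u2 + sd n p r"
    by (simp add: ac_simps)
  have "chn p T Q (sd n p c + bd (Suc p) u1)"
    using c u by (auto simp: rz_def intro!: chn_sd chn_bd_Suc)
  moreover have "chn p T S (sd n p c + bd (Suc p) u1)"
    unfolding eq using u ur by (auto intro!: chn_sd chn_bd_Suc)
  ultimately have "rb p T Q (Q \<inter> S) ((sd n p c + bd (Suc p) u1) + bd (Suc p) u1)"
    using u by (intro rb_add chn_imp_rb bd_imp_rb) (auto simp: chn_Int)
  then have "rb p T Q (Q \<inter> S) (sd n p c)"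
    by (simp add: ac_simps)
  with sd_rb [OF c, of n] show ?thesis
    by (rule rb_cancel)
qed

section \<open>Homology of a trivial bundle relative to the complement of its zero section; degree
  and Borsuk's theorem mod 2\<close>

section \<open>Local homology of Euclidean space with parameters\<close>

definition ES :: "nat \<Rightarrow> 'n topology \<Rightarrow> ((nat \<Rightarrow> real) \<times> 'n) topology"
  where "ES D N = prod_topology (Euclidean_space D) N"

definition Fx :: "'n set \<Rightarrow> ((nat \<Rightarrow> real) \<times> 'n) set"
  where "Fx Y = {e. snd e \<in> Y}"

text \<open>The complement, over \<open>Y\<close>, of the subspace where the first \<open>j\<close>
  coordinates vanish. Induction on \<open>j\<close> splits \<open>Sx (Suc j) Y\<close> into the two
  halves \<open>Px 1 j Y\<close> and \<open>Px (- 1) j Y\<close>, which intersect in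
  \<open>Sx j Y\<close>.\<close>

definition Sx :: "nat \<Rightarrow> 'n set \<Rightarrow> ((nat \<Rightarrow> real) \<times> 'n) set"
  where "Sx j Y = {e. snd e \<in> Y \<and> (\<exists>i<j. fst e i \<noteq> 0)}"

definition Px :: "real \<Rightarrow> nat \<Rightarrow> 'n set \<Rightarrow> ((nat \<Rightarrow> real) \<times> 'n) set"
  where "Px \<sigma> j Y = {e. snd e \<in> Y \<and> ((\<exists>i<j. fst e i \<noteq> 0) \<or> \<sigma> * fst e j > 0)}"

text \<open>The straight-line homotopy from the identity to the replacement of \<open>x j\<close> by
  \<open>\<sigma> * exp (x j)\<close>. For \<open>\<sigma>\<close> equal to \<open>1\<close> or
  \<open>- 1\<close> it deforms everything into \<open>Px \<sigma> j\<close> without leaving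
  \<open>Px \<sigma> j\<close> or \<open>Sx j\<close>.\<close>

definition Gx :: "real \<Rightarrow> nat \<Rightarrow> real \<times> ((nat \<Rightarrow> real) \<times> 'n) \<Rightarrow> (nat \<Rightarrow> real) \<times> 'n"
  where "Gx \<sigma> j = (\<lambda>(t, x, s). (x(j := (1 - t) * x j + t * (\<sigma> * exp (x j))), s))"

lemma Sx_subset_Px: "Sx j Y \<subseteq> Px \<sigma> j Y" and Px_subset_Fx: "Px \<sigma> j Y \<subseteq> Fx Y"
  and Sx_subset_Fx: "Sx j Y \<subseteq> Fx Y" and Sx_0 [simp]: "Sx 0 Y = {}"
  by (auto simp: Sx_def Px_def Fx_def)

lemma Px_Int: "Px 1 j Y \<inter> Px (- 1) j Y = Sx j Y"
  by (auto simp: Sx_def Px_def)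

lemma Px_Un: "Px 1 j Y \<union> Px (- 1) j Y = Sx (Suc j) Y"
  by (force simp: Sx_def Px_def less_Suc_eq)

lemma Px_subset_Sx: "\<sigma> = 1 \<or> \<sigma> = - 1 \<Longrightarrow> Px \<sigma> j Y \<subseteq> Sx (Suc j) Y"
  using Px_Un [of j Y] by blast

lemma continuous_map_coord: "continuous_map (ES D N) euclideanreal (\<lambda>e. fst e i)"
proof -
  have "continuous_map (Euclidean_space D) euclideanreal (\<lambda>x. x i)"
    unfolding Euclidean_space_def
    by (intro continuous_map_from_subtopology continuous_map_product_projection) auto
  then show ?thesis
    unfolding ES_def using continuous_map_compose [OF continuous_map_fst] by (force simp: o_def)
qed

lemma openin_Px:
  "openin (ES D N) {e \<in> topspace (ES D N). (\<exists>i<j. fst e i \<noteq> 0) \<or> \<sigma> * fst e j > 0}"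
proof -
  have 1: "openin (ES D N) {e \<in> topspace (ES D N). fst e i \<in> - {0}}" for i
    by (rule openin_continuous_map_preimage [OF continuous_map_coord]) auto
  have 2: "openin (ES D N) {e \<in> topspace (ES D N). \<sigma> * fst e j \<in> {0<..}}"
    by (intro openin_continuous_map_preimage [where Y = euclideanreal] continuous_map_real_mult continuous_map_coord) auto
  have "{e \<in> topspace (ES D N). (\<exists>i<j. fst e i \<noteq> 0) \<or> \<sigma> * fst e j > 0} =
      (\<Union>i<j. {e \<in> topspace (ES D N). fst e i \<in> - {0}}) \<union> {e \<in> topspace (ES D N). \<sigma> * fst e j \<in> {0<..}}"
    by auto
  also have "openin (ES D N) \<dots>"
    using 1 2 by (intro openin_Un openin_Union) auto
  finally show ?thesis .
qed

lemma sd_split_Px: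
  assumes "chn p (ES D N) (Sx (Suc j) Y) c"
  obtains n a b where "chn p (ES D N) (Px 1 j Y) a" "chn p (ES D N) (Px (- 1) j Y) b" "sd n p c = a + b"
proof -
  let ?P = "\<lambda>\<sigma>. {e \<in> topspace (ES D N). (\<exists>i<j. fst e i \<noteq> 0) \<or> \<sigma> * fst e j > 0}"
  have eq: "topspace (ES D N) \<inter> Px \<sigma> j Y = Fx Y \<inter> ?P \<sigma>" for \<sigma>
    by (auto simp: Px_def Fx_def)
  have "topspace (ES D N) \<inter> Sx (Suc j) Y = Fx Y \<inter> (?P 1 \<union> ?P (- 1))"
    by (simp only: Int_Un_distrib eq [symmetric] Px_Un [symmetric])
  then have "chn p (ES D N) (Fx Y \<inter> (?P 1 \<union> ?P (- 1))) c"
    using assms chn_topspace [of p "ES D N" "Sx (Suc j) Y" c] by simp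
  from sd_split_within [OF this openin_Px openin_Px] that show ?thesis
    unfolding eq [symmetric] chn_topspace by blast
qed

lemma continuous_map_Gx:
  assumes "j < D"
  shows "continuous_map (prod_topology (top_of_set {0..1::real}) (subtopology (ES D N) A)) (ES D N) (Gx \<sigma> j)"
proof -
  let ?P = "prod_topology (top_of_set {0..1::real}) (ES D N)"
  have e: "continuous_map ?P euclideanreal (\<lambda>z. fst (snd z) i)" for i
    using continuous_map_compose [OF continuous_map_snd continuous_map_coord, of "top_of_set {0..1}" D N i]
    by (simp add: o_def)
  have t: "continuous_map ?P euclideanreal fst"
    using continuous_map_into_fulltopology [OF continuous_map_fst] .
  have x: "continuous_map ?P euclideanreal (\<lambda>z. exp (fst (snd z) j))"
    using continuous_map_compose [OF e [of j], of euclideanreal exp] by (simp add: o_def continuous_on_exp continuous_on_id)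
  have 1: "continuous_map ?P (Euclidean_space D) (\<lambda>z i. if i = j then (1 - fst z) * fst (snd z) j + fst z * (\<sigma> * exp (fst (snd z) j)) else fst (snd z) i)"
    unfolding Euclidean_space_def continuous_map_in_subtopology continuous_map_componentwise_UNIV
  proof (intro conjI allI)
    fix i
    show "continuous_map ?P euclideanreal (\<lambda>z. if i = j then (1 - fst z) * fst (snd z) j + fst z * (\<sigma> * exp (fst (snd z) j)) else fst (snd z) i)"
      using e t x by (cases "i = j") (auto intro!: continuous_intros)
  qed (use assms in \<open>auto simp: ES_def topspace_Euclidean_space\<close>)
  have 2: "continuous_map ?P N (\<lambda>z. snd (snd z))"
    unfolding ES_def
    using continuous_map_compose [OF continuous_map_snd continuous_map_snd, of "top_of_set {0..1::real}" "Euclidean_space D" N]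
    by (simp add: o_def)
  have "continuous_map ?P (ES D N) (Gx \<sigma> j)"
    using 1 2 unfolding ES_def
    by (auto simp: continuous_map_pairwise Gx_def o_def case_prod_beta fun_upd_def)
  moreover have "prod_topology (top_of_set {0..1::real}) (subtopology (ES D N) A) = subtopology ?P ({0..1} \<times> A)"
    by (metis subtopology_Times subtopology_topspace topspace_euclidean_subtopology)
  ultimately show ?thesis
    by (simp add: continuous_map_from_subtopology)
qed

lemma Gx_0: "Gx \<sigma> j (0, e) = e"
  by (cases e) (simp add: Gx_def)

lemma snd_Gx [simp]: "snd (Gx \<sigma> j (t, e)) = snd e"
  by (cases e) (simp add: Gx_def)

lemma Gx_mem:
  assumes "0 \<le> t" "t \<le> 1" "\<sigma> = 1 \<or> \<sigma> = - 1"
  shows "e \<in> Fx Y \<Longrightarrow> Gx \<sigma> j (t, e) \<in> Fx Y"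
    and "e \<in> Sx j Y \<Longrightarrow> Gx \<sigma> j (t, e) \<in> Sx j Y"
    and "e \<in> Px \<sigma> j Y \<Longrightarrow> Gx \<sigma> j (t, e) \<in> Px \<sigma> j Y"
    and "e \<in> Fx Y \<Longrightarrow> Gx \<sigma> j (1, e) \<in> Px \<sigma> j Y"
proof -
  obtain x s where e: "e = (x, s)" by (cases e)
  have "0 < (1 - t) * (\<sigma> * x j) + t * exp (x j)" if "0 < \<sigma> * x j"
    using assms(1,2) that
    by (cases "t = 1") (auto intro: add_pos_nonneg mult_pos_pos mult_nonneg_nonneg)
  then have pos: "0 < \<sigma> * ((1 - t) * x j + t * (\<sigma> * exp (x j)))" if "0 < \<sigma> * x j"
    using that assms(3) by (auto simp: algebra_simps)
  show "e \<in> Fx Y \<Longrightarrow> Gx \<sigma> j (t, e) \<in> Fx Y"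
    by (simp add: Fx_def)
  show "e \<in> Sx j Y \<Longrightarrow> Gx \<sigma> j (t, e) \<in> Sx j Y"
    by (auto simp: Sx_def e Gx_def)
  show "e \<in> Px \<sigma> j Y \<Longrightarrow> Gx \<sigma> j (t, e) \<in> Px \<sigma> j Y"
    using pos by (auto simp: Px_def e Gx_def) (metis nat_neq_iff)+
  show "e \<in> Fx Y \<Longrightarrow> Gx \<sigma> j (1, e) \<in> Px \<sigma> j Y"
    using assms(3) by (auto simp: Px_def Fx_def e Gx_def)
qed

lemma gx_Pi:
  assumes "\<sigma> = 1 \<or> \<sigma> = - 1"
  shows "(\<lambda>e. Gx \<sigma> j (1, e)) \<in> X \<inter> Fx Y \<rightarrow> Px \<sigma> j Y"
    and "(\<lambda>e. Gx \<sigma> j (1, e)) \<in> X \<inter> Sx j Y \<rightarrow> Sx j Y"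
proof -
  have "Gx \<sigma> j (1, e) \<in> Px \<sigma> j Y" if "e \<in> Fx Y" for e
    by (rule Gx_mem(4) [OF _ _ assms that, of 0]) simp_all
  then show "(\<lambda>e. Gx \<sigma> j (1, e)) \<in> X \<inter> Fx Y \<rightarrow> Px \<sigma> j Y"
    by (simp add: Pi_def)
  have "Gx \<sigma> j (1, e) \<in> Sx j Y" if "e \<in> Sx j Y" for e
    by (rule Gx_mem(2) [OF _ _ assms that]) simp_all
  then show "(\<lambda>e. Gx \<sigma> j (1, e)) \<in> X \<inter> Sx j Y \<rightarrow> Sx j Y"
    by (simp add: Pi_def)
qed

abbreviation gx :: "real \<Rightarrow> nat \<Rightarrow> (nat \<Rightarrow> real) \<times> 'n \<Rightarrow> (nat \<Rightarrow> real) \<times> 'n"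
  where "gx \<sigma> j \<equiv> \<lambda>e. Gx \<sigma> j (1, e)"

lemma continuous_map_gx:
  assumes "j < D"
  shows "continuous_map (subtopology (ES D N) A) (ES D N) (gx \<sigma> j)"
proof -
  have "continuous_map (subtopology (ES D N) A) (prod_topology (top_of_set {0..1::real}) (subtopology (ES D N) A)) (\<lambda>e. (1, e))"
    by (auto simp: continuous_map_pairwise o_def)
  from continuous_map_compose [OF this continuous_map_Gx [OF assms]] show ?thesis
    by (simp add: o_def)
qed

lemma Gx_rb:
  assumes c: "rz p (ES D N) A B c" and "j < D" "B \<subseteq> A"
    and "\<And>t e. 0 \<le> t \<Longrightarrow> t \<le> 1 \<Longrightarrow> e \<in> A \<Longrightarrow> Gx \<sigma> j (t, e) \<in> A"
    and "\<And>t e. 0 \<le> t \<Longrightarrow> t \<le> 1 \<Longrightarrow> e \<in> B \<Longrightarrow> Gx \<sigma> j (t, e) \<in> B"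
  shows "rb p (ES D N) A B (c + push p (gx \<sigma> j) c)"
proof -
  have "rb p (ES D N) A B (push p (\<lambda>x. Gx \<sigma> j (0, x)) c + push p (\<lambda>x. Gx \<sigma> j (1, x)) c)"
    by (rule homotopy_rb [OF continuous_map_Gx [OF \<open>j < D\<close>] _ _ c]) (use assms in auto)
  moreover have "push p (\<lambda>x. Gx \<sigma> j (0, x)) c = c"
    using c by (intro push_id_gen) (auto simp: rz_def Gx_0)
  ultimately show ?thesis by simp
qed

text \<open>\<open>Gx\<close> deforms the whole space into the half while preserving the
  half.\<close>

lemma rb_Fx_Px:
  assumes c: "rz p (ES D N) (Fx Y) (Px \<sigma> j Y) c" and "j < D" "\<sigma> = 1 \<or> \<sigma> = - 1"
  shows "rb p (ES D N) (Fx Y) (Px \<sigma> j Y) c"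
proof -
  have "rb p (ES D N) (Fx Y) (Px \<sigma> j Y) (c + push p (gx \<sigma> j) c)"
    by (rule Gx_rb [OF c assms(2) Px_subset_Fx]) (simp_all add: Gx_mem assms(3))
  moreover have "chn p (ES D N) (Px \<sigma> j Y) (push p (gx \<sigma> j) c)"
    using c by (intro chn_push [OF _ continuous_map_gx [OF assms(2)] gx_Pi(1) [OF assms(3)]]) (simp add: rz_def)
  ultimately show ?thesis
    by (rule rb_cancel [OF _ chn_imp_rb])
qed

text \<open>\<open>gx\<close> maps the large pair to the small one and is homotopic to the identity
  on the small one. For \<open>d = 0\<close> this says that passing from
  \<open>Px \<sigma> j Y\<close> to \<open>Fx Y\<close> loses nothing relative to
  \<open>Sx j Y\<close>.\<close>

lemma rb_Px_transfer:
  assumes c: "rz p (ES D N) (Px \<sigma> j Y) (Sx j Y) c" and b: "rb p (ES D N) (Fx Y) (Sx j Y) (c + d)"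
    and j: "j < D" and \<sigma>: "\<sigma> = 1 \<or> \<sigma> = - 1"
  shows "rb p (ES D N) (Px \<sigma> j Y) (Sx j Y) (c + push p (gx \<sigma> j) d)"
proof -
  have "rb p (ES D N) (Px \<sigma> j Y) (Sx j Y) (c + push p (gx \<sigma> j) c)"
    by (rule Gx_rb [OF c j Sx_subset_Px]) (simp_all add: Gx_mem \<sigma>)
  moreover have "rb p (ES D N) (Px \<sigma> j Y) (Sx j Y) (push p (gx \<sigma> j) (c + d))"
    by (rule rb_push [OF b continuous_map_gx [OF j] gx_Pi(1) [OF \<sigma>] gx_Pi(2) [OF \<sigma>] Sx_subset_Fx])
  ultimately show ?thesis
    unfolding push_add by (rule rb_trans)
qed

lemma chn_Sx_iff: "chn p T (Sx j Y) c \<longleftrightarrow> chn p T (Px 1 j Y) c \<and> chn p T (Px (- 1) j Y) c"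
  unfolding Px_Int [symmetric] chn_Int ..

text \<open>The inverse of suspension: after subdivision the boundary splits between the two halves,
  and the common boundary of the pieces lies in both of them, hence in
  \<open>Sx j Y\<close>.\<close>

lemma suspension_split:
  assumes c: "rz (Suc p) (ES D N) (Fx Y) (Sx (Suc j) Y) c"
  obtains c' r r' where "rb (Suc p) (ES D N) (Fx Y) (Sx (Suc j) Y) (c + c')"
    "chn (Suc p) (ES D N) (Fx Y) c'" "bd (Suc p) c' = r + r'"
    "rz p (ES D N) (Px 1 j Y) (Sx j Y) r" "rz p (ES D N) (Px (- 1) j Y) (Sx j Y) r'"
proof -
  have c1: "chn (Suc p) (ES D N) (Fx Y) c" "chn p (ES D N) (Sx (Suc j) Y) (bd (Suc p) c)"
    using c by (auto simp: rz_def)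
  obtain n r r' where r: "chn p (ES D N) (Px 1 j Y) r" "chn p (ES D N) (Px (- 1) j Y) r'" "sd n p (bd (Suc p) c) = r + r'"
    by (rule sd_split_Px [OF c1(2)])
  have bd: "bd (Suc p) (sd n (Suc p) c) = r + r'"
    using bd_sd [OF c1(1), of n] r by simp
  have "bd p (r + r') = 0"
    using bd_bd_Suc [OF chn_sd [OF c1(1), of n]] by (simp only: bd)
  then have "bd p r = bd p r'"
    by (simp add: add_eq_0_char_two)
  then have "chn (p - 1) (ES D N) (Sx j Y) (bd p r)" "bd p r' = bd p r"
    unfolding chn_Sx_iff using chn_bd [OF r(1)] chn_bd [OF r(2)] by auto
  then show ?thesis
    using r bd sd_rb [OF c, of n] chn_sd [OF c1(1)] by (intro that [of "sd n (Suc p) c" r r']) (simp_all add: rz_def)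
qed

text \<open>Suspension detects triviality: adding the filling \<open>u\<close> of the upper piece to
  \<open>c'\<close> leaves a boundary in the lower half, where nothing nontrivial exists;
  \<open>u\<close> itself lies in \<open>Sx (Suc j) Y\<close>.\<close>

lemma suspension_rb:
  assumes cc: "rb (Suc p) (ES D N) (Fx Y) (Sx (Suc j) Y) (c + c')" and c': "chn (Suc p) (ES D N) (Fx Y) c'"
    and bd: "bd (Suc p) c' = r + r'"
    and r: "rb p (ES D N) (Px 1 j Y) (Sx j Y) r" and r': "chn p (ES D N) (Px (- 1) j Y) r'" and j: "j < D"
  shows "rb (Suc p) (ES D N) (Fx Y) (Sx (Suc j) Y) c"
proof -
  obtain u s where us: "chn (Suc p) (ES D N) (Px 1 j Y) u" "chn p (ES D N) (Sx j Y) s" "r = bd (Suc p) u + s"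
    using r by (auto simp: rb_def)
  have "chn p (ES D N) (Px (- 1) j Y) (s + r')"
    using us r' by (auto simp: chn_Sx_iff)
  then have "rz (Suc p) (ES D N) (Fx Y) (Px (- 1) j Y) (c' + u)"
    using c' chn_mono [OF us(1) Px_subset_Fx] bd us(3) by (simp add: rz_def chn_add ac_simps)
  then have "rb (Suc p) (ES D N) (Fx Y) (Px (- 1) j Y) (c' + u)"
    using j by (intro rb_Fx_Px) auto
  then have "rb (Suc p) (ES D N) (Fx Y) (Sx (Suc j) Y) (c' + u)"
    by (rule rb_mono [OF _ order_refl Px_subset_Sx]) simp
  moreover have "rb (Suc p) (ES D N) (Fx Y) (Sx (Suc j) Y) u"
    by (intro chn_imp_rb chn_mono [OF us(1) Px_subset_Sx]) simp
  ultimately have "rb (Suc p) (ES D N) (Fx Y) (Sx (Suc j) Y) c'"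
    by (rule rb_cancel)
  with cc show ?thesis
    by (rule rb_cancel)
qed

lemma rb_dimension_0:
  assumes "rz 0 (ES D N) (Fx Y) (Sx (Suc j) Y) c" "j < D"
  shows "rb 0 (ES D N) (Fx Y) (Sx (Suc j) Y) c"
proof -
  have "rz 0 (ES D N) (Fx Y) (Px 1 j Y) c"
    using assms(1) by (simp add: rz_def)
  then have "rb 0 (ES D N) (Fx Y) (Px 1 j Y) c"
    using assms(2) by (rule rb_Fx_Px) simp
  then show ?thesis
    by (rule rb_mono [OF _ order_refl Px_subset_Sx]) simp
qed

lemma rb_suspension_step:
  assumes c: "rz (Suc p) (ES D N) (Fx Y) (Sx (Suc j) Y) c" and j: "j < D"
    and IH: "\<And>r. rz p (ES D N) (Fx Y) (Sx j Y) r \<Longrightarrow> rb p (ES D N) (Fx Y) (Sx j Y) r"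
  shows "rb (Suc p) (ES D N) (Fx Y) (Sx (Suc j) Y) c"
proof -
  obtain c' r r' where *: "rb (Suc p) (ES D N) (Fx Y) (Sx (Suc j) Y) (c + c')"
    "chn (Suc p) (ES D N) (Fx Y) c'" "bd (Suc p) c' = r + r'"
    "rz p (ES D N) (Px 1 j Y) (Sx j Y) r" "rz p (ES D N) (Px (- 1) j Y) (Sx j Y) r'"
    by (rule suspension_split [OF c])
  have "rz p (ES D N) (Fx Y) (Sx j Y) r"
    using *(4) by (rule rz_mono [OF _ Px_subset_Fx order_refl])
  then have "rb p (ES D N) (Fx Y) (Sx j Y) r"
    by (rule IH)
  then have "rb p (ES D N) (Px 1 j Y) (Sx j Y) r"
    using rb_Px_transfer [OF *(4), of 0] j by simp
  moreover have "chn p (ES D N) (Px (- 1) j Y) r'"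
    using *(5) by (simp add: rz_def)
  ultimately show ?thesis
    using j by (rule suspension_rb [OF *(1-3)])
qed

text \<open>Each step lowers the degree and \<open>j\<close> together, until degree \<open>0\<close>
  is reached with \<open>j\<close> still positive; there every chain can be deformed into one
  half.\<close>

theorem rb_below_dimension:
  assumes "i < j" "j \<le> D" "rz i (ES D N) (Fx Y) (Sx j Y) c"
  shows "rb i (ES D N) (Fx Y) (Sx j Y) c"
  using assms
proof (induction j arbitrary: i c)
  case 0
  then show ?case by simp
next
  case (Suc j)
  then have jD: "j < D" by simp
  show ?case
  proof (cases "i = 0")
    case True
    with Suc.prems(3) jD show ?thesis
      by (simp only: rb_dimension_0)
  next
    case False
    then obtain p where i: "i = Suc p"
      using not0_implies_Suc by blast
    have "p < j" "j \<le> D"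
      using Suc.prems(1,2) i by auto
    with Suc.IH show ?thesis
      using Suc.prems(3) unfolding i by (intro rb_suspension_step jD)
  qed
qed

text \<open>A chain of degree \<open>0\<close> is a finite sum of points, each in a single fibre,
  and suspension carries this to degree \<open>j\<close>. The indices are singular simplices because
  they come from the support of that chain.\<close>

theorem fibre_decomposition:
  fixes N :: "'n topology"
  assumes "j \<le> D" "rz j (ES D N) (Fx Y) (Sx j Y) c"
  obtains I s g where "finite (I :: ((nat \<Rightarrow> real) \<Rightarrow> (nat \<Rightarrow> real) \<times> 'n) set)" "\<And>i. i \<in> I \<Longrightarrow> s i \<in> Y"
    "\<And>i. i \<in> I \<Longrightarrow> rz j (ES D N) (Fx {s i}) (Sx j {s i}) (g i)"
    "rb j (ES D N) (Fx Y) (Sx j Y) (c + sum g I)"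
proof -
  have "\<exists>I s g. finite (I :: ((nat \<Rightarrow> real) \<Rightarrow> (nat \<Rightarrow> real) \<times> 'n) set) \<and> (\<forall>i\<in>I. s i \<in> Y) \<and>
    (\<forall>i\<in>I. rz j (ES D N) (Fx {s i}) (Sx j {s i}) (g i)) \<and>
    rb j (ES D N) (Fx Y) (Sx j Y) (c + sum g I)"
    using assms
  proof (induction j arbitrary: c)
    case 0
    let ?v = "\<lambda>j. if j = 0 then 1 else (0::real)"
    have c: "singular_simplex 0 (ES D N) f" "f ` standard_simplex 0 \<subseteq> Fx Y" if "f \<in> keys c" for f
      using 0 that by (auto simp: rz_def chn_def)
    have "snd (f ?v) \<in> Y" if "f \<in> keys c" for f
      using c(2) [OF that] by (auto simp: standard_simplex_0 Fx_def)
    moreover have "rz 0 (ES D N) (Fx {snd (f ?v)}) (Sx 0 {snd (f ?v)}) (unit2 f)" if "f \<in> keys c" for f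
      using c [OF that] by (simp add: rz_def chn_unit standard_simplex_0 Fx_def)
    moreover have "c + sum unit2 (keys c) = 0"
      using sum2_eq_sum_units [of c] by simp
    ultimately show ?case
      by (intro exI [of _ "keys c"] exI [of _ "\<lambda>f. snd (f ?v)"] exI [of _ unit2]) auto
  next
    case (Suc j)
    obtain c' r r' where *: "rb (Suc j) (ES D N) (Fx Y) (Sx (Suc j) Y) (c + c')"
      "chn (Suc j) (ES D N) (Fx Y) c'" "bd (Suc j) c' = r + r'"
      "rz j (ES D N) (Px 1 j Y) (Sx j Y) r" "rz j (ES D N) (Px (- 1) j Y) (Sx j Y) r'"
      by (rule suspension_split [OF Suc.prems(2)])
    have "rz j (ES D N) (Fx Y) (Sx j Y) r"
      using *(4) by (rule rz_mono [OF _ Px_subset_Fx order_refl])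
    from Suc.IH [OF Suc_leD [OF Suc.prems(1)] this] obtain I s g where I0: "finite (I :: ((nat \<Rightarrow> real) \<Rightarrow> (nat \<Rightarrow> real) \<times> 'n) set)" "\<forall>i\<in>I. s i \<in> Y"
      "\<forall>i\<in>I. rz j (ES D N) (Fx {s i}) (Sx j {s i}) (g i)"
      "rb j (ES D N) (Fx Y) (Sx j Y) (r + sum g I)"
      by (elim exE conjE)
    note I = I0(1) I0(2,3) [rule_format] I0(4)
    have jD: "j < D"
      using Suc.prems by simp
    define g' where "g' = (\<lambda>i. push j (gx 1 j) (g i))"
    have rg: "rb j (ES D N) (Px 1 j Y) (Sx j Y) (r + sum g' I)"
      using rb_Px_transfer [OF *(4) I(4) jD] by (simp add: push_sum g'_def)
    have g': "rz j (ES D N) (Px 1 j {s i}) (Sx j {s i}) (g' i)" if "i \<in> I" for i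
      unfolding g'_def
      by (rule rz_push [OF I(3) [OF that] continuous_map_gx [OF jD] gx_Pi(1) gx_Pi(2) Sx_subset_Fx]) auto
    \<comment> \<open>Suspending within the fibre: \<open>g' i\<close> bounds there modulo the lower
      half, and the filling is the required relative cycle in one dimension more.\<close>
    have "\<exists>G \<rho>. chn (Suc j) (ES D N) (Fx {s i}) G \<and> chn j (ES D N) (Px (- 1) j {s i}) \<rho> \<and> g' i = bd (Suc j) G + \<rho>" if "i \<in> I" for i
    proof -
      have "rz j (ES D N) (Fx {s i}) (Px (- 1) j {s i}) (g' i)"
        using g' [OF that] by (rule rz_mono [OF _ Px_subset_Fx Sx_subset_Px])
      from rb_Fx_Px [OF this jD] show ?thesis
        by (auto simp: rb_def)
    qed
    then have "\<forall>i\<in>I. \<exists>p. chn (Suc j) (ES D N) (Fx {s i}) (fst p) \<and> chn j (ES D N) (Px (- 1) j {s i}) (snd p) \<and> g' i = bd (Suc j) (fst p) + snd p"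
      by simp
    then obtain P where "\<forall>i\<in>I. chn (Suc j) (ES D N) (Fx {s i}) (fst (P i)) \<and> chn j (ES D N) (Px (- 1) j {s i}) (snd (P i)) \<and> g' i = bd (Suc j) (fst (P i)) + snd (P i)"
      by (rule bchoice [THEN exE])
    note P = this [rule_format, THEN conjunct1] this [rule_format, THEN conjunct2, THEN conjunct1]
      this [rule_format, THEN conjunct2, THEN conjunct2]
    define G where "G = (\<lambda>i. fst (P i))"
    define \<rho> where "\<rho> = (\<lambda>i. snd (P i))"
    have G: "chn (Suc j) (ES D N) (Fx {s i}) (G i)" "chn j (ES D N) (Px (- 1) j {s i}) (\<rho> i)"
      "g' i = bd (Suc j) (G i) + \<rho> i" if "i \<in> I" for i
      using P [OF that] by (simp_all add: G_def \<rho>_def)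
    have Gz: "rz (Suc j) (ES D N) (Fx {s i}) (Sx (Suc j) {s i}) (G i)" if "i \<in> I" for i
    proof -
      have "bd (Suc j) (G i) = g' i + \<rho> i"
        using G(3) [OF that] by (simp add: ac_simps)
      moreover have "chn j (ES D N) (Sx (Suc j) {s i}) (g' i)" "chn j (ES D N) (Sx (Suc j) {s i}) (\<rho> i)"
        using g' [OF that] G(2) [OF that] by (auto simp: rz_def elim: chn_mono [OF _ Px_subset_Sx])
      ultimately show ?thesis
        using G(1) [OF that] by (auto simp: rz_def)
    qed
    have chG: "chn (Suc j) (ES D N) (Fx Y) (sum G I)"
    proof (rule chn_sum)
      fix i assume "i \<in> I"
      show "chn (Suc j) (ES D N) (Fx Y) (G i)"
        by (rule chn_mono [OF G(1) [OF \<open>i \<in> I\<close>]]) (use I(2) [OF \<open>i \<in> I\<close>] in \<open>auto simp: Fx_def\<close>)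
    qed
    have ch\<rho>: "chn j (ES D N) (Px (- 1) j Y) (sum \<rho> I)"
    proof (rule chn_sum)
      fix i assume "i \<in> I"
      show "chn j (ES D N) (Px (- 1) j Y) (\<rho> i)"
        by (rule chn_mono [OF G(2) [OF \<open>i \<in> I\<close>]]) (use I(2) [OF \<open>i \<in> I\<close>] in \<open>auto simp: Px_def\<close>)
    qed
    have "sum g' I = bd (Suc j) (sum G I) + sum \<rho> I"
      using G(3) by (simp add: bd_sum sum.distrib)
    then have eq: "bd (Suc j) (c' + sum G I) = (r + sum g' I) + (r' + sum \<rho> I)"
      by (simp only: *(3) bd_add) (simp add: ac_simps)
    have "rb (Suc j) (ES D N) (Fx Y) (Sx (Suc j) Y) (c + sum G I)"
    proof (rule suspension_rb [OF _ _ eq rg _ jD])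
      show "rb (Suc j) (ES D N) (Fx Y) (Sx (Suc j) Y) (c + sum G I + (c' + sum G I))"
        using *(1) by (simp add: ac_simps)
      show "chn (Suc j) (ES D N) (Fx Y) (c' + sum G I)"
        using *(2) chG by (rule chn_add)
      show "chn j (ES D N) (Px (- 1) j Y) (r' + sum \<rho> I)"
        using *(5) ch\<rho> by (simp add: rz_def chn_add)
    qed
    then show ?case
      using I(1,2) Gz by (intro exI [of _ I] exI [of _ s] exI [of _ G]) simp
  qed
  then obtain I s g where "finite (I :: ((nat \<Rightarrow> real) \<Rightarrow> (nat \<Rightarrow> real) \<times> 'n) set)" "\<forall>i\<in>I. s i \<in> Y"
    "\<forall>i\<in>I. rz j (ES D N) (Fx {s i}) (Sx j {s i}) (g i)"
    "rb j (ES D N) (Fx Y) (Sx j Y) (c + sum g I)"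
    by blast
  then show ?thesis
    by (intro that [of I s g]) simp_all
qed

lemma char_two_swap: "a + b = c + d \<Longrightarrow> a + c = b + (d :: 'a::char_two)"
proof -
  assume "a + b = c + d"
  then have "(a + b) + (c + d) = 0"
    by simp
  then have "(a + c) + (b + d) = 0"
    by (simp add: ac_simps)
  then show ?thesis
    by (simp only: add_eq_0_char_two)
qed

section \<open>The local degree mod 2 and Borsuk's theorem\<close>

definition additive_on :: "nat \<Rightarrow> 'a topology \<Rightarrow> 'a set \<Rightarrow> 'a set \<Rightarrow> ('a chain2 \<Rightarrow> bit) \<Rightarrow> bool"
  where "additive_on p T A B \<delta> \<longleftrightarrow>
    (\<forall>a b. rz p T A B a \<longrightarrow> rz p T A B b \<longrightarrow> \<delta> (a + b) = \<delta> a + \<delta> b) \<and> (\<forall>c. rb p T A B c \<longrightarrow> \<delta> c = 0)"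

lemma additive_on_add: "additive_on p T A B \<delta> \<Longrightarrow> rz p T A B a \<Longrightarrow> rz p T A B b \<Longrightarrow> \<delta> (a + b) = \<delta> a + \<delta> b"
  and additive_on_rb: "additive_on p T A B \<delta> \<Longrightarrow> rb p T A B c \<Longrightarrow> \<delta> c = 0"
  by (auto simp: additive_on_def)

lemma additive_on_cong:
  assumes "additive_on p T A B \<delta>" "rz p T A B a" "rb p T A B (a + b)" "B \<subseteq> A"
  shows "\<delta> b = \<delta> a"
proof -
  have "rz p T A B b"
    using rz_add [OF assms(2) rb_imp_rz [OF assms(3,4)]] by (simp add: ac_simps)
  then have "\<delta> (a + b) = \<delta> a + \<delta> b"
    using assms by (intro additive_on_add)
  then show ?thesis
    using additive_on_rb [OF assms(1,3)] by (metis add_eq_0_char_two)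
qed

lemma additive_on_sum:
  assumes "additive_on p T A B \<delta>" "\<And>i. i \<in> I \<Longrightarrow> rz p T A B (g i)"
  shows "\<delta> (sum g I) = (\<Sum>i\<in>I. \<delta> (g i))" and "rz p T A B (sum g I)"
proof -
  have "\<delta> (sum g I) = (\<Sum>i\<in>I. \<delta> (g i)) \<and> rz p T A B (sum g I)"
    using assms(2)
  proof (induction I rule: infinite_finite_induct)
    case (insert x I)
    then show ?case
      using additive_on_add [OF assms(1), of "g x" "sum g I"] by (simp add: rz_add)
  qed (auto simp: additive_on_rb [OF assms(1) rb_0])
  then show "\<delta> (sum g I) = (\<Sum>i\<in>I. \<delta> (g i))" "rz p T A B (sum g I)"
    by blast+
qed

definition antip :: "(nat \<Rightarrow> real) \<times> 'n \<Rightarrow> (nat \<Rightarrow> real) \<times> 'n"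
  where "antip = (\<lambda>(x, s). (\<lambda>i. - x i, s))"

text \<open>A chain-level substitute for an odd map of spheres: the members play the role of the images of
  the hemispheres of increasing dimension.  Borsuk's theorem becomes the last clause of \<open>local_degree\<close>.\<close>

definition borsuk_seq :: "nat \<Rightarrow> 'n topology \<Rightarrow> nat \<Rightarrow> (nat \<Rightarrow> ((nat \<Rightarrow> real) \<times> 'n) chain2) \<Rightarrow> bool"
  where "borsuk_seq D N j c \<longleftrightarrow> (\<forall>i<j. chn i (ES D N) (Sx j UNIV) (c i)) \<and> chn j (ES D N) UNIV (c j) \<and>
    (\<forall>i<j. bd (Suc i) (c (Suc i)) = c i + push i antip (c i)) \<and> ext2 (\<lambda>_. 1) (c 0) = (1 :: bit)"

definition local_degree :: "nat \<Rightarrow> 'n topology \<Rightarrow> nat \<Rightarrow> (((nat \<Rightarrow> real) \<times> 'n) chain2 \<Rightarrow> bit) \<Rightarrow> bool"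
  where "local_degree D N j \<delta> \<longleftrightarrow> additive_on j (ES D N) (Fx UNIV) (Sx j UNIV) \<delta> \<and>
    (\<forall>c. rz j (ES D N) (Fx UNIV) (Sx j UNIV) c \<longrightarrow> \<delta> c = 0 \<longrightarrow> rb j (ES D N) (Fx UNIV) (Sx j UNIV) c) \<and>
    (\<forall>c. borsuk_seq D N j c \<longrightarrow> \<delta> (c j) = 1)"

lemma antip_antip [simp]: "antip (antip e) = e"
  by (cases e) (simp add: antip_def)

lemma continuous_map_antip: "continuous_map (subtopology (ES D N) A) (ES D N) antip"
proof -
  have "continuous_map (ES D N) (Euclidean_space D) (\<lambda>e i. - fst e i)"
    unfolding Euclidean_space_def continuous_map_in_subtopology continuous_map_componentwise_UNIV
    by (auto intro!: continuous_map_minus continuous_map_coord) (simp add: ES_def topspace_Euclidean_space)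
  moreover have "continuous_map (ES D N) N snd"
    unfolding ES_def by (rule continuous_map_snd)
  ultimately have "continuous_map (ES D N) (ES D N) antip"
    unfolding ES_def by (simp add: continuous_map_pairwise antip_def o_def case_prod_beta)
  then show ?thesis
    by (rule continuous_map_from_subtopology)
qed

lemma antip_Pi:
  shows "antip \<in> X \<inter> Fx Y \<rightarrow> Fx Y" "antip \<in> X \<inter> Sx j Y \<rightarrow> Sx j Y"
    "antip \<in> X \<inter> Px \<sigma> j Y \<rightarrow> Px (- \<sigma>) j Y"
  by (auto simp: antip_def Fx_def Sx_def Px_def)

lemma chn_antip:
  "chn p (ES D N) (Fx Y) c \<Longrightarrow> chn p (ES D N) (Fx Y) (push p antip c)"
  "chn p (ES D N) (Sx j Y) c \<Longrightarrow> chn p (ES D N) (Sx j Y) (push p antip c)"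
  "chn p (ES D N) (Px \<sigma> j Y) c \<Longrightarrow> chn p (ES D N) (Px (- \<sigma>) j Y) (push p antip c)"
  by (rule chn_push [OF _ continuous_map_antip antip_Pi(1)] chn_push [OF _ continuous_map_antip antip_Pi(2)]
      chn_push [OF _ continuous_map_antip antip_Pi(3)], assumption)+

lemma chn_Sx_antip: "chn p (ES D N) (Sx j Y) c \<Longrightarrow> chn p (ES D N) (Sx j Y) (c + push p antip c)"
  by (intro chn_add chn_antip)

lemma rz_antip: "rz p (ES D N) (Fx Y) (Sx j Y) c \<Longrightarrow> rz p (ES D N) (Fx Y) (Sx j Y) (push p antip c)"
  by (rule rz_push [OF _ continuous_map_antip antip_Pi(1) antip_Pi(2) Sx_subset_Fx])

lemma rb_antip: "rb p (ES D N) (Fx Y) (Sx j Y) c \<Longrightarrow> rb p (ES D N) (Fx Y) (Sx j Y) (push p antip c)"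
  by (rule rb_push [OF _ continuous_map_antip antip_Pi(1) antip_Pi(2) Sx_subset_Fx])

lemma push_antip_antip:
  assumes "chn p (ES D N) A c"
  shows "push p antip (push p antip c) = c"
  unfolding push_compose by (rule push_id_gen [OF assms]) simp

text \<open>A subdivision splits into relative cycles of the two halves, each of which has trivial
  homology below \<open>j\<close> relative to \<open>Sx j Y\<close>.\<close>

lemma rb_Sx_Suc:
  assumes c: "rz i (ES D N) (Sx (Suc j) Y) (Sx j Y) c" and "i < j" "j < D"
  shows "rb i (ES D N) (Sx (Suc j) Y) (Sx j Y) c"
proof -
  have c1: "chn i (ES D N) (Sx (Suc j) Y) c" "chn (i - 1) (ES D N) (Sx j Y) (bd i c)"
    using c by (auto simp: rz_def)
  obtain n a b where ab: "chn i (ES D N) (Px 1 j Y) a" "chn i (ES D N) (Px (- 1) j Y) b" "sd n i c = a + b"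
    by (rule sd_split_Px [OF c1(1)])
  have sdc: "chn (i - 1) (ES D N) (Sx j Y) (bd i (sd n i c))"
    unfolding bd_sd [OF c1(1)] by (intro chn_sd c1)
  have "chn (i - 1) (ES D N) (Px (- 1) j Y) (bd i (sd n i c) + bd i b)"
    using chn_mono [OF sdc Sx_subset_Px] chn_bd [OF ab(2)] by (rule chn_add)
  moreover have "bd i (sd n i c) + bd i b = bd i a"
    unfolding ab(3) by (simp add: add.assoc)
  ultimately have a: "chn (i - 1) (ES D N) (Sx j Y) (bd i a)"
    unfolding chn_Sx_iff using chn_bd [OF ab(1)] by simp
  have "chn (i - 1) (ES D N) (Sx j Y) (bd i (sd n i c) + bd i a)"
    using sdc a by (rule chn_add)
  moreover have "bd i (sd n i c) + bd i a = bd i b"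
    unfolding ab(3) by (simp add: ac_simps)
  ultimately have b: "chn (i - 1) (ES D N) (Sx j Y) (bd i b)"
    by simp
  have "rb i (ES D N) (Px \<sigma> j Y) (Sx j Y) d" if d: "rz i (ES D N) (Px \<sigma> j Y) (Sx j Y) d" and \<sigma>: "\<sigma> = 1 \<or> \<sigma> = - 1" for \<sigma> d
  proof -
    have "rb i (ES D N) (Fx Y) (Sx j Y) (d + 0)"
      using rb_below_dimension [OF assms(2) less_imp_le [OF assms(3)] rz_mono [OF d Px_subset_Fx order_refl]] by simp
    from rb_Px_transfer [OF d this assms(3) \<sigma>] show ?thesis
      by simp
  qed
  then have "rb i (ES D N) (Px 1 j Y) (Sx j Y) a" "rb i (ES D N) (Px (- 1) j Y) (Sx j Y) b"
    using ab a b by (simp_all add: rz_def)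
  then have "rb i (ES D N) (Sx (Suc j) Y) (Sx j Y) (a + b)"
    by (intro rb_add) (erule rb_mono [OF _ Px_subset_Sx order_refl], simp)+
  with sd_rb [OF c, of n] show ?thesis
    unfolding ab(3) by (rule rb_cancel)
qed

text \<open>The degree one dimension up, as a relation, because it depends on a choice of
  subdivision and splitting. Additivity together with \<open>susp_rel_rb\<close> makes the value
  unique.\<close>

definition susp_rel :: "nat \<Rightarrow> 'n topology \<Rightarrow> nat \<Rightarrow> (((nat \<Rightarrow> real) \<times> 'n) chain2 \<Rightarrow> bit) \<Rightarrow>
    ((nat \<Rightarrow> real) \<times> 'n) chain2 \<Rightarrow> bit \<Rightarrow> bool"
  where "susp_rel D N j \<delta> c v \<longleftrightarrow> (\<exists>c' r r'. rb (Suc j) (ES D N) (Fx UNIV) (Sx (Suc j) UNIV) (c + c') \<and>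
    chn (Suc j) (ES D N) (Fx UNIV) c' \<and> bd (Suc j) c' = r + r' \<and>
    rz j (ES D N) (Px 1 j UNIV) (Sx j UNIV) r \<and> rz j (ES D N) (Px (- 1) j UNIV) (Sx j UNIV) r' \<and> v = \<delta> r)"

lemma susp_rel_exists:
  assumes "rz (Suc j) (ES D N) (Fx UNIV) (Sx (Suc j) UNIV) c"
  shows "\<exists>v. susp_rel D N j \<delta> c v"
  by (rule suspension_split [OF assms]) (unfold susp_rel_def, blast)

lemma susp_rel_add:
  assumes \<delta>: "additive_on j (ES D N) (Fx UNIV) (Sx j UNIV) \<delta>"
    and "susp_rel D N j \<delta> c v" "susp_rel D N j \<delta> d w"
  shows "susp_rel D N j \<delta> (c + d) (v + w)"
proof -
  obtain c' r r' where c: "rb (Suc j) (ES D N) (Fx UNIV) (Sx (Suc j) UNIV) (c + c')"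
    "chn (Suc j) (ES D N) (Fx UNIV) c'" "bd (Suc j) c' = r + r'"
    "rz j (ES D N) (Px 1 j UNIV) (Sx j UNIV) r" "rz j (ES D N) (Px (- 1) j UNIV) (Sx j UNIV) r'" "v = \<delta> r"
    using assms(2) unfolding susp_rel_def by blast
  obtain d' s s' where d: "rb (Suc j) (ES D N) (Fx UNIV) (Sx (Suc j) UNIV) (d + d')"
    "chn (Suc j) (ES D N) (Fx UNIV) d'" "bd (Suc j) d' = s + s'"
    "rz j (ES D N) (Px 1 j UNIV) (Sx j UNIV) s" "rz j (ES D N) (Px (- 1) j UNIV) (Sx j UNIV) s'" "w = \<delta> s"
    using assms(3) unfolding susp_rel_def by blast
  have "rb (Suc j) (ES D N) (Fx UNIV) (Sx (Suc j) UNIV) ((c + d) + (c' + d'))"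
    using rb_add [OF c(1) d(1)] by (simp add: ac_simps)
  moreover have "bd (Suc j) (c' + d') = (r + s) + (r' + s')"
    by (simp add: c(3) d(3) ac_simps)
  moreover have "v + w = \<delta> (r + s)"
    unfolding c(6) d(6)
    using additive_on_add [OF \<delta> rz_mono [OF c(4) Px_subset_Fx order_refl] rz_mono [OF d(4) Px_subset_Fx order_refl]] by simp
  ultimately show ?thesis
    unfolding susp_rel_def using chn_add [OF c(2) d(2)] rz_add [OF c(4) d(4)] rz_add [OF c(5) d(5)] by blast
qed

text \<open>If \<open>c'\<close> bounds modulo a chain \<rho> in \<open>Sx (Suc j) UNIV\<close>,
  split \<rho> as well. Up to the boundary of its upper part, the subdivided \<open>r\<close> equals
  a chain of the lower half, so it is supported in \<open>Sx j UNIV\<close> and \<open>r\<close> is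
  trivial.\<close>

lemma susp_rel_rb:
  assumes \<delta>: "additive_on j (ES D N) (Fx UNIV) (Sx j UNIV) \<delta>"
    and v: "susp_rel D N j \<delta> c v" and c: "rb (Suc j) (ES D N) (Fx UNIV) (Sx (Suc j) UNIV) c"
  shows "v = 0"
proof -
  obtain c' r r' where c': "rb (Suc j) (ES D N) (Fx UNIV) (Sx (Suc j) UNIV) (c + c')"
    "chn (Suc j) (ES D N) (Fx UNIV) c'" "bd (Suc j) c' = r + r'"
    "rz j (ES D N) (Px 1 j UNIV) (Sx j UNIV) r" "rz j (ES D N) (Px (- 1) j UNIV) (Sx j UNIV) r'" "v = \<delta> r"
    using v unfolding susp_rel_def by blast
  have "rb (Suc j) (ES D N) (Fx UNIV) (Sx (Suc j) UNIV) (c' + c)"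
    using c'(1) by (simp add: ac_simps)
  then have "rb (Suc j) (ES D N) (Fx UNIV) (Sx (Suc j) UNIV) c'"
    using c by (rule rb_cancel)
  then obtain w \<rho> where w: "chn (Suc (Suc j)) (ES D N) (Fx UNIV) w" "chn (Suc j) (ES D N) (Sx (Suc j) UNIV) \<rho>"
      "c' = bd (Suc (Suc j)) w + \<rho>"
    by (auto simp: rb_def)
  obtain n a b where ab: "chn (Suc j) (ES D N) (Px 1 j UNIV) a" "chn (Suc j) (ES D N) (Px (- 1) j UNIV) b"
      "sd n (Suc j) \<rho> = a + b"
    by (rule sd_split_Px [OF w(2)])
  have "bd (Suc j) \<rho> = r + r'"
    using c'(3) w(3) bd_bd_Suc [OF w(1)] by simp
  then have "sd n j r + sd n j r' = bd (Suc j) a + bd (Suc j) b"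
    using bd_sd [OF w(2), of n] by (simp add: ab(3))
  then have eq: "sd n j r + bd (Suc j) a = sd n j r' + bd (Suc j) b"
    by (rule char_two_swap)
  have "chn j (ES D N) (Px 1 j UNIV) (sd n j r + bd (Suc j) a)"
    using c'(4) ab by (auto simp: rz_def intro!: chn_sd chn_bd_Suc)
  moreover have "chn j (ES D N) (Px (- 1) j UNIV) (sd n j r + bd (Suc j) a)"
    unfolding eq using c'(5) ab by (auto simp: rz_def intro!: chn_sd chn_bd_Suc)
  ultimately have "chn j (ES D N) (Sx j UNIV) (sd n j r + bd (Suc j) a)"
    by (simp add: chn_Sx_iff)
  then have "rb j (ES D N) (Fx UNIV) (Sx j UNIV) (sd n j r)"
    by (rule rb_cancel [OF chn_imp_rb bd_imp_rb]) (rule chn_mono [OF ab(1) Px_subset_Fx])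
  then have "rb j (ES D N) (Fx UNIV) (Sx j UNIV) r"
    by (rule rb_cancel [OF sd_rb [OF rz_mono [OF c'(4) Px_subset_Fx order_refl]]])
  then show ?thesis
    unfolding c'(6) by (rule additive_on_rb [OF \<delta>])
qed

lemma susp_rel_unique:
  assumes \<delta>: "additive_on j (ES D N) (Fx UNIV) (Sx j UNIV) \<delta>"
    and "susp_rel D N j \<delta> c v" "susp_rel D N j \<delta> c w"
  shows "v = w"
proof -
  have "susp_rel D N j \<delta> 0 (v + w)"
    using susp_rel_add [OF assms] by simp
  from susp_rel_rb [OF \<delta> this] show ?thesis
    by (simp add: add_eq_0_char_two)
qed

text \<open>Equivariantly pushing the lower members of a sequence off the subspace where one
  coordinate fewer is available.\<close>

lemma borsuk_seq_push_off:
  assumes c: "borsuk_seq D N (Suc j) c" and j: "j < D" and "m \<le> j"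
  shows "\<exists>c' d. \<forall>i<m. chn i (ES D N) (Sx j UNIV) (c' i) \<and> chn (Suc i) (ES D N) (Sx (Suc j) UNIV) (d i) \<and>
     c' i = c i + bd (Suc i) (d i) + (if i = 0 then 0 else d (i - 1) + push i antip (d (i - 1)))"
  using \<open>m \<le> j\<close>
proof (induction m)
  case (Suc m)
  then obtain c' d where IH: "\<And>i. i < m \<Longrightarrow> chn i (ES D N) (Sx j UNIV) (c' i)"
    "\<And>i. i < m \<Longrightarrow> chn (Suc i) (ES D N) (Sx (Suc j) UNIV) (d i)"
    "\<And>i. i < m \<Longrightarrow> c' i = c i + bd (Suc i) (d i) + (if i = 0 then 0 else d (i - 1) + push i antip (d (i - 1)))"
    by (meson Suc_leD)
  \<comment> \<open>An equivariant chain homotopy: the previous correction enters together with its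
    antipode. This makes the boundary of \<open>c m + ?e\<close> equal to \<open>c' (m - 1)\<close>
    plus its antipode, which already lies in \<open>Sx j UNIV\<close>.\<close>
  let ?e = "if m = 0 then 0 else d (m - 1) + push m antip (d (m - 1))"
  have mj: "m < j" "m < Suc j"
    using Suc.prems by auto
  have cm: "chn m (ES D N) (Sx (Suc j) UNIV) (c m)"
    using c mj by (auto simp: borsuk_seq_def)
  have e: "chn m (ES D N) (Sx (Suc j) UNIV) ?e"
    using chn_Sx_antip [OF IH(2) [of "m - 1"]] by simp
  have "chn (m - 1) (ES D N) (Sx j UNIV) (bd m (c m + ?e))"
  proof (cases m)
    case (Suc i)
    have i: "i < m" using Suc by simp
    have ci: "chn i (ES D N) (Sx (Suc j) UNIV) (c i)" "bd (Suc i) (c (Suc i)) = c i + push i antip (c i)"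
      using c mj Suc by (auto simp: borsuk_seq_def)
    note di = IH(2) [OF i]
    have eq: "bd (Suc i) (d i) = c' i + c i + (if i = 0 then 0 else d (i - 1) + push i antip (d (i - 1)))"
      using IH(3) [OF i] by (simp add: ac_simps)
    have "bd m (c m + ?e) = c i + push i antip (c i) + bd (Suc i) (d i) + push i antip (bd (Suc i) (d i))"
      using bd_push [OF di, of antip] by (simp add: Suc ci ac_simps)
    also have "\<dots> = c' i + push i antip (c' i) + (if i = 0 then 0 else
        (d (i - 1) + push i antip (d (i - 1))) + push i antip (d (i - 1) + push i antip (d (i - 1))))"
      unfolding eq by (simp add: ac_simps)
    also have "\<dots> = c' i + push i antip (c' i)"
    proof (cases "i = 0")
      case False
      then have "chn i (ES D N) (Sx (Suc j) UNIV) (d (i - 1))"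
        using IH(2) [of "i - 1"] i by simp
      from push_antip_antip [OF this] show ?thesis
        by (simp add: ac_simps)
    qed simp
    finally show ?thesis
      using chn_Sx_antip [OF IH(1) [OF i]] Suc by simp
  qed simp
  then have "rz m (ES D N) (Sx (Suc j) UNIV) (Sx j UNIV) (c m + ?e)"
    using cm e by (simp add: rz_def chn_add)
  from rb_Sx_Suc [OF this mj(1) j] obtain u r where ur: "chn (Suc m) (ES D N) (Sx (Suc j) UNIV) u"
    "chn m (ES D N) (Sx j UNIV) r" "c m + ?e = bd (Suc m) u + r"
    unfolding rb_def by blast
  have r: "r = c m + bd (Suc m) u + ?e"
    using char_two_swap [OF ur(3)] by (simp add: eq_add_char_two ac_simps)
  show ?case
    by (rule exI [of _ "c'(m := r)"], rule exI [of _ "d(m := u)"])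
       (use IH ur(1,2) r in \<open>auto simp: less_Suc_eq\<close>)
qed auto

text \<open>The degree is injective on homology and takes values in a field of two elements, so an
  involution cannot change it.\<close>

lemma local_degree_antip:
  assumes "local_degree D N j \<delta>" "rz j (ES D N) (Fx UNIV) (Sx j UNIV) c"
  shows "\<delta> (push j antip c) = \<delta> c"
proof -
  have 0: "\<delta> (push j antip c) = 0" if "rz j (ES D N) (Fx UNIV) (Sx j UNIV) c" "\<delta> c = 0" for c
    using assms(1) that rb_antip additive_on_rb unfolding local_degree_def by blast
  have "push j antip (push j antip c) = c"
    using push_antip_antip assms(2) by (auto simp: rz_def)
  then have "\<delta> c = 0 \<longleftrightarrow> \<delta> (push j antip c) = 0"
    using 0 [of c] 0 [of "push j antip c"] assms(2) rz_antip [OF assms(2)] by auto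
  then show ?thesis
    by (metis bit_not_zero_iff)
qed

text \<open>The induction step of Borsuk's theorem. The boundary of the top member is
  \<open>f\<close> plus its antipode, where \<open>f\<close> ends a corrected sequence one dimension
  lower and so has degree \<open>1\<close>. Splitting a subdivision of \<open>f\<close> as
  \<open>p + q\<close>, the upper half of that boundary is \<open>p\<close> plus the antipode of
  \<open>q\<close>; by antipodal invariance its degree is that of \<open>p + q\<close>, hence of
  \<open>f\<close>.\<close>

lemma susp_rel_borsuk:
  assumes \<delta>: "local_degree D N j \<delta>" and c: "borsuk_seq D N (Suc j) c" and j: "j < D"
  shows "susp_rel D N j \<delta> (c (Suc j)) 1"
proof -
  note add = \<delta> [unfolded local_degree_def, THEN conjunct1]
  obtain c' d where *: "\<And>i. i < j \<Longrightarrow> chn i (ES D N) (Sx j UNIV) (c' i)"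
    "\<And>i. i < j \<Longrightarrow> chn (Suc i) (ES D N) (Sx (Suc j) UNIV) (d i)"
    "\<And>i. i < j \<Longrightarrow> c' i = c i + bd (Suc i) (d i) + (if i = 0 then 0 else d (i - 1) + push i antip (d (i - 1)))"
    using borsuk_seq_push_off [OF c j order_refl] by blast
  have C: "\<And>i. i < Suc j \<Longrightarrow> chn i (ES D N) (Sx (Suc j) UNIV) (c i)" "chn (Suc j) (ES D N) (Fx UNIV) (c (Suc j))"
    "\<And>i. i < Suc j \<Longrightarrow> bd (Suc i) (c (Suc i)) = c i + push i antip (c i)" "ext2 (\<lambda>_. 1) (c 0) = (1 :: bit)"
    using c by (auto simp: borsuk_seq_def Fx_def)
  define f where "f = c j + (if j = 0 then 0 else d (j - 1) + push j antip (d (j - 1)))"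
  have bdf: "bd (Suc i) (c (Suc i) + (d i + push (Suc i) antip (d i))) = c' i + push i antip (c' i)" if "i < j" for i
  proof -
    let ?e = "if i = 0 then 0 else d (i - 1) + push i antip (d (i - 1))"
    have eq: "bd (Suc i) (d i) = c' i + c i + ?e"
      using *(3) [OF that] by (simp add: ac_simps)
    have "push i antip ?e = ?e"
      using push_antip_antip [OF *(2) [of "i - 1"]] that by (auto simp: ac_simps)
    moreover have "bd (Suc i) (c (Suc i) + (d i + push (Suc i) antip (d i))) =
        c i + push i antip (c i) + (bd (Suc i) (d i) + push i antip (bd (Suc i) (d i)))"
      using bd_push [OF *(2) [OF that], of antip] C(3) [of i] that by simp
    ultimately show ?thesis
      unfolding eq by (simp add: ac_simps)
  qed
  have f: "chn j (ES D N) (Sx (Suc j) UNIV) f"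
  proof (cases j)
    case (Suc i)
    with *(2) [of i] have "chn j (ES D N) (Sx (Suc j) UNIV) (d i)"
      by simp
    from chn_add [OF C(1) [of j] chn_Sx_antip [OF this]] show ?thesis
      by (simp add: f_def Suc)
  qed (use C(1) [of 0] in \<open>simp add: f_def\<close>)
  have seq: "borsuk_seq D N j (\<lambda>i. if i < j then c' i else f)"
    unfolding borsuk_seq_def
  proof (intro conjI allI impI)
    show "chn j (ES D N) UNIV (if j < j then c' j else f)"
      using chn_mono [OF f subset_UNIV] by simp
    fix i assume i: "i < j"
    show "chn i (ES D N) (Sx j UNIV) (if i < j then c' i else f)"
      using *(1) i by simp
    have "bd (Suc i) (if Suc i < j then c' (Suc i) else f) = c' i + push i antip (c' i)"
    proof (cases "Suc i < j")
      case True
      then show ?thesis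
        using bdf [OF i] *(3) [OF True] bd_bd_Suc [OF *(2) [OF True]] by (simp add: ac_simps)
    next
      case False
      then have "j = Suc i"
        using i by simp
      then show ?thesis
        using bdf [OF i] by (simp add: f_def)
    qed
    then show "bd (Suc i) (if Suc i < j then c' (Suc i) else f) =
        (if i < j then c' i else f) + push i antip (if i < j then c' i else f)"
      using i by simp
  next
    have "ext2 (\<lambda>_. 1) (bd (Suc 0) u) = (0 :: bit)" for u :: "((nat \<Rightarrow> real) \<times> 'a) chain2"
      by (simp add: bd_def ext2_ext2)
    then show "ext2 (\<lambda>_. 1) (if 0 < j then c' 0 else f) = (1 :: bit)"
      using C(4) *(3) [of 0] by (simp add: f_def)
  qed
  then have "\<delta> f = 1"
    using \<delta> unfolding local_degree_def by fastforce
  have fz: "rz j (ES D N) (Fx UNIV) (Sx j UNIV) f"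
  proof (cases j)
    case 0
    then show ?thesis
      using f by (simp add: rz_def chn_def Fx_def)
  next
    case (Suc i)
    then have "bd j f = c' i + push i antip (c' i)"
      using bdf [of i] by (simp add: f_def)
    then have "chn (j - 1) (ES D N) (Sx j UNIV) (bd j f)"
      using chn_Sx_antip [OF *(1) [of i]] Suc by simp
    then show ?thesis
      using chn_mono [OF f Sx_subset_Fx] by (simp add: rz_def)
  qed
  have bdc: "bd (Suc j) (c (Suc j)) = f + push j antip f"
  proof (cases "j = 0")
    case False
    then have "push j antip (push j antip (d (j - 1))) = d (j - 1)"
      using push_antip_antip [OF *(2) [of "j - 1"]] by simp
    then show ?thesis
      using C(3) [of j] by (simp add: f_def ac_simps)
  qed (use C(3) [of 0] in \<open>simp add: f_def\<close>)
  obtain n p q where pq: "chn j (ES D N) (Px 1 j UNIV) p" "chn j (ES D N) (Px (- 1) j UNIV) q" "sd n j f = p + q"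
    by (rule sd_split_Px [OF f])
  have fzS: "rz j (ES D N) (Sx (Suc j) UNIV) (Sx j UNIV) f"
    using fz f by (simp add: rz_def)
  from sd_rb [OF this, of n] obtain e k where ek: "chn (Suc j) (ES D N) (Sx (Suc j) UNIV) e" "chn j (ES D N) (Sx j UNIV) k"
      "f + sd n j f = bd (Suc j) e + k"
    unfolding rb_def by blast
  have bf: "f + bd (Suc j) e = p + q + k"
    using char_two_swap [OF ek(3)] unfolding pq(3) by simp
  have bdq: "chn (j - 1) (ES D N) (Sx j UNIV) (bd j p)" "chn (j - 1) (ES D N) (Sx j UNIV) (bd j q)"
  proof -
    have s: "chn (j - 1) (ES D N) (Sx j UNIV) (bd j (sd n j f))"
      unfolding bd_sd [OF f] using fz by (intro chn_sd) (simp add: rz_def)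
    have "chn (j - 1) (ES D N) (Px (- 1) j UNIV) (bd j (sd n j f) + bd j q)"
      using chn_mono [OF s Sx_subset_Px] chn_bd [OF pq(2)] by (rule chn_add)
    moreover have "bd j (sd n j f) + bd j q = bd j p"
      unfolding pq(3) by (simp add: add.assoc)
    ultimately show p: "chn (j - 1) (ES D N) (Sx j UNIV) (bd j p)"
      unfolding chn_Sx_iff using chn_bd [OF pq(1)] by simp
    have "chn (j - 1) (ES D N) (Sx j UNIV) (bd j (sd n j f) + bd j p)"
      using s p by (rule chn_add)
    moreover have "bd j (sd n j f) + bd j p = bd j q"
      unfolding pq(3) by (simp add: ac_simps)
    ultimately show "chn (j - 1) (ES D N) (Sx j UNIV) (bd j q)"
      by simp
  qed
  let ?a = "push j antip"
  have pz: "rz j (ES D N) (Px 1 j UNIV) (Sx j UNIV) p" and qz: "rz j (ES D N) (Px (- 1) j UNIV) (Sx j UNIV) q"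
    using pq bdq by (simp_all add: rz_def)
  have apz: "rz j (ES D N) (Px (- 1) j UNIV) (Sx j UNIV) (?a p)"
    by (rule rz_push [OF pz continuous_map_antip antip_Pi(3) antip_Pi(2) Sx_subset_Px])
  have aqz: "rz j (ES D N) (Px 1 j UNIV) (Sx j UNIV) (?a q)"
    using rz_push [OF qz continuous_map_antip antip_Pi(3) antip_Pi(2) Sx_subset_Px] by simp
  have kk: "chn j (ES D N) (Sx j UNIV) (k + ?a k)"
    by (rule chn_Sx_antip [OF ek(2)])
  \<comment> \<open>\<open>k\<close> is the error of the subdivision, supported in
    \<open>Sx j UNIV\<close>; its symmetrization may be put into either half without changing the
    degree.\<close>
  have r: "rz j (ES D N) (Px 1 j UNIV) (Sx j UNIV) (p + ?a q + (k + ?a k))"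
    by (intro rz_add pz aqz chn_imp_rz kk Sx_subset_Px)
  have r': "rz j (ES D N) (Px (- 1) j UNIV) (Sx j UNIV) (q + ?a p)"
    by (intro rz_add qz apz)
  let ?u = "c (Suc j) + (e + push (Suc j) antip e)"
  have ee: "chn (Suc j) (ES D N) (Sx (Suc j) UNIV) (e + push (Suc j) antip e)"
    by (rule chn_Sx_antip [OF ek(1)])
  have "bd (Suc j) ?u = (f + bd (Suc j) e) + ?a (f + bd (Suc j) e)"
    using bd_push [OF ek(1), of antip] bdc by (simp add: ac_simps)
  also have "\<dots> = (p + ?a q + (k + ?a k)) + (q + ?a p)"
    unfolding bf by (simp add: ac_simps)
  finally have bu: "bd (Suc j) ?u = (p + ?a q + (k + ?a k)) + (q + ?a p)" .
  have cu: "rb (Suc j) (ES D N) (Fx UNIV) (Sx (Suc j) UNIV) (c (Suc j) + ?u)"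
    using chn_imp_rb [OF ee] by simp
  have chu: "chn (Suc j) (ES D N) (Fx UNIV) ?u"
    using C(2) chn_mono [OF ee Sx_subset_Fx] by (rule chn_add)
  note F = rz_mono [OF _ Px_subset_Fx order_refl]
  have "\<delta> (p + ?a q + (k + ?a k)) = \<delta> (p + ?a q) + \<delta> (k + ?a k)"
    by (intro additive_on_add [OF add] rz_add F [OF pz] F [OF aqz] chn_imp_rz [OF kk] Sx_subset_Fx)
  also have "\<delta> (k + ?a k) = 0"
    by (intro additive_on_rb [OF add] chn_imp_rb kk)
  also have "\<delta> (p + ?a q) = \<delta> p + \<delta> q"
    using additive_on_add [OF add F [OF pz] F [OF aqz]] local_degree_antip [OF \<delta> F [OF qz]] by simp
  also have "\<dots> = \<delta> (p + q)"
    using additive_on_add [OF add F [OF pz] F [OF qz]] by simp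
  also have "\<dots> = \<delta> f"
    unfolding pq(3) [symmetric]
    by (rule additive_on_cong [OF add fz sd_rb [OF fz] Sx_subset_Fx])
  finally have "1 = \<delta> (p + ?a q + (k + ?a k))"
    using \<open>\<delta> f = 1\<close> by simp
  then show ?thesis
    unfolding susp_rel_def using cu chu bu r r' by blast
qed

theorem local_degree_exists:
  assumes "j \<le> D" "N = discrete_topology {()}"
  shows "\<exists>\<delta>. local_degree D N j \<delta>"
  using assms(1)
proof (induction j)
  case 0
  define \<epsilon> where "\<epsilon> = (\<lambda>c :: ((nat \<Rightarrow> real) \<times> unit) chain2. ext2 (\<lambda>_. 1 :: bit) c)"
  have "\<epsilon> c = 0" if c: "rb 0 (ES D N) (Fx UNIV) (Sx 0 UNIV) c" for c
  proof -
    obtain u where "c = bd (Suc 0) u"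
      using c by (auto simp: rb_def chn_empty)
    then show ?thesis
      by (simp add: \<epsilon>_def bd_def ext2_ext2)
  qed
  then have "additive_on 0 (ES D N) (Fx UNIV) (Sx 0 UNIV) \<epsilon>"
    by (auto simp: additive_on_def \<epsilon>_def)
  moreover have "rb 0 (ES D N) (Fx UNIV) (Sx 0 UNIV) c"
    if c: "rz 0 (ES D N) (Fx UNIV) (Sx 0 UNIV) c" and "\<epsilon> c = 0" for c
  proof -
    let ?E = "ES D N"
    \<comment> \<open>Contraction to the origin: every chain of degree \<open>0\<close> is
      homologous to its augmentation times one point.\<close>
    define h where "h = (\<lambda>(t :: real, x :: nat \<Rightarrow> real, s :: unit). (\<lambda>i. (1 - t) * x i, s))"
    have cont: "continuous_map (prod_topology (top_of_set {0..1::real}) (subtopology ?E (Fx UNIV))) ?E h"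
    proof -
      let ?P = "prod_topology (top_of_set {0..1::real}) ?E"
      have e: "continuous_map ?P euclideanreal (\<lambda>z. fst (snd z) i)" for i
        using continuous_map_compose [OF continuous_map_snd continuous_map_coord, of "top_of_set {0..1}" D N i]
        by (simp add: o_def)
      have t: "continuous_map ?P euclideanreal fst"
        using continuous_map_into_fulltopology [OF continuous_map_fst] .
      have "continuous_map ?P (Euclidean_space D) (\<lambda>z i. (1 - fst z) * fst (snd z) i)"
        unfolding Euclidean_space_def continuous_map_in_subtopology continuous_map_componentwise_UNIV
        using e t by (auto intro!: continuous_intros simp: ES_def topspace_Euclidean_space)
      moreover have "continuous_map ?P N (\<lambda>z. snd (snd z))"
        unfolding ES_def
        using continuous_map_compose [OF continuous_map_snd continuous_map_snd, of "top_of_set {0..1::real}" "Euclidean_space D" N]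
        by (simp add: o_def)
      ultimately have "continuous_map ?P ?E h"
        unfolding ES_def by (auto simp: continuous_map_pairwise h_def o_def case_prod_beta)
      then show ?thesis
        by (simp add: Fx_def)
    qed
    have "rb 0 ?E (Fx UNIV) {} (push 0 (\<lambda>x. h (0, x)) c + push 0 (\<lambda>x. h (1, x)) c)"
      by (rule homotopy_rb [OF cont]) (use c in \<open>auto simp: Fx_def\<close>)
    moreover have "push 0 (\<lambda>x. h (0, x)) c = c"
      using c by (intro push_id_gen [of _ ?E "Fx UNIV"]) (auto simp: rz_def h_def)
    moreover have "push 0 (\<lambda>x. h (1, x)) c = 0"
    proof -
      have "h (1, x) = (\<lambda>i. 0, ())" for x
        by (cases x) (simp add: h_def)
      then have "push 0 (\<lambda>x. h (1, x)) c = ext2 (\<lambda>_. unit2 (\<lambda>x\<in>standard_simplex 0. (\<lambda>i. 0, ()))) c"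
        by (simp add: push_def simplex_map_def o_def)
      also have "\<dots> = Poly_Mapping.single (\<lambda>x\<in>standard_simplex 0. (\<lambda>i. 0, ())) (\<epsilon> c)"
        unfolding \<epsilon>_def by (rule additive_ext2 [symmetric]) (simp add: single_add)
      finally show ?thesis
        using that by simp
    qed
    ultimately show ?thesis
      by simp
  qed
  moreover have "\<epsilon> (c 0) = 1" if "borsuk_seq D N 0 c" for c
    using that by (simp add: borsuk_seq_def \<epsilon>_def)
  ultimately show ?case
    unfolding local_degree_def by blast
next
  case (Suc j)
  then obtain \<delta> where \<delta>: "local_degree D N j \<delta>"
    by auto
  have jD: "j < D"
    using Suc.prems by simp
  note add = \<delta> [unfolded local_degree_def, THEN conjunct1]
  note ker = \<delta> [unfolded local_degree_def, THEN conjunct2, THEN conjunct1, rule_format]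
  define \<delta>' where "\<delta>' = (\<lambda>c. SOME v. susp_rel D N j \<delta> c v)"
  have \<delta>': "susp_rel D N j \<delta> c (\<delta>' c)" if "rz (Suc j) (ES D N) (Fx UNIV) (Sx (Suc j) UNIV) c" for c
    unfolding \<delta>'_def by (rule someI_ex) (rule susp_rel_exists [OF that])
  have rzb: "rz (Suc j) (ES D N) (Fx UNIV) (Sx (Suc j) UNIV) c" if "rb (Suc j) (ES D N) (Fx UNIV) (Sx (Suc j) UNIV) c" for c
    using rb_imp_rz [OF that Sx_subset_Fx] .
  have "additive_on (Suc j) (ES D N) (Fx UNIV) (Sx (Suc j) UNIV) \<delta>'"
    unfolding additive_on_def
  proof (intro conjI allI impI)
    fix a b assume ab: "rz (Suc j) (ES D N) (Fx UNIV) (Sx (Suc j) UNIV) a" "rz (Suc j) (ES D N) (Fx UNIV) (Sx (Suc j) UNIV) b"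
    show "\<delta>' (a + b) = \<delta>' a + \<delta>' b"
      by (rule susp_rel_unique [OF add \<delta>' [OF rz_add [OF ab]] susp_rel_add [OF add \<delta>' [OF ab(1)] \<delta>' [OF ab(2)]]])
  next
    fix c assume c: "rb (Suc j) (ES D N) (Fx UNIV) (Sx (Suc j) UNIV) c"
    show "\<delta>' c = 0"
      by (rule susp_rel_rb [OF add \<delta>' [OF rzb [OF c]] c])
  qed
  moreover have "rb (Suc j) (ES D N) (Fx UNIV) (Sx (Suc j) UNIV) c"
    if c: "rz (Suc j) (ES D N) (Fx UNIV) (Sx (Suc j) UNIV) c" and 0: "\<delta>' c = 0" for c
  proof -
    obtain c' r r' where *: "rb (Suc j) (ES D N) (Fx UNIV) (Sx (Suc j) UNIV) (c + c')"
      "chn (Suc j) (ES D N) (Fx UNIV) c'" "bd (Suc j) c' = r + r'"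
      "rz j (ES D N) (Px 1 j UNIV) (Sx j UNIV) r" "rz j (ES D N) (Px (- 1) j UNIV) (Sx j UNIV) r'" "\<delta> r = 0"
      using \<delta>' [OF c] unfolding 0 susp_rel_def by metis
    have "rb j (ES D N) (Fx UNIV) (Sx j UNIV) (r + 0)"
      using ker [OF rz_mono [OF *(4) Px_subset_Fx order_refl] *(6)] by simp
    from rb_Px_transfer [OF *(4) this jD] have "rb j (ES D N) (Px 1 j UNIV) (Sx j UNIV) r"
      by simp
    then show ?thesis
      by (rule suspension_rb [OF *(1-3)]) (use *(5) jD in \<open>auto simp: rz_def\<close>)
  qed
  moreover have "\<delta>' (c (Suc j)) = 1" if c: "borsuk_seq D N (Suc j) c" for c
  proof (rule susp_rel_unique [OF add \<delta>' susp_rel_borsuk [OF \<delta> c jD]])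
    have "chn j (ES D N) (Sx (Suc j) UNIV) (bd (Suc j) (c (Suc j)))"
      using c chn_Sx_antip [of j D N "Suc j" UNIV "c j"] by (simp add: borsuk_seq_def)
    then show "rz (Suc j) (ES D N) (Fx UNIV) (Sx (Suc j) UNIV) (c (Suc j))"
      using c by (simp add: rz_def borsuk_seq_def Fx_def)
  qed
  ultimately show ?case
    unfolding local_degree_def by blast
qed

section \<open>The Thom class of a section: local construction, uniqueness and gluing\<close>

section \<open>The mod 2 intersection functional\<close>

definition Fb :: "'n set \<Rightarrow> ('a \<times> 'n) set"
  where "Fb Y = {e. snd e \<in> Y}"

lemma rz_topspace: "rz p T (topspace T \<inter> A) (topspace T \<inter> B) c \<longleftrightarrow> rz p T A B c"
  by (simp add: rz_def chn_topspace)

lemma rb_topspace: "rb p T (topspace T \<inter> A) (topspace T \<inter> B) c \<longleftrightarrow> rb p T A B c"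
  by (simp add: rb_def chn_topspace)

lemma rz_subtopology: "rz p (subtopology T C) A B c \<longleftrightarrow> rz p T (C \<inter> A) (C \<inter> B) c"
  by (simp add: rz_def chn_subtopology)

lemma rb_subtopology: "rb p (subtopology T C) A B c \<longleftrightarrow> rb p T (C \<inter> A) (C \<inter> B) c"
  by (simp add: rb_def chn_subtopology)

lemma excision_surj_within:
  assumes c: "rz p T (C \<inter> (Q \<union> S)) (C \<inter> S) c" and "openin T Q" "openin T S"
  obtains c' where "rz p T (C \<inter> Q) (C \<inter> Q \<inter> S) c'" "rb p T (C \<inter> (Q \<union> S)) (C \<inter> S) (c + c')"
proof -
  have "\<exists>c'. rz p (subtopology T C) (C \<inter> Q) ((C \<inter> Q) \<inter> (C \<inter> S)) c' \<and>
      rb p (subtopology T C) ((C \<inter> Q) \<union> (C \<inter> S)) (C \<inter> S) (c + c')"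
    using assms by (intro excision_surj) (simp_all add: rz_subtopology openin_subtopology_Int2 Int_Un_distrib)
  then obtain c' where "rz p (subtopology T C) (C \<inter> Q) ((C \<inter> Q) \<inter> (C \<inter> S)) c'"
      "rb p (subtopology T C) ((C \<inter> Q) \<union> (C \<inter> S)) (C \<inter> S) (c + c')"
    by blast
  moreover have "C \<inter> ((C \<inter> Q) \<inter> (C \<inter> S)) = C \<inter> Q \<inter> S" "C \<inter> ((C \<inter> Q) \<union> (C \<inter> S)) = C \<inter> (Q \<union> S)"
    by auto
  ultimately show ?thesis
    by (intro that [of c']) (simp_all add: rz_subtopology rb_subtopology)
qed

lemma excision_inj_within:
  assumes c: "rz p T (C \<inter> Q) (C \<inter> Q \<inter> S) c" and b: "rb p T (C \<inter> (Q \<union> S)) (C \<inter> S) c" and "openin T Q" "openin T S"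
  shows "rb p T (C \<inter> Q) (C \<inter> Q \<inter> S) c"
proof -
  have eq: "C \<inter> ((C \<inter> Q) \<inter> (C \<inter> S)) = C \<inter> Q \<inter> S" "C \<inter> ((C \<inter> Q) \<union> (C \<inter> S)) = C \<inter> (Q \<union> S)"
    by auto
  have "rb p (subtopology T C) (C \<inter> Q) ((C \<inter> Q) \<inter> (C \<inter> S)) c"
    using assms by (intro excision_inj) (simp_all add: rz_subtopology rb_subtopology openin_subtopology_Int2 eq)
  then show ?thesis
    by (simp add: rb_subtopology eq)
qed

lemma rb_sum: "(\<And>i. i \<in> I \<Longrightarrow> rb p T A B (g i)) \<Longrightarrow> rb p T A B (sum g I)"
  by (induction I rule: infinite_finite_induct) (auto simp: rb_add)

lemma rz_sum: "(\<And>i. i \<in> I \<Longrightarrow> rz p T A B (g i)) \<Longrightarrow> rz p T A B (sum g I)"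
  by (induction I rule: infinite_finite_induct) (auto simp: rz_add)

lemma rb_swap: "rb p T A B (a + b) \<Longrightarrow> rb p T A B a \<Longrightarrow> rb p T A B b"
  using rb_cancel [of p T A B b a] by (simp add: add.commute)

lemma openin_ES_Sx: "openin (ES d K) (topspace (ES d K) \<inter> Sx j UNIV)"
proof -
  have "openin (ES d K) {e \<in> topspace (ES d K). fst e i \<in> - {0}}" for i
    by (rule openin_continuous_map_preimage [OF continuous_map_coord]) auto
  moreover have "topspace (ES d K) \<inter> Sx j UNIV = (\<Union>i<j. {e \<in> topspace (ES d K). fst e i \<in> - {0}})"
    by (auto simp: Sx_def)
  ultimately show ?thesis
    by auto
qed

lemma Sx_Int_Fx: "Sx j Y = Sx j UNIV \<inter> Fx Y"
  by (auto simp: Sx_def Fx_def)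

text \<open>A chart in which a fibrewise pointed space over the parameter space becomes a neighbourhood
  of the zero section of a trivial bundle; \<open>S\<close> is the complement of the section.\<close>

locale param_chart =
  fixes T :: "('a \<times> 'n) topology" and K :: "'n topology" and S :: "('a \<times> 'n) set" and d :: nat
    and W :: "('a \<times> 'n) set" and Q :: "((nat \<Rightarrow> real) \<times> 'n) set"
    and \<Psi> :: "'a \<times> 'n \<Rightarrow> (nat \<Rightarrow> real) \<times> 'n" and \<Theta> :: "(nat \<Rightarrow> real) \<times> 'n \<Rightarrow> 'a \<times> 'n"
  assumes openS: "openin T S" and openW: "openin T W" and openQ: "openin (ES d K) Q"
    and cont\<Psi>: "continuous_map (subtopology T W) (ES d K) \<Psi>"
    and cont\<Theta>: "continuous_map (subtopology (ES d K) Q) T \<Theta>"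
    and \<Psi>_mem: "e \<in> W \<Longrightarrow> \<Psi> e \<in> Q" and \<Theta>_mem: "e' \<in> Q \<Longrightarrow> \<Theta> e' \<in> W"
    and \<Theta>\<Psi>: "e \<in> W \<Longrightarrow> \<Theta> (\<Psi> e) = e" and \<Psi>\<Theta>: "e' \<in> Q \<Longrightarrow> \<Psi> (\<Theta> e') = e'"
    and snd\<Psi>: "e \<in> W \<Longrightarrow> snd (\<Psi> e) = snd e"
    and S_iff: "e \<in> W \<Longrightarrow> e \<in> S \<longleftrightarrow> \<Psi> e \<in> Sx d UNIV"
    and section_unique: "e \<in> topspace T - S \<Longrightarrow> f \<in> topspace T - S \<Longrightarrow> snd e = snd f \<Longrightarrow> e = f"
begin

lemma snd\<Theta>: "e' \<in> Q \<Longrightarrow> snd (\<Theta> e') = snd e'"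
  using snd\<Psi> [OF \<Theta>_mem] \<Psi>\<Theta> by simp

lemma S_iff': "e' \<in> Q \<Longrightarrow> \<Theta> e' \<in> S \<longleftrightarrow> e' \<in> Sx d UNIV"
  using S_iff [OF \<Theta>_mem] \<Psi>\<Theta> by simp

lemma Q_topspace: "Q \<subseteq> topspace (ES d K)"
  by (rule openin_subset [OF openQ])

definition img :: "('a \<times> 'n) set \<Rightarrow> ((nat \<Rightarrow> real) \<times> 'n) set"
  where "img V = {e \<in> Q. \<Theta> e \<in> V}"

lemma openin_img:
  assumes "openin T V"
  shows "openin (ES d K) (img V)"
proof -
  have "openin (subtopology (ES d K) Q) {e \<in> topspace (subtopology (ES d K) Q). \<Theta> e \<in> V}"
    by (rule openin_continuous_map_preimage [OF cont\<Theta> assms])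
  moreover have "{e \<in> topspace (subtopology (ES d K) Q). \<Theta> e \<in> V} = img V"
    using Q_topspace by (auto simp: img_def)
  ultimately show ?thesis
    using openin_trans_full [OF _ openQ] by simp
qed

lemma push_\<Psi>:
  assumes "V \<subseteq> W"
  shows "rz p T V (V \<inter> S) c \<Longrightarrow> rz p (ES d K) (img V) (img V \<inter> Sx d UNIV) (push p \<Psi> c)"
    and "rb p T V (V \<inter> S) c \<Longrightarrow> rb p (ES d K) (img V) (img V \<inter> Sx d UNIV) (push p \<Psi> c)"
proof -
  have c: "continuous_map (subtopology T V) (ES d K) \<Psi>"
    by (rule continuous_map_from_subtopology_mono [OF cont\<Psi> assms])
  have P: "\<Psi> \<in> topspace T \<inter> V \<rightarrow> img V" "\<Psi> \<in> topspace T \<inter> (V \<inter> S) \<rightarrow> img V \<inter> Sx d UNIV"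
    using assms \<Psi>_mem \<Theta>\<Psi> S_iff by (auto simp: img_def subset_iff Pi_iff simp del: split_paired_All)
  show "rz p T V (V \<inter> S) c \<Longrightarrow> rz p (ES d K) (img V) (img V \<inter> Sx d UNIV) (push p \<Psi> c)"
    by (rule rz_push [OF _ c P]) auto
  show "rb p T V (V \<inter> S) c \<Longrightarrow> rb p (ES d K) (img V) (img V \<inter> Sx d UNIV) (push p \<Psi> c)"
    by (rule rb_push [OF _ c P]) auto
qed

lemma push_\<Theta>:
  shows "rz p (ES d K) (img V) (img V \<inter> Sx d UNIV) c \<Longrightarrow> rz p T V (V \<inter> S) (push p \<Theta> c)"
    and "rb p (ES d K) (img V) (img V \<inter> Sx d UNIV) c \<Longrightarrow> rb p T V (V \<inter> S) (push p \<Theta> c)"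
proof -
  have c: "continuous_map (subtopology (ES d K) (img V)) T \<Theta>"
    by (rule continuous_map_from_subtopology_mono [OF cont\<Theta>]) (auto simp: img_def)
  have P: "\<Theta> \<in> topspace (ES d K) \<inter> img V \<rightarrow> V" "\<Theta> \<in> topspace (ES d K) \<inter> (img V \<inter> Sx d UNIV) \<rightarrow> V \<inter> S"
    using S_iff' by (auto simp: img_def Pi_iff simp del: split_paired_All)
  show "rz p (ES d K) (img V) (img V \<inter> Sx d UNIV) c \<Longrightarrow> rz p T V (V \<inter> S) (push p \<Theta> c)"
    by (rule rz_push [OF _ c P]) auto
  show "rb p (ES d K) (img V) (img V \<inter> Sx d UNIV) c \<Longrightarrow> rb p T V (V \<inter> S) (push p \<Theta> c)"
    by (rule rb_push [OF _ c P]) auto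
qed

lemma push_\<Theta>\<Psi>:
  assumes "chn p T V c" "V \<subseteq> W"
  shows "push p \<Theta> (push p \<Psi> c) = c"
  unfolding push_compose by (rule push_id_gen [OF assms(1)]) (use assms(2) \<Theta>\<Psi> in auto)

text \<open>The parameters over which the section passes through \<open>V\<close>.\<close>

definition zeros :: "('a \<times> 'n) set \<Rightarrow> 'n set"
  where "zeros V = {s. (\<lambda>i. 0, s) \<in> img V}"

lemma img_zeros:
  assumes "openin T V"
  shows "openin (ES d K) (img V \<inter> Fx (zeros V))"
    and "img V = (img V \<inter> Fx (zeros V)) \<union> (img V \<inter> Sx d UNIV)"
    and "topspace (ES d K) \<inter> Fx (zeros V) =
         topspace (ES d K) \<inter> Fx (zeros V) \<inter> ((img V \<inter> Fx (zeros V)) \<union> (topspace (ES d K) \<inter> Sx d UNIV))"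
proof -
  have "continuous_map K (ES d K) (\<lambda>s. (\<lambda>i. 0, s))"
    unfolding ES_def by (auto simp: continuous_map_pairwise o_def topspace_Euclidean_space)
  from openin_continuous_map_preimage [OF this openin_img [OF assms]]
  have oz: "openin K {s \<in> topspace K. (\<lambda>i. 0, s) \<in> img V}" .
  have "img V \<subseteq> topspace (ES d K)"
    by (rule openin_subset [OF openin_img [OF assms]])
  then have "{s \<in> topspace K. (\<lambda>i. 0, s) \<in> img V} = zeros V"
    by (auto simp: zeros_def ES_def)
  with oz have "openin K (zeros V)"
    by simp
  from openin_continuous_map_preimage [OF continuous_map_snd this, of "Euclidean_space d"]
  have "openin (ES d K) {e \<in> topspace (ES d K). snd e \<in> zeros V}"
    by (simp add: ES_def)
  moreover have "img V \<inter> Fx (zeros V) = img V \<inter> {e \<in> topspace (ES d K). snd e \<in> zeros V}"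
    using \<open>img V \<subseteq> topspace (ES d K)\<close> by (auto simp: Fx_def)
  ultimately show "openin (ES d K) (img V \<inter> Fx (zeros V))"
    using openin_Int [OF openin_img [OF assms]] by simp
  have z: "fst e = (\<lambda>i. 0)" if "e \<in> topspace (ES d K)" "e \<notin> Sx d UNIV" for e
  proof
    fix i
    show "fst e i = 0"
      using that by (cases "i < d") (auto simp: ES_def topspace_Euclidean_space Sx_def)
  qed
  show "img V = (img V \<inter> Fx (zeros V)) \<union> (img V \<inter> Sx d UNIV)"
  proof -
    have "e \<in> Fx (zeros V)" if "e \<in> img V" "e \<notin> Sx d UNIV" for e
    proof -
      have "fst e = (\<lambda>i. 0)"
        by (rule z) (use that \<open>img V \<subseteq> topspace (ES d K)\<close> in blast)+
      then have "(\<lambda>i. 0, snd e) = e"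
        by (simp add: prod_eq_iff)
      with that(1) show ?thesis
        by (simp add: Fx_def zeros_def)
    qed
    then show ?thesis
      by blast
  qed
  have "e \<in> img V" if "e \<in> topspace (ES d K)" "e \<in> Fx (zeros V)" "e \<notin> Sx d UNIV" for e
  proof -
    have "fst e = (\<lambda>i. 0)"
      using that(1,3) by (rule z)
    then have "(\<lambda>i. 0, snd e) = e"
      by (simp add: prod_eq_iff)
    with that(2) show ?thesis
      by (simp add: Fx_def zeros_def)
  qed
  then show "topspace (ES d K) \<inter> Fx (zeros V) =
      topspace (ES d K) \<inter> Fx (zeros V) \<inter> ((img V \<inter> Fx (zeros V)) \<union> (topspace (ES d K) \<inter> Sx d UNIV))"
    by blast
qed

text \<open>Over \<open>Y\<close> the image of \<open>V\<close> is a neighbourhood of the zero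
  section, so the rest of the bundle can be excised.\<close>

lemma bundle_excision:
  assumes "openin T V" "Y \<subseteq> zeros V"
    and c: "rz p (ES d K) (img V \<inter> Fx Y) (img V \<inter> Fx Y \<inter> Sx d UNIV) c"
    and b: "rb p (ES d K) (Fx Y) (Sx d Y) c"
  shows "rb p (ES d K) (img V \<inter> Fx Y) (img V \<inter> Fx Y \<inter> Sx d UNIV) c"
proof -
  let ?E = "ES d K" and ?Q = "img V \<inter> Fx (zeros V)"
  have eq: "topspace ?E \<inter> Fx Y = topspace ?E \<inter> Fx Y \<inter> (?Q \<union> (topspace ?E \<inter> Sx d UNIV))"
    using img_zeros(3) [OF assms(1)] assms(2) by (auto simp: Fx_def)
  have Y: "Fx Y \<inter> ?Q = img V \<inter> Fx Y"
    using assms(2) by (auto simp: Fx_def)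
  have sub: "img V \<subseteq> topspace ?E"
    by (rule openin_subset [OF openin_img [OF assms(1)]])
  have "rz p ?E (topspace ?E \<inter> Fx Y \<inter> ?Q) (topspace ?E \<inter> Fx Y \<inter> ?Q \<inter> (topspace ?E \<inter> Sx d UNIV)) c"
  proof -
    have "topspace ?E \<inter> Fx Y \<inter> ?Q = img V \<inter> Fx Y"
      "topspace ?E \<inter> Fx Y \<inter> ?Q \<inter> (topspace ?E \<inter> Sx d UNIV) = img V \<inter> Fx Y \<inter> Sx d UNIV"
      using Y sub by auto
    with c show ?thesis by simp
  qed
  moreover have "rb p ?E (topspace ?E \<inter> Fx Y \<inter> (?Q \<union> (topspace ?E \<inter> Sx d UNIV))) (topspace ?E \<inter> Fx Y \<inter> (topspace ?E \<inter> Sx d UNIV)) c"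
  proof -
    have "topspace ?E \<inter> Fx Y \<inter> (topspace ?E \<inter> Sx d UNIV) = topspace ?E \<inter> Sx d Y"
      using Sx_Int_Fx [of d Y] by auto
    with b show ?thesis
      by (simp add: rb_topspace flip: eq)
  qed
  ultimately have "rb p ?E (topspace ?E \<inter> Fx Y \<inter> ?Q) (topspace ?E \<inter> Fx Y \<inter> ?Q \<inter> (topspace ?E \<inter> Sx d UNIV)) c"
    by (rule excision_inj_within) (rule img_zeros(1) [OF assms(1)], rule openin_ES_Sx)
  then show ?thesis
    by (rule rb_mono) auto
qed

text \<open>Outside the fibres over \<open>zeros V\<close> the image of \<open>V\<close> lies in the
  complement of the zero section, so excision discards that part.\<close>

lemma restrict_zeros:
  assumes V: "openin T V" "V \<subseteq> W" and c: "rz p T V (V \<inter> S) c"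
  obtains c' where "rz p (ES d K) (img V \<inter> Fx (zeros V)) (img V \<inter> Fx (zeros V) \<inter> Sx d UNIV) c'"
    "rb p (ES d K) (img V) (img V \<inter> Sx d UNIV) (push p \<Psi> c + c')"
proof -
  let ?E = "ES d K" and ?Q = "img V \<inter> Fx (zeros V)"
  have o: "openin ?E (img V \<inter> (topspace ?E \<inter> Sx d UNIV))"
    using openin_img [OF V(1)] openin_ES_Sx by (rule openin_Int)
  moreover have "img V \<inter> (topspace ?E \<inter> Sx d UNIV) = img V \<inter> Sx d UNIV"
    using openin_subset [OF openin_img [OF V(1)]] by auto
  ultimately have o: "openin ?E (img V \<inter> Sx d UNIV)"
    by simp
  have "rz p ?E (?Q \<union> (img V \<inter> Sx d UNIV)) (img V \<inter> Sx d UNIV) (push p \<Psi> c)"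
    using push_\<Psi>(1) [OF V(2) c] by (simp flip: img_zeros(2) [OF V(1)])
  from excision_surj [OF this img_zeros(1) [OF V(1)] o]
  obtain c' where c': "rz p ?E ?Q (?Q \<inter> (img V \<inter> Sx d UNIV)) c'"
      "rb p ?E (?Q \<union> (img V \<inter> Sx d UNIV)) (img V \<inter> Sx d UNIV) (push p \<Psi> c + c')"
    by blast
  have "?Q \<inter> (img V \<inter> Sx d UNIV) = ?Q \<inter> Sx d UNIV"
    by auto
  then show ?thesis
    using c' by (intro that [of c']) (simp_all flip: img_zeros(2) [OF V(1)])
qed

lemma rb_back:
  assumes V: "openin T V" "V \<subseteq> W" and c: "chn p T V c"
    and b: "rb p (ES d K) (img V) (img V \<inter> Sx d UNIV) (push p \<Psi> c + e)"
  shows "rb p T V (V \<inter> S) (c + push p \<Theta> e)"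
  using push_\<Theta>(2) [OF b] push_\<Theta>\<Psi> [OF c V(2)] by simp

text \<open>For \<open>p = d - 1\<close> this is the vanishing that allows Thom classes to be
  glued.\<close>

lemma chart_rb_below:
  assumes V: "openin T V" "V \<subseteq> W" and c: "rz p T V (V \<inter> S) c" and "p < d"
  shows "rb p T V (V \<inter> S) c"
proof -
  let ?E = "ES d K" and ?Q = "img V \<inter> Fx (zeros V)"
  obtain c' where c': "rz p ?E ?Q (?Q \<inter> Sx d UNIV) c'" "rb p ?E (img V) (img V \<inter> Sx d UNIV) (push p \<Psi> c + c')"
    by (rule restrict_zeros [OF V c])
  have "rz p ?E (Fx (zeros V)) (Sx d (zeros V)) c'"
    using c'(1) by (rule rz_mono) (auto simp: Sx_Int_Fx [of d "zeros V"])
  then have "rb p ?E (Fx (zeros V)) (Sx d (zeros V)) c'"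
    by (rule rb_below_dimension [OF \<open>p < d\<close> order_refl])
  from bundle_excision [OF V(1) order_refl c'(1) this]
  have "rb p ?E (img V) (img V \<inter> Sx d UNIV) c'"
    by (rule rb_mono) auto
  from rb_cancel [OF c'(2) this] have "rb p ?E (img V) (img V \<inter> Sx d UNIV) (push p \<Psi> c + 0)"
    by simp
  from rb_back [OF V _ this] show ?thesis
    using c by (simp add: rz_def)
qed

lemma chart_fibre_decomposition:
  assumes V: "openin T V" "V \<subseteq> W" and c: "rz d T V (V \<inter> S) c"
  obtains I s g where "finite (I :: ((nat \<Rightarrow> real) \<Rightarrow> (nat \<Rightarrow> real) \<times> 'n) set)"
    "\<And>i. i \<in> I \<Longrightarrow> rz d T (V \<inter> Fb {s i}) (V \<inter> Fb {s i} \<inter> S) (g i)"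
    "rb d T V (V \<inter> S) (c + sum g I)"
proof -
  let ?E = "ES d K" and ?Q = "img V \<inter> Fx (zeros V)"
  obtain c' where c': "rz d ?E ?Q (?Q \<inter> Sx d UNIV) c'" "rb d ?E (img V) (img V \<inter> Sx d UNIV) (push d \<Psi> c + c')"
    by (rule restrict_zeros [OF V c])
  have "rz d ?E (Fx (zeros V)) (Sx d (zeros V)) c'"
    using c'(1) by (rule rz_mono) (auto simp: Sx_Int_Fx [of d "zeros V"])
  then obtain I s g where I: "finite (I :: ((nat \<Rightarrow> real) \<Rightarrow> (nat \<Rightarrow> real) \<times> 'n) set)" "\<And>i. i \<in> I \<Longrightarrow> s i \<in> zeros V"
    "\<And>i. i \<in> I \<Longrightarrow> rz d ?E (Fx {s i}) (Sx d {s i}) (g i)"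
    "rb d ?E (Fx (zeros V)) (Sx d (zeros V)) (c' + sum g I)"
    by (rule fibre_decomposition [OF order_refl]) blast
  \<comment> \<open>The summands so far occupy whole Euclidean fibres; since \<open>s i\<close> is
    in \<open>zeros V\<close>, excision moves each of them into the image of
    \<open>V\<close>.\<close>
  have "\<exists>g'. rz d ?E (img V \<inter> Fx {s i}) (img V \<inter> Fx {s i} \<inter> Sx d UNIV) g' \<and> rb d ?E (Fx {s i}) (Sx d {s i}) (g i + g')"
    if "i \<in> I" for i
  proof -
    let ?C = "topspace ?E \<inter> Fx {s i}" and ?S = "topspace ?E \<inter> Sx d UNIV"
    have eq: "?C \<inter> (?Q \<union> ?S) = topspace ?E \<inter> Fx {s i}" "?C \<inter> ?S = topspace ?E \<inter> Sx d {s i}"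
      "?C \<inter> ?Q = img V \<inter> Fx {s i}" "img V \<inter> Fx {s i} \<inter> ?S = img V \<inter> Fx {s i} \<inter> Sx d UNIV"
      using img_zeros(3) [OF V(1)] I(2) [OF that] Sx_Int_Fx [of d "{s i}"] openin_subset [OF openin_img [OF V(1)]]
      by (auto simp: Fx_def)
    have "rz d ?E (?C \<inter> (?Q \<union> ?S)) (?C \<inter> ?S) (g i)"
      unfolding eq rz_topspace by (rule I(3) [OF that])
    then obtain g' where "rz d ?E (?C \<inter> ?Q) (?C \<inter> ?Q \<inter> ?S) g'" "rb d ?E (?C \<inter> (?Q \<union> ?S)) (?C \<inter> ?S) (g i + g')"
      by (rule excision_surj_within) (rule img_zeros(1) [OF V(1)], rule openin_ES_Sx)
    then show ?thesis
      unfolding eq rb_topspace by blast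
  qed
  then obtain g' where g': "\<forall>i\<in>I. rz d ?E (img V \<inter> Fx {s i}) (img V \<inter> Fx {s i} \<inter> Sx d UNIV) (g' i) \<and>
      rb d ?E (Fx {s i}) (Sx d {s i}) (g i + g' i)"
    by metis
  have "rb d ?E (Fx (zeros V)) (Sx d (zeros V)) (\<Sum>i\<in>I. g i + g' i)"
  proof (rule rb_sum)
    fix i assume "i \<in> I"
    with g' have "rb d ?E (Fx {s i}) (Sx d {s i}) (g i + g' i)"
      by blast
    then show "rb d ?E (Fx (zeros V)) (Sx d (zeros V)) (g i + g' i)"
      by (rule rb_mono) (use I(2) [OF \<open>i \<in> I\<close>] in \<open>auto simp: Fx_def Sx_def\<close>)
  qed
  from rb_add [OF I(4) this] have b: "rb d ?E (Fx (zeros V)) (Sx d (zeros V)) (c' + sum g' I)"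
    by (simp add: sum.distrib ac_simps)
  have "rz d ?E ?Q (?Q \<inter> Sx d UNIV) (sum g' I)"
  proof (rule rz_sum)
    fix i assume "i \<in> I"
    with g' have "rz d ?E (img V \<inter> Fx {s i}) (img V \<inter> Fx {s i} \<inter> Sx d UNIV) (g' i)"
      by blast
    then show "rz d ?E ?Q (?Q \<inter> Sx d UNIV) (g' i)"
      by (rule rz_mono) (use I(2) [OF \<open>i \<in> I\<close>] in \<open>auto simp: Fx_def\<close>)
  qed
  from bundle_excision [OF V(1) order_refl rz_add [OF c'(1) this] b]
  have "rb d ?E (img V) (img V \<inter> Sx d UNIV) (c' + sum g' I)"
    by (rule rb_mono) auto
  from rb_trans [OF c'(2) this] have "rb d T V (V \<inter> S) (c + push d \<Theta> (sum g' I))"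
    by (rule rb_back [OF V, rotated]) (use c in \<open>simp add: rz_def\<close>)
  then have "rb d T V (V \<inter> S) (c + (\<Sum>i\<in>I. push d \<Theta> (g' i)))"
    by (simp add: push_sum)
  moreover have "rz d T (V \<inter> Fb {s i}) (V \<inter> Fb {s i} \<inter> S) (push d \<Theta> (g' i))" if "i \<in> I" for i
  proof (rule push_\<Theta>(1))
    have "img (V \<inter> Fb {s i}) = img V \<inter> Fx {s i}"
      using snd\<Theta> by (auto simp: img_def Fb_def Fx_def)
    with g' that show "rz d ?E (img (V \<inter> Fb {s i})) (img (V \<inter> Fb {s i}) \<inter> Sx d UNIV) (g' i)"
      by simp
  qed
  ultimately show ?thesis
    using I(1) by (intro that [of I s "\<lambda>i. push d \<Theta> (g' i)"]) simp_all
qed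

end

text \<open>A mod 2 Thom class over the open set \<open>V\<close>.  Being detected on fibres, it is unique, so that
  local ones can be glued.\<close>

definition thom :: "('a \<times> 'n) topology \<Rightarrow> ('a \<times> 'n) set \<Rightarrow> nat \<Rightarrow> ('a \<times> 'n) set \<Rightarrow> (('a \<times> 'n) chain2 \<Rightarrow> bit) \<Rightarrow> bool"
  where "thom T S d V t \<longleftrightarrow> additive_on d T V (V \<inter> S) t \<and>
    (\<forall>s c. rz d T (V \<inter> Fb {s}) (V \<inter> Fb {s} \<inter> S) c \<longrightarrow> (t c = 0 \<longleftrightarrow> rb d T (Fb {s}) (Fb {s} \<inter> S) c))"

lemma rz_fibre: "rz p T (V \<inter> Fb Y) (V \<inter> Fb Y \<inter> S) c \<Longrightarrow> rz p T V (V \<inter> S) c"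
  by (erule rz_mono) auto

lemma additive_on_mono:
  assumes "additive_on p T A B t" "A' \<subseteq> A" "B' \<subseteq> B"
  shows "additive_on p T A' B' t"
  unfolding additive_on_def
  using assms rz_mono [OF _ assms(2,3)] rb_mono [OF _ assms(2,3)] by (auto simp: additive_on_def)

text \<open>The fibre condition speaks of boundaries in the whole fibre and not in \<open>V\<close>,
  so it restricts to smaller sets unchanged.\<close>

lemma thom_mono:
  assumes "thom T S d V t" "V' \<subseteq> V"
  shows "thom T S d V' t"
  unfolding thom_def
proof (intro conjI allI impI)
  show "additive_on d T V' (V' \<inter> S) t"
    using assms by (auto simp: thom_def intro: additive_on_mono)
  fix s c assume "rz d T (V' \<inter> Fb {s}) (V' \<inter> Fb {s} \<inter> S) c"
  then have "rz d T (V \<inter> Fb {s}) (V \<inter> Fb {s} \<inter> S) c"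
    by (rule rz_mono) (use assms in auto)
  then show "t c = 0 \<longleftrightarrow> rb d T (Fb {s}) (Fb {s} \<inter> S) c"
    using assms(1) by (simp add: thom_def)
qed

text \<open>Every relative cycle over a chart is homologous to a sum of cycles in fibres. There the
  vanishing of \<open>t\<close> is an intrinsic condition, which over the field of two elements
  determines the value.\<close>

lemma (in param_chart) thom_unique:
  assumes t: "thom T S d V t" "thom T S d V t'" and V: "openin T V" "V \<subseteq> W" and c: "rz d T V (V \<inter> S) c"
  shows "t c = t' c"
proof -
  obtain I s g where I: "finite (I :: ((nat \<Rightarrow> real) \<Rightarrow> (nat \<Rightarrow> real) \<times> 'n) set)"
    "\<And>i. i \<in> I \<Longrightarrow> rz d T (V \<inter> Fb {s i}) (V \<inter> Fb {s i} \<inter> S) (g i)" "rb d T V (V \<inter> S) (c + sum g I)"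
    by (rule chart_fibre_decomposition [OF V c]) blast
  note g = I(2) [THEN rz_fibre]
  have eq: "f c = (\<Sum>i\<in>I. f (g i))" if f: "thom T S d V f" for f
  proof -
    have a: "additive_on d T V (V \<inter> S) f"
      using f by (simp add: thom_def)
    have "f (sum g I) = f c"
      by (rule additive_on_cong [OF a c I(3)]) auto
    moreover have "f (sum g I) = (\<Sum>i\<in>I. f (g i))"
      by (rule additive_on_sum(1) [OF a g])
    ultimately show ?thesis
      by simp
  qed
  have "t (g i) = t' (g i)" if "i \<in> I" for i
  proof -
    have "t (g i) = 0 \<longleftrightarrow> t' (g i) = 0"
      using t I(2) [OF that] unfolding thom_def by blast
    then show ?thesis
      by (metis bit_not_zero_iff)
  qed
  then show ?thesis
    unfolding eq [OF t(1)] eq [OF t(2)] by (rule sum.cong [OF refl])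
qed

definition forget :: "'a \<times> 'n \<Rightarrow> 'a \<times> unit"
  where "forget e = (fst e, ())"

abbreviation point :: "unit topology"
  where "point \<equiv> discrete_topology {()}"

text \<open>The degree in the trivialization with the parameter forgotten. Detection on a fibre
  comes from the injectivity of the degree, once the parameter has been put back.\<close>

lemma (in param_chart) thom_chart:
  assumes \<delta>: "local_degree d point d \<delta>"
  shows "thom T S d W (\<lambda>c. \<delta> (push d forget (push d \<Psi> c)))"
  unfolding thom_def
proof (intro conjI allI impI)
  let ?P = "ES d point"
  note add = \<delta> [unfolded local_degree_def, THEN conjunct1]
  note ker = \<delta> [unfolded local_degree_def, THEN conjunct2, THEN conjunct1, rule_format]
  have cf: "continuous_map (subtopology (ES d K) A) ?P forget" for A
  proof -
    have "continuous_map (ES d K) ?P forget"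
      unfolding ES_def forget_def by (auto simp: continuous_map_pairwise o_def continuous_map_fst)
    then show ?thesis
      by (rule continuous_map_from_subtopology)
  qed
  have z: "rz d ?P (Fx UNIV) (Sx d UNIV) (push d forget c)" if "rz d (ES d K) A (A \<inter> Sx d UNIV) c" for A c
    by (rule rz_push [OF that cf]) (auto simp: forget_def Fx_def Sx_def)
  have b: "rb d ?P (Fx UNIV) (Sx d UNIV) (push d forget c)" if "rb d (ES d K) A (A \<inter> Sx d UNIV) c" for A c
    by (rule rb_push [OF that cf]) (auto simp: forget_def Fx_def Sx_def)
  show "additive_on d T W (W \<inter> S) (\<lambda>c. \<delta> (push d forget (push d \<Psi> c)))"
    unfolding additive_on_def
  proof (intro conjI allI impI)
    fix a b assume "rz d T W (W \<inter> S) a" "rz d T W (W \<inter> S) b"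
    then show "\<delta> (push d forget (push d \<Psi> (a + b))) = \<delta> (push d forget (push d \<Psi> a)) + \<delta> (push d forget (push d \<Psi> b))"
      using additive_on_add [OF add z [OF push_\<Psi>(1) [OF order_refl]] z [OF push_\<Psi>(1) [OF order_refl]], of a b] by simp
  next
    fix c assume "rb d T W (W \<inter> S) c"
    then show "\<delta> (push d forget (push d \<Psi> c)) = 0"
      by (intro additive_on_rb [OF add] b [OF push_\<Psi>(2) [OF order_refl]])
  qed
  fix s c assume c: "rz d T (W \<inter> Fb {s}) (W \<inter> Fb {s} \<inter> S) c"
  have chc: "chn d T (W \<inter> Fb {s}) c"
    using c by (simp add: rz_def)
  have img: "img (W \<inter> Fb {s}) = img W \<inter> Fx {s}"
    using snd\<Theta> by (auto simp: img_def Fb_def Fx_def)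
  have imgW: "img W = Q"
    using \<Theta>_mem by (auto simp: img_def)
  note pc = push_\<Psi>(1) [OF _ c, unfolded img, simplified]
  show "\<delta> (push d forget (push d \<Psi> c)) = 0 \<longleftrightarrow> rb d T (Fb {s}) (Fb {s} \<inter> S) c"
  proof
    assume 0: "\<delta> (push d forget (push d \<Psi> c)) = 0"
    \<comment> \<open>If the section over \<open>s\<close> does not pass through \<open>W\<close>,
      the part of the fibre in \<open>W\<close> lies in \<open>S\<close> and the chain is
      trivial.\<close>
    show "rb d T (Fb {s}) (Fb {s} \<inter> S) c"
    proof (cases "s \<in> zeros W")
      case False
      have "img W \<inter> Fx {s} \<subseteq> Sx d UNIV"
        using img_zeros(2) [OF openW] False by (auto simp: Fx_def)
      then have "W \<inter> Fb {s} \<subseteq> S"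
        using S_iff \<Psi>_mem snd\<Psi> imgW by (auto simp: Fb_def Fx_def subset_iff simp del: split_paired_All)
      then have "chn d T (Fb {s} \<inter> S) c"
        by (intro chn_mono [OF chc]) auto
      then show ?thesis
        by (rule chn_imp_rb)
    next
      case True
      have sK: "s \<in> topspace K"
        using True openin_subset [OF openin_img [OF openW]] by (auto simp: zeros_def ES_def)
      have "rb d ?P (Fx UNIV) (Sx d UNIV) (push d forget (push d \<Psi> c))"
        by (rule ker [OF z [OF pc] 0])
      then have "rb d (ES d K) (Fx {s}) (Sx d {s}) (push d (\<lambda>e. (fst e, s)) (push d forget (push d \<Psi> c)))"
      proof (rule rb_push)
        have "continuous_map ?P (ES d K) (\<lambda>e. (fst e, s))"
          unfolding ES_def using sK by (auto simp: continuous_map_pairwise o_def continuous_map_fst)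
        then show "continuous_map (subtopology ?P (Fx UNIV)) (ES d K) (\<lambda>e. (fst e, s))"
          by (rule continuous_map_from_subtopology)
      qed (auto simp: Fx_def Sx_def)
      moreover have "push d (\<lambda>e. (fst e, s)) (push d forget (push d \<Psi> c)) = push d \<Psi> c"
      proof -
        have "chn d (ES d K) (img W \<inter> Fx {s}) (push d \<Psi> c)"
          using pc by (simp add: rz_def)
        then show ?thesis
          unfolding push_compose [of d _ forget] by (rule push_id_gen) (auto simp: forget_def Fx_def)
      qed
      ultimately have "rb d (ES d K) (Fx {s}) (Sx d {s}) (push d \<Psi> c)"
        by simp
      from bundle_excision [OF openW _ pc this]
      have "rb d (ES d K) (img (W \<inter> Fb {s})) (img (W \<inter> Fb {s}) \<inter> Sx d UNIV) (push d \<Psi> c)"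
        using True by (simp add: img)
      from push_\<Theta>(2) [OF this] have "rb d T (W \<inter> Fb {s}) (W \<inter> Fb {s} \<inter> S) c"
        using push_\<Theta>\<Psi> [OF chc] by simp
      then show ?thesis
        by (rule rb_mono) auto
    qed
  next
    assume b': "rb d T (Fb {s}) (Fb {s} \<inter> S) c"
    \<comment> \<open>If \<open>W\<close> and \<open>S\<close> do not cover the fibre, its unique
      section point is outside \<open>W\<close>, and again the chain is supported in
      \<open>S\<close>.\<close>
    show "\<delta> (push d forget (push d \<Psi> c)) = 0"
    proof (cases "topspace T \<inter> Fb {s} \<subseteq> W \<union> S")
      case True
      then have eq: "topspace T \<inter> Fb {s} \<inter> (W \<union> S) = topspace T \<inter> Fb {s}"
          "topspace T \<inter> Fb {s} \<inter> S = topspace T \<inter> (Fb {s} \<inter> S)"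
          "topspace T \<inter> Fb {s} \<inter> W = W \<inter> Fb {s}"
          "topspace T \<inter> Fb {s} \<inter> W \<inter> S = W \<inter> Fb {s} \<inter> S"
        using openin_subset [OF openW] by auto
      have "rb d T (topspace T \<inter> Fb {s} \<inter> W) (topspace T \<inter> Fb {s} \<inter> W \<inter> S) c"
      proof (rule excision_inj_within [OF _ _ openW openS])
        show "rz d T (topspace T \<inter> Fb {s} \<inter> W) (topspace T \<inter> Fb {s} \<inter> W \<inter> S) c"
          unfolding eq by (rule c)
        show "rb d T (topspace T \<inter> Fb {s} \<inter> (W \<union> S)) (topspace T \<inter> Fb {s} \<inter> S) c"
          unfolding eq rb_topspace by (rule b')
      qed
      then have "rb d T (W \<inter> Fb {s}) (W \<inter> Fb {s} \<inter> S) c"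
        unfolding eq .
      from push_\<Psi>(2) [OF _ this] show ?thesis
        by (intro additive_on_rb [OF add] b [of "img (W \<inter> Fb {s})"]) auto
    next
      case False
      then obtain f where f: "f \<in> topspace T" "f \<in> Fb {s}" "f \<notin> W" "f \<notin> S"
        by blast
      have "e \<in> S" if "e \<in> W" "e \<in> Fb {s}" for e
        using section_unique [of e f] f that openin_subset [OF openW] by (auto simp: Fb_def)
      then have "chn d T (W \<inter> Fb {s} \<inter> S) c"
        by (intro chn_mono [OF chc]) auto
      then have "rb d T (W \<inter> Fb {s}) (W \<inter> Fb {s} \<inter> S) c"
        by (rule chn_imp_rb)
      from push_\<Psi>(2) [OF _ this] show ?thesis
        by (intro additive_on_rb [OF add] b [of "img (W \<inter> Fb {s})"]) auto
    qed
  qed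
qed

text \<open>Mayer-Vietoris. A class splits between \<open>X\<close> and \<open>W\<close> because the
  obstruction lives over the overlap in degree \<open>d - 1\<close>, where it vanishes. The value
  does not depend on the splitting because \<open>t1\<close> and \<open>t2\<close> agree over the
  overlap by uniqueness. Both facts are available since the overlap lies in the chart
  \<open>W\<close>.\<close>

lemma (in param_chart) thom_glue:
  assumes X: "openin T X" "S \<subseteq> X" and t1: "thom T S d X t1" and t2: "thom T S d W t2" and d: "0 < d"
  shows "\<exists>t. thom T S d (X \<union> W) t"
proof -
  let ?U = "X \<union> W" and ?V = "X \<inter> W"
  have XS: "X \<inter> S = S" "?U \<inter> S = S"
    using X by auto
  have V: "openin T ?V" "?V \<subseteq> W"
    using X openW by auto
  have a1: "additive_on d T X S t1" and a2: "additive_on d T W (W \<inter> S) t2"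
    using t1 t2 by (simp_all add: thom_def XS)
  have agree: "t1 c = t2 c" if "rz d T ?V (?V \<inter> S) c" for c
    by (rule thom_unique [OF thom_mono [OF t1] thom_mono [OF t2] V that]) auto
  define G where "G = (\<lambda>c v. \<exists>x y. rz d T X S x \<and> rz d T W (W \<inter> S) y \<and> rb d T ?U S (c + (x + y)) \<and> v = t1 x + t2 y)"
  have G0: "v = 0" if G0v: "G 0 v" for v
  proof -
    obtain x y where xy: "rz d T X S x" "rz d T W (W \<inter> S) y" "rb d T ?U S (x + y)" "v = t1 x + t2 y"
      using G0v by (auto simp: G_def)
    obtain u r where ur: "chn (Suc d) T ?U u" "chn d T S r" "x + y = bd (Suc d) u + r"
      using xy(3) by (auto simp: rb_def)
    obtain n u1 u2 where u: "chn (Suc d) T X u1" "chn (Suc d) T W u2" "sd n (Suc d) u = u1 + u2"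
      by (rule sd_split1 [OF ur(1) X(1) openW])
    have "bd (Suc d) (sd n (Suc d) u) = sd n d (x + y) + sd n d r"
      unfolding bd_sd [OF ur(1)] ur(3) by (simp add: ac_simps)
    then have "(sd n d x + sd n d r) + sd n d y = bd (Suc d) u1 + bd (Suc d) u2"
      unfolding u(3) by (simp add: ac_simps)
    from char_two_swap [OF this]
    have eq: "sd n d x + sd n d r + bd (Suc d) u1 = sd n d y + bd (Suc d) u2" .
    \<comment> \<open>\<open>b\<close> lives over the overlap and is homologous to \<open>x\<close>
      over \<open>X\<close> and to \<open>y\<close> over \<open>W\<close>.\<close>
    define b where "b = sd n d y + bd (Suc d) u2"
    have chx: "chn d T X x" and chy: "chn d T W y" and bdy: "chn (d - 1) T (W \<inter> S) (bd d y)"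
      using xy by (simp_all add: rz_def)
    have "chn d T X b"
      unfolding b_def eq [symmetric]
      by (intro chn_add chn_sd chx chn_bd_Suc u chn_mono [OF ur(2) X(2)])
    moreover have "chn d T W b"
      unfolding b_def by (intro chn_add chn_sd chy chn_bd_Suc u)
    ultimately have chb: "chn d T ?V b"
      by (simp add: chn_Int)
    have "bd d b = sd n (d - 1) (bd d y)"
      unfolding b_def by (simp add: bd_sd [OF chy] bd_bd_Suc [OF u(2)])
    then have "chn (d - 1) T (W \<inter> S) (bd d b)"
      using bdy by (simp add: chn_sd)
    then have bV: "rz d T ?V (?V \<inter> S) b"
      using chb chn_bd [OF chb] by (simp add: rz_def chn_Int)
    have "rb d T X S (x + b)"
    proof -
      have "rb d T X S ((x + sd n d x) + (sd n d r + bd (Suc d) u1))"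
        by (intro rb_add sd_rb xy chn_imp_rb chn_sd ur bd_imp_rb u)
      then show ?thesis
        unfolding b_def eq [symmetric] by (simp add: ac_simps)
    qed
    then have "t1 b = t1 x"
      by (rule additive_on_cong [OF a1 xy(1) _ X(2)])
    have "rb d T W (W \<inter> S) (y + b)"
    proof -
      have "rb d T W (W \<inter> S) ((y + sd n d y) + bd (Suc d) u2)"
        by (intro rb_add sd_rb xy bd_imp_rb u)
      then show ?thesis
        unfolding b_def by (simp add: ac_simps)
    qed
    then have "t2 b = t2 y"
      by (rule additive_on_cong [OF a2 xy(2)]) auto
    then show ?thesis
      using agree [OF bV] \<open>t1 b = t1 x\<close> xy(4) by simp
  qed
  have Gadd: "G (a + b) (v + w)" if "G a v" "G b w" for a b v w
  proof -
    obtain x y x' y' where xy: "rz d T X S x" "rz d T W (W \<inter> S) y" "rb d T ?U S (a + (x + y))" "v = t1 x + t2 y"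
      "rz d T X S x'" "rz d T W (W \<inter> S) y'" "rb d T ?U S (b + (x' + y'))" "w = t1 x' + t2 y'"
      using \<open>G a v\<close> \<open>G b w\<close> unfolding G_def by blast
    have "rb d T ?U S ((a + b) + ((x + x') + (y + y')))"
      using rb_add [OF xy(3) xy(7)] by (simp add: ac_simps)
    moreover have "v + w = t1 (x + x') + t2 (y + y')"
      using additive_on_add [OF a1 xy(1) xy(5)] additive_on_add [OF a2 xy(2) xy(6)] xy(4) xy(8) by (simp add: ac_simps)
    ultimately show ?thesis
      unfolding G_def using rz_add [OF xy(1) xy(5)] rz_add [OF xy(2) xy(6)] by blast
  qed
  have Gex: "\<exists>v. G c v" if c: "rz d T ?U S c" for c
  proof -
    have chc: "chn d T ?U c" "chn (d - 1) T S (bd d c)"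
      using c by (simp_all add: rz_def)
    obtain n c1 c2 where cc: "chn d T X c1" "chn d T W c2" "sd n d c = c1 + c2"
      by (rule sd_split1 [OF chc(1) X(1) openW])
    have bsd: "chn (d - 1) T S (bd d (sd n d c))"
      unfolding bd_sd [OF chc(1)] by (intro chn_sd chc)
    have e: "bd d c2 = bd d (sd n d c) + bd d c1"
      unfolding cc(3) by (simp add: ac_simps)
    have "chn (d - 1) T X (bd d c2)"
      unfolding e by (intro chn_add chn_mono [OF bsd X(2)] chn_bd cc)
    then have ech: "chn (d - 1) T ?V (bd d c2)"
      using chn_bd [OF cc(2)] by (simp add: chn_Int)
    have "rz (d - 1) T ?V (?V \<inter> S) (bd d c2)"
      using ech bd_bd [OF cc(2)] by (simp add: rz_def)
    \<comment> \<open>The boundary of \<open>c2\<close> is a relative cycle over the overlap. Its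
      filling \<open>y\<close>, added to both pieces, makes them relative cycles.\<close>
    then have "rb (d - 1) T ?V (?V \<inter> S) (bd d c2)"
      by (rule chart_rb_below [OF V]) (use d in simp)
    then obtain y r where y: "chn d T ?V y" "chn (d - 1) T (?V \<inter> S) r" "bd d c2 = bd d y + r"
      using d by (auto simp: rb_def)
    have r2: "bd d (c2 + y) = r"
      unfolding bd_add y(3) by (simp add: ac_simps)
    have r1: "bd d (c1 + y) = bd d (sd n d c) + r"
    proof -
      have "bd d (c1 + y) = bd d (sd n d c) + bd d (c2 + y)"
        unfolding cc(3) by (simp add: ac_simps)
      then show ?thesis
        unfolding r2 .
    qed
    have "rz d T X S (c1 + y)"
      unfolding rz_def r1 by (intro conjI chn_add cc bsd chn_mono [OF y(1)] chn_mono [OF y(2)]) auto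
    moreover have "rz d T W (W \<inter> S) (c2 + y)"
      unfolding rz_def r2 by (intro conjI chn_add cc chn_mono [OF y(1)] chn_mono [OF y(2)]) auto
    moreover have "rb d T ?U S (c + ((c1 + y) + (c2 + y)))"
      using sd_rb [OF c, of n] unfolding cc(3) by (simp add: ac_simps)
    ultimately show ?thesis
      unfolding G_def by blast
  qed
  have Guniq: "v = w" if "G c v" "G c w" for c v w
    using G0 [of "v + w"] Gadd [OF that] by (simp add: add_eq_0_char_two)
  have Grb: "G c 0" if "rb d T ?U S c" for c
    unfolding G_def
    using that additive_on_rb [OF a1 rb_0] additive_on_rb [OF a2 rb_0]
    by (intro exI [of _ 0]) simp
  have GX: "G c (t1 c)" if "rz d T X S c" for c
    unfolding G_def using that additive_on_rb [OF a2 rb_0] by (intro exI [of _ c] exI [of _ 0]) simp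
  have GW: "G c (t2 c)" if "rz d T W (W \<inter> S) c" for c
    unfolding G_def using that additive_on_rb [OF a1 rb_0] by (intro exI [of _ 0] exI [of _ c]) simp
  define t where "t = (\<lambda>c. SOME v. G c v)"
  have t: "G c (t c)" if "rz d T ?U S c" for c
    unfolding t_def by (rule someI_ex) (rule Gex [OF that])
  have rzX: "rz d T ?U S c" if "rz d T X S c" for c
    using that by (rule rz_mono) auto
  have rzW: "rz d T ?U S c" if "rz d T W (W \<inter> S) c" for c
    using that by (rule rz_mono) auto
  have add: "additive_on d T ?U S t"
    unfolding additive_on_def
  proof (intro conjI allI impI)
    fix a b assume ab: "rz d T ?U S a" "rz d T ?U S b"
    show "t (a + b) = t a + t b"
      by (rule Guniq [OF t [OF rz_add [OF ab]] Gadd [OF t [OF ab(1)] t [OF ab(2)]]])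
  next
    fix c assume c: "rb d T ?U S c"
    have "S \<subseteq> ?U"
      using X by auto
    then show "t c = 0"
      by (rule Guniq [OF t [OF rb_imp_rz [OF c]] Grb [OF c]])
  qed
  \<comment> \<open>Either the relevant part of the fibre lies in \<open>X\<close>, or it contains a
    section point in \<open>W\<close>. In the second case uniqueness of the section shows that
    \<open>W\<close> and \<open>S\<close> cover the fibre, and excision moves \<open>c\<close> into
    \<open>W\<close>.\<close>
  have "t c = 0 \<longleftrightarrow> rb d T (Fb {s}) (Fb {s} \<inter> S) c" if c: "rz d T (?U \<inter> Fb {s}) (?U \<inter> Fb {s} \<inter> S) c" for s c
  proof (cases "topspace T \<inter> ?U \<inter> Fb {s} \<subseteq> X")
    case True
    have eq: "topspace T \<inter> (?U \<inter> Fb {s}) = topspace T \<inter> (X \<inter> Fb {s})"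
        "topspace T \<inter> (?U \<inter> Fb {s} \<inter> S) = topspace T \<inter> (X \<inter> Fb {s} \<inter> S)"
      using True X by auto
    from c have "rz d T (topspace T \<inter> (?U \<inter> Fb {s})) (topspace T \<inter> (?U \<inter> Fb {s} \<inter> S)) c"
      by (simp only: rz_topspace)
    then have cX: "rz d T (X \<inter> Fb {s}) (X \<inter> Fb {s} \<inter> S) c"
      by (simp only: eq rz_topspace)
    then have cS: "rz d T X S c"
      by (rule rz_mono) auto
    have "t c = t1 c"
      by (rule Guniq [OF t [OF rzX [OF cS]] GX [OF cS]])
    then show ?thesis
      using t1 cX by (simp add: thom_def)
  next
    case False
    then obtain f where f: "f \<in> topspace T" "f \<in> W" "f \<in> Fb {s}" "f \<notin> S"
      using X by auto
    have sub: "e \<in> W \<union> S" if "e \<in> topspace T" "e \<in> Fb {s}" for e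
      using section_unique [of e f] that f by (auto simp: Fb_def)
    let ?C = "topspace T \<inter> Fb {s}"
    have eq: "?C \<inter> (W \<union> S) = topspace T \<inter> (?U \<inter> Fb {s})" "?C \<inter> S = topspace T \<inter> (?U \<inter> Fb {s} \<inter> S)"
      "?C \<inter> W = W \<inter> Fb {s}"
      using sub X openin_subset [OF openW] openin_subset [OF X(1)] by auto
    have "rz d T (?C \<inter> (W \<union> S)) (?C \<inter> S) c"
      unfolding eq rz_topspace by (rule c)
    then obtain c' where "rz d T (?C \<inter> W) (?C \<inter> W \<inter> S) c'" "rb d T (?C \<inter> (W \<union> S)) (?C \<inter> S) (c + c')"
      by (rule excision_surj_within) (rule openW, rule openS)
    then have c': "rz d T (W \<inter> Fb {s}) (W \<inter> Fb {s} \<inter> S) c'" "rb d T (?U \<inter> Fb {s}) (?U \<inter> Fb {s} \<inter> S) (c + c')"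
      unfolding eq rb_topspace .
    have c'W: "rz d T W (W \<inter> S) c'"
      by (rule rz_fibre [OF c'(1)])
    have tc': "t c' = t2 c'"
      by (rule Guniq [OF t [OF rzW [OF c'W]] GW [OF c'W]])
    have cU: "rz d T ?U S c"
      using rz_fibre [OF c] by (simp add: XS)
    have "rb d T ?U S (c + c')"
      using c'(2) by (rule rb_mono) auto
    then have "t c' = t c"
      by (rule additive_on_cong [OF add cU]) (use X in auto)
    moreover have cc': "rb d T (Fb {s}) (Fb {s} \<inter> S) (c + c')"
      using c'(2) by (rule rb_mono) auto
    have "rb d T (Fb {s}) (Fb {s} \<inter> S) c \<longleftrightarrow> rb d T (Fb {s}) (Fb {s} \<inter> S) c'"
      using rb_cancel [OF cc'] rb_swap [OF cc'] by (rule iffI [rotated])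
    moreover have "t2 c' = 0 \<longleftrightarrow> rb d T (Fb {s}) (Fb {s} \<inter> S) c'"
      using t2 c'(1) by (simp add: thom_def)
    ultimately show ?thesis
      using tc' by simp
  qed
  with add have "thom T S d ?U t"
    unfolding thom_def by (simp add: XS)
  then show ?thesis by blast
qed

theorem thom_exists:
  assumes S: "openin T S" and d: "0 < d" and \<delta>: "local_degree d point d \<delta>" and "finite C"
    and chart: "\<And>i. i \<in> C \<Longrightarrow> param_chart T K S d (W i) (Q i) (\<Psi> i) (\<Theta> i)"
  shows "\<exists>t. thom T S d (S \<union> (\<Union>i\<in>C. W i)) t"
  using \<open>finite C\<close> chart
proof (induction C rule: finite_induct)
  case empty
  have "rb d T (Fb {s}) (Fb {s} \<inter> S) c" if "rz d T (S \<inter> Fb {s}) (S \<inter> Fb {s} \<inter> S) c" for s c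
  proof -
    have "chn d T (Fb {s} \<inter> S) c"
      using that by (simp add: rz_def Int_commute)
    then show ?thesis
      by (rule chn_imp_rb)
  qed
  then have "thom T S d S (\<lambda>_. 0)"
    by (simp add: thom_def additive_on_def)
  then show ?case
    by auto
next
  case (insert i C)
  interpret param_chart T K S d "W i" "Q i" "\<Psi> i" "\<Theta> i"
    by (rule insert.prems) simp
  obtain t where t: "thom T S d (S \<union> (\<Union>i\<in>C. W i)) t"
    using insert.IH insert.prems by auto
  have "openin T (W j)" if "j \<in> C" for j
    using insert.prems [of j] that by (simp add: param_chart_def)
  then have o: "openin T (S \<union> (\<Union>i\<in>C. W i))"
    using S by auto
  have "\<exists>t. thom T S d ((S \<union> (\<Union>i\<in>C. W i)) \<union> W i) t"
    by (rule thom_glue [OF o _ t thom_chart [OF \<delta>] d]) auto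
  moreover have "(S \<union> (\<Union>i\<in>C. W i)) \<union> W i = S \<union> (\<Union>i\<in>insert i C. W i)"
    by auto
  ultimately show ?case
    by simp
qed

section \<open>The intersection functional of a map into a manifold, and displacement off the
  boundary\<close>

section \<open>Charts of a manifold along a map from a compact space\<close>

definition interior_chart :: "nat \<Rightarrow> 'a topology \<Rightarrow> 'a set \<Rightarrow> ('a \<Rightarrow> nat \<Rightarrow> real) \<Rightarrow> bool"
  where "interior_chart d M U \<phi> \<longleftrightarrow> openin M U \<and> openin (Euclidean_space d) (\<phi> ` U) \<and>
    homeomorphic_map (subtopology M U) (subtopology (Euclidean_space d) (\<phi> ` U)) \<phi>"

definition offdiag :: "'a topology \<Rightarrow> 'n topology \<Rightarrow> ('n \<Rightarrow> 'a) \<Rightarrow> ('a \<times> 'n) set"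
  where "offdiag M K F = {(y, s) \<in> topspace (prod_topology M K). y \<noteq> F s}"

text \<open>A fibrewise translation of the chart that carries the section \<open>F\<close> to the
  zero section.\<close>

definition chartdiff :: "('a \<Rightarrow> nat \<Rightarrow> real) \<Rightarrow> ('n \<Rightarrow> 'a) \<Rightarrow> 'a \<times> 'n \<Rightarrow> (nat \<Rightarrow> real) \<times> 'n"
  where "chartdiff \<phi> F = (\<lambda>(y, s). (\<lambda>i. \<phi> y i - \<phi> (F s) i, s))"

lemma openin_offdiag:
  assumes "Hausdorff_space M" "continuous_map K M F"
  shows "openin (prod_topology M K) (offdiag M K F)"
proof -
  have "closedin (prod_topology M K) {e \<in> topspace (prod_topology M K). fst e = (F \<circ> snd) e}"
    by (rule closedin_continuous_maps_eq [OF assms(1)])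
       (intro continuous_map_fst continuous_map_compose [OF continuous_map_snd assms(2)])+
  moreover have "offdiag M K F = topspace (prod_topology M K) - {e \<in> topspace (prod_topology M K). fst e = (F \<circ> snd) e}"
    by (auto simp: offdiag_def)
  ultimately show ?thesis
    by (simp only: openin_diff openin_topspace)
qed

lemma param_chart_chartdiff:
  assumes M: "Hausdorff_space M" and F: "continuous_map K M F" and ch: "interior_chart d M U \<phi>"
  shows "\<exists>Q \<Theta>. param_chart (prod_topology M K) K (offdiag M K F) d (U \<times> {s \<in> topspace K. F s \<in> U}) Q (chartdiff \<phi> F) \<Theta>"
proof -
  have oU: "openin M U" and o\<phi>: "openin (Euclidean_space d) (\<phi> ` U)"
    and hom: "homeomorphic_map (subtopology M U) (subtopology (Euclidean_space d) (\<phi> ` U)) \<phi>"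
    using ch by (auto simp: interior_chart_def)
  have UM: "U \<subseteq> topspace M"
    by (rule openin_subset [OF oU])
  have \<phi>E: "\<phi> ` U \<subseteq> topspace (Euclidean_space d)"
    by (rule openin_subset [OF o\<phi>])
  obtain g where g: "homeomorphic_maps (subtopology M U) (subtopology (Euclidean_space d) (\<phi> ` U)) \<phi> g"
    using hom by (auto simp: homeomorphic_map_maps)
  have c\<phi>: "continuous_map (subtopology M U) (Euclidean_space d) \<phi>"
    and cg: "continuous_map (subtopology (Euclidean_space d) (\<phi> ` U)) M g"
    and g\<phi>: "\<And>y. y \<in> U \<Longrightarrow> g (\<phi> y) = y" and gU: "\<And>x. x \<in> \<phi> ` U \<Longrightarrow> g x \<in> U" "\<And>x. x \<in> \<phi> ` U \<Longrightarrow> \<phi> (g x) = x"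
    using g UM by (auto simp: homeomorphic_maps_def continuous_map_in_subtopology Int_absorb1)
  define V where "V = {s \<in> topspace K. F s \<in> U}"
  have oV: "openin K V"
    unfolding V_def by (rule openin_continuous_map_preimage [OF F oU])
  have c\<phi>F: "continuous_map (subtopology K V) (Euclidean_space d) (\<phi> \<circ> F)"
    by (rule continuous_map_compose [OF _ c\<phi>])
       (auto simp: continuous_map_in_subtopology V_def intro: continuous_map_from_subtopology F)
  have coord: "continuous_map X euclideanreal (\<lambda>z. f z i)" if "continuous_map X (Euclidean_space d) f" for X and f :: "'z \<Rightarrow> nat \<Rightarrow> real" and i
    using that unfolding Euclidean_space_def continuous_map_in_subtopology continuous_map_componentwise_UNIV by blast
  define \<Theta> where "\<Theta> = (\<lambda>(v :: nat \<Rightarrow> real, s). (g (\<lambda>i. v i + \<phi> (F s) i), s))"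
  define Q where "Q = {e \<in> topspace (ES d (subtopology K V)). (\<lambda>i. fst e i + \<phi> (F (snd e)) i) \<in> \<phi> ` U}"
  have cadd: "continuous_map (ES d (subtopology K V)) (Euclidean_space d) (\<lambda>e i. fst e i + \<phi> (F (snd e)) i)"
  proof (rule continuous_map_Euclidean_space_add)
    show "continuous_map (ES d (subtopology K V)) (Euclidean_space d) fst"
      unfolding ES_def by (rule continuous_map_fst)
    show "continuous_map (ES d (subtopology K V)) (Euclidean_space d) (\<lambda>e. \<phi> (F (snd e)))"
      using continuous_map_compose [OF continuous_map_snd c\<phi>F, of "Euclidean_space d"] by (simp add: ES_def o_def)
  qed
  have ESV: "ES d (subtopology K V) = subtopology (ES d K) (UNIV \<times> V)"
    unfolding ES_def by (metis subtopology_Times subtopology_UNIV)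
  have oUV: "openin (ES d K) (topspace (Euclidean_space d) \<times> V)"
    unfolding ES_def by (simp add: openin_prod_Times_iff oV)
  have oQ: "openin (ES d K) Q"
  proof -
    have "openin (ES d (subtopology K V)) Q"
      unfolding Q_def by (rule openin_continuous_map_preimage [OF cadd o\<phi>])
    moreover have "ES d (subtopology K V) = subtopology (ES d K) (topspace (Euclidean_space d) \<times> V)"
      unfolding ES_def by (metis subtopology_Times subtopology_topspace)
    ultimately show ?thesis
      using openin_trans_full [OF _ oUV] by simp
  qed
  have memQ: "(v, s) \<in> Q \<longleftrightarrow> v \<in> topspace (Euclidean_space d) \<and> s \<in> V \<and> (\<lambda>i. v i + \<phi> (F s) i) \<in> \<phi> ` U" for v s
    using openin_subset [OF oV] by (auto simp: Q_def ES_def)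
  show ?thesis
  proof (intro exI)
    show "param_chart (prod_topology M K) K (offdiag M K F) d (U \<times> {s \<in> topspace K. F s \<in> U}) Q (chartdiff \<phi> F) \<Theta>"
      unfolding V_def [symmetric]
    proof
      show "openin (prod_topology M K) (offdiag M K F)"
        by (rule openin_offdiag [OF M F])
      show "openin (prod_topology M K) (U \<times> V)"
        by (simp add: openin_prod_Times_iff oU oV)
      show "openin (ES d K) Q"
        by (rule oQ)
      show "continuous_map (subtopology (prod_topology M K) (U \<times> V)) (ES d K) (chartdiff \<phi> F)"
      proof -
        have "continuous_map (prod_topology (subtopology M U) (subtopology K V)) (Euclidean_space d) (\<lambda>e i. \<phi> (fst e) i - \<phi> (F (snd e)) i)"
        proof (rule continuous_map_Euclidean_space_diff)
          show "continuous_map (prod_topology (subtopology M U) (subtopology K V)) (Euclidean_space d) (\<lambda>e. \<phi> (fst e))"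
            using continuous_map_compose [OF continuous_map_fst c\<phi>] by (simp add: o_def)
          show "continuous_map (prod_topology (subtopology M U) (subtopology K V)) (Euclidean_space d) (\<lambda>e. \<phi> (F (snd e)))"
            using continuous_map_compose [OF continuous_map_snd c\<phi>F] by (simp add: o_def)
        qed
        moreover have "continuous_map (prod_topology (subtopology M U) (subtopology K V)) K snd"
          by (rule continuous_map_into_fulltopology [OF continuous_map_snd])
        ultimately show ?thesis
          unfolding ES_def subtopology_Times
          by (simp add: continuous_map_pairwise chartdiff_def o_def case_prod_beta)
      qed
      show "continuous_map (subtopology (ES d K) Q) (prod_topology M K) \<Theta>"
      proof -
        have QV: "subtopology (ES d K) Q = subtopology (ES d (subtopology K V)) Q"
          using memQ by (auto simp: ESV subtopology_subtopology intro!: arg_cong [where f = "subtopology (ES d K)"])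
        have "continuous_map (subtopology (ES d K) Q) (subtopology (Euclidean_space d) (\<phi> ` U)) (\<lambda>e i. fst e i + \<phi> (F (snd e)) i)"
          unfolding QV continuous_map_in_subtopology
          by (auto simp: Q_def intro: continuous_map_from_subtopology cadd)
        from continuous_map_compose [OF this cg]
        have "continuous_map (subtopology (ES d K) Q) M (\<lambda>e. g (\<lambda>i. fst e i + \<phi> (F (snd e)) i))"
          by (simp add: o_def)
        moreover have "continuous_map (subtopology (ES d K) Q) K snd"
          unfolding ES_def by (intro continuous_map_from_subtopology continuous_map_snd)
        ultimately show ?thesis
          by (simp add: continuous_map_pairwise \<Theta>_def o_def case_prod_beta)
      qed
      show "chartdiff \<phi> F e \<in> Q" if e: "e \<in> U \<times> V" for e
      proof -
        obtain y s where ys: "e = (y, s)" "y \<in> U" "s \<in> V" "F s \<in> U"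
          using e by (auto simp: V_def)
        then have "\<phi> y \<in> topspace (Euclidean_space d)" "\<phi> (F s) \<in> topspace (Euclidean_space d)"
          using \<phi>E by auto
        then have "(\<lambda>i. \<phi> y i - \<phi> (F s) i) \<in> topspace (Euclidean_space d)"
          by (simp add: topspace_Euclidean_space)
        then show ?thesis
          using ys by (simp add: chartdiff_def memQ)
      qed
      show "\<Theta> e \<in> U \<times> V" if "e \<in> Q" for e
        using that gU(1) by (cases e) (simp add: memQ \<Theta>_def)
      show "\<Theta> (chartdiff \<phi> F e) = e" if "e \<in> U \<times> V" for e
        using that g\<phi> by (auto simp: \<Theta>_def chartdiff_def)
      show "chartdiff \<phi> F (\<Theta> e) = e" if "e \<in> Q" for e
        using that gU(2) by (cases e) (simp add: memQ \<Theta>_def chartdiff_def)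
      show "snd (chartdiff \<phi> F e) = snd e" for e
        by (simp add: chartdiff_def case_prod_beta)
      show "e \<in> offdiag M K F \<longleftrightarrow> chartdiff \<phi> F e \<in> Sx d UNIV" if e: "e \<in> U \<times> V" for e
      proof -
        obtain y s where ys: "e = (y, s)" "y \<in> U" "s \<in> V" "F s \<in> U"
          using e by (auto simp: V_def)
        then have E: "\<phi> y \<in> topspace (Euclidean_space d)" "\<phi> (F s) \<in> topspace (Euclidean_space d)"
          using \<phi>E by auto
        have "y \<noteq> F s \<longleftrightarrow> \<phi> y \<noteq> \<phi> (F s)"
          using g\<phi> ys by metis
        also have "\<dots> \<longleftrightarrow> (\<exists>i<d. \<phi> y i - \<phi> (F s) i \<noteq> 0)"
        proof
          assume "\<phi> y \<noteq> \<phi> (F s)"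
          then obtain i where i: "\<phi> y i \<noteq> \<phi> (F s) i"
            by auto
          have "i < d"
            by (rule ccontr) (use E i in \<open>simp add: topspace_Euclidean_space\<close>)
          with i show "\<exists>i<d. \<phi> y i - \<phi> (F s) i \<noteq> 0"
            by auto
        qed auto
        finally show ?thesis
          using ys UM openin_subset [OF oV] by (auto simp: offdiag_def chartdiff_def Sx_def)
      qed
      show "e = f" if "e \<in> topspace (prod_topology M K) - offdiag M K F" "f \<in> topspace (prod_topology M K) - offdiag M K F" "snd e = snd f" for e f
        using that by (cases e; cases f) (auto simp: offdiag_def)
    qed
  qed
qed

text \<open>Compactness of the parameter space leaves finitely many charts to glue. The formula
  still holds in every interior chart, by uniqueness of Thom classes.\<close>

theorem intersection_functional_exists:
  fixes M :: "'a topology" and K :: "'n topology"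
  assumes M: "Hausdorff_space M" and F: "continuous_map K M F" and K: "compact_space K" and d: "0 < d"
    and int: "\<And>s. s \<in> topspace K \<Longrightarrow> \<exists>U \<phi>. interior_chart d M U \<phi> \<and> F s \<in> U"
    and \<delta>: "local_degree d point d \<delta>"
  obtains t where "additive_on d (prod_topology M K) UNIV (offdiag M K F) t"
    "\<And>U \<phi> c. interior_chart d M U \<phi> \<Longrightarrow>
       rz d (prod_topology M K) (U \<times> {s \<in> topspace K. F s \<in> U}) ((U \<times> {s \<in> topspace K. F s \<in> U}) \<inter> offdiag M K F) c \<Longrightarrow>
       t c = \<delta> (push d forget (push d (chartdiff \<phi> F) c))"
proof -
  let ?T = "prod_topology M K" and ?S = "offdiag M K F" and ?W = "\<lambda>U. U \<times> {s \<in> topspace K. F s \<in> U}"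
  obtain U \<phi> where U: "\<And>s. s \<in> topspace K \<Longrightarrow> interior_chart d M (U s) (\<phi> s) \<and> F s \<in> U s"
    using int by metis
  define V where "V = (\<lambda>s. {x \<in> topspace K. F x \<in> U s})"
  have "openin K (V s)" if "s \<in> topspace K" for s
    unfolding V_def by (rule openin_continuous_map_preimage [OF F]) (use U [OF that] in \<open>simp add: interior_chart_def\<close>)
  moreover have "topspace K \<subseteq> \<Union> (V ` topspace K)"
    using U by (auto simp: V_def)
  ultimately obtain \<F> where F': "finite \<F>" "\<F> \<subseteq> V ` topspace K" "topspace K \<subseteq> \<Union> \<F>"
    using K [unfolded compact_space_alt, rule_format, of "V ` topspace K"] by auto
  then obtain C where C: "finite C" "C \<subseteq> topspace K" "\<F> = V ` C"
    using finite_subset_image [OF F'(1,2)] by auto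
  have "\<exists>Q \<Theta>. param_chart ?T K ?S d (?W (U s)) Q (chartdiff (\<phi> s) F) \<Theta>" if "s \<in> C" for s
    using param_chart_chartdiff [OF M F] U C that by blast
  then obtain Q \<Theta> where *: "\<And>s. s \<in> C \<Longrightarrow> param_chart ?T K ?S d (?W (U s)) (Q s) (chartdiff (\<phi> s) F) (\<Theta> s)"
    by metis
  obtain t where t: "thom ?T ?S d (?S \<union> (\<Union>s\<in>C. ?W (U s))) t"
    using thom_exists [where C = C and W = "\<lambda>s. ?W (U s)" and Q = Q and \<Psi> = "\<lambda>s. chartdiff (\<phi> s) F" and \<Theta> = \<Theta>,
        OF openin_offdiag [OF M F] d \<delta> C(1) *] by blast
  have "e \<in> ?S \<union> (\<Union>s\<in>C. ?W (U s))" if "e \<in> topspace ?T" for e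
    using that F'(3) unfolding C(3) by (cases e) (auto simp: offdiag_def V_def)
  then have "topspace ?T \<subseteq> ?S \<union> (\<Union>s\<in>C. ?W (U s))"
    by blast
  with t have t': "thom ?T ?S d (topspace ?T) t"
    by (rule thom_mono)
  show ?thesis
  proof
    have "additive_on d ?T (topspace ?T \<inter> UNIV) (topspace ?T \<inter> ?S) t"
      using t' by (simp add: thom_def)
    then show "additive_on d ?T UNIV ?S t"
      unfolding additive_on_def rz_topspace rb_topspace .
    fix U \<phi> c
    assume ch: "interior_chart d M U \<phi>" and c: "rz d ?T (?W U) (?W U \<inter> ?S) c"
    obtain Q \<Theta> where "param_chart ?T K ?S d (?W U) Q (chartdiff \<phi> F) \<Theta>"
      using param_chart_chartdiff [OF M F ch] by blast
    then interpret param_chart ?T K ?S d "?W U" Q "chartdiff \<phi> F" \<Theta> .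
    show "t c = \<delta> (push d forget (push d (chartdiff \<phi> F) c))"
      by (rule thom_unique [OF thom_mono [OF t'] thom_chart [OF \<delta>] openW order_refl c]) (rule openin_subset [OF openW])
  qed
qed

section \<open>Pushing a compact set into the interior of a manifold\<close>

text \<open>The sum of absolute values is chosen as distance so that all estimates below are
  linear.\<close>

definition gap :: "nat \<Rightarrow> (nat \<Rightarrow> real) \<Rightarrow> (nat \<Rightarrow> real) \<Rightarrow> real"
  where "gap d a x = (\<Sum>i<d. \<bar>x i - a i\<bar>)"

lemma continuous_map_gap: "continuous_map (powertop_real UNIV) euclideanreal (gap d a)"
  unfolding gap_def
  by (intro continuous_map_sum continuous_map_real_abs continuous_map_diff continuous_map_product_projection) auto

lemma gap_coord: "i < d \<Longrightarrow> \<bar>x i - a i\<bar> \<le> gap d a x"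
  unfolding gap_def by (rule member_le_sum) auto

lemma openin_Euclidean_space_gap:
  assumes W: "openin (Euclidean_space d) W" and a: "a \<in> W"
  obtains r where "0 < r" "\<And>x. x \<in> topspace (Euclidean_space d) \<Longrightarrow> gap d a x < r \<Longrightarrow> x \<in> W"
proof -
  obtain Q where Q: "openin (powertop_real UNIV) Q" "W = Q \<inter> {x. \<forall>i\<ge>d. x i = 0}"
    using W by (auto simp: Euclidean_space_def openin_subtopology)
  then obtain X where X: "a \<in> PiE UNIV X" "\<And>i. openin euclideanreal (X i)" "PiE UNIV X \<subseteq> Q"
    using product_topology_open_contains_basis [of "\<lambda>_. euclideanreal" UNIV Q a] a by auto
  have "\<exists>e>0. \<forall>t. \<bar>t - a i\<bar> < e \<longrightarrow> t \<in> X i" for i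
  proof -
    have "open (X i)" "a i \<in> X i"
      using X by (auto simp: PiE_def)
    then show ?thesis
      unfolding open_dist by (auto simp: dist_real_def)
  qed
  then obtain e where e: "\<And>i. e i > 0" "\<And>i t. \<bar>t - a i\<bar> < e i \<Longrightarrow> t \<in> X i"
    by metis
  define r where "r = Min (insert 1 (e ` {..<d}))"
  show ?thesis
  proof
    show "0 < r"
      using e(1) by (auto simp: r_def)
    fix x assume x: "x \<in> topspace (Euclidean_space d)" "gap d a x < r"
    have "x i \<in> X i" for i
    proof (cases "i < d")
      case True
      then have "r \<le> e i"
        unfolding r_def by (intro Min_le) auto
      then have "\<bar>x i - a i\<bar> < e i"
        using gap_coord [OF True, of x a] x(2) by linarith
      then show ?thesis
        by (rule e(2))
    next
      case False
      then have "x i = a i"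
        using x(1) a Q(2) by (simp add: topspace_Euclidean_space)
      then show ?thesis
        using e(1)[of i] by (intro e(2)) simp
    qed
    then have "x \<in> Q"
      using X(3) by auto
    then show "x \<in> W"
      using x(1) by (simp add: Q(2) topspace_Euclidean_space)
  qed
qed

text \<open>The displacement along the inward coordinate \<open>0\<close> is half the distance to
  the rim of the ball. The factor one half keeps the ball invariant and makes the displacement a
  contraction in that coordinate, hence the map injective.\<close>

definition nudge :: "nat \<Rightarrow> real \<Rightarrow> (nat \<Rightarrow> real) \<Rightarrow> (nat \<Rightarrow> real) \<Rightarrow> nat \<Rightarrow> real"
  where "nudge d r a x = x(0 := x 0 + max 0 (r - gap d a x) / 2)"

lemma gap_update:
  assumes "0 < d"
  shows "gap d a x = \<bar>x 0 - a 0\<bar> + (\<Sum>i\<in>{..<d} - {0}. \<bar>x i - a i\<bar>)"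
  unfolding gap_def using assms by (subst sum.remove [of _ 0]) auto

lemma gap_nudge:
  assumes "0 < d" "gap d a x < r"
  shows "gap d a (nudge d r a x) < r"
proof -
  define t where "t = (r - gap d a x) / 2"
  define \<sigma> where "\<sigma> = (\<Sum>i\<in>{..<d} - {0}. \<bar>x i - a i\<bar>)"
  have "gap d a (nudge d r a x) = \<bar>x 0 + t - a 0\<bar> + \<sigma>"
    using assms by (subst gap_update) (auto simp: nudge_def t_def \<sigma>_def intro!: sum.cong)
  moreover have "gap d a x = \<bar>x 0 - a 0\<bar> + \<sigma>"
    using gap_update [OF assms(1)] by (simp add: \<sigma>_def)
  moreover have "0 < t" "2 * t = r - gap d a x"
    using assms(2) by (simp_all add: t_def)
  ultimately show ?thesis
    by linarith
qed

lemma nudge_eq: "r \<le> gap d a x \<Longrightarrow> nudge d r a x = x"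
  by (simp add: nudge_def)

lemma inj_nudge:
  assumes d: "0 < d" and eq: "nudge d r a x = nudge d r a y"
  shows "x = y"
proof -
  have i: "x i = y i" if "i \<noteq> 0" for i
    using fun_cong [OF eq, of i] that by (simp add: nudge_def)
  then have "gap d a x - gap d a y = \<bar>x 0 - a 0\<bar> - \<bar>y 0 - a 0\<bar>"
    by (simp add: gap_update [OF d])
  then have "\<bar>gap d a x - gap d a y\<bar> \<le> \<bar>x 0 - y 0\<bar>"
    by linarith
  moreover have "2 * (x 0 - y 0) = max 0 (r - gap d a y) - max 0 (r - gap d a x)"
    using fun_cong [OF eq, of 0] by (simp add: nudge_def field_simps)
  moreover have "\<bar>max 0 (r - gap d a x) - max 0 (r - gap d a y)\<bar> \<le> \<bar>gap d a x - gap d a y\<bar>"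
    by linarith
  ultimately have "\<bar>2 * (x 0 - y 0)\<bar> \<le> \<bar>x 0 - y 0\<bar>"
    by (metis abs_minus_commute order_trans)
  then have "x 0 = y 0"
    by simp
  with i show ?thesis
    by (metis ext)
qed

lemma continuous_map_nudge: "continuous_map (powertop_real UNIV) (powertop_real UNIV) (nudge d r a)"
  unfolding continuous_map_componentwise_UNIV
proof
  fix i
  have "continuous_map (powertop_real UNIV) euclideanreal (\<lambda>x. x 0 + max 0 (r - gap d a x) * (1 / 2))"
    by (intro continuous_map_add continuous_map_real_mult continuous_map_real_max continuous_map_diff continuous_map_gap
        continuous_map_product_projection) auto
  then show "continuous_map (powertop_real UNIV) euclideanreal (\<lambda>x. nudge d r a x i)"
    by (cases "i = 0") (auto simp: nudge_def intro: continuous_map_product_projection)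
qed

lemma topspace_half_space: "topspace (half_space d) = {x. (\<forall>i\<ge>d. x i = 0) \<and> 0 \<le> x 0}"
  by (auto simp: half_space_def topspace_Euclidean_space)

lemma half_space_eq: "half_space d = subtopology (powertop_real UNIV) {x. (\<forall>i\<ge>d. x i = 0) \<and> 0 \<le> x 0}"
proof -
  have "{x. \<forall>i\<ge>d. x i = 0} \<inter> {x::nat\<Rightarrow>real. 0 \<le> x 0} = {x. (\<forall>i\<ge>d. x i = 0) \<and> 0 \<le> x 0}"
    by auto
  then show ?thesis
    unfolding half_space_def Euclidean_space_def subtopology_subtopology by simp
qed

lemma compactin_half_ball:
  "compactin (half_space d) {x \<in> topspace (half_space d). gap d a x \<le> r}" if "\<forall>i\<ge>d. a i = 0"
proof -
  let ?B = "{x \<in> topspace (half_space d). gap d a x \<le> r}"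
  let ?P = "PiE UNIV (\<lambda>i. {a i - \<bar>r\<bar>..a i + \<bar>r\<bar>})"
  have "compactin (powertop_real UNIV) ?P"
    by (simp add: compactin_PiE)
  moreover have "?B \<subseteq> ?P"
  proof
    fix x assume x: "x \<in> ?B"
    have "\<bar>x i - a i\<bar> \<le> \<bar>r\<bar>" for i :: nat
      using x gap_coord [of i d x a] that by (cases "i < d") (auto simp: topspace_half_space)
    then show "x \<in> ?P"
      by (auto simp: abs_le_iff algebra_simps)
  qed
  moreover have "closedin (powertop_real UNIV) ?B"
  proof -
    have C: "closedin (powertop_real UNIV) {x. x i \<in> C}" if "closed C" for i :: nat and C :: "real set"
    proof -
      have "closedin (powertop_real UNIV) {x \<in> topspace (powertop_real UNIV). x i \<in> C}"
        by (rule closedin_continuous_map_preimage [OF continuous_map_product_projection]) (use that in auto)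
      then show ?thesis by simp
    qed
    have 1: "closedin (powertop_real UNIV) {x. x i = (0::real)}" for i :: nat
      using C [of "{0}" i] by simp
    have 2: "closedin (powertop_real UNIV) {x. 0 \<le> x (0::nat)}"
      using C [of "{0::real..}" 0] by simp
    have "closedin (powertop_real UNIV) {x \<in> topspace (powertop_real UNIV). gap d a x \<in> {..r}}"
      by (rule closedin_continuous_map_preimage [OF continuous_map_gap]) auto
    then have 3: "closedin (powertop_real UNIV) {x. gap d a x \<le> r}"
      by simp
    have "?B = (\<Inter>i\<in>{d..}. {x. x i = 0}) \<inter> {x. 0 \<le> x 0} \<inter> {x. gap d a x \<le> r}"
      by (auto simp: topspace_half_space)
    also have "closedin (powertop_real UNIV) \<dots>"
      by (intro closedin_Int closedin_Inter 2 3) (use 1 in auto)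
    finally show ?thesis .
  qed
  ultimately have "compactin (powertop_real UNIV) ?B"
    by (rule closed_compactin)
  then show ?thesis
    unfolding half_space_eq by (auto simp: compactin_subtopology)
qed

definition interior_pt :: "'a chart set \<Rightarrow> 'a \<Rightarrow> bool"
  where "interior_pt \<A> y \<longleftrightarrow> (\<exists>(U, \<phi>)\<in>\<A>. y \<in> U \<and> 0 < \<phi> y 0)"

text \<open>Cutting the chart down to positive coordinate \<open>0\<close> makes its image open in
  Euclidean space and not only in the half space.\<close>

lemma interior_pt_chart:
  assumes ch: "manifold_chart d M (U, \<phi>)" and y: "y \<in> U" "0 < \<phi> y 0"
  shows "\<exists>U \<phi>. interior_chart d M U \<phi> \<and> y \<in> U"
proof -
  define V where "V = {y \<in> U. 0 < \<phi> y 0}"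
  have U: "openin M U" "openin (half_space d) (\<phi> ` U)"
    "homeomorphic_map (subtopology M U) (subtopology (half_space d) (\<phi> ` U)) \<phi>"
    using ch by (auto simp: manifold_chart_def)
  have im: "\<phi> ` V = \<phi> ` U \<inter> {x. 0 < x 0}"
    by (auto simp: V_def)
  have pos: "openin (powertop_real UNIV) {x. 0 < x (0::nat)}"
  proof -
    have "openin (powertop_real UNIV) {x \<in> topspace (powertop_real UNIV). x (0::nat) \<in> {0<..}}"
      by (rule openin_continuous_map_preimage [OF continuous_map_product_projection]) auto
    then show ?thesis by simp
  qed
  obtain O' where O': "openin (powertop_real UNIV) O'" "\<phi> ` U = O' \<inter> {x. (\<forall>i\<ge>d. x i = 0) \<and> 0 \<le> x 0}"
    using U(2) by (auto simp: half_space_eq openin_subtopology)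
  have "\<phi> ` V = (O' \<inter> {x. 0 < x 0}) \<inter> {x. \<forall>i\<ge>d. x i = 0}"
    unfolding im O'(2) by auto
  then have o: "openin (Euclidean_space d) (\<phi> ` V)"
    unfolding Euclidean_space_def openin_subtopology using openin_Int [OF O'(1) pos] by blast
  have "\<phi> ` V \<subseteq> {x. 0 \<le> x 0}"
    by (auto simp: V_def)
  then have sub: "subtopology (Euclidean_space d) (\<phi> ` V) = subtopology (half_space d) (\<phi> ` V)"
    by (simp add: half_space_def subtopology_subtopology Int_absorb1)
  have hom: "homeomorphic_map (subtopology (subtopology M U) V) (subtopology (subtopology (half_space d) (\<phi> ` U)) (\<phi> ` V)) \<phi>"
    by (rule homeomorphic_map_subtopologies_alt [OF U(3)]) (use U(1,2) openin_subset in \<open>fastforce simp: V_def\<close>)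
  then have hom: "homeomorphic_map (subtopology M V) (subtopology (Euclidean_space d) (\<phi> ` V)) \<phi>"
  proof -
    have "U \<inter> V = V" "\<phi> ` U \<inter> \<phi> ` V = \<phi> ` V"
      by (auto simp: V_def)
    with hom show ?thesis
      by (simp add: subtopology_subtopology sub)
  qed
  have "openin (subtopology M U) {y \<in> topspace (subtopology M U). \<phi> y \<in> \<phi> ` U \<inter> {x. 0 < x 0}}"
  proof (rule openin_continuous_map_preimage)
    show "continuous_map (subtopology M U) (subtopology (half_space d) (\<phi> ` U)) \<phi>"
      by (rule homeomorphic_imp_continuous_map [OF U(3)])
    have "openin (half_space d) (\<phi> ` V)"
      unfolding half_space_def openin_subtopology using o \<open>\<phi> ` V \<subseteq> {x. 0 \<le> x 0}\<close> by blast
    then have "openin (subtopology (half_space d) (\<phi> ` U)) (\<phi> ` U \<inter> \<phi> ` V)"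
      by (rule openin_subtopology_Int2)
    moreover have "\<phi> ` U \<inter> \<phi> ` V = \<phi> ` U \<inter> {x. 0 < x 0}"
      unfolding im by auto
    ultimately show "openin (subtopology (half_space d) (\<phi> ` U)) (\<phi> ` U \<inter> {x. 0 < x 0})"
      by simp
  qed
  moreover have "{y \<in> topspace (subtopology M U). \<phi> y \<in> \<phi> ` U \<inter> {x. 0 < x 0}} = V"
    using openin_subset [OF U(1)] by (auto simp: V_def)
  ultimately have "openin M V"
    using openin_trans_full [OF _ U(1)] by simp
  with o hom have "interior_chart d M V \<phi>"
    by (simp add: interior_chart_def)
  then show ?thesis
    using y by (auto simp: V_def)
qed

text \<open>The nudge in a chart is extended by the identity. Continuity of the extension uses that
  the closed half ball is compact: its image \<open>C\<close> is closed in the Hausdorff space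
  \<open>M\<close>, so \<open>U\<close> and the complement of \<open>C\<close> are open sets to
  paste along.\<close>

lemma push_near_point:
  assumes M: "Hausdorff_space M" and ch: "manifold_chart d M (U, \<phi>)" "(U, \<phi>) \<in> \<A>" and d: "0 < d" and y0: "y0 \<in> U"
  obtains h Y where "continuous_map M M h" "inj_on h (topspace M)" "openin M Y" "y0 \<in> Y"
    "\<And>y. y \<in> Y \<Longrightarrow> interior_pt \<A> (h y)" "\<And>y. y \<notin> Y \<Longrightarrow> h y = y"
proof -
  have U: "openin M U" "openin (half_space d) (\<phi> ` U)"
    "homeomorphic_map (subtopology M U) (subtopology (half_space d) (\<phi> ` U)) \<phi>"
    using ch by (auto simp: manifold_chart_def)
  define H where "H = topspace (half_space d)"
  have UM: "U \<subseteq> topspace M"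
    by (rule openin_subset [OF U(1)])
  have \<phi>H: "\<phi> ` U \<subseteq> H"
    unfolding H_def by (rule openin_subset [OF U(2)])
  obtain g where g: "homeomorphic_maps (subtopology M U) (subtopology (half_space d) (\<phi> ` U)) \<phi> g"
    using U(3) by (auto simp: homeomorphic_map_maps)
  have c\<phi>: "continuous_map (subtopology M U) (subtopology (half_space d) (\<phi> ` U)) \<phi>"
    and cg: "continuous_map (subtopology (half_space d) (\<phi> ` U)) (subtopology M U) g"
    and g\<phi>: "\<And>y. y \<in> U \<Longrightarrow> g (\<phi> y) = y" and gU: "\<And>x. x \<in> \<phi> ` U \<Longrightarrow> g x \<in> U" "\<And>x. x \<in> \<phi> ` U \<Longrightarrow> \<phi> (g x) = x"
    using g UM \<phi>H unfolding H_def by (auto simp: homeomorphic_maps_def continuous_map_in_subtopology Int_absorb1)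
  define a where "a = \<phi> y0"
  have aU: "a \<in> \<phi> ` U"
    using y0 by (simp add: a_def)
  obtain W where W: "openin (Euclidean_space d) W" "\<phi> ` U = W \<inter> {x. 0 \<le> x 0}"
    using U(2) by (auto simp: half_space_def openin_subtopology)
  obtain r0 where r0: "0 < r0" "\<And>x. x \<in> topspace (Euclidean_space d) \<Longrightarrow> gap d a x < r0 \<Longrightarrow> x \<in> W"
    using openin_Euclidean_space_gap [OF W(1), of a] aU W(2) by blast
  \<comment> \<open>Halving the radius places the closed ball inside the chart image as
    well.\<close>
  define r where "r = r0 / 2"
  have r: "0 < r" "\<And>x. x \<in> H \<Longrightarrow> gap d a x \<le> r \<Longrightarrow> x \<in> \<phi> ` U"
    using r0 by (auto simp: r_def W(2) H_def half_space_def)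
  let ?n = "nudge d r a"
  have nH: "?n x \<in> H" if "x \<in> H" for x
    using that d by (auto simp: H_def topspace_half_space nudge_def)
  have nU: "?n x \<in> \<phi> ` U" if "x \<in> \<phi> ` U" for x
  proof (cases "gap d a x < r")
    case True
    then show ?thesis
      using r(2) [OF nH [of x]] gap_nudge [OF d True] that \<phi>H by auto
  next
    case False
    then show ?thesis
      using that nudge_eq [of r d a x] by simp
  qed
  define h where "h = (\<lambda>y. if y \<in> U then g (?n (\<phi> y)) else y)"
  define Y where "Y = {y \<in> U. gap d a (\<phi> y) < r}"
  define B where "B = {x \<in> H. gap d a x \<le> r}"
  define C where "C = g ` B"
  have B: "B \<subseteq> \<phi> ` U"
    using r(2) by (auto simp: B_def)
  have "a i = 0" if "i \<ge> d" for i
    using aU \<phi>H that by (auto simp: H_def topspace_half_space)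
  then have "compactin (half_space d) B"
    unfolding B_def H_def by (intro compactin_half_ball) auto
  then have "compactin (subtopology (half_space d) (\<phi> ` U)) B"
    using B by (simp add: compactin_subtopology)
  from image_compactin [OF this cg] have "compactin M C"
    by (simp add: C_def compactin_subtopology)
  then have closedC: "closedin M C"
    using M by (simp add: compactin_imp_closedin)
  have hid: "h y = y" if "y \<notin> Y" for y
    using that g\<phi> nudge_eq [of r d a "\<phi> y"] by (auto simp: h_def Y_def)
  have YC: "Y \<subseteq> C"
  proof
    fix y assume "y \<in> Y"
    then have "\<phi> y \<in> B" "g (\<phi> y) = y"
      using \<phi>H g\<phi> by (auto simp: Y_def B_def)
    then show "y \<in> C"
      by (metis C_def imageI)
  qed
  have contU: "continuous_map (subtopology M U) M h"
  proof -
    have "continuous_map (half_space d) (powertop_real UNIV) ?n"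
      unfolding half_space_eq by (intro continuous_map_from_subtopology continuous_map_nudge)
    then have "continuous_map (subtopology (half_space d) (\<phi> ` U)) (half_space d) ?n"
      using nH unfolding H_def half_space_eq [of d]
      by (auto simp: continuous_map_in_subtopology intro: continuous_map_from_subtopology)
    then have "continuous_map (subtopology (half_space d) (\<phi> ` U)) (subtopology (half_space d) (\<phi> ` U)) ?n"
      using nU by (auto simp: continuous_map_in_subtopology)
    from continuous_map_compose [OF continuous_map_compose [OF c\<phi> this] cg]
    have "continuous_map (subtopology M U) M (g \<circ> (?n \<circ> \<phi>))"
      by (simp add: continuous_map_in_subtopology)
    then show ?thesis
      by (rule continuous_map_eq) (auto simp: h_def)
  qed
  have cont: "continuous_map M M h"
  proof (rule pasting_lemma [where I = "{True, False}" and T = "\<lambda>b. if b then U else topspace M - C" and f = "\<lambda>b. if b then h else id"])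
    show "openin M (if i then U else topspace M - C)" if "i \<in> {True, False}" for i
      using U(1) closedC by auto
    show "continuous_map (subtopology M (if i then U else topspace M - C)) M (if i then h else id)" if "i \<in> {True, False}" for i
      using contU by (auto simp: continuous_map_from_subtopology)
    show "(if i then h else id) x = (if j then h else id) x"
      if "i \<in> {True, False}" "j \<in> {True, False}" "x \<in> topspace M \<inter> (if i then U else topspace M - C) \<inter> (if j then U else topspace M - C)" for i j x
    proof -
      have "h x = x" if "x \<notin> C"
        using hid YC that by blast
      with that show ?thesis
        by (auto split: if_splits)
    qed
    show "\<exists>j. j \<in> {True, False} \<and> x \<in> (if j then U else topspace M - C) \<and> h x = (if j then h else id) x" if "x \<in> topspace M" for x
    proof (cases "x \<in> U")
      case False
      moreover have "C \<subseteq> U"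
        using gU(1) B by (auto simp: C_def)
      ultimately show ?thesis
        using that hid [of x] YC by (intro exI [of _ False]) auto
    qed auto
  qed
  have inj: "inj_on h (topspace M)"
  proof (rule inj_onI)
    fix x y assume xy: "h x = h y"
    have hU: "h z \<in> U \<longleftrightarrow> z \<in> U" for z
      using gU(1) [OF nU [of "\<phi> z"]] by (auto simp: h_def)
    show "x = y"
    proof (cases "x \<in> U")
      case True
      then have y: "y \<in> U"
        using hU xy by metis
      have "g (?n (\<phi> x)) = g (?n (\<phi> y))"
        using xy True y by (simp add: h_def)
      then have "?n (\<phi> x) = ?n (\<phi> y)"
        using gU(2) nU True y by (metis imageI)
      then have "\<phi> x = \<phi> y"
        by (rule inj_nudge [OF d])
      then show ?thesis
        using g\<phi> True y by metis
    next
      case False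
      then have "y \<notin> U"
        using hU xy by metis
      with False xy show ?thesis
        by (simp add: h_def)
    qed
  qed
  show ?thesis
  proof
    show "continuous_map M M h" "inj_on h (topspace M)"
      by (fact cont inj)+
    have "continuous_map (subtopology M U) (half_space d) \<phi>"
      using c\<phi> by (simp add: continuous_map_in_subtopology)
    moreover have "continuous_map (half_space d) euclideanreal (gap d a)"
      unfolding half_space_eq by (intro continuous_map_from_subtopology continuous_map_gap)
    ultimately have "continuous_map (subtopology M U) euclideanreal (gap d a \<circ> \<phi>)"
      by (rule continuous_map_compose)
    from openin_continuous_map_preimage [OF this, of "{..<r}"]
    have "openin (subtopology M U) {y \<in> topspace (subtopology M U). gap d a (\<phi> y) < r}"
      by simp
    moreover have "{y \<in> topspace (subtopology M U). gap d a (\<phi> y) < r} = Y"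
      using UM by (auto simp: Y_def)
    ultimately show "openin M Y"
      using openin_trans_full [OF _ U(1)] by simp
    show "y0 \<in> Y"
      using y0 r(1) by (simp add: Y_def a_def gap_def)
    show "interior_pt \<A> (h y)" if "y \<in> Y" for y
    proof -
      have y: "y \<in> U" "gap d a (\<phi> y) < r"
        using that by (auto simp: Y_def)
      then have "h y \<in> U" "\<phi> (h y) = ?n (\<phi> y)"
        using gU nU [of "\<phi> y"] by (auto simp: h_def)
      moreover have "0 \<le> \<phi> y 0"
        using y(1) \<phi>H by (auto simp: H_def topspace_half_space)
      ultimately show ?thesis
        using y(2) ch(2) unfolding interior_pt_def nudge_def by (intro bexI [of _ "(U, \<phi>)"]) (auto intro!: add_nonneg_pos)
    qed
    show "h y = y" if "y \<notin> Y" for y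
      by (rule hid [OF that])
  qed
qed

text \<open>Composition works because every moved point lands in the interior: a point once interior
  is either fixed by the next map or moved to an interior point again.\<close>

lemma push_finite:
  assumes "finite C" and h: "\<And>c. c \<in> C \<Longrightarrow> continuous_map M M (h c) \<and> inj_on (h c) (topspace M) \<and>
    (\<forall>y\<in>Y c. interior_pt \<A> (h c y)) \<and> (\<forall>y. y \<notin> Y c \<longrightarrow> h c y = y)"
  shows "\<exists>g. continuous_map M M g \<and> inj_on g (topspace M) \<and> (\<forall>y\<in>\<Union>(Y ` C). interior_pt \<A> (g y)) \<and>
    (\<forall>y. g y \<noteq> y \<longrightarrow> interior_pt \<A> (g y))"
  using assms
proof (induction C rule: finite_induct)
  case empty
  show ?case
    by (rule exI [of _ id]) auto
next
  case (insert c C)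
  then have "\<exists>g. continuous_map M M g \<and> inj_on g (topspace M) \<and> (\<forall>y\<in>\<Union>(Y ` C). interior_pt \<A> (g y)) \<and>
    (\<forall>y. g y \<noteq> y \<longrightarrow> interior_pt \<A> (g y))"
    by simp
  then obtain g where g: "continuous_map M M g" "inj_on g (topspace M)" "\<And>y. y \<in> \<Union>(Y ` C) \<Longrightarrow> interior_pt \<A> (g y)"
    "\<And>y. g y \<noteq> y \<Longrightarrow> interior_pt \<A> (g y)"
    by blast
  have c: "continuous_map M M (h c)" "inj_on (h c) (topspace M)" "\<And>y. y \<in> Y c \<Longrightarrow> interior_pt \<A> (h c y)"
    "\<And>y. y \<notin> Y c \<Longrightarrow> h c y = y"
    using insert.prems [of c] by auto
  have pres: "interior_pt \<A> (h c y)" if "interior_pt \<A> y" for y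
    using c(3,4) that by metis
  show ?case
  proof (intro exI conjI ballI allI impI)
    show "continuous_map M M (h c \<circ> g)"
      by (rule continuous_map_compose [OF g(1) c(1)])
    have "g ` topspace M \<subseteq> topspace M"
      using g(1) by (rule continuous_map_image_subset_topspace)
    then show "inj_on (h c \<circ> g) (topspace M)"
      by (intro comp_inj_on g(2) inj_on_subset [OF c(2)])
    show "interior_pt \<A> ((h c \<circ> g) y)" if "y \<in> \<Union> (Y ` insert c C)" for y
      using that g(3,4) [of y] c(3) [of y] pres by (cases "g y = y") auto
    show "interior_pt \<A> ((h c \<circ> g) y)" if "(h c \<circ> g) y \<noteq> y" for y
      using that g(4) [of y] c(3,4) [of y] pres by (cases "g y = y") auto
  qed
qed

theorem push_into_interior:
  assumes M: "Hausdorff_space M" "pl_atlas d M \<A>" and d: "0 < d" and K: "compactin M K"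
  obtains g where "continuous_map M M g" "inj_on g (topspace M)" "\<And>y. y \<in> K \<Longrightarrow> \<exists>U \<phi>. interior_chart d M U \<phi> \<and> g y \<in> U"
proof -
  have at: "\<And>c. c \<in> \<A> \<Longrightarrow> manifold_chart d M c" "\<Union> (fst ` \<A>) = topspace M"
    using M(2) by (auto simp: pl_atlas_def case_prod_beta)
  have "\<exists>p. continuous_map M M (fst p) \<and> inj_on (fst p) (topspace M) \<and> openin M (snd p) \<and> z \<in> snd p \<and>
     (\<forall>y\<in>snd p. interior_pt \<A> (fst p y)) \<and> (\<forall>y. y \<notin> snd p \<longrightarrow> fst p y = y)" if "z \<in> K" for z
  proof -
    have "z \<in> \<Union> (fst ` \<A>)"
      unfolding at(2) using compactin_subset_topspace [OF K] that by (rule subsetD)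
    then obtain U \<phi> where c: "(U, \<phi>) \<in> \<A>" "z \<in> U"
      by auto
    obtain h Y where "continuous_map M M h" "inj_on h (topspace M)" "openin M Y" "z \<in> Y"
      "\<And>y. y \<in> Y \<Longrightarrow> interior_pt \<A> (h y)" "\<And>y. y \<notin> Y \<Longrightarrow> h y = y"
      by (rule push_near_point [OF M(1) at(1) [OF c(1)] c(1) d c(2)]) blast
    then show ?thesis
      by (intro exI [of _ "(h, Y)"]) simp
  qed
  then obtain p where p: "\<And>z. z \<in> K \<Longrightarrow> continuous_map M M (fst (p z)) \<and> inj_on (fst (p z)) (topspace M) \<and> openin M (snd (p z)) \<and> z \<in> snd (p z) \<and>
     (\<forall>y\<in>snd (p z). interior_pt \<A> (fst (p z) y)) \<and> (\<forall>y. y \<notin> snd (p z) \<longrightarrow> fst (p z) y = y)"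
    by metis
  define Y where "Y = (\<lambda>z. snd (p z))"
  have oY: "\<forall>U \<in> Y ` K. openin M U" and KY: "K \<subseteq> \<Union> (Y ` K)"
    using p by (auto simp: Y_def)
  from K oY KY have "\<exists>\<F>. finite \<F> \<and> \<F> \<subseteq> Y ` K \<and> K \<subseteq> \<Union> \<F>"
    unfolding compactin_def by (elim conjE allE [of _ "Y ` K"]) simp
  then obtain \<F> where F: "finite \<F>" "\<F> \<subseteq> Y ` K" "K \<subseteq> \<Union> \<F>"
    by blast
  then obtain C where C: "finite C" "C \<subseteq> K" "\<F> = Y ` C"
    using finite_subset_image [OF F(1,2)] by auto
  have "\<exists>g. continuous_map M M g \<and> inj_on g (topspace M) \<and> (\<forall>y\<in>\<Union>(Y ` C). interior_pt \<A> (g y)) \<and>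
    (\<forall>y. g y \<noteq> y \<longrightarrow> interior_pt \<A> (g y))"
    by (rule push_finite [where h = "\<lambda>z. fst (p z)", OF C(1)]) (use p C(2) in \<open>auto simp: Y_def\<close>)
  then obtain g where g: "continuous_map M M g" "inj_on g (topspace M)" "\<And>y. y \<in> \<Union>(Y ` C) \<Longrightarrow> interior_pt \<A> (g y)"
    by blast
  show ?thesis
  proof
    show "continuous_map M M g" "inj_on g (topspace M)"
      by (fact g)+
    fix y assume "y \<in> K"
    then have "interior_pt \<A> (g y)"
      using F(3) C(3) g(3) by blast
    then obtain U \<phi> where "(U, \<phi>) \<in> \<A>" "g y \<in> U" "0 < \<phi> (g y) 0"
      by (auto simp: interior_pt_def)
    then show "\<exists>U \<phi>. interior_chart d M U \<phi> \<and> g y \<in> U"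
      by (intro interior_pt_chart at(1))
  qed
qed

section \<open>Formal joins of vertices and their realization by chains in a product\<close>

section \<open>Products of simplices spanned by coordinate vectors\<close>

text \<open>\<open>Cell a b\<close> stands for the product of the simplices spanned by the vertices in \<open>a\<close> and in \<open>b\<close>;
  addition joins factorwise, so that formal sums of cells form a ring.\<close>

datatype cell = Cell "nat list" "nat list"

instantiation cell :: monoid_add
begin

definition zero_cell :: cell
  where "0 = Cell [] []"

fun plus_cell :: "cell \<Rightarrow> cell \<Rightarrow> cell"
  where "Cell a b + Cell c e = Cell (a @ c) (b @ e)"

instance
proof
  fix x y z :: cell
  show "x + y + z = x + (y + z)"
    by (cases x; cases y; cases z) simp
  show "0 + x = x" "x + 0 = x"
    by (cases x; simp add: zero_cell_def)+
qed

end

type_synonym cells = "cell sum2"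

lemma sum2_mult: "P * Q = ext2 (\<lambda>a. ext2 (\<lambda>b. unit2 (a + b)) Q) P" for P Q :: cells
proof -
  have "P * Q = (\<Sum>a\<in>keys P. unit2 a) * (\<Sum>b\<in>keys Q. unit2 b)"
    by (simp flip: sum2_eq_sum_units)
  also have "\<dots> = ext2 (\<lambda>a. ext2 (\<lambda>b. unit2 (a + b)) Q) P"
    by (simp add: sum_product mult_single ext2_def)
  finally show ?thesis .
qed

lemma keys_mult: "c \<in> keys (P * Q) \<Longrightarrow> \<exists>a\<in>keys P. \<exists>b\<in>keys Q. c = a + b" for P Q :: cells
proof -
  assume "c \<in> keys (P * Q)"
  then obtain a where "a \<in> keys P" "c \<in> keys (ext2 (\<lambda>b. unit2 (a + b)) Q)"
    using keys_ext2 [of "\<lambda>a. ext2 (\<lambda>b. unit2 (a + b)) Q" P] by (auto simp: sum2_mult)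
  moreover have "c \<in> (\<Union>b\<in>keys Q. keys (unit2 (a + b)))"
    using keys_ext2 calculation(2) by (rule subsetD)
  ultimately show ?thesis
    by auto
qed

lemma sum2_eqI:
  assumes "\<And>a. F (unit2 a) = (G (unit2 a) :: 'b::char_two)" "\<And>x y. F (x + y) = F x + F y" "\<And>x y. G (x + y) = G x + G y"
  shows "F P = G P"
proof -
  have 0: "F 0 = 0" "G 0 = 0"
    using assms(2,3) [of 0 0] by (simp_all add: eq_add_char_two)
  have "keys P \<subseteq> UNIV" by simp
  then show ?thesis
    by (induction rule: sum2_induct) (simp_all add: assms 0)
qed

abbreviation cX :: "nat \<Rightarrow> cells" where "cX v \<equiv> unit2 (Cell [v] [])"
abbreviation cY :: "nat \<Rightarrow> cells" where "cY v \<equiv> unit2 (Cell [] [v])"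

text \<open>The augmented boundary: deleting the only vertex of a factor leaves the empty simplex,
  whence \<open>dJ (cX v) = 1\<close>. With this convention \<open>dJ\<close> is a derivation for
  joins.\<close>

fun dcell :: "cell \<Rightarrow> cells"
  where "dcell (Cell a b) = ext2 (\<lambda>L. unit2 (Cell L b)) (ldel a) + ext2 (\<lambda>L. unit2 (Cell a L)) (ldel b)"

definition dJ :: "cells \<Rightarrow> cells"
  where "dJ = ext2 dcell"

lemma dJ_add [simp]: "dJ (P + Q) = dJ P + dJ Q" and dJ_0 [simp]: "dJ 0 = 0" and dJ_unit: "dJ (unit2 c) = dcell c"
  by (simp_all add: dJ_def)

lemma ldel_append: "ldel (a @ c) = ext2 (\<lambda>L. unit2 (L @ c)) (ldel a) + ext2 (\<lambda>L. unit2 (a @ L)) (ldel c)"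
proof (induction a)
  case (Cons x a)
  have "lcons x (ext2 (\<lambda>L. unit2 (L @ c)) P) = ext2 (\<lambda>L. unit2 (L @ c)) (lcons x P)"
    "lcons x (ext2 (\<lambda>L. unit2 (a @ L)) P) = ext2 (\<lambda>L. unit2 ((x # a) @ L)) P" for P
    by (simp_all add: ext2_lcons lcons_ext2)
  then show ?case
    using Cons by (simp add: ac_simps)
qed simp

lemma dJ_mult: "dJ (P * Q) = dJ P * Q + P * dJ Q"
proof -
  have 1: "dJ (unit2 a * unit2 b) = dJ (unit2 a) * unit2 b + unit2 a * dJ (unit2 b)" for a b
  proof (cases a; cases b)
    fix a1 a2 b1 b2 assume ab: "a = Cell a1 a2" "b = Cell b1 b2"
    have m: "ext2 f P * unit2 c = ext2 (\<lambda>x. f x * unit2 c) P" "unit2 c * ext2 f P = ext2 (\<lambda>x. unit2 c * f x) P"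
      for f :: "nat list \<Rightarrow> cells" and P c
      by (rule additive_ext2, simp add: algebra_simps)+
    show ?thesis
      by (simp add: ab dJ_unit mult_single ldel_append ext2_ext2 m algebra_simps)
  qed
  have 2: "dJ (unit2 a * Q) = dJ (unit2 a) * Q + unit2 a * dJ Q" for a
    by (rule sum2_eqI [where P = Q]) (simp_all add: 1 algebra_simps)
  show ?thesis
    by (rule sum2_eqI [where P = P]) (simp_all add: 2 algebra_simps)
qed

lemma dJ_cX [simp]: "dJ (cX v) = 1" and dJ_cY [simp]: "dJ (cY v) = 1" and dJ_1 [simp]: "dJ 1 = 0"
proof -
  have "unit2 (Cell [] []) = (1 :: cells)"
    unfolding zero_cell_def [symmetric] by simp
  then show "dJ (cX v) = 1" "dJ (cY v) = 1"
    by (simp_all add: dJ_unit)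
  have "dJ (unit2 (Cell [] [])) = 0"
    by (simp add: dJ_unit)
  then show "dJ 1 = 0"
    by (simp add: \<open>unit2 (Cell [] []) = 1\<close>)
qed

fun swc :: "cell \<Rightarrow> cell"
  where "swc (Cell a b) = Cell b a"

definition swJ :: "cells \<Rightarrow> cells"
  where "swJ = ext2 (\<lambda>c. unit2 (swc c))"

lemma swJ_add [simp]: "swJ (P + Q) = swJ P + swJ Q" and swJ_unit [simp]: "swJ (unit2 c) = unit2 (swc c)" and swJ_0 [simp]: "swJ 0 = 0"
  by (simp_all add: swJ_def)

lemma swJ_mult: "swJ (P * Q) = swJ P * swJ Q"
proof -
  have "swc (a + b) = swc a + swc b" for a b
    by (cases a; cases b) simp
  then have 1: "swJ (unit2 a * unit2 b) = swJ (unit2 a) * swJ (unit2 b)" for a b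
    by (simp add: mult_single)
  have 2: "swJ (unit2 a * Q) = swJ (unit2 a) * swJ Q" for a
    by (rule sum2_eqI [where P = Q]) (simp_all add: 1 algebra_simps del: swJ_unit)
  show ?thesis
    by (rule sum2_eqI [where P = P]) (simp_all add: 2 algebra_simps del: swJ_unit)
qed

lemma swJ_1 [simp]: "swJ 1 = 1"
proof -
  have "unit2 (Cell [] []) = (1 :: cells)"
    unfolding zero_cell_def [symmetric] by simp
  then show ?thesis
    using swJ_unit [of "Cell [] []"] by simp
qed

subsection \<open>Hexagons\<close>

text \<open>The deleted join of three points is a hexagon with a free involution.  \<open>hx\<close> is the sum of its edges,
  \<open>hx1\<close> half of the hexagon, and \<open>hx0\<close> one end of this half; \<open>bseq\<close> is the resulting sequence of
  hemispheres of a sphere that is a join of hexagons.\<close>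

fun hx0 :: "nat \<times> nat \<times> nat \<Rightarrow> cells"
  where "hx0 (a, b, c) = cX a"

fun hx1 :: "nat \<times> nat \<times> nat \<Rightarrow> cells"
  where "hx1 (a, b, c) = cX a * cY b + cX c * cY b + cX c * cY a"

fun hx :: "nat \<times> nat \<times> nat \<Rightarrow> cells"
  where "hx (a, b, c) = cX a * cY b + cX b * cY a + cX a * cY c + cX c * cY a + cX b * cY c + cX c * cY b"

lemma hx_eq: "hx T = hx1 T + swJ (hx1 T)"
  by (cases T) (simp add: swJ_mult mult_single ac_simps)

lemma swJ_hx [simp]: "swJ (hx T) = hx T"
  by (cases T) (simp add: swJ_mult mult_single ac_simps)

lemma dJ_hx0: "dJ (hx0 T) = 1"
  by (cases T) simp

lemma dJ_hx1: "dJ (hx1 T) = hx0 T + swJ (hx0 T)"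
  by (cases T) (simp add: dJ_mult ac_simps)

lemma dJ_hx [simp]: "dJ (hx T) = 0"
  by (cases T) (simp add: dJ_mult ac_simps)

text \<open>The six edges come from only two products of pairs, because the term
  \<open>cX a * cY a\<close> occurs twice and cancels. This is why a triple costs no more than a
  factor \<open>2\<close> in the rank.\<close>

lemma hx_expand: "hx (a, b, c) = (cX a + cX b) * (cY a + cY c) + (cX a + cX c) * (cY a + cY b)"
  by (simp add: algebra_simps)

definition hprod :: "(nat \<times> nat \<times> nat) list \<Rightarrow> cells"
  where "hprod ts = prod_list (map hx ts)"

lemma hprod_Nil [simp]: "hprod [] = 1" and hprod_Cons [simp]: "hprod (T # ts) = hx T * hprod ts"
  and hprod_snoc: "hprod (ts @ [T]) = hprod ts * hx T"
  by (simp_all add: hprod_def)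

lemma dJ_hprod [simp]: "dJ (hprod ts) = 0"
  by (induction ts) (simp_all add: dJ_mult)

lemma swJ_hprod [simp]: "swJ (hprod ts) = hprod ts"
  by (induction ts) (simp_all add: swJ_mult)

definition bseq :: "(nat \<times> nat \<times> nat) list \<Rightarrow> nat \<Rightarrow> cells"
  where "bseq ts i = hprod (take (i div 2) ts) * (if even i then hx0 (ts ! (i div 2)) else hx1 (ts ! (i div 2)))"

lemma bseq_Suc:
  assumes "Suc i < 2 * length ts"
  shows "dJ (bseq ts (Suc i)) = bseq ts i + swJ (bseq ts i)"
proof (cases "even i")
  case True
  then show ?thesis
    by (simp add: bseq_def dJ_mult dJ_hx1 swJ_mult algebra_simps)
next
  case False
  then obtain l where l: "i = 2 * l + 1"
    by (auto elim: oddE)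
  then have 1: "take (Suc l) ts = take l ts @ [ts ! l]"
    using assms by (simp add: take_Suc_conv_app_nth)
  have "dJ (bseq ts (Suc i)) = hprod (take l ts) * hx (ts ! l)"
    using l 1 by (simp add: bseq_def dJ_mult dJ_hx0 hprod_snoc)
  also have "\<dots> = bseq ts i + swJ (bseq ts i)"
    using l by (simp add: bseq_def hx_eq swJ_mult algebra_simps)
  finally show ?thesis .
qed

lemma bseq_last:
  assumes "ts \<noteq> []"
  shows "bseq ts (2 * length ts - 1) + swJ (bseq ts (2 * length ts - 1)) = hprod ts"
proof -
  obtain us T where ts: "ts = us @ [T]"
    using assms by (metis rev_exhaust)
  have "(2 * length ts - 1) div 2 = length us" "odd (2 * length ts - 1)"
    using ts by auto
  then show ?thesis
    unfolding bseq_def by (simp add: ts hprod_snoc swJ_mult hx_eq [of T] algebra_simps)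
qed

section \<open>Realization of cells by singular chains\<close>

definition ev :: "nat \<Rightarrow> nat \<Rightarrow> real"
  where "ev v = (\<lambda>j. if j = v then 1 else 0)"

abbreviation RR :: "(nat \<Rightarrow> real) topology"
  where "RR \<equiv> powertop_real UNIV"

definition simplex_on :: "nat set \<Rightarrow> (nat \<Rightarrow> real) set"
  where "simplex_on A = {x. (\<forall>i. 0 \<le> x i) \<and> (\<forall>i. i \<notin> A \<longrightarrow> x i = 0) \<and> sum x A = 1}"

definition sch :: "nat list \<Rightarrow> (nat \<Rightarrow> real) chain2"
  where "sch L = (if L = [] then 0 else unit2 (oriented_simplex (length L - 1) (\<lambda>m. ev (L ! m))))"

lemma sch_Nil [simp]: "sch [] = 0"
  by (simp add: sch_def)

lemma oriented_simplex_in_simplex_on: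
  assumes "x \<in> standard_simplex (length L - 1)" "L \<noteq> []"
  shows "(\<lambda>i. \<Sum>j\<le>length L - 1. ev (L ! j) i * x j) \<in> simplex_on (set L)"
proof -
  have x: "\<And>j. 0 \<le> x j" "(\<Sum>j\<le>length L - 1. x j) = 1"
    using assms by (auto simp: standard_simplex_def)
  have mem: "L ! j \<in> set L" if "j \<le> length L - 1" for j
    using that assms(2) by (intro nth_mem) (cases L, auto)
  have "(\<Sum>i\<in>set L. \<Sum>j\<le>length L - 1. ev (L ! j) i * x j) = (\<Sum>j\<le>length L - 1. \<Sum>i\<in>set L. ev (L ! j) i * x j)"
    by (rule sum.swap)
  also have "\<dots> = (\<Sum>j\<le>length L - 1. x j)"
  proof (rule sum.cong [OF refl])
    fix j assume "j \<in> {..length L - 1}"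
    then have "(\<Sum>i\<in>set L. ev (L ! j) i * x j) = (\<Sum>i\<in>set L. if i = L ! j then x j else 0)"
      by (intro sum.cong) (auto simp: ev_def)
    also have "\<dots> = x j"
      using mem \<open>j \<in> {..length L - 1}\<close> by simp
    finally show "(\<Sum>i\<in>set L. ev (L ! j) i * x j) = x j" .
  qed
  finally have "(\<Sum>i\<in>set L. \<Sum>j\<le>length L - 1. ev (L ! j) i * x j) = 1"
    using x(2) by simp
  moreover have "(\<Sum>j\<le>length L - 1. ev (L ! j) i * x j) = 0" if "i \<notin> set L" for i
    using that mem by (intro sum.neutral) (auto simp: ev_def)
  moreover have "0 \<le> (\<Sum>j\<le>length L - 1. ev (L ! j) i * x j)" for i
    using x(1) by (intro sum_nonneg) (auto simp: ev_def)
  ultimately show ?thesis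
    by (simp add: simplex_on_def)
qed

lemma chn_sch: "chn (length L - 1) RR (simplex_on (set L)) (sch L)"
proof (cases "L = []")
  case False
  have "simplicial_simplex (length L - 1) (simplex_on (set L)) (oriented_simplex (length L - 1) (\<lambda>m. ev (L ! m)))"
    unfolding simplicial_simplex_oriented_simplex
    using oriented_simplex_in_simplex_on [of _ L] False by auto
  then have "singular_simplex (length L - 1) (subtopology RR (simplex_on (set L))) (oriented_simplex (length L - 1) (\<lambda>m. ev (L ! m)))"
    by (rule simplicial_imp_singular_simplex)
  then show ?thesis
    using False by (simp add: sch_def chn_unit singular_simplex_subtopology)
qed simp

lemma bd_sch: "bd (length L - 1) (sch L) = ext2 sch (ldel L)"
proof (cases "length L \<le> 1")
  case True
  then show ?thesis
    by (cases L) auto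
next
  case False
  define n where "n = length L - 1"
  have n: "length L = Suc n" "0 < n"
    using False by (auto simp: n_def)
  have "bd n (sch L) = (\<Sum>k\<le>n. unit2 (singular_face n k (oriented_simplex n (\<lambda>m. ev (L ! m)))))"
    using n by (auto simp: bd_def sch_def)
  also have "\<dots> = (\<Sum>k\<le>n. sch (del k L))"
  proof (rule sum.cong [OF refl])
    fix k assume k: "k \<in> {..n}"
    have "length (del k L) = n"
      using k n by (simp add: length_del)
    moreover have "singular_face n k (oriented_simplex n (\<lambda>m. ev (L ! m))) = oriented_simplex (n - 1) (\<lambda>m. ev (del k L ! m))"
    proof -
      have "singular_face n k (oriented_simplex n (\<lambda>m. ev (L ! m))) = oriented_simplex (n - 1) (\<lambda>j. if j < k then ev (L ! j) else ev (L ! Suc j))"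
        using k n by (intro singular_face_oriented_simplex) auto
      also have "\<dots> = oriented_simplex (n - 1) (\<lambda>m. ev (del k L ! m))"
        unfolding oriented_simplex_eq using k n by (auto simp: nth_del)
      finally show ?thesis .
    qed
    ultimately show "unit2 (singular_face n k (oriented_simplex n (\<lambda>m. ev (L ! m)))) = sch (del k L)"
      using n by (auto simp: sch_def)
  qed
  also have "\<dots> = ext2 sch (ldel L)"
    using n by (simp add: ldel_eq_sum ext2_sum lessThan_Suc_atMost)
  finally show ?thesis
    by (simp add: n_def)
qed

text \<open>A cell with an empty factor is realized by \<open>0\<close> because
  \<open>sch [] = 0\<close>; this turns the augmented boundary of joins into the boundary of
  products.\<close>

fun realize1 :: "cell \<Rightarrow> ((nat \<Rightarrow> real) \<times> (nat \<Rightarrow> real)) chain2"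
  where "realize1 (Cell a b) = cr (length a - 1) (length b - 1) (sch a) (sch b)"

definition realize :: "cells \<Rightarrow> ((nat \<Rightarrow> real) \<times> (nat \<Rightarrow> real)) chain2"
  where "realize = ext2 realize1"

lemma realize_add [simp]: "realize (P + Q) = realize P + realize Q" and realize_0 [simp]: "realize 0 = 0"
  and realize_unit [simp]: "realize (unit2 c) = realize1 c"
  by (simp_all add: realize_def)

fun clen :: "cell \<Rightarrow> nat"
  where "clen (Cell a b) = length a + length b"

fun carrier2 :: "cell \<Rightarrow> ((nat \<Rightarrow> real) \<times> (nat \<Rightarrow> real)) set"
  where "carrier2 (Cell a b) = (if a = [] \<or> b = [] then {} else simplex_on (set a) \<times> simplex_on (set b))"

lemma chn_realize1:
  assumes "clen c = n + 2"
  shows "chn n (prod_topology RR RR) (carrier2 c) (realize1 c)"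
proof (cases c)
  case (Cell a b)
  show ?thesis
  proof (cases "a = [] \<or> b = []")
    case False
    then have "(length a - 1) + (length b - 1) = n"
      using assms Cell by (cases a; cases b) auto
    then show ?thesis
      using chn_cr [OF chn_sch chn_sch, of a b] False Cell by simp
  qed (auto simp: Cell)
qed

lemma chn_realize:
  assumes "\<And>c. c \<in> keys P \<Longrightarrow> clen c = n + 2" "\<And>c. c \<in> keys P \<Longrightarrow> carrier2 c \<subseteq> A"
  shows "chn n (prod_topology RR RR) A (realize P)"
  unfolding realize_def using assms chn_mono [OF chn_realize1] by (intro chn_ext2) blast

text \<open>Two simplices with \<open>n + 2\<close> vertices altogether have a product of dimension
  \<open>n\<close>.\<close>

lemma bd_realize:
  assumes "\<And>c. c \<in> keys P \<Longrightarrow> clen c = n + 2"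
  shows "bd n (realize P) = realize (dJ P)"
proof -
  have "bd n (realize1 c) = realize (dJ (unit2 c))" if c: "clen c = n + 2" for c
  proof (cases c)
    case (Cell a b)
    have r: "realize (ext2 g P) = ext2 (\<lambda>L. realize (g L)) P" for g :: "nat list \<Rightarrow> cells" and P
      by (rule additive_ext2) simp
    show ?thesis
    proof (cases "a = [] \<or> b = []")
      case True
      then show ?thesis
        by (auto simp: Cell dJ_unit r)
    next
      case False
      then have n: "(length a - 1) + (length b - 1) = n"
        using c Cell by (cases a; cases b) auto
      have "bd n (realize1 c) = cr (length a - 1 - 1) (length b - 1) (ext2 sch (ldel a)) (sch b)
          + cr (length a - 1) (length b - 1 - 1) (sch a) (ext2 sch (ldel b))"
        using bd_cr [of "length a - 1" "length b - 1" "sch a" "sch b"] by (simp add: Cell n bd_sch del: One_nat_def)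
      also have "cr (length a - 1 - 1) (length b - 1) (ext2 sch (ldel a)) (sch b) = ext2 (\<lambda>L. realize1 (Cell L b)) (ldel a)"
        unfolding cr_ext2_left
      proof (rule ext2_cong)
        fix L assume "L \<in> keys (ldel a)"
        then have "length a = Suc (length L)"
          using keys_ldel by fastforce
        then show "cr (length a - 1 - 1) (length b - 1) (sch L) (sch b) = realize1 (Cell L b)"
          by simp
      qed
      also have "cr (length a - 1) (length b - 1 - 1) (sch a) (ext2 sch (ldel b)) = ext2 (\<lambda>L. realize1 (Cell a L)) (ldel b)"
        unfolding cr_ext2_right
      proof (rule ext2_cong)
        fix L assume "L \<in> keys (ldel b)"
        then have "length b = Suc (length L)"
          using keys_ldel by fastforce
        then show "cr (length a - 1) (length b - 1 - 1) (sch a) (sch L) = realize1 (Cell a L)"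
          by simp
      qed
      finally show ?thesis
        by (simp add: Cell dJ_unit r)
    qed
  qed
  then have "ext2 (\<lambda>c. bd n (realize1 c)) P = ext2 (\<lambda>c. realize (dJ (unit2 c))) P"
    using assms by (intro ext2_cong) blast
  moreover have "bd n (realize P) = ext2 (\<lambda>c. bd n (realize1 c)) P"
    unfolding realize_def by (rule additive_ext2) simp
  moreover have "realize (dJ P) = ext2 (\<lambda>c. realize (dJ (unit2 c))) P"
    unfolding dJ_def by (simp add: realize_def ext2_ext2)
  ultimately show ?thesis
    by simp
qed

lemma push_swap_realize:
  assumes "\<And>c. c \<in> keys P \<Longrightarrow> clen c = n + 2"
  shows "push n prod.swap (realize P) = realize (swJ P)"
proof -
  have "push n prod.swap (realize1 c) = realize1 (swc c)" if c: "clen c = n + 2" for c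
  proof (cases c)
    case (Cell a b)
    show ?thesis
    proof (cases "a = [] \<or> b = []")
      case False
      then have n: "(length a - 1) + (length b - 1) = n"
        using c Cell by (cases a; cases b) auto
      then show ?thesis
        using push_swap_cr [of "length a - 1" "length b - 1" "sch a" "sch b"] by (simp add: Cell)
    qed (auto simp: Cell)
  qed
  then have "ext2 (\<lambda>c. push n prod.swap (realize1 c)) P = ext2 (\<lambda>c. realize1 (swc c)) P"
    using assms by (intro ext2_cong) blast
  moreover have "push n prod.swap (realize P) = ext2 (\<lambda>c. push n prod.swap (realize1 c)) P"
    unfolding realize_def by (rule additive_ext2) simp
  ultimately show ?thesis
    by (simp add: realize_def swJ_def ext2_ext2)
qed

lemma simplex_on_disjoint: "A \<inter> B = {} \<Longrightarrow> simplex_on A \<inter> simplex_on B = {}"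
proof (rule ccontr)
  assume AB: "A \<inter> B = {}" and "simplex_on A \<inter> simplex_on B \<noteq> {}"
  then obtain x where x: "x \<in> simplex_on A" "x \<in> simplex_on B"
    by blast
  then have "x i = 0" for i
    using AB by (cases "i \<in> A") (auto simp: simplex_on_def)
  then show False
    using x(1) by (simp add: simplex_on_def)
qed

section \<open>Evaluation of the intersection functional on cells of the skeleton\<close>

section \<open>The intersection functional on products of disjoint simplices\<close>

definition slide :: "nat \<Rightarrow> real \<Rightarrow> (nat \<Rightarrow> real) \<Rightarrow> nat \<Rightarrow> real"
  where "slide x s p = (\<lambda>i. (1 - s) * p i + s * ev x i)"

lemma slide_0 [simp]: "slide x 0 p = p"
  by (simp add: slide_def)

lemma slide_inject: "s < 1 \<Longrightarrow> slide x s p = slide x s q \<longleftrightarrow> p = q"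
  by (auto simp: slide_def fun_eq_iff)

lemma continuous_map_slide:
  assumes "continuous_map X euclideanreal \<sigma>" "continuous_map X RR g"
  shows "continuous_map X RR (\<lambda>z. slide x (\<sigma> z) (g z))"
  unfolding continuous_map_componentwise_UNIV slide_def
proof
  fix i
  have "continuous_map X euclideanreal (\<lambda>z. g z i)"
    using assms(2) by (simp add: continuous_map_componentwise_UNIV)
  then show "continuous_map X euclideanreal (\<lambda>z. (1 - \<sigma> z) * g z i + \<sigma> z * ev x i)"
    using assms(1) by (auto intro!: continuous_intros)
qed

locale simplicial_embedding =
  fixes M :: "'a topology" and S :: "(nat \<Rightarrow> real) set" and F :: "(nat \<Rightarrow> real) \<Rightarrow> 'a"
    and d :: nat and t :: "('a \<times> (nat \<Rightarrow> real)) chain2 \<Rightarrow> bit" and \<delta> :: "((nat \<Rightarrow> real) \<times> unit) chain2 \<Rightarrow> bit"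
  assumes F: "continuous_map (subtopology RR S) M F" and inj: "inj_on F S"
    and bounded: "\<And>p i. p \<in> S \<Longrightarrow> 0 \<le> p i \<and> p i \<le> 1"
    and int: "\<And>p. p \<in> S \<Longrightarrow> \<exists>U \<phi>. interior_chart d M U \<phi> \<and> F p \<in> U"
    and \<delta>: "local_degree d point d \<delta>"
    and t_add: "additive_on d (prod_topology M (subtopology RR S)) UNIV (offdiag M (subtopology RR S) F) t"
    and t_chart: "\<And>U \<phi> c. interior_chart d M U \<phi> \<Longrightarrow>
       rz d (prod_topology M (subtopology RR S)) (U \<times> {s \<in> topspace (subtopology RR S). F s \<in> U})
         ((U \<times> {s \<in> topspace (subtopology RR S). F s \<in> U}) \<inter> offdiag M (subtopology RR S) F) c \<Longrightarrow>
       t c = \<delta> (push d forget (push d (chartdiff \<phi> F) c))"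
begin

abbreviation "K \<equiv> subtopology RR S"
abbreviation "TT \<equiv> prod_topology RR RR"

definition star :: "nat \<Rightarrow> (nat \<Rightarrow> real) set"
  where "star x = {p \<in> S. \<forall>s. 0 \<le> s \<and> s \<le> 1 \<longrightarrow> slide x s p \<in> S}"

lemma star_subset: "star x \<subseteq> S"
  by (auto simp: star_def)

text \<open>An open set restricts finitely many coordinates only, and coordinates on
  \<open>S\<close> lie in the unit interval; hence one \<open>s\<close> serves the whole star. That
  \<open>s < 1\<close> keeps the slide injective.\<close>

lemma shrink_into:
  assumes "openin K W" "ev x \<in> W"
  obtains s where "0 \<le> s" "s < 1" "\<And>p. p \<in> star x \<Longrightarrow> slide x s p \<in> W"
proof -
  obtain Q where Q: "openin RR Q" "W = S \<inter> Q"
    using assms(1) by (auto simp: openin_subtopology)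
  then obtain Y where Y: "finite {i. Y i \<noteq> UNIV}" "\<And>i. open (Y i)" "ev x \<in> Pi\<^sub>E UNIV Y" "Pi\<^sub>E UNIV Y \<subseteq> Q"
    using assms(2) by (fastforce simp: openin_product_topology_alt)
  define I where "I = {i. Y i \<noteq> UNIV}"
  have "\<exists>e>0. \<forall>y. dist y (ev x i) < e \<longrightarrow> y \<in> Y i" for i
    using Y(2) [of i] Y(3) by (auto simp: open_dist)
  then obtain e where e: "\<And>i. 0 < e i" "\<And>i y. dist y (ev x i) < e i \<Longrightarrow> y \<in> Y i"
    by metis
  \<comment> \<open>The inserted \<open>1\<close> makes the minimum meaningful if no coordinate is
    restricted, and ensures that \<open>1 - E / 2\<close> is nonnegative.\<close>
  define E where "E = Min (insert 1 (e ` I))"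
  have fin: "finite (insert 1 (e ` I))"
    using Y(1) by (simp add: I_def)
  have E: "0 < E" "E \<le> 1" and Ee: "i \<in> I \<Longrightarrow> E \<le> e i" for i
    using fin e(1) by (auto simp: E_def)
  show ?thesis
  proof
    show "0 \<le> 1 - E / 2" "1 - E / 2 < 1"
      using E by auto
    fix p assume p: "p \<in> star x"
    have "slide x (1 - E / 2) p i \<in> Y i" for i
    proof (cases "i \<in> I")
      case True
      have eq: "slide x (1 - E / 2) p i - ev x i = (E / 2) * (p i - ev x i)"
        by (simp add: slide_def algebra_simps)
      have "\<bar>p i - ev x i\<bar> \<le> 1"
        using bounded [of p i] p subsetD [OF star_subset p] by (auto simp: ev_def)
      then have "dist (slide x (1 - E / 2) p i) (ev x i) \<le> E / 2"
        unfolding dist_real_def eq abs_mult using E mult_left_le [of "\<bar>p i - ev x i\<bar>" "E / 2"] by simp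
      then show ?thesis
        using E Ee [OF True] by (intro e(2)) auto
    qed (auto simp: I_def)
    then have "slide x (1 - E / 2) p \<in> Q"
      using Y(4) by auto
    moreover have "slide x (1 - E / 2) p \<in> S"
      using p E by (simp add: star_def)
    ultimately show "slide x (1 - E / 2) p \<in> W"
      by (simp add: Q)
  qed
qed

text \<open>Sliding both points towards \<open>x\<close> simultaneously keeps distinct points
  distinct, so \<open>t\<close> does not change until both lie in one chart around
  \<open>F (ev x)\<close>. There it is the degree of a difference map.\<close>

lemma star_chart:
  assumes x: "ev x \<in> S"
  obtains g where "continuous_map (subtopology RR (star x)) (Euclidean_space d) g" "inj_on g (star x)"
    "\<And>c. rz d TT (star x \<times> star x) ((star x \<times> star x) \<inter> {e. fst e \<noteq> snd e}) c \<Longrightarrow>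
      t (push d (map_prod F id) c) = \<delta> (push d (\<lambda>(p, q). (\<lambda>i. g p i - g q i, ())) c)"
proof -
  obtain U \<phi> where ch: "interior_chart d M U \<phi>" and xU: "F (ev x) \<in> U"
    using int [OF x] by blast
  have oU: "openin M U"
    and hom: "homeomorphic_map (subtopology M U) (subtopology (Euclidean_space d) (\<phi> ` U)) \<phi>"
    using ch by (auto simp: interior_chart_def)
  define W where "W = {p \<in> topspace K. F p \<in> U}"
  have "openin K W"
    unfolding W_def by (rule openin_continuous_map_preimage [OF F oU])
  moreover have "ev x \<in> W"
    using x xU by (simp add: W_def)
  ultimately obtain s where s: "0 \<le> s" "s < 1" "\<And>p. p \<in> star x \<Longrightarrow> slide x s p \<in> W"
    by (rule shrink_into) blast
  let ?A = "star x \<times> star x"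
  let ?B = "?A \<inter> {e. fst e \<noteq> snd e}"
  define h where "h = (\<lambda>(u, e). (F (slide x (u * s) (fst e)), slide x (u * s) (snd e)))"
  have hS: "slide x (u * s) p \<in> S" if "0 \<le> u" "u \<le> 1" "p \<in> star x" for u p
    using that s mult_le_one [of u s] by (auto simp: star_def)
  define r where "r = slide x s"
  define g where "g = \<phi> \<circ> F \<circ> r"
  have us: "u * s < 1" if "0 \<le> u" "u \<le> 1" for u
    using that s mult_left_le_one_le [of s u] by simp
  have ch1: "continuous_map (prod_topology (top_of_set {0..1::real}) (subtopology TT ?A)) (prod_topology M K) h"
  proof -
    let ?P = "prod_topology (top_of_set {0..1::real}) (subtopology TT ?A)"
    have c1: "continuous_map ?P euclideanreal (\<lambda>z. fst z * s)"
      by (intro continuous_map_real_mult continuous_map_into_fulltopology [OF continuous_map_fst]) simp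
    have c2: "continuous_map ?P RR (\<lambda>z. fst (snd z))" "continuous_map ?P RR (\<lambda>z. snd (snd z))"
      using continuous_map_compose [OF continuous_map_snd continuous_map_from_subtopology [OF continuous_map_fst], of "top_of_set {0..1::real}" RR RR ?A]
        continuous_map_compose [OF continuous_map_snd continuous_map_from_subtopology [OF continuous_map_snd], of "top_of_set {0..1::real}" RR RR ?A]
      by (simp_all add: o_def)
    have c3: "continuous_map ?P K (\<lambda>z. slide x (fst z * s) (fst (snd z)))" "continuous_map ?P K (\<lambda>z. slide x (fst z * s) (snd (snd z)))"
      using continuous_map_slide [OF c1 c2(1), of x] continuous_map_slide [OF c1 c2(2), of x] hS
      by (auto simp: continuous_map_in_subtopology)
    show ?thesis
      using continuous_map_compose [OF c3(1) F] c3(2)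
      by (simp add: h_def continuous_map_pairwise o_def case_prod_beta)
  qed
  have hB: "h (u, e) \<in> offdiag M K F" if "0 \<le> u" "u \<le> 1" "e \<in> ?B" for u e
  proof -
    obtain p q where e: "e = (p, q)" by (cases e)
    have pq: "p \<in> star x" "q \<in> star x" "p \<noteq> q"
      using that e by auto
    then have S: "slide x (u * s) p \<in> S" "slide x (u * s) q \<in> S"
      using hS that by auto
    moreover have "slide x (u * s) p \<noteq> slide x (u * s) q"
      using slide_inject [OF us] that pq by simp
    ultimately have "F (slide x (u * s) p) \<noteq> F (slide x (u * s) q)"
      using inj by (auto dest: inj_onD)
    moreover have "F (slide x (u * s) p) \<in> topspace M"
      using continuous_map_image_subset_topspace [OF F] S(1) by auto
    ultimately show ?thesis
      using S by (simp add: offdiag_def h_def e)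
  qed
  have ch1': "continuous_map (subtopology TT ?A) (prod_topology M K) (\<lambda>e. h (u, e))" if "0 \<le> u" "u \<le> 1" for u
  proof -
    have "continuous_map (subtopology TT ?A) (prod_topology (top_of_set {0..1::real}) (subtopology TT ?A)) (\<lambda>e. (u, e))"
      using that by (simp add: continuous_map_pairwise o_def)
    then show ?thesis
      using continuous_map_compose [OF _ ch1] by (fastforce simp: o_def)
  qed
  show ?thesis
  proof
    have r: "continuous_map (subtopology RR (star x)) (subtopology K W) r"
      unfolding r_def continuous_map_in_subtopology
      using continuous_map_slide [of "subtopology RR (star x)" "\<lambda>_. s" "\<lambda>p. p" x] s(3) star_subset
      by (auto simp: W_def continuous_map_from_subtopology)
    have "continuous_map (subtopology K W) (subtopology M U) F"
      by (auto simp: continuous_map_in_subtopology W_def intro: continuous_map_from_subtopology F)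
    from continuous_map_compose [OF continuous_map_compose [OF r this] homeomorphic_imp_continuous_map [OF hom]]
    show "continuous_map (subtopology RR (star x)) (Euclidean_space d) g"
      by (simp add: g_def o_assoc continuous_map_in_subtopology)
    show "inj_on g (star x)"
    proof (rule inj_onI)
      fix p q assume pq: "p \<in> star x" "q \<in> star x" "g p = g q"
      have W: "r p \<in> W" "r q \<in> W"
        using s(3) pq by (auto simp: r_def)
      have "inj_on \<phi> U"
        using homeomorphic_imp_injective_map [OF hom] openin_subset [OF oU] by (simp add: inf.absorb2)
      then have "F (r p) = F (r q)"
        using pq(3) W by (auto simp: g_def W_def dest: inj_onD)
      then have "r p = r q"
        using inj W by (auto simp: W_def dest: inj_onD)
      then show "p = q"
        using slide_inject [OF s(2)] by (simp add: r_def)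
    qed
    fix c assume c: "rz d TT ?A ?B c"
    have eq0: "push d (\<lambda>e. h (0, e)) c = push d (map_prod F id) c"
      by (rule arg_cong [where f = "\<lambda>f. push d f c"]) (auto simp: h_def)
    have rz0: "rz d (prod_topology M K) UNIV (offdiag M K F) (push d (\<lambda>e. h (0, e)) c)"
      using hB [of 0] by (intro rz_push [OF c ch1' [of 0]] Pi_I Int_lower1) simp_all
    have rb01: "rb d (prod_topology M K) UNIV (offdiag M K F) (push d (\<lambda>e. h (0, e)) c + push d (\<lambda>e. h (1, e)) c)"
      by (rule homotopy_rb [OF ch1 UNIV_I hB c Int_lower1])
    have 1: "t (push d (\<lambda>e. h (1, e)) c) = t (push d (map_prod F id) c)"
      unfolding eq0 [symmetric] by (rule additive_on_cong [OF t_add rz0 rb01 subset_UNIV])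
    let ?W = "U \<times> {s \<in> topspace K. F s \<in> U}"
    have hW: "h (1, e) \<in> ?W" if "e \<in> ?A" for e
      using that s(3) by (cases e) (simp add: h_def W_def)
    have "rz d (prod_topology M K) ?W (?W \<inter> offdiag M K F) (push d (\<lambda>e. h (1, e)) c)"
    proof (rule rz_push [OF c ch1'])
      show "(\<lambda>e. h (1, e)) \<in> topspace TT \<inter> ?A \<rightarrow> ?W"
        using hW by (intro Pi_I) simp
      show "(\<lambda>e. h (1, e)) \<in> topspace TT \<inter> ?B \<rightarrow> ?W \<inter> offdiag M K F"
        using hW hB [of 1] by (intro Pi_I IntI) simp_all
    qed simp_all
    then have "t (push d (\<lambda>e. h (1, e)) c) = \<delta> (push d (forget \<circ> chartdiff \<phi> F \<circ> (\<lambda>e. h (1, e))) c)"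
      using t_chart [OF ch] by (simp add: push_compose o_assoc)
    also have "forget \<circ> chartdiff \<phi> F \<circ> (\<lambda>e. h (1, e)) = (\<lambda>(p, q). (\<lambda>i. g p i - g q i, ()))"
      by (auto simp: fun_eq_iff forget_def chartdiff_def h_def g_def r_def)
    finally show "t (push d (map_prod F id) c) = \<delta> (push d (\<lambda>(p, q). (\<lambda>i. g p i - g q i, ())) c)"
      by (simp add: 1)
  qed
qed

end

section \<open>Vertex bookkeeping for formal sums of cells\<close>

text \<open>\<open>n\<close> is the total number of vertices and fixes the dimension
  \<open>n - 2\<close> of the products; \<open>p\<close> bounds the vertices of each factor and
  keeps the factors in a skeleton.\<close>

definition fits :: "nat set \<Rightarrow> nat \<Rightarrow> nat \<Rightarrow> cells \<Rightarrow> bool"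
  where "fits V p n P \<longleftrightarrow> (\<forall>a b. Cell a b \<in> keys P \<longrightarrow>
    length a + length b = n \<and> length a \<le> p \<and> length b \<le> p \<and> set a \<subseteq> V \<and> set b \<subseteq> V)"

definition off_diagonal :: "cells \<Rightarrow> bool"
  where "off_diagonal P \<longleftrightarrow> (\<forall>a b. Cell a b \<in> keys P \<longrightarrow> set a \<inter> set b = {})"

lemma keys_add_cases: "c \<in> keys (P + Q) \<Longrightarrow> c \<in> keys P \<or> c \<in> keys Q" for P Q :: "'a sum2"
  by (auto simp: keys_add_bit)

lemma fits_0 [simp]: "fits V p n 0" and off_diagonal_0 [simp]: "off_diagonal 0"
  by (simp_all add: fits_def off_diagonal_def)

lemma fits_1 [simp]: "fits V p 0 1" and off_diagonal_1 [simp]: "off_diagonal 1"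
  by (auto simp: fits_def off_diagonal_def zero_cell_def simp flip: single_one)

lemma fits_add: "fits V p n P \<Longrightarrow> fits V p n Q \<Longrightarrow> fits V p n (P + Q)"
  unfolding fits_def using keys_add_cases by metis

lemma off_diagonal_add: "off_diagonal P \<Longrightarrow> off_diagonal Q \<Longrightarrow> off_diagonal (P + Q)"
  unfolding off_diagonal_def using keys_add_cases by metis

lemma fits_mono: "fits V p n P \<Longrightarrow> V \<subseteq> W \<Longrightarrow> p \<le> q \<Longrightarrow> fits W q n P"
  unfolding fits_def by (meson order_trans)

lemma keys_mult_Cell:
  fixes P Q :: cells
  assumes "Cell a b \<in> keys (P * Q)"
  obtains a1 b1 a2 b2 where "Cell a1 b1 \<in> keys P" "Cell a2 b2 \<in> keys Q" "a = a1 @ a2" "b = b1 @ b2"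
proof -
  obtain c e where ce: "c \<in> keys P" "e \<in> keys Q" "Cell a b = c + e"
    using keys_mult [OF assms] by blast
  then show ?thesis
    using that by (cases c; cases e) auto
qed

lemma fits_mult:
  assumes "fits V p n P" "fits W q m Q"
  shows "fits (V \<union> W) (p + q) (n + m) (P * Q)"
  unfolding fits_def
proof (intro allI impI)
  fix a b assume "Cell a b \<in> keys (P * Q)"
  then obtain a1 b1 a2 b2 where "Cell a1 b1 \<in> keys P" "Cell a2 b2 \<in> keys Q" and ab: "a = a1 @ a2" "b = b1 @ b2"
    by (rule keys_mult_Cell)
  then have "length a1 + length b1 = n \<and> length a1 \<le> p \<and> length b1 \<le> p \<and> set a1 \<subseteq> V \<and> set b1 \<subseteq> V"
    "length a2 + length b2 = m \<and> length a2 \<le> q \<and> length b2 \<le> q \<and> set a2 \<subseteq> W \<and> set b2 \<subseteq> W"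
    using assms by (simp_all add: fits_def)
  then show "length a + length b = n + m \<and> length a \<le> p + q \<and> length b \<le> p + q \<and> set a \<subseteq> V \<union> W \<and> set b \<subseteq> V \<union> W"
    unfolding ab by auto
qed

lemma off_diagonal_mult:
  assumes "off_diagonal P" "off_diagonal Q" "fits V p n P" "fits W q m Q" "V \<inter> W = {}"
  shows "off_diagonal (P * Q)"
  unfolding off_diagonal_def
proof (intro allI impI)
  fix a b assume "Cell a b \<in> keys (P * Q)"
  then obtain a1 b1 a2 b2 where c: "Cell a1 b1 \<in> keys P" "Cell a2 b2 \<in> keys Q" and ab: "a = a1 @ a2" "b = b1 @ b2"
    by (rule keys_mult_Cell)
  then have "set a1 \<subseteq> V \<and> set b1 \<subseteq> V" "set a2 \<subseteq> W \<and> set b2 \<subseteq> W" "set a1 \<inter> set b1 = {}" "set a2 \<inter> set b2 = {}"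
    using assms by (simp_all add: fits_def off_diagonal_def)
  then show "set a \<inter> set b = {}"
    unfolding ab using assms(5) by auto
qed

lemma fits_cX [simp]: "fits V p n (cX v) \<longleftrightarrow> n = 1 \<and> 1 \<le> p \<and> v \<in> V"
  and fits_cY [simp]: "fits V p n (cY v) \<longleftrightarrow> n = 1 \<and> 1 \<le> p \<and> v \<in> V"
  and off_diagonal_cX [simp]: "off_diagonal (cX v)" and off_diagonal_cY [simp]: "off_diagonal (cY v)"
  by (auto simp: fits_def off_diagonal_def)

lemma fits_cXY: "v \<in> V \<Longrightarrow> w \<in> V \<Longrightarrow> fits V 1 2 (cX v * cY w)"
  and off_diagonal_cXY: "v \<noteq> w \<Longrightarrow> off_diagonal (cX v * cY w)"
  by (auto simp: fits_def off_diagonal_def mult_single)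

lemma keys_dJ:
  assumes "Cell a b \<in> keys (dJ P)"
  obtains a' b' where "Cell a' b' \<in> keys P" "length a + length b + 1 = length a' + length b'"
    "length a \<le> length a'" "length b \<le> length b'" "set a \<subseteq> set a'" "set b \<subseteq> set b'"
proof -
  have "Cell a b \<in> (\<Union>c\<in>keys P. keys (dcell c))"
    using assms keys_ext2 [of dcell P] unfolding dJ_def by (rule subsetD [rotated])
  then obtain a' b' where c: "Cell a' b' \<in> keys P" "Cell a b \<in> keys (dcell (Cell a' b'))"
    by (metis UN_E cell.exhaust)
  then consider "Cell a b \<in> keys (ext2 (\<lambda>L. unit2 (Cell L b')) (ldel a'))" | "Cell a b \<in> keys (ext2 (\<lambda>L. unit2 (Cell a' L)) (ldel b'))"
    using keys_add_cases by fastforce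
  then show ?thesis
  proof cases
    case 1
    then have "a \<in> keys (ldel a')" "b = b'"
      using subsetD [OF keys_ext2 1] by auto
    then show ?thesis
      using that [OF c(1)] keys_ldel [of a a'] by auto
  next
    case 2
    then have "b \<in> keys (ldel b')" "a = a'"
      using subsetD [OF keys_ext2 2] by auto
    then show ?thesis
      using that [OF c(1)] keys_ldel [of b b'] by auto
  qed
qed

lemma fits_dJ:
  assumes "fits V p (n + 1) P"
  shows "fits V p n (dJ P)"
  unfolding fits_def
proof (intro allI impI)
  fix a b assume "Cell a b \<in> keys (dJ P)"
  then obtain a' b' where ab: "Cell a' b' \<in> keys P" "length a + length b + 1 = length a' + length b'"
    "length a \<le> length a'" "length b \<le> length b'" "set a \<subseteq> set a'" "set b \<subseteq> set b'"
    by (rule keys_dJ)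
  then have "length a' + length b' = n + 1 \<and> length a' \<le> p \<and> length b' \<le> p \<and> set a' \<subseteq> V \<and> set b' \<subseteq> V"
    using assms by (simp add: fits_def)
  then show "length a + length b = n \<and> length a \<le> p \<and> length b \<le> p \<and> set a \<subseteq> V \<and> set b \<subseteq> V"
    using ab(2-) by auto
qed

lemma off_diagonal_dJ:
  assumes "off_diagonal P"
  shows "off_diagonal (dJ P)"
  unfolding off_diagonal_def
proof (intro allI impI)
  fix a b assume "Cell a b \<in> keys (dJ P)"
  then obtain a' b' where ab: "Cell a' b' \<in> keys P" "length a + length b + 1 = length a' + length b'"
    "length a \<le> length a'" "length b \<le> length b'" "set a \<subseteq> set a'" "set b \<subseteq> set b'"
    by (rule keys_dJ)
  then have "set a' \<inter> set b' = {}"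
    using assms by (simp add: off_diagonal_def)
  then show "set a \<inter> set b = {}"
    using ab(5,6) by auto
qed

fun triple_verts :: "nat \<times> nat \<times> nat \<Rightarrow> nat set"
  where "triple_verts (a, b, c) = {a, b, c}"

fun distinct3 :: "nat \<times> nat \<times> nat \<Rightarrow> bool"
  where "distinct3 (a, b, c) \<longleftrightarrow> a \<noteq> b \<and> a \<noteq> c \<and> b \<noteq> c"

fun triples_verts :: "(nat \<times> nat \<times> nat) list \<Rightarrow> nat set"
  where "triples_verts [] = {}" | "triples_verts (T # ts) = triple_verts T \<union> triples_verts ts"

fun disjoint_triples :: "(nat \<times> nat \<times> nat) list \<Rightarrow> bool"
  where "disjoint_triples [] = True" | "disjoint_triples (T # ts) \<longleftrightarrow> distinct3 T \<and> triple_verts T \<inter> triples_verts ts = {} \<and> disjoint_triples ts"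

lemma fits_hx0: "fits (triple_verts T) 1 1 (hx0 T)" and off_diagonal_hx0: "off_diagonal (hx0 T)"
  by (cases T; simp)+

lemma fits_hx: "fits (triple_verts T) 1 2 (hx T)"
  by (cases T) (auto intro!: fits_add fits_cXY simp del: One_nat_def)

lemma fits_hx1: "fits (triple_verts T) 1 2 (hx1 T)"
  by (cases T) (auto intro!: fits_add fits_cXY simp del: One_nat_def)

lemma off_diagonal_hx: "distinct3 T \<Longrightarrow> off_diagonal (hx T)"
  by (cases T) (auto intro!: off_diagonal_add off_diagonal_cXY)

lemma off_diagonal_hx1: "distinct3 T \<Longrightarrow> off_diagonal (hx1 T)"
  by (cases T) (auto intro!: off_diagonal_add off_diagonal_cXY)

lemma fits_hprod: "fits (triples_verts ts) (length ts) (2 * length ts) (hprod ts)"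
proof (induction ts)
  case (Cons T ts)
  show ?case
    using fits_mult [OF fits_hx Cons, of T] by simp
qed simp

lemma off_diagonal_hprod: "disjoint_triples ts \<Longrightarrow> off_diagonal (hprod ts)"
proof (induction ts)
  case (Cons T ts)
  then show ?case
    using off_diagonal_mult [OF off_diagonal_hx _ fits_hx fits_hprod, of T ts] by simp
qed simp

lemma disjoint_triples_append: "disjoint_triples (ts @ us) \<longleftrightarrow> disjoint_triples ts \<and> disjoint_triples us \<and> triples_verts ts \<inter> triples_verts us = {}"
  and triples_verts_append: "triples_verts (ts @ us) = triples_verts ts \<union> triples_verts us"
  by (induction ts) auto

lemma bseq_props:
  assumes "disjoint_triples ts" "i < 2 * length ts"
  shows "fits (triples_verts ts) (length ts) (Suc i) (bseq ts i)" "off_diagonal (bseq ts i)"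
proof -
  define l where "l = i div 2"
  define T where "T = ts ! l"
  define h where "h = (if even i then hx0 T else hx1 T)"
  have l: "l < length ts"
    using assms(2) by (auto simp: l_def)
  have ts: "ts = (take l ts @ [T]) @ drop (Suc l) ts"
    using l by (simp add: T_def id_take_nth_drop [symmetric])
  have g: "disjoint_triples (take l ts)" "distinct3 T" "triples_verts (take l ts) \<inter> triple_verts T = {}" "triples_verts (take l ts) \<union> triple_verts T \<subseteq> triples_verts ts"
  proof -
    have "disjoint_triples ((take l ts @ [T]) @ drop (Suc l) ts)"
      using assms(1) ts by simp
    moreover have "triples_verts ts = triples_verts ((take l ts @ [T]) @ drop (Suc l) ts)"
      using ts by simp
    ultimately show "disjoint_triples (take l ts)" "distinct3 T" "triples_verts (take l ts) \<inter> triple_verts T = {}" "triples_verts (take l ts) \<union> triple_verts T \<subseteq> triples_verts ts"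
      by (auto simp: disjoint_triples_append triples_verts_append)
  qed
  have b: "bseq ts i = hprod (take l ts) * h"
    by (simp add: bseq_def l_def T_def h_def)
  define e where "e = (if even i then 1 else 2 :: nat)"
  have h: "fits (triple_verts T) 1 e h" "off_diagonal h"
    using fits_hx0 fits_hx1 off_diagonal_hx0 off_diagonal_hx1 g(2) by (simp_all add: h_def e_def)
  have hp: "fits (triples_verts (take l ts)) l (2 * l) (hprod (take l ts))"
    using fits_hprod [of "take l ts"] l by simp
  have "2 * l + e = Suc i"
    by (auto simp: l_def e_def elim: oddE)
  then show "fits (triples_verts ts) (length ts) (Suc i) (bseq ts i)"
    using fits_mono [OF fits_mult [OF hp h(1)] g(4), of "length ts"] l by (simp add: b)
  show "off_diagonal (bseq ts i)"
    unfolding b by (rule off_diagonal_mult [OF off_diagonal_hprod [OF g(1)] h(2) hp h(1) g(3)])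
qed

section \<open>Skeleta of simplices\<close>

lemma simplex_on_subset_skeleton:
  assumes "A \<subseteq> {..N}" "card A \<le> Suc k" "k \<le> N"
  shows "simplex_on A \<subseteq> simplex_skeleton N k"
proof
  fix p assume p: "p \<in> simplex_on A"
  obtain I where I: "A \<subseteq> I" "I \<subseteq> {..N}" "card I = Suc k"
    using exists_subset_between [of A "Suc k" "{..N}"] assms by auto
  have fin: "finite A"
    using assms(1) finite_subset by blast
  have "sum p A = (\<Sum>i\<le>N. p i)"
    using assms(1) p by (intro sum.mono_neutral_left) (auto simp: simplex_on_def)
  moreover have "p i \<le> 1" for i
  proof (cases "i \<in> A")
    case True
    then have "p i \<le> sum p A"
      using fin p by (intro member_le_sum) (auto simp: simplex_on_def)
    then show ?thesis
      using p by (simp add: simplex_on_def)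
  qed (use p in \<open>auto simp: simplex_on_def\<close>)
  moreover have "p i = 0" if "i \<notin> I" for i
    using p I(1) that by (auto simp: simplex_on_def)
  moreover have "p i = 0" if "i > N" for i
    using p assms(1) that by (auto simp: simplex_on_def)
  ultimately have "p \<in> standard_simplex N" "\<forall>i. i \<notin> I \<longrightarrow> p i = 0"
    using p by (auto simp: simplex_on_def standard_simplex_def)
  then show "p \<in> simplex_skeleton N k"
    unfolding simplex_skeleton_def using I by blast
qed

lemma slide_simplex_on:
  assumes "p \<in> simplex_on A" "finite A" "0 \<le> s" "s \<le> 1"
  shows "slide x s p \<in> simplex_on (insert x A)"
proof -
  have "sum p (insert x A) = 1"
    using assms(1,2) by (simp add: simplex_on_def sum.insert_if)
  moreover have "sum (ev x) (insert x A) = 1"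
    using assms(2) by (simp add: ev_def)
  ultimately have "sum (slide x s p) (insert x A) = 1"
    by (simp add: slide_def sum.distrib flip: sum_distrib_left)
  then show ?thesis
    using assms by (auto simp: simplex_on_def slide_def ev_def)
qed

lemma ev_simplex_on: "ev x \<in> simplex_on {x}"
  by (simp add: simplex_on_def ev_def)

lemma compactin_simplex_skeleton: "compactin RR (simplex_skeleton N k)"
proof -
  have "compactin RR {x \<in> standard_simplex N. \<forall>i. i \<notin> I \<longrightarrow> x i = 0}" for I
  proof -
    have "closedin RR {x \<in> topspace RR. x i \<in> {0}}" for i
      by (rule closedin_continuous_map_preimage [where Y = euclideanreal])
         (auto intro: continuous_map_product_projection)
    then have "closedin RR (\<Inter>i\<in>-I. {x \<in> topspace RR. x i \<in> {0}})" if "I \<noteq> UNIV"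
      using that by (intro closedin_INT) auto
    moreover have "{x \<in> standard_simplex N. \<forall>i. i \<notin> I \<longrightarrow> x i = 0} =
        standard_simplex N \<inter> (if I = UNIV then UNIV else \<Inter>i\<in>-I. {x \<in> topspace RR. x i \<in> {0}})"
      by auto
    ultimately show ?thesis
      using compactin_standard_simplex [of N] by (auto intro: compact_Int_closedin)
  qed
  moreover have "finite {I. I \<subseteq> {..N} \<and> card I = Suc k}"
    by (rule finite_subset [of _ "Pow {..N}"]) auto
  ultimately show ?thesis
    unfolding simplex_skeleton_def by (intro compactin_Union) auto
qed

locale skeleton_embedding = simplicial_embedding M "simplex_skeleton N k" F "2 * k" t \<delta>
  for M :: "'a topology" and N k F t \<delta> +
  assumes k: "1 \<le> k" "k \<le> N"
begin

lemma carrier2_off_diagonal: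
  assumes "off_diagonal P" "c \<in> keys P"
  shows "carrier2 c \<subseteq> {e. fst e \<noteq> snd e}"
proof (cases c)
  case (Cell a b)
  then have "set a \<inter> set b = {}"
    using assms by (simp add: off_diagonal_def)
  then show ?thesis
    using simplex_on_disjoint [of "set a" "set b"] Cell by auto
qed

lemma clen_fits: "fits V p n P \<Longrightarrow> c \<in> keys P \<Longrightarrow> clen c = n"
  by (cases c) (simp add: fits_def)

lemma chn_realize_skeleton:
  assumes "fits {..N} (Suc k) (n + 2) P"
  shows "chn n TT (simplex_skeleton N k \<times> simplex_skeleton N k) (realize P)"
proof (rule chn_realize)
  fix c assume c: "c \<in> keys P"
  show "clen c = n + 2"
    by (rule clen_fits [OF assms c])
  show "carrier2 c \<subseteq> simplex_skeleton N k \<times> simplex_skeleton N k"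
  proof (cases c)
    case (Cell a b)
    then have "set a \<subseteq> {..N}" "set b \<subseteq> {..N}" "card (set a) \<le> Suc k" "card (set b) \<le> Suc k"
      using assms c by (auto simp: fits_def intro: order_trans [OF card_length])
    then show ?thesis
      using k Cell by (simp add: Sigma_mono simplex_on_subset_skeleton)
  qed
qed

text \<open>Sliding adds at most the vertex \<open>x\<close> to the support, so the moved points
  stay in the simplex on \<open>insert x A\<close>.\<close>

lemma simplex_on_subset_star:
  assumes "A \<subseteq> {..N}" "card (insert x A) \<le> Suc k" "x \<le> N"
  shows "simplex_on A \<subseteq> star x"
proof
  fix p assume p: "p \<in> simplex_on A"
  have fin: "finite A"
    using assms(1) finite_subset by blast
  have "simplex_on A \<subseteq> simplex_skeleton N k" "simplex_on (insert x A) \<subseteq> simplex_skeleton N k"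
    using assms k card_mono [OF finite.insertI [OF fin] subset_insertI [of A x]] by (intro simplex_on_subset_skeleton; simp)+
  then show "p \<in> star x"
    using p slide_simplex_on [OF p fin] unfolding star_def by blast
qed

lemma chn_realize_off_diagonal:
  assumes "fits V p (n + 2) P" "off_diagonal P"
  shows "chn n TT {e. fst e \<noteq> snd e} (realize P)"
  by (rule chn_realize [OF clen_fits [OF assms(1)] carrier2_off_diagonal [OF assms(2)]])

lemma rz_realize:
  assumes P: "fits {..N} (Suc k) (2 * k + 2) P" and "off_diagonal (dJ P)" and A: "chn (2 * k) TT A (realize P)"
  shows "rz (2 * k) TT A (A \<inter> {e. fst e \<noteq> snd e}) (realize P)"
proof -
  have "bd (2 * k) (realize P) = realize (dJ P)"
    using bd_realize [OF clen_fits [OF P]] by simp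
  moreover have "chn (2 * k - 1) TT {e. fst e \<noteq> snd e} (realize (dJ P))"
    using fits_dJ [of "{..N}" "Suc k" "2 * k + 1" P] assms k by (intro chn_realize_off_diagonal [of "{..N}" "Suc k"]) auto
  moreover have "chn (2 * k - 1) TT A (bd (2 * k) (realize P))"
    by (rule chn_bd [OF A])
  ultimately show ?thesis
    using A by (simp add: rz_def chn_Int)
qed

text \<open>Only the boundary has to avoid the diagonal, which makes the realization a relative
  cycle. The cells themselves may meet the diagonal; nonzero values arise from those.\<close>

definition admissible :: "cells \<Rightarrow> bool"
  where "admissible P \<longleftrightarrow> fits {..N} (Suc k) (2 * k + 2) P \<and> off_diagonal (dJ P)"

definition \<theta> :: "cells \<Rightarrow> bit"
  where "\<theta> P = t (push (2 * k) (map_prod F id) (realize P))"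

abbreviation "OD \<equiv> offdiag M K F"
abbreviation "MK \<equiv> prod_topology M K"
abbreviation "SS \<equiv> simplex_skeleton N k \<times> simplex_skeleton N k"

lemma admissible_add: "admissible P \<Longrightarrow> admissible Q \<Longrightarrow> admissible (P + Q)"
  by (simp add: admissible_def fits_add off_diagonal_add)

lemma admissible_off_diagonal: "fits {..N} (Suc k) (2 * k + 2) P \<Longrightarrow> off_diagonal P \<Longrightarrow> admissible P"
  by (simp add: admissible_def off_diagonal_dJ)

lemma continuous_map_F_id: "continuous_map (subtopology TT SS) MK (map_prod F id)"
proof -
  have eq: "subtopology TT SS = prod_topology K K"
    by (simp add: subtopology_Times)
  show ?thesis
    unfolding eq map_prod_def
    using continuous_map_compose [OF continuous_map_fst F, of K]
    by (simp add: continuous_map_pairwise o_def case_prod_beta continuous_map_snd)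
qed

lemma F_id_offdiag: "map_prod F id \<in> topspace TT \<inter> (SS \<inter> {e. fst e \<noteq> snd e}) \<rightarrow> OD"
proof (rule Pi_I)
  fix e assume e: "e \<in> topspace TT \<inter> (SS \<inter> {e. fst e \<noteq> snd e})"
  obtain p q where pq: "e = (p, q)" by (cases e)
  then have "p \<in> simplex_skeleton N k" "q \<in> simplex_skeleton N k" "p \<noteq> q"
    using e by auto
  then show "map_prod F id e \<in> OD"
    using inj continuous_map_image_subset_topspace [OF F] by (auto simp: pq offdiag_def dest: inj_onD)
qed

lemma rz_admissible:
  assumes "admissible P"
  shows "rz (2 * k) MK UNIV OD (push (2 * k) (map_prod F id) (realize P))"
proof (rule rz_push)
  have P: "fits {..N} (Suc k) (2 * k + 2) P" "off_diagonal (dJ P)"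
    using assms by (simp_all add: admissible_def)
  show "rz (2 * k) TT SS (SS \<inter> {e. fst e \<noteq> snd e}) (realize P)"
    by (rule rz_realize [OF P chn_realize_skeleton [OF P(1)]])
qed (rule continuous_map_F_id F_id_offdiag Int_lower1 | simp)+

lemma \<theta>_add: "admissible P \<Longrightarrow> admissible Q \<Longrightarrow> \<theta> (P + Q) = \<theta> P + \<theta> Q"
  using additive_on_add [OF t_add rz_admissible rz_admissible] by (simp add: \<theta>_def)

lemma \<theta>_0 [simp]: "\<theta> 0 = 0"
  using additive_on_rb [OF t_add rb_0] by (simp add: \<theta>_def)

text \<open>By injectivity of \<open>F\<close> disjoint simplices have disjoint images, so the whole
  chain lies off the diagonal.\<close>

lemma \<theta>_off_diagonal:
  assumes "fits {..N} (Suc k) (2 * k + 2) P" "off_diagonal P"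
  shows "\<theta> P = 0"
proof -
  have "chn (2 * k) TT (SS \<inter> {e. fst e \<noteq> snd e}) (realize P)"
    unfolding chn_Int using chn_realize_skeleton [OF assms(1)] chn_realize_off_diagonal [OF assms] by blast
  then have "chn (2 * k) MK OD (push (2 * k) (map_prod F id) (realize P))"
    by (rule chn_push [OF _ continuous_map_from_subtopology_mono [OF continuous_map_F_id Int_lower1] F_id_offdiag])
  then show ?thesis
    unfolding \<theta>_def by (rule additive_on_rb [OF t_add chn_imp_rb])
qed

end

context skeleton_embedding
begin

lemma fits_base: "fits {x} 1 1 (cX x + cY x)"
  by (intro fits_add) simp_all

lemma chn_realize_star:
  assumes "fits V p n P" "x \<le> N" "V \<subseteq> {..N}"
    and "\<And>a b. Cell a b \<in> keys P \<Longrightarrow> card (insert x (set a)) \<le> Suc k \<and> card (insert x (set b)) \<le> Suc k"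
    and "n = m + 2"
  shows "chn m TT (star x \<times> star x) (realize P)"
proof (rule chn_realize)
  fix c assume c: "c \<in> keys P"
  show "clen c = m + 2"
    using clen_fits [OF assms(1) c] assms(5) by simp
  show "carrier2 c \<subseteq> star x \<times> star x"
  proof (cases c)
    case (Cell a b)
    then have "set a \<subseteq> V" "set b \<subseteq> V"
      using assms(1) c by (simp_all add: fits_def)
    then have "set a \<subseteq> {..N}" "set b \<subseteq> {..N}"
      using assms(3) by blast+
    moreover have "card (insert x (set a)) \<le> Suc k" "card (insert x (set b)) \<le> Suc k"
      using assms(4) c Cell by auto
    ultimately have "simplex_on (set a) \<subseteq> star x" "simplex_on (set b) \<subseteq> star x"
      using assms(2) by (simp_all add: simplex_on_subset_star)
    then show ?thesis
      using Cell by (simp add: Sigma_mono)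
  qed
qed

text \<open>After contraction towards \<open>x\<close>, the differences of points in a chart turn the join of hexagons into a
  sequence to which Borsuk's theorem applies.\<close>

lemma \<theta>_star:
  assumes x: "x \<le> N" "x \<notin> triples_verts ts" and ts: "disjoint_triples ts" "triples_verts ts \<subseteq> {..N}" "length ts = k"
  shows "admissible (cX x * cY x * hprod ts)" "\<theta> (cX x * cY x * hprod ts) = 1"
proof -
  let ?P = "cX x * cY x * hprod ts" and ?X = "cX x + cY x"
  have V: "insert x (triples_verts ts) \<subseteq> {..N}"
    using x ts by auto
  have fP: "fits (insert x (triples_verts ts)) (Suc k) (2 * k + 2) ?P"
    using fits_mult [OF fits_cXY [of x "{x}" x] fits_hprod, of ts] ts(3) by simp
  have dP: "dJ ?P = ?X * hprod ts"
    by (simp add: dJ_mult algebra_simps)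
  have oX: "off_diagonal ?X"
    by (intro off_diagonal_add) simp_all
  have oP: "off_diagonal (dJ ?P)"
    unfolding dP using x by (intro off_diagonal_mult [OF oX off_diagonal_hprod [OF ts(1)] fits_base fits_hprod]) simp
  show "admissible ?P"
    unfolding admissible_def using fits_mono [OF fP V] oP by simp
  have cardP: "card (insert x (set a)) \<le> Suc k \<and> card (insert x (set b)) \<le> Suc k" if cell: "Cell a b \<in> keys (cX x * cY x * hprod ts)" for a b
  proof -
    obtain a1 b1 a2 b2 where c: "Cell a1 b1 \<in> keys (cX x * cY x)" "Cell a2 b2 \<in> keys (hprod ts)" and ab: "a = a1 @ a2" "b = b1 @ b2"
      using cell by (rule keys_mult_Cell)
    have "a1 = [x]" "b1 = [x]"
      using c(1) by (auto simp: mult_single)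
    moreover have "length a2 \<le> k" "length b2 \<le> k"
      using c(2) fits_hprod [of ts] ts(3) by (auto simp: fits_def)
    ultimately show ?thesis
      unfolding ab by (auto intro!: card_insert_le_m1 order_trans [OF card_length])
  qed
  \<comment> \<open>The hexagons contribute at most \<open>k\<close> vertices to each factor and
    leave room for \<open>x\<close>, so these cells lie in the star of \<open>x\<close>.\<close>
  have cardi: "card (insert x (set a)) \<le> Suc k \<and> card (insert x (set b)) \<le> Suc k"
    if i: "i < 2 * k" and cell: "Cell a b \<in> keys (?X * bseq ts i)" for a b i
  proof -
    obtain a1 b1 a2 b2 where c: "Cell a1 b1 \<in> keys ?X" "Cell a2 b2 \<in> keys (bseq ts i)" and ab: "a = a1 @ a2" "b = b1 @ b2"
      using cell by (rule keys_mult_Cell)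
    have "insert x (set (a1 @ a2)) = insert x (set a2)" "insert x (set (b1 @ b2)) = insert x (set b2)"
      using keys_add_cases [OF c(1)] by auto
    moreover have "length a2 \<le> k" "length b2 \<le> k"
      using c(2) bseq_props [OF ts(1), of i] i ts(3) by (auto simp: fits_def)
    ultimately show ?thesis
      unfolding ab by (auto intro!: card_insert_le_m1 order_trans [OF card_length])
  qed
  have "ev x \<in> simplex_skeleton N k"
    using simplex_on_subset_skeleton [of "{x}" N k] x k ev_simplex_on [of x] by auto
  then obtain g where g: "continuous_map (subtopology RR (star x)) (Euclidean_space (2 * k)) g" "inj_on g (star x)"
    and tg: "\<And>c. rz (2 * k) TT (star x \<times> star x) ((star x \<times> star x) \<inter> {e. fst e \<noteq> snd e}) c \<Longrightarrow>
      t (push (2 * k) (map_prod F id) c) = \<delta> (push (2 * k) (\<lambda>(p, q). (\<lambda>i. g p i - g q i, ())) c)"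
    by (rule star_chart) blast
  define G where "G = (\<lambda>(p, q). (\<lambda>i. g p i - g q i, ()))"
  let ?A = "star x \<times> star x" and ?E = "ES (2 * k) point"
  have G: "continuous_map (subtopology TT ?A) ?E G"
  proof -
    have eq: "subtopology TT ?A = prod_topology (subtopology RR (star x)) (subtopology RR (star x))"
      by (simp add: subtopology_Times)
    have "continuous_map (subtopology TT ?A) (Euclidean_space (2 * k)) (\<lambda>e i. g (fst e) i - g (snd e) i)"
      unfolding eq
      using continuous_map_compose [OF continuous_map_fst g(1)] continuous_map_compose [OF continuous_map_snd g(1)]
      by (intro continuous_map_Euclidean_space_diff) (simp_all add: o_def)
    then show ?thesis
      by (simp add: ES_def continuous_map_pairwise G_def o_def case_prod_beta)
  qed
  have GS: "G \<in> topspace TT \<inter> (?A \<inter> {e. fst e \<noteq> snd e}) \<rightarrow> Sx (2 * k) UNIV"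
  proof (rule Pi_I)
    fix e assume e: "e \<in> topspace TT \<inter> (?A \<inter> {e. fst e \<noteq> snd e})"
    obtain p q where pq: "e = (p, q)" by (cases e)
    then have pq': "p \<in> star x" "q \<in> star x" "p \<noteq> q"
      using e by auto
    then have "g p \<noteq> g q"
      using g(2) by (auto dest: inj_onD)
    then obtain i where i: "g p i \<noteq> g q i"
      by auto
    have "g p \<in> topspace (Euclidean_space (2 * k))" "g q \<in> topspace (Euclidean_space (2 * k))"
      using continuous_map_image_subset_topspace [OF g(1)] pq' by auto
    then have "i < 2 * k"
      using i by (metis (mono_tags, lifting) mem_Collect_eq not_le topspace_Euclidean_space)
    then show "G e \<in> Sx (2 * k) UNIV"
      using i by (auto simp: Sx_def G_def pq)
  qed
  \<comment> \<open>Interchanging two points negates their difference, so the swap of cells becomes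
    the antipodal map.\<close>
  have Gsw: "G \<circ> prod.swap = antip \<circ> G"
    by (auto simp: G_def antip_def fun_eq_iff)
  \<comment> \<open>\<open>?X\<close> is a cycle for the augmented boundary and the boundary of
    \<open>cX x * cY x\<close>. Joining with it shifts the number of vertices by one and preserves
    the hemisphere relations of \<open>bseq\<close>; \<open>?P\<close> becomes the top
    member.\<close>
  define c where "c = (\<lambda>i. if i < 2 * k then push i G (realize (?X * bseq ts i)) else push (2 * k) G (realize ?P))"
  have fb: "fits (insert x (triples_verts ts)) (Suc k) (i + 2) (?X * bseq ts i)" and ob: "off_diagonal (?X * bseq ts i)" if "i < 2 * k" for i
    using fits_mult [OF fits_base bseq_props(1) [OF ts(1)], of i x] off_diagonal_mult [OF oX bseq_props(2) [OF ts(1)] fits_base bseq_props(1) [OF ts(1)], of i] that ts(3) x(2)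
    by simp_all
  have ri: "chn i TT (?A \<inter> {e. fst e \<noteq> snd e}) (realize (?X * bseq ts i))" if "i < 2 * k" for i
    unfolding chn_Int using chn_realize_star [OF fb [OF that] x(1) V cardi [OF that]] chn_realize_off_diagonal [OF fb ob] that by blast
  have rP: "chn (2 * k) TT ?A (realize ?P)"
    by (rule chn_realize_star [OF fP x(1) V cardP refl])
  have "borsuk_seq (2 * k) point (2 * k) c"
    unfolding borsuk_seq_def
  proof (intro conjI allI impI)
    fix i assume i: "i < 2 * k"
    show "chn i ?E (Sx (2 * k) UNIV) (c i)"
      using chn_push [OF ri [OF i] continuous_map_from_subtopology_mono [OF G Int_lower1] GS] i by (simp add: c_def)
    have "push i antip (c i) = push i G (push i prod.swap (realize (?X * bseq ts i)))"
      using i by (simp add: c_def push_compose Gsw)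
    also have "push i prod.swap (realize (?X * bseq ts i)) = realize (?X * swJ (bseq ts i))"
      by (subst push_swap_realize [OF clen_fits [OF fb [OF i]]]) (simp_all add: swJ_mult add.commute)
    finally have "c i + push i antip (c i) = push i G (realize (?X * (bseq ts i + swJ (bseq ts i))))"
      using i by (simp add: c_def distrib_left)
    moreover have "bd (Suc i) (c (Suc i)) = push i G (realize (?X * (bseq ts i + swJ (bseq ts i))))"
    proof (cases "Suc i < 2 * k")
      case True
      have "bd (Suc i) (c (Suc i)) = push i G (bd (Suc i) (realize (?X * bseq ts (Suc i))))"
        using bd_push [OF ri [OF True], of G] True by (simp add: c_def)
      also have "bd (Suc i) (realize (?X * bseq ts (Suc i))) = realize (dJ (?X * bseq ts (Suc i)))"
        using clen_fits [OF fb [OF True]] by (intro bd_realize) simp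
      also have "dJ (?X * bseq ts (Suc i)) = ?X * (bseq ts i + swJ (bseq ts i))"
        unfolding dJ_mult using True ts(3) by (simp add: bseq_Suc)
      finally show ?thesis .
    next
      case False
      then have Si: "Suc i = 2 * k"
        and i': "2 * k - 1 = i"
        using i by simp_all
      have "bd (2 * k) (c (2 * k)) = push i G (bd (2 * k) (realize ?P))"
        using bd_push [OF rP, of G] unfolding i' by (simp add: c_def)
      also have "bd (2 * k) (realize ?P) = realize (?X * hprod ts)"
        using bd_realize [OF clen_fits [OF fP]] dP by simp
      also have "hprod ts = bseq ts i + swJ (bseq ts i)"
      proof -
        have "ts \<noteq> []"
          using ts(3) k by auto
        from bseq_last [OF this] show ?thesis
          unfolding ts(3) i' by (rule sym)
      qed
      finally show ?thesis
        unfolding Si .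
    qed
    ultimately show "bd (Suc i) (c (Suc i)) = c i + push i antip (c i)"
      by simp
  next
    show "chn (2 * k) ?E UNIV (c (2 * k))"
      using chn_push [OF rP G] by (simp add: c_def)
    obtain a b e where T: "ts ! 0 = (a, b, e)"
      by (cases "ts ! 0") auto
    \<comment> \<open>Of the two cells only \<open>Cell [a] [x]\<close> has both factors nonempty,
      so the lowest member is a single point.\<close>
    have "realize (?X * bseq ts 0) = cr 0 0 (sch [a]) (sch [x])"
      using T by (simp add: bseq_def distrib_right mult_single)
    then show "ext2 (\<lambda>_. 1) (c 0) = (1 :: bit)"
      using k by (simp add: c_def sch_def rl_def)
  qed
  then have "\<delta> (c (2 * k)) = 1"
    using \<delta> by (simp add: local_degree_def)
  then show "\<theta> ?P = 1"
    using tg [OF rz_realize [OF fits_mono [OF fP V order_refl] oP rP]] by (simp add: \<theta>_def c_def G_def)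
qed

definition cycleX :: "cells \<Rightarrow> bool"
  where "cycleX P \<longleftrightarrow> dJ P = 0 \<and> (\<forall>c\<in>keys P. \<exists>a. c = Cell a [] \<and> length a = Suc k \<and> set a \<subseteq> {..N})"

definition cycleY :: "cells \<Rightarrow> bool"
  where "cycleY P \<longleftrightarrow> dJ P = 0 \<and> (\<forall>c\<in>keys P. \<exists>b. c = Cell [] b \<and> length b = Suc k \<and> set b \<subseteq> {..N})"

fun schX :: "cell \<Rightarrow> (nat \<Rightarrow> real) chain2"
  where "schX (Cell a b) = sch a"

fun schY :: "cell \<Rightarrow> (nat \<Rightarrow> real) chain2"
  where "schY (Cell a b) = sch b"

lemma chn_sch_skeleton:
  assumes "length L = Suc k" "set L \<subseteq> {..N}"
  shows "chn k RR (simplex_skeleton N k) (sch L)"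
proof -
  have "simplex_on (set L) \<subseteq> simplex_skeleton N k"
    using assms k card_length [of L] by (intro simplex_on_subset_skeleton) auto
  then show ?thesis
    using chn_mono [OF chn_sch [of L]] assms(1) by simp
qed

lemma cycleX_realize:
  assumes "cycleX P"
  shows "chn k RR (simplex_skeleton N k) (ext2 schX P)" "bd k (ext2 schX P) = 0"
proof -
  have P: "\<exists>a. c = Cell a [] \<and> length a = Suc k \<and> set a \<subseteq> {..N}" if "c \<in> keys P" for c
    using assms that by (simp add: cycleX_def)
  show "chn k RR (simplex_skeleton N k) (ext2 schX P)"
    using P by (fastforce intro: chn_ext2 chn_sch_skeleton)
  have "bd k (ext2 schX P) = ext2 (\<lambda>c. bd k (schX c)) P"
    by (rule additive_ext2) simp
  also have "\<dots> = ext2 (\<lambda>c. ext2 schX (dcell c)) P"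
  proof (rule ext2_cong)
    fix c assume "c \<in> keys P"
    then obtain a where c: "c = Cell a []" "length a = Suc k"
      using P by blast
    then show "bd k (schX c) = ext2 schX (dcell c)"
      using bd_sch [of a] by (simp add: ext2_ext2)
  qed
  also have "\<dots> = ext2 schX (dJ P)"
    by (simp add: dJ_def ext2_ext2)
  finally show "bd k (ext2 schX P) = 0"
    using assms by (simp add: cycleX_def)
qed

lemma cycleY_realize:
  assumes "cycleY P"
  shows "chn k RR (simplex_skeleton N k) (ext2 schY P)" "bd k (ext2 schY P) = 0"
proof -
  have P: "\<exists>a. c = Cell [] a \<and> length a = Suc k \<and> set a \<subseteq> {..N}" if "c \<in> keys P" for c
    using assms that by (simp add: cycleY_def)
  show "chn k RR (simplex_skeleton N k) (ext2 schY P)"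
    using P by (fastforce intro: chn_ext2 chn_sch_skeleton)
  have "bd k (ext2 schY P) = ext2 (\<lambda>c. bd k (schY c)) P"
    by (rule additive_ext2) simp
  also have "\<dots> = ext2 (\<lambda>c. ext2 schY (dcell c)) P"
  proof (rule ext2_cong)
    fix c assume "c \<in> keys P"
    then obtain a where c: "c = Cell [] a" "length a = Suc k"
      using P by blast
    then show "bd k (schY c) = ext2 schY (dcell c)"
      using bd_sch [of a] by (simp add: ext2_ext2)
  qed
  also have "\<dots> = ext2 schY (dJ P)"
    by (simp add: dJ_def ext2_ext2)
  finally show "bd k (ext2 schY P) = 0"
    using assms by (simp add: cycleY_def)
qed

lemma admissible_cycles:
  assumes z: "cycleX z" and w: "cycleY w"
  shows "admissible (z * w)"
proof -
  have "fits {..N} (Suc k) (2 * k + 2) (z * w)"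
    unfolding fits_def
  proof (intro allI impI)
    fix a b assume "Cell a b \<in> keys (z * w)"
    then obtain a1 b1 a2 b2 where "Cell a1 b1 \<in> keys z" "Cell a2 b2 \<in> keys w" and ab: "a = a1 @ a2" "b = b1 @ b2"
      by (rule keys_mult_Cell)
    then have "b1 = []" "length a1 = Suc k" "set a1 \<subseteq> {..N}" "a2 = []" "length b2 = Suc k" "set b2 \<subseteq> {..N}"
      using z w by (fastforce simp: cycleX_def cycleY_def)+
    then show "length a + length b = 2 * k + 2 \<and> length a \<le> Suc k \<and> length b \<le> Suc k \<and> set a \<subseteq> {..N} \<and> set b \<subseteq> {..N}"
      unfolding ab by simp
  qed
  moreover have "dJ (z * w) = 0"
    using z w by (simp add: dJ_mult cycleX_def cycleY_def)
  ultimately show ?thesis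
    by (simp add: admissible_def)
qed

lemma realize_cycles:
  assumes z: "cycleX z" and w: "cycleY w"
  shows "realize (z * w) = cr k k (ext2 schX z) (ext2 schY w)"
proof -
  have "realize (z * w) = ext2 (\<lambda>a. ext2 (\<lambda>b. realize1 (a + b)) w) z"
    by (simp add: sum2_mult realize_def ext2_ext2)
  also have "\<dots> = ext2 (\<lambda>a. ext2 (\<lambda>b. cr k k (schX a) (schY b)) w) z"
  proof (intro ext2_cong)
    fix a b assume "a \<in> keys z" "b \<in> keys w"
    then obtain L L' where "a = Cell L []" "length L = Suc k" "b = Cell [] L'" "length L' = Suc k"
      using z w unfolding cycleX_def cycleY_def by blast
    then show "realize1 (a + b) = cr k k (schX a) (schY b)"
      by simp
  qed
  also have "\<dots> = cr k k (ext2 schX z) (ext2 schY w)"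
    unfolding cr_ext2_left unfolding cr_ext2_right by (rule refl)
  finally show ?thesis .
qed

text \<open>The factorization through the homology of \<open>M\<close>: if the image of the first
  cycle changes by a boundary in \<open>M\<close>, its product with a fixed second cycle changes by
  a boundary in \<open>MK\<close>, to which \<open>t\<close> is insensitive.\<close>

lemma \<theta>_cycles:
  assumes z: "cycleX z" and w: "cycleY w"
    and E: "\<And>e. e \<in> E \<Longrightarrow> chn k M UNIV e \<and> bd k e = 0"
    and u: "chn (Suc k) M UNIV u" "push k F (ext2 schX z) = sum (\<lambda>e. e) E + bd (Suc k) u"
  shows "\<theta> (z * w) = (\<Sum>e\<in>E. t (cr k k e (ext2 schY w)))"
proof -
  let ?w = "ext2 schY w"
  have w': "chn k K UNIV ?w" "bd k ?w = 0"
    using cycleY_realize [OF w] by (simp_all add: chn_subtopology)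
  have "push (k + k) (map_prod F id) (realize (z * w)) = cr k k (push k F (ext2 schX z)) (push k id ?w)"
    unfolding realize_cycles [OF z w] by (rule push_cr)
  also have "push k id ?w = ?w"
    by (rule push_id_gen [OF w'(1)]) simp
  finally have 1: "\<theta> (z * w) = t (cr k k (push k F (ext2 schX z)) ?w)"
    by (simp only: \<theta>_def mult_2)
  have rz: "rz (2 * k) MK UNIV OD (cr k k e ?w)" if "e \<in> E" for e
  proof -
    have "chn (2 * k) MK UNIV (cr k k e ?w)"
      using chn_cr [OF conjunct1 [OF E [OF that]] w'(1)] by (simp add: mult_2)
    moreover have "bd (2 * k) (cr k k e ?w) = 0"
      using bd_cr [of k k e ?w] E [OF that] w'(2) by (simp add: mult_2)
    ultimately show ?thesis
      by (simp add: rz_def)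
  qed
  have 2: "t (\<Sum>e\<in>E. cr k k e ?w) = (\<Sum>e\<in>E. t (cr k k e ?w))" "rz (2 * k) MK UNIV OD (\<Sum>e\<in>E. cr k k e ?w)"
    by (rule additive_on_sum [OF t_add rz]; assumption)+
  have "chn (Suc k + k) MK (UNIV \<times> UNIV) (cr (Suc k) k u ?w)"
    by (rule chn_cr [OF u(1) w'(1)])
  then have u': "chn (Suc (2 * k)) MK UNIV (cr (Suc k) k u ?w)"
    by (simp add: mult_2)
  have "bd (Suc (2 * k)) (cr (Suc k) k u ?w) = cr k k (bd (Suc k) u) ?w"
    using bd_cr [of "Suc k" k u ?w] w'(2) by (simp add: mult_2)
  then have "rb (2 * k) MK UNIV OD ((\<Sum>e\<in>E. cr k k e ?w) + cr k k (push k F (ext2 schX z)) ?w)"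
    using bd_imp_rb [OF u', of OD] by (simp add: u(2) cr_sum_left)
  then show ?thesis
    unfolding 1 2(1) [symmetric] by (rule additive_on_cong [OF t_add 2(2) _ subset_UNIV])
qed

end

section \<open>Lower bounds for the rank of matrices with prescribed symmetrization\<close>

section \<open>Rank of matrices over the field of two elements\<close>

definition dyad_sum :: "(('a \<Rightarrow> bit) \<times> ('a \<Rightarrow> bit)) list \<Rightarrow> 'a \<Rightarrow> 'a \<Rightarrow> bit"
  where "dyad_sum L x y = (\<Sum>(p, q)\<leftarrow>L. p x * q y)"

text \<open>Rank bounded by a decomposition into products of a row function and a column function,
  required only on the given index set.\<close>

definition rank_le :: "'a set \<Rightarrow> nat \<Rightarrow> ('a \<Rightarrow> 'a \<Rightarrow> bit) \<Rightarrow> bool"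
  where "rank_le \<Omega> r B \<longleftrightarrow> (\<exists>L. length L \<le> r \<and> (\<forall>x\<in>\<Omega>. \<forall>y\<in>\<Omega>. B x y = dyad_sum L x y))"

lemma dyad_sum_Nil [simp]: "dyad_sum [] x y = 0" and dyad_sum_Cons [simp]: "dyad_sum ((p, q) # L) x y = p x * q y + dyad_sum L x y"
  and dyad_sum_append: "dyad_sum (L @ L') x y = dyad_sum L x y + dyad_sum L' x y"
  by (simp_all add: dyad_sum_def)

lemma rank_le_mono: "rank_le \<Omega> r B \<Longrightarrow> \<Omega>' \<subseteq> \<Omega> \<Longrightarrow> r \<le> r' \<Longrightarrow> rank_le \<Omega>' r' B"
  unfolding rank_le_def by (meson order_trans subsetD)

lemma rank_le_cong: "rank_le \<Omega> r B \<Longrightarrow> (\<And>x y. x \<in> \<Omega> \<Longrightarrow> y \<in> \<Omega> \<Longrightarrow> B x y = B' x y) \<Longrightarrow> rank_le \<Omega> r B'"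
  unfolding rank_le_def by (metis (no_types, lifting))

lemma rank_le_product: "rank_le \<Omega> 1 (\<lambda>x y. p x * q y)"
  unfolding rank_le_def by (intro exI [of _ "[(p, q)]"]) simp

lemma rank_le_add:
  assumes "rank_le \<Omega> r A" "rank_le \<Omega> s B"
  shows "rank_le \<Omega> (r + s) (\<lambda>x y. A x y + B x y)"
proof -
  obtain L L' where "length L \<le> r" "\<forall>x\<in>\<Omega>. \<forall>y\<in>\<Omega>. A x y = dyad_sum L x y"
    "length L' \<le> s" "\<forall>x\<in>\<Omega>. \<forall>y\<in>\<Omega>. B x y = dyad_sum L' x y"
    using assms unfolding rank_le_def by blast
  then show ?thesis
    unfolding rank_le_def by (intro exI [of _ "L @ L'"]) (simp add: dyad_sum_append)
qed

lemma rank_le_transpose: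
  assumes "rank_le \<Omega> r B"
  shows "rank_le \<Omega> r (\<lambda>x y. B y x)"
proof -
  obtain L where L: "length L \<le> r" "\<forall>x\<in>\<Omega>. \<forall>y\<in>\<Omega>. B x y = dyad_sum L x y"
    using assms unfolding rank_le_def by blast
  have "dyad_sum L y x = dyad_sum (map prod.swap L) x y" for x y
    by (induction L) (auto simp: mult.commute)
  then show ?thesis
    unfolding rank_le_def using L by (intro exI [of _ "map prod.swap L"]) simp
qed

lemma dyad_sum_shear:
  "dyad_sum (map (\<lambda>(p, q). (\<lambda>x. p x + b x * p x0, \<lambda>y. q y + e y * q y0)) L) x y =
   dyad_sum L x y + e y * dyad_sum L x y0 + b x * dyad_sum L x0 y + b x * e y * dyad_sum L x0 y0"
  by (induction L) (auto simp: algebra_simps)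

text \<open>Wedderburn's rank reduction: shearing all factors along the pivot kills one of the summands.\<close>

lemma rank_le_schur:
  assumes B: "rank_le \<Omega> r B" and x0: "x0 \<in> \<Omega>" "y0 \<in> \<Omega>" "B x0 y0 = 1"
  shows "0 < r" "rank_le \<Omega> (r - 1) (\<lambda>x y. B x y + B x y0 * B x0 y)"
proof -
  obtain L where L: "length L \<le> r" "\<forall>x\<in>\<Omega>. \<forall>y\<in>\<Omega>. B x y = dyad_sum L x y"
    using assms unfolding rank_le_def by blast
  have "\<exists>(p, q)\<in>set L. q y0 = 1"
  proof (rule ccontr)
    assume "\<not> ?thesis"
    then have "\<forall>(p, q)\<in>set L. q y0 = 0"
      by (auto simp: bit_not_one_iff)
    then have "dyad_sum L x0 y0 = 0"
      by (induction L) auto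
    then show False
      using L(2) x0 by simp
  qed
  then obtain p0 q0 L1 L2 where L12: "L = L1 @ (p0, q0) # L2" "q0 y0 = 1"
    by (auto dest: split_list)
  then show "0 < r"
    using L(1) by auto
  \<comment> \<open>Shearing the second factors by \<open>q0\<close> itself produces two additional
    terms that cancel because \<open>dyad_sum L x0 y0 = 1\<close>. As \<open>q0 y0 = 1\<close>, the
    sheared second factor of \<open>(p0, q0)\<close> is \<open>0\<close>.\<close>
  let ?f = "\<lambda>(p, q). (\<lambda>x. p x + B x y0 * p x0, \<lambda>y. q y + q0 y * q y0)"
  have "dyad_sum (map ?f L) x y = B x y + B x y0 * B x0 y" if "x \<in> \<Omega>" "y \<in> \<Omega>" for x y
  proof -
    have "B x y = dyad_sum L x y" "B x y0 = dyad_sum L x y0" "B x0 y = dyad_sum L x0 y" "dyad_sum L x0 y0 = 1"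
      using L(2) that x0 by auto
    then show ?thesis
      unfolding dyad_sum_shear by (simp add: algebra_simps)
  qed
  moreover have "dyad_sum (map ?f L) x y = dyad_sum (map ?f (L1 @ L2)) x y" for x y
    using L12(2) by (simp add: L12(1) dyad_sum_append)
  ultimately have "\<forall>x\<in>\<Omega>. \<forall>y\<in>\<Omega>. B x y + B x y0 * B x0 y = dyad_sum (map ?f (L1 @ L2)) x y"
    by (metis (no_types, lifting))
  moreover have "length (map ?f (L1 @ L2)) \<le> r - 1"
    using L(1) L12(1) by simp
  ultimately show "rank_le \<Omega> (r - 1) (\<lambda>x y. B x y + B x y0 * B x0 y)"
    unfolding rank_le_def by (intro exI [of _ "map ?f (L1 @ L2)"] conjI)
qed

lemma rank_le_identity:
  assumes "finite U" "rank_le U r (\<lambda>x y. of_bool (x = y))"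
  shows "card U \<le> r"
  using assms
proof (induction U arbitrary: r rule: finite_induct)
  case (insert u U)
  note r = rank_le_schur [OF insert.prems, of u u]
  have "rank_le U (r - 1) (\<lambda>x y. of_bool (x = y))"
    by (rule rank_le_cong [OF rank_le_mono [OF r(2), of U "r - 1"]]) (use insert.hyps in auto)
  then show ?case
    using insert.IH r(1) insert.hyps by fastforce
qed simp

text \<open>Adding the rank two function \<open>1 + c x + c y\<close> to \<open>T\<close> and its
  transpose leaves the identity matrix, since the diagonal of \<open>T\<close> is added to itself
  and disappears.\<close>

lemma rank_le_tournament:
  assumes "finite U" "rank_le U r T" and T: "\<And>x y. x \<in> U \<Longrightarrow> y \<in> U \<Longrightarrow> x \<noteq> y \<Longrightarrow> T x y + T y x = 1 + c x + c y"
  shows "card U \<le> 2 * r + 2"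
proof -
  have "rank_le U ((r + r) + (1 + 1)) (\<lambda>x y. (T x y + T y x) + ((1 + c x) * 1 + 1 * c y))"
    by (rule rank_le_add [OF rank_le_add [OF assms(2) rank_le_transpose [OF assms(2)]]
      rank_le_add [OF rank_le_product [of U "\<lambda>x. 1 + c x" "\<lambda>_. 1"] rank_le_product [of U "\<lambda>_. 1" c]]])
  then have "rank_le U (2 * r + 2) (\<lambda>x y. of_bool (x = y))"
    by (rule rank_le_cong [OF rank_le_mono [OF _ order_refl]]) (use T in auto)
  then show ?thesis
    by (rule rank_le_identity [OF assms(1)])
qed

text \<open>Pivots are taken in the first diagonal block. Since \<open>B x0 y = 0\<close> for
  \<open>y\<close> in \<open>\<Omega>2\<close>, the Schur complement changes neither the zero block
  nor the second diagonal block.\<close>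

lemma rank_le_triangular:
  assumes "rank_le (\<Omega>1 \<union> \<Omega>2) r B" "\<And>x y. x \<in> \<Omega>1 \<Longrightarrow> y \<in> \<Omega>2 \<Longrightarrow> B x y = 0"
  obtains r1 r2 where "r1 + r2 \<le> r" "rank_le \<Omega>1 r1 B" "rank_le \<Omega>2 r2 B"
  using assms
proof (induction r arbitrary: B thesis rule: less_induct)
  case (less r)
  show ?case
  proof (cases "\<exists>x\<in>\<Omega>1. \<exists>y\<in>\<Omega>1. B x y = 1")
    case True
    then obtain x0 y0 where x0: "x0 \<in> \<Omega>1" "y0 \<in> \<Omega>1" "B x0 y0 = 1"
      by blast
    define B' where "B' = (\<lambda>x y. B x y + B x y0 * B x0 y)"
    have r: "0 < r" "rank_le (\<Omega>1 \<union> \<Omega>2) (r - 1) B'"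
      unfolding B'_def using rank_le_schur [OF less.prems(2) _ _ x0(3)] x0 by auto
    have "B' x y = 0" if "x \<in> \<Omega>1" "y \<in> \<Omega>2" for x y
      using less.prems(3) that x0 by (simp add: B'_def)
    then obtain r1 r2 where r12: "r1 + r2 \<le> r - 1" "rank_le \<Omega>1 r1 B'" "rank_le \<Omega>2 r2 B'"
      using less.IH [OF _ _ r(2)] r(1) by (metis diff_less zero_less_one)
    have "rank_le \<Omega>1 (r1 + 1) B"
      by (rule rank_le_cong [OF rank_le_add [OF r12(2) rank_le_product [of _ "\<lambda>x. B x y0" "\<lambda>y. B x0 y"]]])
         (simp add: B'_def algebra_simps)
    moreover have "rank_le \<Omega>2 r2 B"
      by (rule rank_le_cong [OF r12(3)]) (use less.prems(3) x0 in \<open>simp add: B'_def\<close>)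
    ultimately show ?thesis
      using less.prems(1) [of "r1 + 1" r2] r12(1) r(1) by simp
  next
    case False
    then have "rank_le \<Omega>1 0 B"
      unfolding rank_le_def by (intro exI [of _ "[]"]) (simp add: bit_not_one_iff)
    moreover have "rank_le \<Omega>2 r B"
      by (rule rank_le_mono [OF less.prems(2)]) auto
    ultimately show ?thesis
      using less.prems(1) [of 0 r] by simp
  qed
qed

text \<open>The ranks of the diagonal blocks add up, and each of the \<open>m\<close> blocks
  contributes the loss \<open>2\<close> of \<open>rank_le_tournament\<close>.\<close>

lemma rank_le_block_triangular:
  fixes B :: "nat \<times> nat \<Rightarrow> nat \<times> nat \<Rightarrow> bit"
  assumes "finite \<Omega>" "\<And>x. x \<in> \<Omega> \<Longrightarrow> fst x < m" "rank_le \<Omega> r B"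
    and "\<And>x y. x \<in> \<Omega> \<Longrightarrow> y \<in> \<Omega> \<Longrightarrow> fst x < fst y \<Longrightarrow> B x y = 0"
    and "\<And>x y. x \<in> \<Omega> \<Longrightarrow> y \<in> \<Omega> \<Longrightarrow> fst x = fst y \<Longrightarrow> x \<noteq> y \<Longrightarrow> B x y + B y x = 1 + c x + c y"
  shows "card \<Omega> \<le> 2 * r + 2 * m"
  using assms
proof (induction m arbitrary: \<Omega> r)
  case 0
  then have "\<Omega> = {}" by auto
  then show ?case by simp
next
  case (Suc m)
  define \<Omega>1 where "\<Omega>1 = {x \<in> \<Omega>. fst x < m}"
  define \<Omega>2 where "\<Omega>2 = {x \<in> \<Omega>. fst x = m}"
  have un: "\<Omega> = \<Omega>1 \<union> \<Omega>2" "\<Omega>1 \<inter> \<Omega>2 = {}"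
    using Suc.prems(2) by (auto simp: \<Omega>1_def \<Omega>2_def less_Suc_eq)
  obtain r1 r2 where r: "r1 + r2 \<le> r" "rank_le \<Omega>1 r1 B" "rank_le \<Omega>2 r2 B"
    by (rule rank_le_triangular [OF Suc.prems(3) [unfolded un(1)]]) (use Suc.prems(4) in \<open>auto simp: \<Omega>1_def \<Omega>2_def\<close>)
  have "card \<Omega>1 \<le> 2 * r1 + 2 * m"
    using r(2) Suc.prems by (intro Suc.IH) (auto simp: \<Omega>1_def)
  moreover have "card \<Omega>2 \<le> 2 * r2 + 2"
    using Suc.prems by (intro rank_le_tournament [OF _ r(3), of c]) (auto simp: \<Omega>2_def)
  moreover have "card \<Omega> = card \<Omega>1 + card \<Omega>2"
    using un Suc.prems(1) by (metis card_Un_disjoint finite_Un)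
  ultimately show ?case
    using r(1) by simp
qed

text \<open>A nonzero entry above the diagonal blocks is used as a pivot, one with the largest distance from the
  diagonal first: then its Schur complement inherits the hypotheses, at the price of one unit of rank for two indices.
  Without such entries the matrix is block triangular.\<close>

lemma rank_le_lower_bound:
  fixes B :: "nat \<times> nat \<Rightarrow> nat \<times> nat \<Rightarrow> bit"
  assumes "finite \<Omega>" "\<And>x. x \<in> \<Omega> \<Longrightarrow> fst x < m" "rank_le \<Omega> r B"
    and "\<And>x y. x \<in> \<Omega> \<Longrightarrow> y \<in> \<Omega> \<Longrightarrow> fst x < fst y \<Longrightarrow> snd x \<noteq> snd y \<Longrightarrow> B x y = 0"
    and "\<And>x y. x \<in> \<Omega> \<Longrightarrow> y \<in> \<Omega> \<Longrightarrow> fst x = fst y \<Longrightarrow> x \<noteq> y \<Longrightarrow> B x y + B y x = 1 + c x + c y"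
  shows "card \<Omega> \<le> 2 * r + 2 * m"
  using assms
proof (induction "card \<Omega>" arbitrary: \<Omega> r B rule: less_induct)
  case less
  note zero = less.prems(4) and tour = less.prems(5)
  define D where "D = {(x, y). x \<in> \<Omega> \<and> y \<in> \<Omega> \<and> fst x < fst y \<and> snd x = snd y \<and> B x y = 1}"
  show ?case
  proof (cases "D = {}")
    case True
    have "B x y = 0" if "x \<in> \<Omega>" "y \<in> \<Omega>" "fst x < fst y" for x y
    proof (cases "snd x = snd y")
      case eq: True
      then have "(x, y) \<notin> D" using True by simp
      then show ?thesis
        using that eq by (simp add: D_def bit_not_one_iff)
    qed (use zero that in blast)
    then show ?thesis
      using less.prems by (intro rank_le_block_triangular)
  next
    case False
    define gap where "gap = (\<lambda>(x :: nat \<times> nat, y :: nat \<times> nat). fst y - fst x)"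
    have "finite D"
      by (rule finite_subset [of _ "\<Omega> \<times> \<Omega>"]) (use less.prems(1) in \<open>auto simp: D_def\<close>)
    then have "Max (gap ` D) \<in> gap ` D" "\<And>e'. e' \<in> D \<Longrightarrow> gap e' \<le> Max (gap ` D)"
      using False by simp_all
    then obtain e where e: "e \<in> D" "\<And>e'. e' \<in> D \<Longrightarrow> gap e' \<le> gap e"
      by force
    obtain x0 y0 where xy: "e = (x0, y0)" by (cases e)
    have x0: "x0 \<in> \<Omega>" "y0 \<in> \<Omega>" "fst x0 < fst y0" "snd x0 = snd y0" "B x0 y0 = 1"
      using e(1) by (auto simp: D_def xy)
    have gap: "fst y - fst x \<le> fst y0 - fst x0"
      if "x \<in> \<Omega>" "y \<in> \<Omega>" "fst x < fst y" "snd x = snd y" "B x y = 1" for x y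
      using e(2) [of "(x, y)"] that by (auto simp: D_def gap_def xy)
    define \<Omega>' where "\<Omega>' = \<Omega> - {x0, y0}"
    define B' where "B' = (\<lambda>x y. B x y + B x y0 * B x0 y)"
    have r: "0 < r" "rank_le \<Omega> (r - 1) B'"
      unfolding B'_def using rank_le_schur [OF less.prems(3) x0(1,2,5)] by auto
    have "x0 \<noteq> y0" using x0(3) by auto
    then have "2 \<le> card \<Omega>"
      using card_mono [OF less.prems(1), of "{x0, y0}"] x0 by simp
    have card: "card \<Omega>' = card \<Omega> - 2"
      using x0 less.prems(1) \<open>x0 \<noteq> y0\<close> unfolding \<Omega>'_def by (simp add: card_Diff_subset)
    \<comment> \<open>If the product is nonzero, then \<open>fst x0 < fst x\<close>: for
      \<open>snd x = snd y0\<close> by maximality of the gap, otherwise because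
      \<open>B x y0\<close> vanishes when \<open>fst x < fst y0\<close>. As
      \<open>fst x \<le> fst y\<close>, a nonzero \<open>B x0 y\<close> requires
      \<open>snd y = snd x0\<close>. Then \<open>snd x\<close> differs from \<open>snd y0\<close>,
      so \<open>fst y0 \<le> fst x\<close>, and the gap from \<open>x0\<close> to \<open>y\<close>
      exceeds the maximal one.\<close>
    have key: "B x y0 * B x0 y = 0"
      if xy: "x \<in> \<Omega>'" "y \<in> \<Omega>'" and le: "fst x \<le> fst y" and ne: "snd x \<noteq> snd y" for x y
    proof (rule ccontr)
      assume "B x y0 * B x0 y \<noteq> 0"
      then have 1: "B x y0 = 1" "B x0 y = 1"
        by (auto simp: bit_not_zero_iff)
      have x: "x \<in> \<Omega>" "x \<noteq> x0" "x \<noteq> y0" and y: "y \<in> \<Omega>" "y \<noteq> x0" "y \<noteq> y0"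
        using xy by (auto simp: \<Omega>'_def)
      have x2: "fst y0 \<le> fst x" if "snd x \<noteq> snd y0"
        using zero [OF x(1) x0(2)] that 1(1) by (cases "fst x < fst y0") auto
      have x3: "fst x0 < fst x"
      proof (cases "snd x = snd y0")
        case True
        show ?thesis
        proof (cases "fst x < fst y0")
          case lt: True
          then have "fst x0 \<le> fst x"
            using gap [OF x(1) x0(2) lt True 1(1)] x0(3) by linarith
          moreover have "fst x \<noteq> fst x0"
            using True x(2) x0(4) by (auto simp: prod_eq_iff)
          ultimately show ?thesis by simp
        qed (use x0 in simp)
      qed (use x2 x0 in linarith)
      show False
      proof (cases "snd y = snd x0")
        case True
        then have "fst y0 \<le> fst x"
          using x2 ne x0(4) by simp
        moreover have "fst y \<noteq> fst y0"
          using True y(3) x0(4) by (auto simp: prod_eq_iff)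
        ultimately have "fst y0 < fst y"
          using le by simp
        then show False
          using gap [OF x0(1) y(1) _ True [symmetric] 1(2)] x0(3) by linarith
      next
        case False
        then show False
          using zero [OF x0(1) y(1)] x3 le 1(2) by auto
      qed
    qed
    have "card \<Omega>' \<le> 2 * (r - 1) + 2 * m"
    proof (rule less.hyps)
      show "card \<Omega>' < card \<Omega>"
        using card \<open>2 \<le> card \<Omega>\<close> by simp
      show "finite \<Omega>'" "\<And>x. x \<in> \<Omega>' \<Longrightarrow> fst x < m" "rank_le \<Omega>' (r - 1) B'"
        using less.prems(1,2) rank_le_mono [OF r(2), of \<Omega>' "r - 1"] by (auto simp: \<Omega>'_def)
      show "B' x y = 0" if "x \<in> \<Omega>'" "y \<in> \<Omega>'" "fst x < fst y" "snd x \<noteq> snd y" for x y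
        using key [OF that(1,2) _ that(4)] zero [of x y] that by (simp add: B'_def \<Omega>'_def)
      show "B' x y + B' y x = 1 + c x + c y" if "x \<in> \<Omega>'" "y \<in> \<Omega>'" "fst x = fst y" "x \<noteq> y" for x y
      proof -
        have "snd x \<noteq> snd y"
          using that by (simp add: prod_eq_iff)
        then have "B x y0 * B x0 y = 0" "B y y0 * B x0 x = 0"
          using key that by simp_all
        moreover have "B x y + B y x = 1 + c x + c y"
          using tour that by (simp add: \<Omega>'_def)
        ultimately show ?thesis
          unfolding B'_def by (simp only: add_0_right)
      qed
    qed
    then show ?thesis
      using r(1) card \<open>2 \<le> card \<Omega>\<close> by simp
  qed
qed

section \<open>Comparison with the Betti number, and the intersection matrix\<close>

section \<open>Spanning sets of mod 2 homology\<close>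

definition cyc :: "nat \<Rightarrow> 'a topology \<Rightarrow> 'a chain2 \<Rightarrow> bool"
  where "cyc p X c \<longleftrightarrow> chn p X UNIV c \<and> bd p c = 0"

definition bdry :: "nat \<Rightarrow> 'a topology \<Rightarrow> 'a chain2 \<Rightarrow> bool"
  where "bdry p X c \<longleftrightarrow> (\<exists>u. chn (Suc p) X UNIV u \<and> c = bd (Suc p) u)"

lemma bdry_red2:
  assumes "mod2_boundary p X c"
  shows "bdry p X (red2 c)"
proof -
  obtain d e where "singular_chain (Suc p) X d" "c = chain_boundary (Suc p) d + frag_cmul 2 e"
    using assms by (auto simp: mod2_boundary_def)
  then show ?thesis
    unfolding bdry_def using chn_mono [OF chn_red2 subset_UNIV]
    by (intro exI [of _ "red2 d"]) (simp add: red2_add red2_cmul red2_boundary)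
qed

lemma mod2_cycle_lift2:
  assumes "cyc p X c"
  shows "mod2_cycle p X (lift2 c)"
proof -
  have c: "singular_chain p X (lift2 c)"
    using assms singular_chain_lift2 [of p X UNIV c] by (simp add: cyc_def)
  have "red2 (chain_boundary p (lift2 c)) = 0"
    using assms by (simp add: red2_boundary cyc_def)
  then obtain e where e: "chain_boundary p (lift2 c) = frag_cmul 2 e" "keys e \<subseteq> keys (chain_boundary p (lift2 c))"
    by (auto simp: red2_eq_0_iff)
  then have "singular_chain (p - 1) X e"
    using singular_chain_boundary [OF c] by (auto simp: singular_chain_def)
  then show ?thesis
    using c e(1) by (auto simp: mod2_cycle_def)
qed

text \<open>The cosets are represented by integral lifts of cycles mod 2, so that independence can
  be tested on formal sums.\<close>

lemma Z2_independent_classes: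
  fixes X :: "'a topology"
  assumes fin: "finite E" and cyc: "\<And>e. e \<in> E \<Longrightarrow> cyc p X e"
    and ind: "\<And>T. T \<subseteq> E \<Longrightarrow> bdry p X (\<Sum>T) \<Longrightarrow> T = {}"
  shows "enat (card E) \<le> mod2_betti p X"
proof -
  let ?C = "mod2_cycle_group p X" and ?H = "Collect (mod2_boundary p X)" and ?G = "mod2_homology_group p X"
  interpret C: comm_group ?C
    by (rule comm_group_mod2_cycle_group)
  interpret N: normal ?H ?C
    using C.normal_iff_subgroup mod2_boundary_subgroup by blast
  interpret G: comm_group ?G
    by (rule comm_group_mod2_homology_group)
  define cls where "cls = (\<lambda>e. ?H #>\<^bsub>?C\<^esub> lift2 e)"
  have carr: "?H #>\<^bsub>?C\<^esub> c \<in> carrier ?G" if "mod2_cycle p X c" for c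
    using that unfolding mod2_homology_group_def by (auto simp: FactGroup_def RCOSETS_def)
  have lc: "mod2_cycle p X (lift2 e)" if "e \<in> E" for e
    by (rule mod2_cycle_lift2 [OF cyc [OF that]])
  have prod: "finprod ?G cls T = ?H #>\<^bsub>?C\<^esub> (\<Sum>e\<in>T. lift2 e) \<and> mod2_cycle p X (\<Sum>e\<in>T. lift2 e)" if "T \<subseteq> E" for T
  proof -
    have "finite T"
      using that fin finite_subset by blast
    then show ?thesis
      using that
    proof (induction T rule: finite_induct)
      case empty
      have "\<one>\<^bsub>?C\<^esub> = 0" "mod2_cycle p X 0"
        by (simp add: mod2_cycle_group_def, simp add: mod2_cycle_def exI [of _ 0])
      moreover have "\<one>\<^bsub>?G\<^esub> = ?H"
        by (simp add: mod2_homology_group_def)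
      ultimately show ?case
        using C.coset_mult_one [OF N.subset] by simp
    next
      case (insert e T)
      have e: "mod2_cycle p X (lift2 e)" and T: "mod2_cycle p X (\<Sum>e\<in>T. lift2 e)"
        using lc insert by auto
      have "finprod ?G cls (insert e T) = cls e \<otimes>\<^bsub>?G\<^esub> finprod ?G cls T"
        using insert.hyps insert.prems lc by (intro G.finprod_insert) (auto simp: cls_def intro!: carr)
      also have "\<dots> = ?H #>\<^bsub>?C\<^esub> (lift2 e + (\<Sum>e\<in>T. lift2 e))"
        using insert e T N.rcos_sum [of "lift2 e" "\<Sum>e\<in>T. lift2 e"]
        by (simp add: cls_def mod2_homology_group_def)
      finally show ?case
        using insert.hyps C.m_closed [of "lift2 e" "\<Sum>e\<in>T. lift2 e"] e T by simp
    qed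
  qed
  have trivial: "T = {}" if T: "T \<subseteq> E" "finprod ?G cls T = \<one>\<^bsub>?G\<^esub>" for T
  proof -
    have "?H #>\<^bsub>?C\<^esub> (\<Sum>e\<in>T. lift2 e) = ?H"
      using prod [OF T(1)] T(2) by (simp add: mod2_homology_group_def)
    then have "(\<Sum>e\<in>T. lift2 e) \<in> ?H"
      using C.coset_join1 [OF _ _ N.subgroup_axioms] prod [OF T(1)] by simp
    then have "bdry p X (red2 (\<Sum>e\<in>T. lift2 e))"
      by (intro bdry_red2) simp
    then show ?thesis
      using ind [OF T(1)] by (simp add: red2_sum)
  qed
  \<comment> \<open>Two members with the same class would have trivial product, by exponent two,
    against the independence of the pair.\<close>
  have inj: "inj_on cls E"
  proof (rule inj_onI)
    fix e f assume ef: "e \<in> E" "f \<in> E" "cls e = cls f"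
    show "e = f"
    proof (rule ccontr)
      assume "e \<noteq> f"
      have c: "cls e \<in> carrier ?G" "cls f \<in> carrier ?G"
        using carr lc ef by (simp_all add: cls_def)
      have "finprod ?G cls {f} = cls f"
        using G.finprod_insert [of "{}" f cls] c by simp
      then have "finprod ?G cls {e, f} = cls e \<otimes>\<^bsub>?G\<^esub> cls f"
        using G.finprod_insert [of "{f}" e cls] c \<open>e \<noteq> f\<close> by simp
      also have "\<dots> = \<one>\<^bsub>?G\<^esub>"
        unfolding ef(3) by (rule mod2_homology_group_exponent) (use carr lc ef in \<open>simp add: cls_def\<close>)
      finally show False
        using trivial [of "{e, f}"] ef by simp
    qed
  qed
  have "Z2_independent ?G (cls ` E)"
    unfolding Z2_independent_def
  proof (intro conjI allI impI)
    show "finite (cls ` E)" "cls ` E \<subseteq> carrier ?G"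
      using fin carr lc by (auto simp: cls_def)
    fix T assume T: "T \<subseteq> cls ` E" "finprod ?G (\<lambda>x. x) T = \<one>\<^bsub>?G\<^esub>"
    obtain T' where T': "T' \<subseteq> E" "T = cls ` T'"
      using T(1) by (meson subset_imageE)
    have "finprod ?G (\<lambda>x. x) T = finprod ?G cls T'"
      unfolding T'(2) using T'(1) carr lc
      by (intro G.finprod_reindex inj_on_subset [OF inj]) (auto simp: cls_def)
    then show "T = {}"
      using trivial [OF T'(1)] T(2) T'(2) by simp
  qed
  then have "enat (card (cls ` E)) \<le> mod2_betti p X"
    unfolding mod2_betti_def Z2_dim_def by (intro SUP_upper) simp
  then show ?thesis
    by (simp add: card_image inj)
qed

text \<open>An independent family of maximal size spans: adjoining another cycle creates a relation,
  and this must involve the new cycle. The maximum exists because sizes are bounded by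
  \<open>b\<close>.\<close>

lemma finite_betti_spanning:
  assumes "mod2_betti p X = enat b"
  obtains E where "finite E" "card E \<le> b" "\<And>e. e \<in> E \<Longrightarrow> cyc p X e"
    "\<And>c. cyc p X c \<Longrightarrow> \<exists>T u. T \<subseteq> E \<and> chn (Suc p) X UNIV u \<and> c = \<Sum>T + bd (Suc p) u"
proof -
  define P where "P = (\<lambda>E. finite E \<and> (\<forall>e\<in>E. cyc p X e) \<and> (\<forall>T\<subseteq>E. bdry p X (\<Sum>T) \<longrightarrow> T = {}))"
  have bound: "card E \<le> b" if "P E" for E
    using Z2_independent_classes [of E p X] that assms unfolding P_def by auto
  have "P {}"
    by (simp add: P_def)
  then obtain E where E: "P E" "\<And>E'. P E' \<Longrightarrow> card E' \<le> card E"
    using ex_has_greatest_nat [of P "{}" card "Suc b"] bound by (metis less_Suc_eq_le)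
  show ?thesis
  proof
    show "finite E" "card E \<le> b" "\<And>e. e \<in> E \<Longrightarrow> cyc p X e"
      using E(1) bound by (auto simp: P_def)
    fix c assume c: "cyc p X c"
    show "\<exists>T u. T \<subseteq> E \<and> chn (Suc p) X UNIV u \<and> c = \<Sum>T + bd (Suc p) u"
    proof (cases "c \<in> E")
      case True
      then show ?thesis
        by (intro exI [of _ "{c}"] exI [of _ 0]) simp
    next
      case False
      then have "\<not> P (insert c E)"
        using E(2) [of "insert c E"] E(1) by (auto simp: P_def)
      then obtain T where T: "T \<subseteq> insert c E" "bdry p X (\<Sum>T)" "T \<noteq> {}"
        using E(1) c by (auto simp: P_def)
      have "c \<in> T"
        using T E(1) unfolding P_def by (metis subset_insert)
      have "finite T"
        using T(1) E(1) finite_subset unfolding P_def by blast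
      obtain u where u: "chn (Suc p) X UNIV u" "\<Sum>T = bd (Suc p) u"
        using T(2) by (auto simp: bdry_def)
      have "\<Sum>T = c + \<Sum>(T - {c})"
        using \<open>c \<in> T\<close> \<open>finite T\<close> by (simp add: sum.remove)
      then have "c = \<Sum>(T - {c}) + bd (Suc p) u"
        using u(2) by (metis add.commute add_left_self)
      moreover have "T - {c} \<subseteq> E"
        using T(1) by blast
      ultimately show ?thesis
        using u(1) by blast
    qed
  qed
qed

section \<open>The intersection matrix\<close>

abbreviation eX :: "nat \<Rightarrow> nat \<Rightarrow> cells" where "eX v w \<equiv> cX v + cX w"
abbreviation eY :: "nat \<Rightarrow> nat \<Rightarrow> cells" where "eY v w \<equiv> cY v + cY w"

definition cyX :: "nat set \<Rightarrow> nat \<Rightarrow> cells \<Rightarrow> bool"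
  where "cyX V n P \<longleftrightarrow> dJ P = 0 \<and> (\<forall>c\<in>keys P. \<exists>a. c = Cell a [] \<and> length a = n \<and> set a \<subseteq> V)"

definition cyY :: "nat set \<Rightarrow> nat \<Rightarrow> cells \<Rightarrow> bool"
  where "cyY V n P \<longleftrightarrow> dJ P = 0 \<and> (\<forall>c\<in>keys P. \<exists>a. c = Cell [] a \<and> length a = n \<and> set a \<subseteq> V)"

lemma cyX_mono: "cyX V n P \<Longrightarrow> V \<subseteq> W \<Longrightarrow> cyX W n P" and cyY_mono: "cyY V n P \<Longrightarrow> V \<subseteq> W \<Longrightarrow> cyY W n P"
  unfolding cyX_def cyY_def by (meson order_trans)+

lemma cyX_1: "cyX V 0 1" and cyY_1: "cyY V 0 1"
  by (auto simp: cyX_def cyY_def zero_cell_def dJ_unit simp flip: single_one)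

lemma cyX_eX: "v \<in> V \<Longrightarrow> w \<in> V \<Longrightarrow> cyX V 1 (eX v w)" and cyY_eY: "v \<in> V \<Longrightarrow> w \<in> V \<Longrightarrow> cyY V 1 (eY v w)"
  by (auto simp: cyX_def cyY_def dest!: keys_add_cases)

lemma cyX_mult:
  assumes "cyX V n P" "cyX V m Q"
  shows "cyX V (n + m) (P * Q)"
  unfolding cyX_def
proof (intro conjI ballI)
  show "dJ (P * Q) = 0"
    using assms by (simp add: dJ_mult cyX_def)
  fix c assume "c \<in> keys (P * Q)"
  then obtain a b where "a \<in> keys P" "b \<in> keys Q" "c = a + b"
    using keys_mult by blast
  moreover from this obtain a' b' where "a = Cell a' []" "length a' = n" "set a' \<subseteq> V" "b = Cell b' []" "length b' = m" "set b' \<subseteq> V"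
    using assms unfolding cyX_def by blast
  ultimately show "\<exists>a. c = Cell a [] \<and> length a = n + m \<and> set a \<subseteq> V"
    by (intro exI [of _ "a' @ b'"]) simp
qed

lemma cyY_mult:
  assumes "cyY V n P" "cyY V m Q"
  shows "cyY V (n + m) (P * Q)"
  unfolding cyY_def
proof (intro conjI ballI)
  show "dJ (P * Q) = 0"
    using assms by (simp add: dJ_mult cyY_def)
  fix c assume "c \<in> keys (P * Q)"
  then obtain a b where "a \<in> keys P" "b \<in> keys Q" "c = a + b"
    using keys_mult by blast
  moreover from this obtain a' b' where "a = Cell [] a'" "length a' = n" "set a' \<subseteq> V" "b = Cell [] b'" "length b' = m" "set b' \<subseteq> V"
    using assms unfolding cyY_def by blast
  ultimately show "\<exists>a. c = Cell [] a \<and> length a = n + m \<and> set a \<subseteq> V"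
    by (intro exI [of _ "a' @ b'"]) simp
qed

lemma cyY_cyX_commute:
  assumes "cyX V n P" "cyY W m Q"
  shows "Q * P = P * Q"
proof -
  have "Q * P = ext2 (\<lambda>b. ext2 (\<lambda>a. unit2 (b + a)) P) Q"
    by (rule sum2_mult)
  also have "\<dots> = ext2 (\<lambda>b. ext2 (\<lambda>a. unit2 (a + b)) P) Q"
  proof (intro ext2_cong)
    fix b a assume "b \<in> keys Q" "a \<in> keys P"
    then obtain a' b' where "a = Cell a' []" "b = Cell [] b'"
      using assms unfolding cyX_def cyY_def by blast
    then show "unit2 (b + a) = unit2 (a + b)"
      by simp
  qed
  also have "\<dots> = ext2 (\<lambda>a. ext2 (\<lambda>b. unit2 (a + b)) Q) P"
    unfolding ext2_def by (rule sum.swap)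
  finally show ?thesis
    by (simp add: sum2_mult)
qed

text \<open>One entry for each choice of a summand of \<open>hx_expand\<close> in every triple: the
  list has \<open>2 ^ length ts\<close> entries, while the product of hexagons has
  \<open>6 ^ length ts\<close> cells.\<close>

fun hx_factors :: "(nat \<times> nat \<times> nat) list \<Rightarrow> (cells \<times> cells) list"
  where "hx_factors [] = [(1, 1)]"
  | "hx_factors ((a, b, c) # ts) = map (\<lambda>(z, w). (eX a b * z, eY a c * w)) (hx_factors ts)
      @ map (\<lambda>(z, w). (eX a c * z, eY a b * w)) (hx_factors ts)"

lemma length_hx_factors: "length (hx_factors ts) = 2 ^ length ts"
  by (induction ts rule: hx_factors.induct) simp_all

lemma hx_factors_cycles: "(z, w) \<in> set (hx_factors ts) \<Longrightarrow> cyX (triples_verts ts) (length ts) z \<and> cyY (triples_verts ts) (length ts) w"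
proof (induction ts arbitrary: z w rule: hx_factors.induct)
  case 1
  then show ?case by (simp add: cyX_1 cyY_1)
next
  case (2 a b c ts)
  let ?V = "triples_verts ((a, b, c) # ts)"
  have *: "cyX ?V 1 (eX a b)" "cyX ?V 1 (eX a c)" "cyY ?V 1 (eY a b)" "cyY ?V 1 (eY a c)"
    by (intro cyX_eX cyY_eY; simp)+
  from "2.prems" obtain z' w' where zw: "(z', w') \<in> set (hx_factors ts)"
      "z = eX a b * z' \<and> w = eY a c * w' \<or> z = eX a c * z' \<and> w = eY a b * w'"
    by auto
  have z': "cyX ?V (length ts) z'" and w': "cyY ?V (length ts) w'"
    using "2.IH"(1) [OF zw(1)] by (auto elim!: cyX_mono cyY_mono)
  have "cyX ?V (1 + length ts) (eX a b * z')" "cyX ?V (1 + length ts) (eX a c * z')"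
     "cyY ?V (1 + length ts) (eY a b * w')" "cyY ?V (1 + length ts) (eY a c * w')"
    by (rule cyX_mult [OF *(1) z'] cyX_mult [OF *(2) z'] cyY_mult [OF *(4) w'] cyY_mult [OF *(3) w'])+
  then show ?case
    using zw(2) by auto
qed

text \<open>\<open>X\<close>-cycles and \<open>Y\<close>-cycles occupy different factors of a cell
  and therefore commute, which allows the pairs to be regrouped.\<close>

lemma hprod_hx_factors: "hprod ts = (\<Sum>(z, w)\<leftarrow>hx_factors ts. z * w)"
proof (induction ts rule: hx_factors.induct)
  case (2 a b c ts)
  have "hx (a, b, c) * (\<Sum>(z, w)\<leftarrow>L. z * w) =
      (\<Sum>(z, w)\<leftarrow>map (\<lambda>(z, w). (eX a b * z, eY a c * w)) L @ map (\<lambda>(z, w). (eX a c * z, eY a b * w)) L. z * w)"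
    if "set L \<subseteq> set (hx_factors ts)" for L
    using that
  proof (induction L)
    case (Cons p L)
    obtain z w where p: "p = (z, w)" by (cases p)
    then have z: "cyX (triples_verts ts) (length ts) z"
      using Cons.prems hx_factors_cycles by auto
    have "cyY {a, b, c} 1 (eY a c)" "cyY {a, b, c} 1 (eY a b)"
      by (intro cyY_eY; simp)+
    then have "eY a c * z = z * eY a c" "eY a b * z = z * eY a b"
      using cyY_cyX_commute [OF z] by blast+
    then have "hx (a, b, c) * (z * w) = (eX a b * z) * (eY a c * w) + (eX a c * z) * (eY a b * w)"
      unfolding hx_expand distrib_right [of "eX a b * eY a c"] by (metis (no_types, lifting) mult.assoc)
    then show ?case
      using Cons by (simp add: p distrib_left ac_simps del: hx.simps)
  qed simp
  then show ?case
    using 2 by (simp del: hx.simps)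
qed simp

lemma rank_le_finite_sum:
  assumes "finite E" "\<And>x y. x \<in> \<Omega> \<Longrightarrow> y \<in> \<Omega> \<Longrightarrow> B x y = (\<Sum>e\<in>E. f e x * g e y)"
  shows "rank_le \<Omega> (card E) B"
proof -
  obtain L where L: "set L = E" "distinct L" "length L = card E"
    using finite_distinct_list [OF assms(1)] distinct_card by metis
  have "dyad_sum (map (\<lambda>e. (f e, g e)) L) x y = (\<Sum>e\<in>E. f e x * g e y)" for x y
    using L(1,2) by (simp add: dyad_sum_def o_def sum_list_distinct_conv_sum_set flip: L(1))
  then show ?thesis
    unfolding rank_le_def using assms(2) L(3) by (intro exI [of _ "map (\<lambda>e. (f e, g e)) L"]) simp
qed

lemma rank_le_sum_list:
  assumes "\<And>p. p \<in> set L \<Longrightarrow> rank_le \<Omega> r (B p)"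
  shows "rank_le \<Omega> (length L * r) (\<lambda>x y. \<Sum>p\<leftarrow>L. B p x y)"
  using assms
proof (induction L)
  case Nil
  then show ?case
    by (auto simp: rank_le_def intro: exI [of _ "[]"])
next
  case (Cons p L)
  then show ?case
    using rank_le_add [of \<Omega> r "B p" "length L * r"] by simp
qed

fun consecutive_triples :: "nat \<Rightarrow> nat \<Rightarrow> (nat \<times> nat \<times> nat) list"
  where "consecutive_triples v 0 = []" | "consecutive_triples v (Suc r) = (v, v + 1, v + 2) # consecutive_triples (v + 3) r"

lemma length_consecutive_triples [simp]: "length (consecutive_triples v r) = r"
  by (induction r arbitrary: v) simp_all

lemma triples_verts_consecutive_triples: "triples_verts (consecutive_triples v r) = {v..<v + 3 * r}"
  by (induction r arbitrary: v) auto

lemma disjoint_triples_consecutive_triples: "disjoint_triples (consecutive_triples v r)"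
  by (induction r arbitrary: v) (auto simp: triples_verts_consecutive_triples)

context skeleton_embedding
begin

lemma cycleX_iff: "cycleX z \<longleftrightarrow> cyX {..N} (Suc k) z" and cycleY_iff: "cycleY w \<longleftrightarrow> cyY {..N} (Suc k) w"
  by (simp_all add: cycleX_def cyX_def cycleY_def cyY_def)

lemma \<theta>_sum_list:
  assumes "\<And>P. P \<in> set L \<Longrightarrow> admissible P"
  shows "\<theta> (sum_list L) = (\<Sum>P\<leftarrow>L. \<theta> P) \<and> admissible (sum_list L)"
  using assms
proof (induction L)
  case Nil
  then show ?case
    by (simp add: admissible_def)
next
  case (Cons P L)
  then show ?case
    by (simp add: \<theta>_add admissible_add)
qed

text \<open>The row \<open>Z x\<close> enters only through its coordinates in a spanning family of
  at most \<open>b\<close> classes, and each class accounts for one product of a row function and a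
  column function.\<close>

lemma rank_le_\<theta>:
  assumes b: "mod2_betti k M = enat b"
    and Z: "\<And>x. x \<in> \<Omega> \<Longrightarrow> cycleX (Z x)" and W: "\<And>y. y \<in> \<Omega> \<Longrightarrow> cycleY (W y)"
  shows "rank_le \<Omega> b (\<lambda>x y. \<theta> (Z x * W y))"
proof -
  obtain E where E: "finite E" "card E \<le> b" "\<And>e. e \<in> E \<Longrightarrow> cyc k M e"
    and span: "\<And>c. cyc k M c \<Longrightarrow> \<exists>T u. T \<subseteq> E \<and> chn (Suc k) M UNIV u \<and> c = \<Sum>T + bd (Suc k) u"
    by (rule finite_betti_spanning [OF b]) blast
  have "\<exists>T u. T \<subseteq> E \<and> chn (Suc k) M UNIV u \<and> push k F (ext2 schX (Z x)) = \<Sum>T + bd (Suc k) u" if x: "x \<in> \<Omega>" for x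
  proof (rule span)
    have z: "chn k K UNIV (ext2 schX (Z x))" "bd k (ext2 schX (Z x)) = 0"
      using cycleX_realize [OF Z [OF x]] by (simp_all add: chn_subtopology)
    have "chn k M UNIV (push k F (ext2 schX (Z x)))"
      by (rule chn_push [OF z(1)]) (simp_all add: F)
    then show "cyc k M (push k F (ext2 schX (Z x)))"
      using bd_push [OF z(1), of F] z(2) by (simp add: cyc_def)
  qed
  then obtain T u where T: "\<And>x. x \<in> \<Omega> \<Longrightarrow> T x \<subseteq> E" "\<And>x. x \<in> \<Omega> \<Longrightarrow> chn (Suc k) M UNIV (u x)"
      "\<And>x. x \<in> \<Omega> \<Longrightarrow> push k F (ext2 schX (Z x)) = \<Sum>(T x) + bd (Suc k) (u x)"
    by metis
  have "rank_le \<Omega> (card E) (\<lambda>x y. \<theta> (Z x * W y))"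
  proof (rule rank_le_finite_sum [OF E(1), where f = "\<lambda>e x. of_bool (e \<in> T x)" and g = "\<lambda>e y. t (cr k k e (ext2 schY (W y)))"])
    fix x y assume xy: "x \<in> \<Omega>" "y \<in> \<Omega>"
    have "\<theta> (Z x * W y) = (\<Sum>e\<in>T x. t (cr k k e (ext2 schY (W y))))"
      using E(3) T(1) [OF xy(1)] by (intro \<theta>_cycles [OF Z [OF xy(1)] W [OF xy(2)] _ T(2) [OF xy(1)] T(3) [OF xy(1)]]) (auto simp: cyc_def)
    also have "\<dots> = (\<Sum>e\<in>E. of_bool (e \<in> T x) * t (cr k k e (ext2 schY (W y))))"
      using E(1) T(1) [OF xy(1)] by (intro sum.mono_neutral_cong_left) auto
    finally show "\<theta> (Z x * W y) = (\<Sum>e\<in>E. of_bool (e \<in> T x) * t (cr k k e (ext2 schY (W y))))" .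
  qed
  then show ?thesis
    by (rule rank_le_mono [OF _ order_refl E(2)])
qed

lemma fits_eXY: "{v, w, v', w'} \<subseteq> V \<Longrightarrow> fits V 1 2 (eX v w * eY v' w')"
  unfolding distrib_left distrib_right by (intro fits_add fits_cXY) auto

lemma off_diagonal_eXY: "{v, w} \<inter> {v', w'} = {} \<Longrightarrow> off_diagonal (eX v w * eY v' w')"
  unfolding distrib_left distrib_right by (intro off_diagonal_add off_diagonal_cXY) auto

lemma dJ_eXY: "dJ (eX v w * eY v' w') = 0"
  by (simp add: dJ_mult)

text \<open>The vertices are a sequence of length \<open>m + 2\<close>, two base vertices \<open>b0\<close> and \<open>b0'\<close> with \<open>n\<close> partners,
  and \<open>k - 1\<close> triples.  Replacing \<open>b0'\<close> by \<open>b0\<close> changes a diagonal block by terms depending on one index only (\<open>c\<close>), and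
  the symmetrized entries then contain a further hexagon on \<open>b0\<close> and two partners.\<close>

lemma betti_bound:
  assumes b: "mod2_betti k M = enat b" and N: "m + 4 + n + 3 * (k - 1) \<le> Suc N"
  shows "m * n \<le> 2 ^ k * b + 2 * m"
proof -
  define b0 b0' v where "b0 = m + 2" and "b0' = m + 3" and "v = (\<lambda>j. m + 4 + j)"
  define ts where "ts = consecutive_triples (m + 4 + n) (k - 1)"
  let ?H = "hprod ts"
  \<comment> \<open>The shift by one makes the two pairs disjoint for \<open>i < p\<close>, and for
    \<open>i = p\<close> they meet exactly in \<open>Suc i\<close>.\<close>
  define A where "A = (\<lambda>i p. eX i (Suc i) * eY (Suc p) (Suc (Suc p)))"
  \<comment> \<open>Different base vertices on the two sides make the pairs disjoint unless
    \<open>j = q\<close>.\<close>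
  define C where "C = (\<lambda>j q. eX b0 (v j) * eY b0' (v q))"
  \<comment> \<open>The change of base vertex: \<open>C j q + C0 j\<close> has base vertex
    \<open>b0\<close> on both sides, and symmetrized in \<open>j\<close> and \<open>q\<close> it is
    a hexagon on \<open>b0\<close> and the two partners.\<close>
  define C0 where "C0 = (\<lambda>j. eX b0 (v j) * eY b0' b0)"
  define P where "P = (\<lambda>(i, j) (p, q). A i p * C j q * ?H)"
  define c where "c = (\<lambda>(i, j). \<theta> (A i i * C0 j * ?H))"
  let ?\<Omega> = "{..<m} \<times> {..<n}"
  have ts: "disjoint_triples ts" "triples_verts ts = {m + 4 + n..<m + 4 + n + 3 * (k - 1)}" "length ts = k - 1"
    by (simp_all add: ts_def disjoint_triples_consecutive_triples triples_verts_consecutive_triples)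
  have fH: "fits (triples_verts ts) (k - 1) (2 * (k - 1)) ?H" and oH: "off_diagonal ?H"
    using fits_hprod [of ts] off_diagonal_hprod ts by simp_all
  have fA: "fits {..<m + 2} 1 2 (A i p)" if "i < m" "p < m" for i p
    unfolding A_def using that by (intro fits_eXY) auto
  have fC: "fits {m + 2..<m + 4 + n} 1 2 (C j q)" if "j < n" "q < n" for j q
    unfolding C_def b0_def b0'_def v_def using that by (intro fits_eXY) auto
  have fC0: "fits {m + 2..<m + 4 + n} 1 2 (C0 j)" if "j < n" for j
    unfolding C0_def b0_def b0'_def v_def using that by (intro fits_eXY) auto
  have VN: "{..<m + 2} \<union> {m + 2..<m + 4 + n} \<union> triples_verts ts \<subseteq> {..N}"
    using N by (auto simp: ts(2))
  have fits3: "fits {..N} (Suc k) (2 * k + 2) (R * S * ?H)"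
    if "fits {..<m + 2} 1 2 R" "fits {m + 2..<m + 4 + n} 1 2 S" for R S
  proof -
    have "1 + 1 + (k - 1) = Suc k" "2 + 2 + 2 * (k - 1) = 2 * k + 2"
      using k by simp_all
    then show ?thesis
      using fits_mono [OF fits_mult [OF fits_mult [OF that] fH] VN order_refl] by (simp only:)
  qed
  have adm3: "admissible (R * S * ?H)" if "fits {..<m + 2} 1 2 R" "fits {m + 2..<m + 4 + n} 1 2 S" "dJ R = 0" "dJ S = 0" for R S
    using fits3 [OF that(1,2)] that(3,4) by (simp add: admissible_def dJ_mult)
  have off_diagonal3: "\<theta> (R * S * ?H) = 0" if "fits {..<m + 2} 1 2 R" "fits {m + 2..<m + 4 + n} 1 2 S" "off_diagonal R" "off_diagonal S" for R S
  proof -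
    have "off_diagonal (R * S)"
      by (rule off_diagonal_mult [OF that(3,4,1,2)]) auto
    then have "off_diagonal (R * S * ?H)"
      by (rule off_diagonal_mult [OF _ oH fits_mult [OF that(1,2)] fH]) (auto simp: ts(2))
    then show ?thesis
      by (rule \<theta>_off_diagonal [OF fits3 [OF that(1,2)]])
  qed
  have dA: "dJ (A i p) = 0" and dC: "dJ (C i p) = 0" and dC0: "dJ (C0 i) = 0" for i p
    unfolding A_def C_def C0_def by (rule dJ_eXY)+
  have zero: "\<theta> (P x y) = 0" if xy: "x \<in> ?\<Omega>" "y \<in> ?\<Omega>" "fst x < fst y" "snd x \<noteq> snd y" for x y
  proof -
    obtain i j p q where ij: "x = (i, j)" "y = (p, q)" by (cases x; cases y)
    have "off_diagonal (A i p)" "off_diagonal (C j q)"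
      using xy unfolding A_def C_def b0_def b0'_def v_def ij by (intro off_diagonal_eXY; auto)+
    then show ?thesis
      using xy off_diagonal3 [OF fA fC] by (simp add: P_def ij)
  qed
  have tour: "\<theta> (P x y) + \<theta> (P y x) = 1 + c x + c y"
    if xy: "x \<in> ?\<Omega>" "y \<in> ?\<Omega>" "fst x = fst y" "x \<noteq> y" for x y
  proof -
    obtain i j q where ij: "x = (i, j)" "y = (i, q)" using xy(3) by (cases x; cases y) auto
    have i: "i < m" "j < n" "q < n" "j \<noteq> q"
      using xy by (auto simp: ij)
    let ?T = "(b0, v j, v q)"
    have T: "disjoint_triples (?T # ts)" "triples_verts (?T # ts) \<subseteq> {..N}" "length (?T # ts) = k" "Suc i \<notin> triples_verts (?T # ts)"
      using i ts k N by (auto simp: b0_def v_def)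
    define R where "R = cX i * cY (Suc i) + cX i * cY (Suc (Suc i)) + cX (Suc i) * cY (Suc (Suc i))"
    have A: "A i i = cX (Suc i) * cY (Suc i) + R"
      unfolding A_def R_def by (simp add: algebra_simps)
    have fR: "fits {..<m + 2} 1 2 R" and oR: "off_diagonal R"
      unfolding R_def using i by (intro fits_add fits_cXY off_diagonal_add off_diagonal_cXY; simp)+
    have fT: "fits {m + 2..<m + 4 + n} 1 2 (hx ?T)"
      by (rule fits_mono [OF fits_hx]) (use i in \<open>auto simp: b0_def v_def\<close>)
    have oT: "off_diagonal (hx ?T)"
      by (rule off_diagonal_hx) (use T(1) in simp)
    have C: "C j q + C q j = C0 j + C0 q + hx ?T"
      unfolding C_def C0_def hx_expand by (simp add: algebra_simps)
    have "P x y + P y x = A i i * (C j q + C q j) * ?H"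
      by (simp add: P_def ij algebra_simps)
    \<comment> \<open>Three kinds of terms: those with \<open>C0\<close> depend on one index only,
      the term at the repeated vertex \<open>Suc i\<close> has \<open>k\<close> hexagons and value
      \<open>1\<close> by \<open>\<theta>_star\<close>, and the remainder avoids the
      diagonal.\<close>
    also have "\<dots> = (A i i * C0 j * ?H + A i i * C0 q * ?H) + (cX (Suc i) * cY (Suc i) * hprod (?T # ts) + R * hx ?T * ?H)"
      unfolding C A by (simp add: algebra_simps del: hx.simps)
    finally have eq: "P x y + P y x = \<dots>" .
    have a1: "admissible (P x y)" "admissible (P y x)" "admissible (A i i * C0 j * ?H)" "admissible (A i i * C0 q * ?H)"
      using adm3 [OF fA fC dA dC] adm3 [OF fA fC0 dA dC0] i by (simp_all add: P_def ij)
    have a2: "admissible (cX (Suc i) * cY (Suc i) * hprod (?T # ts))" "\<theta> (cX (Suc i) * cY (Suc i) * hprod (?T # ts)) = 1"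
      using i N by (intro \<theta>_star T; simp)+
    have a3: "admissible (R * hx ?T * ?H)" "\<theta> (R * hx ?T * ?H) = 0"
    proof -
      have "off_diagonal (R * hx ?T)"
        by (rule off_diagonal_mult [OF oR oT fR fT]) auto
      then have "off_diagonal (R * hx ?T * ?H)"
        by (rule off_diagonal_mult [OF _ oH fits_mult [OF fR fT] fH]) (auto simp: ts(2))
      then show "admissible (R * hx ?T * ?H)"
        by (rule admissible_off_diagonal [OF fits3 [OF fR fT]])
      show "\<theta> (R * hx ?T * ?H) = 0"
        by (rule off_diagonal3 [OF fR fT oR oT])
    qed
    have "\<theta> (P x y) + \<theta> (P y x) = \<theta> (P x y + P y x)"
      by (rule \<theta>_add [OF a1(1,2), symmetric])
    also have "\<dots> = (\<theta> (A i i * C0 j * ?H) + \<theta> (A i i * C0 q * ?H)) + (1 + 0)"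
      unfolding eq \<theta>_add [OF admissible_add [OF a1(3,4)] admissible_add [OF a2(1) a3(1)]] \<theta>_add [OF a1(3,4)] \<theta>_add [OF a2(1) a3(1)] a2(2) a3(2) ..
    finally show ?thesis
      by (simp add: c_def ij ac_simps)
  qed
  have "rank_le ?\<Omega> (length (hx_factors ts) * b) (\<lambda>x y. \<theta> (P x y))"
  proof -
    \<comment> \<open>For each summand of the hexagon expansion the entry separates into an
      \<open>X\<close>-cycle given by the row and a \<open>Y\<close>-cycle given by the column, so
      the summand has rank at most \<open>b\<close>.\<close>
    define Z where "Z = (\<lambda>(z :: cells, w :: cells) (i, j). eX i (Suc i) * eX b0 (v j) * z :: cells)"
    define W where "W = (\<lambda>(z :: cells, w :: cells) (p, q). eY (Suc p) (Suc (Suc p)) * eY b0' (v q) * w :: cells)"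
    have Z: "cycleX (Z zw x)" and W: "cycleY (W zw x)" if zw: "zw \<in> set (hx_factors ts)" and x: "x \<in> ?\<Omega>" for zw x
    proof -
      obtain z w i j where zw': "zw = (z, w)" "x = (i, j)" by (cases zw; cases x)
      have zw1: "cyX {..N} (k - 1) z" "cyY {..N} (k - 1) w"
        using hx_factors_cycles [of z w ts] zw VN ts(3) by (auto simp: zw' elim!: cyX_mono cyY_mono)
      have "cyX {..N} 1 (eX i (Suc i))" "cyX {..N} 1 (eX b0 (v j))"
          "cyY {..N} 1 (eY (Suc i) (Suc (Suc i)))" "cyY {..N} 1 (eY b0' (v j))"
        using x N unfolding zw' b0_def b0'_def v_def by (intro cyX_eX cyY_eY; simp)+
      then have "cyX {..N} (1 + 1 + (k - 1)) (Z zw x)" "cyY {..N} (1 + 1 + (k - 1)) (W zw x)"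
        unfolding Z_def W_def zw' prod.case using zw1 by (blast intro: cyX_mult cyY_mult)+
      then show "cycleX (Z zw x)" "cycleY (W zw x)"
        using k by (simp_all add: cycleX_iff cycleY_iff)
    qed
    have "rank_le ?\<Omega> b (\<lambda>x y. \<theta> (Z zw x * W zw y))" if "zw \<in> set (hx_factors ts)" for zw
      using Z W that by (intro rank_le_\<theta> [OF b])
    then have "rank_le ?\<Omega> (length (hx_factors ts) * b) (\<lambda>x y. \<Sum>zw\<leftarrow>hx_factors ts. \<theta> (Z zw x * W zw y))"
      by (rule rank_le_sum_list)
    moreover have "(\<Sum>zw\<leftarrow>hx_factors ts. \<theta> (Z zw x * W zw y)) = \<theta> (P x y)" if xy: "x \<in> ?\<Omega>" "y \<in> ?\<Omega>" for x y
    proof -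
      obtain i j p q where ij: "x = (i, j)" "y = (p, q)" by (cases x; cases y)
      have e: "Z zw x * W zw y = A i p * C j q * (fst zw * snd zw)" if zw: "zw \<in> set (hx_factors ts)" for zw
      proof -
        let ?y1 = "eY (Suc p) (Suc (Suc p))" and ?y2 = "eY b0' (v q)" and ?x1 = "eX i (Suc i)" and ?x2 = "eX b0 (v j)"
        obtain z w where zw': "zw = (z, w)" by (cases zw)
        have y: "cyY UNIV 1 ?y1" "cyY UNIV 1 ?y2"
          by (intro cyY_eY; simp)+
        have z: "cyX (triples_verts ts) (length ts) z"
          using hx_factors_cycles zw zw' by blast
        have "cyX UNIV 1 ?x2"
          by (intro cyX_eX; simp)
        then have 1: "?y1 * ?x2 = ?x2 * ?y1"
          by (rule cyY_cyX_commute [OF _ y(1)])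
        have 2: "(?y1 * ?y2) * z = z * (?y1 * ?y2)"
          by (rule cyY_cyX_commute [OF z cyY_mult [OF y]])
        have "A i p * C j q * (z * w) = ?x1 * (?y1 * ?x2) * ?y2 * (z * w)"
          unfolding A_def C_def by (simp only: mult.assoc)
        also have "\<dots> = ?x1 * ?x2 * ((?y1 * ?y2) * z) * w"
          unfolding 1 by (simp only: mult.assoc)
        also have "\<dots> = (?x1 * ?x2 * z) * (?y1 * ?y2 * w)"
          unfolding 2 by (simp only: mult.assoc)
        finally show ?thesis
          by (simp only: Z_def W_def zw' ij prod.case fst_conv snd_conv)
      qed
      have "P x y = A i p * C j q * (\<Sum>zw\<leftarrow>hx_factors ts. fst zw * snd zw)"
        by (simp add: P_def ij hprod_hx_factors case_prod_unfold)
      also have "\<dots> = (\<Sum>zw\<leftarrow>hx_factors ts. A i p * C j q * (fst zw * snd zw))"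
        by (rule sum_list_const_mult [symmetric])
      also have "\<dots> = (\<Sum>zw\<leftarrow>hx_factors ts. Z zw x * W zw y)"
        by (rule arg_cong [where f = sum_list], rule map_cong) (simp_all add: e)
      finally have "\<theta> (P x y) = \<theta> (sum_list (map (\<lambda>zw. Z zw x * W zw y) (hx_factors ts)))"
        by simp
      also have "\<dots> = (\<Sum>zw\<leftarrow>hx_factors ts. \<theta> (Z zw x * W zw y))"
      proof -
        have admissible: "admissible Q" if "Q \<in> set (map (\<lambda>zw. Z zw x * W zw y) (hx_factors ts))" for Q
          using that admissible_cycles [OF Z [OF _ xy(1)] W [OF _ xy(2)]] by (simp only: set_map) blast
        show ?thesis
          using conjunct1 [OF \<theta>_sum_list [OF admissible]] by (simp only: map_map o_def)
      qed
      finally show ?thesis ..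
    qed
    ultimately show ?thesis
      by (rule rank_le_cong) 
  qed
  then have "card ?\<Omega> \<le> 2 * (length (hx_factors ts) * b) + 2 * m"
    using zero tour by (intro rank_le_lower_bound [where c = c and B = "\<lambda>x y. \<theta> (P x y)"]) (simp_all add: mem_Times_iff)
  \<comment> \<open>One factor \<open>2\<close> is the cost of symmetrization, the others come from
    the triples.\<close>
  moreover have "2 * 2 ^ (k - 1) = (2 :: nat) ^ k"
    using k by (simp flip: power_Suc)
  ultimately show ?thesis
    using ts(3) by (simp add: length_hx_factors mult.assoc [symmetric] del: mult_Suc)
qed

end

section \<open>From the rank inequality to the numerical bounds\<close>

section \<open>The main theorem\<close>

lemma embedding_bound:
  fixes M :: "'a topology"
  assumes M: "pl_manifold (2 * k) M \<A>" and emb: "pl_embeds (simplex_skeleton N k) M \<A>"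
    and k: "1 \<le> k" "k \<le> N" and b: "mod2_betti k M = enat b"
    and N: "m + 4 + n + 3 * (k - 1) \<le> Suc N"
  shows "m * n \<le> 2 ^ k * b + 2 * m"
proof -
  let ?S = "simplex_skeleton N k"
  let ?K = "subtopology RR ?S"
  have Haus: "Hausdorff_space M" and atlas: "pl_atlas (2 * k) M \<A>"
    using M by (auto simp: pl_manifold_def)
  obtain f where "embedding_map ?K M f"
    using emb by (auto simp: pl_embeds_def pl_embedding_def)
  then have "homeomorphic_map ?K (subtopology M (f ` topspace ?K)) f"
    by (simp add: embedding_map_def)
  then have f: "continuous_map ?K M f" and f_inj: "inj_on f ?S"
    using homeomorphic_imp_continuous_map homeomorphic_imp_injective_map
    by (fastforce simp: continuous_map_in_subtopology)+
  have comp: "compact_space ?K"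
    by (simp add: compact_space_subtopology compactin_simplex_skeleton)
  have "compactin ?K ?S"
    using comp by (simp add: compact_space_def)
  then have "compactin M (f ` ?S)"
    by (rule image_compactin [OF _ f])
  then obtain g where g: "continuous_map M M g" "inj_on g (topspace M)"
      "\<forall>y\<in>f ` ?S. \<exists>U \<phi>. interior_chart (2 * k) M U \<phi> \<and> g y \<in> U"
    using k by (rule_tac push_into_interior [OF Haus atlas]) auto
  define F where "F = g \<circ> f"
  have F: "continuous_map ?K M F"
    unfolding F_def by (rule continuous_map_compose [OF f g(1)])
  have fM: "f ` ?S \<subseteq> topspace M"
    using continuous_map_image_subset_topspace [OF f] by simp
  have F_inj: "inj_on F ?S"
    unfolding F_def by (rule comp_inj_on [OF f_inj inj_on_subset [OF g(2) fM]])
  have int: "\<exists>U \<phi>. interior_chart (2 * k) M U \<phi> \<and> F p \<in> U" if "p \<in> ?S" for p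
    using g(3) that by (simp add: F_def)
  obtain \<delta> where \<delta>: "local_degree (2 * k) point (2 * k) \<delta>"
    using local_degree_exists [of "2 * k" "2 * k" point] by blast
  obtain t where t: "additive_on (2 * k) (prod_topology M ?K) UNIV (offdiag M ?K F) t"
    "\<And>U \<phi> c. interior_chart (2 * k) M U \<phi> \<Longrightarrow>
       rz (2 * k) (prod_topology M ?K) (U \<times> {s \<in> topspace ?K. F s \<in> U}) ((U \<times> {s \<in> topspace ?K. F s \<in> U}) \<inter> offdiag M ?K F) c \<Longrightarrow>
       t c = \<delta> (push (2 * k) forget (push (2 * k) (chartdiff \<phi> F) c))"
    using k int by (rule_tac intersection_functional_exists [OF Haus F comp _ _ \<delta>]) auto
  interpret skeleton_embedding M N k F t \<delta>
  proof
    show "0 \<le> p i \<and> p i \<le> 1" if "p \<in> ?S" for p i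
      using that by (auto simp: simplex_skeleton_def standard_simplex_def)
  qed (use F F_inj int \<delta> t k in blast)+
  show ?thesis
    by (rule betti_bound [OF b N])
qed

lemma betti_lower_bound:
  fixes M :: "'a topology"
  assumes k: "1 \<le> k" and n: "5 * k + 3 \<le> n"
    and M: "pl_manifold (2 * k) M \<A>" and emb: "pl_embeds (simplex_skeleton n k) M \<A>"
  shows "ereal ((real n - 4 * real k - 2)^2 / (2 ^ k * (real k + 1)^2)) \<le> ereal_of_enat (mod2_betti k M)"
proof (cases "mod2_betti k M")
  case (enat b)
  \<comment> \<open>The vertex count allows \<open>m\<close> pairs and \<open>n - 3 * k - m\<close>
    partners, which is \<open>s - m + 2\<close>. The two extra partners absorb the loss
    \<open>2 * m\<close>, and the remaining \<open>m * (s - m)\<close> is largest for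
    \<open>m\<close> about half of \<open>s\<close>.\<close>
  define s where "s = n - 3 * k - 2"
  define m where "m = s div 2"
  have s: "m + (s - m + 2) + 3 * k + 0 = n" "m \<le> s"
    using n by (auto simp: s_def m_def)
  have "m * (s - m + 2) \<le> 2 ^ k * b + 2 * m"
    using n k s by (intro embedding_bound [OF M emb k _ enat]) auto
  then have 1: "m * (s - m) \<le> 2 ^ k * b"
    by (simp add: algebra_simps)
  \<comment> \<open>The \<open>1\<close> is the loss for odd \<open>s\<close>.\<close>
  have 2: "s ^ 2 \<le> 4 * (m * (s - m)) + 1"
  proof (cases "even s")
    case True
    then obtain u where "s = 2 * u" by (elim evenE)
    then show ?thesis by (simp add: m_def power2_eq_square)
  next
    case False
    then obtain u where "s = 2 * u + 1" by (elim oddE)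
    then show ?thesis by (simp add: m_def power2_eq_square algebra_simps)
  qed
  have 3: "real s ^ 2 - 1 \<le> 4 * (2 ^ k * real b)"
  proof -
    have "s ^ 2 \<le> 4 * (2 ^ k * b) + 1"
      using 1 2 by linarith
    then have "real (s ^ 2) \<le> real (4 * (2 ^ k * b) + 1)"
      by (rule of_nat_mono)
    then show ?thesis by simp
  qed
  \<comment> \<open>As \<open>1 \<le> k\<close>, passing from \<open>s\<close> to
    \<open>s - k\<close> costs at least the \<open>1\<close> lost by parity;
    \<open>5 * k + 3 \<le> n\<close> makes \<open>s - k\<close> nonnegative.\<close>
  have 4: "(real s - real k) ^ 2 \<le> real s ^ 2 - 1"
  proof -
    have "1 \<le> real k" "1 \<le> real s" "0 \<le> real s - real k"
      using k n by (simp_all add: s_def)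
    then have "(real s - real k) ^ 2 \<le> (real s - 1) ^ 2"
      by (intro power_mono) auto
    also have "\<dots> \<le> real s ^ 2 - 1"
      using \<open>1 \<le> real s\<close> by (simp add: power2_eq_square algebra_simps)
    finally show ?thesis .
  qed
  \<comment> \<open>Here \<open>4\<close> is replaced by the constant of the statement; for
    \<open>k = 1\<close> they are equal.\<close>
  have 5: "4 * (2 ^ k * real b) \<le> (real k + 1) ^ 2 * (2 ^ k * real b)"
  proof (rule mult_right_mono)
    have "(2::real) ^ 2 \<le> (real k + 1) ^ 2"
      using k by (intro power_mono) auto
    then show "4 \<le> (real k + 1) ^ 2" by simp
  qed simp
  have "real n - 4 * real k - 2 = real s - real k"
    using n by (simp add: s_def of_nat_diff)
  then have "(real n - 4 * real k - 2) ^ 2 \<le> (real k + 1) ^ 2 * (2 ^ k * real b)"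
    using order_trans [OF order_trans [OF 4 3] 5] by (simp only:)
  also have "\<dots> = real b * (2 ^ k * (real k + 1) ^ 2)"
    by simp
  finally have "(real n - 4 * real k - 2) ^ 2 \<le> real b * (2 ^ k * (real k + 1) ^ 2)" .
  then have "(real n - 4 * real k - 2) ^ 2 / (2 ^ k * (real k + 1) ^ 2) \<le> real b"
    by (subst pos_divide_le_eq) auto
  then show ?thesis
    by (simp add: enat)
qed simp

theorem theorem1p1:
  fixes k :: nat
  assumes "k \<ge> 1"
  shows "(\<forall>n::nat. n \<ge> 5 * k + 3 \<longrightarrow>
           (\<forall>(M :: 'a topology) \<A>.
              pl_manifold (2 * k) M \<A> \<and> pl_embeds (simplex_skeleton n k) M \<A> \<longrightarrow>
              ereal_of_enat (mod2_betti k M) \<ge>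
                ereal ((real n - 4 * real k - 2)^2 / (2 ^ k * (real k + 1)^2))))
       \<and>
         (\<forall>\<epsilon>::real. \<epsilon> > 0 \<longrightarrow>
           (\<forall>\<^sub>F n::nat in sequentially.
             (\<forall>(M :: 'a topology) \<A>.
                pl_manifold (2 * k) M \<A> \<and> pl_embeds (simplex_skeleton n k) M \<A> \<longrightarrow>
                ereal_of_enat (mod2_betti k M) \<ge>
                  ereal ((1 - \<epsilon>) * ((real n)^2 / (2 ^ k * (real k + 1)^2))))))"
proof (intro conjI allI impI)
  fix n :: nat and M :: "'a topology" and \<A>
  assume "5 * k + 3 \<le> n" "pl_manifold (2 * k) M \<A> \<and> pl_embeds (simplex_skeleton n k) M \<A>"
  then show "ereal ((real n - 4 * real k - 2)^2 / (2 ^ k * (real k + 1)^2)) \<le> ereal_of_enat (mod2_betti k M)"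
    by (intro betti_lower_bound assms) auto
next
  fix \<epsilon> :: real assume \<epsilon>: "0 < \<epsilon>"
  define c where "c = 4 * real k + 2"
  \<comment> \<open>From \<open>n \<ge> 2 * c / \<epsilon>\<close> on, the linear term
    \<open>2 * c * n\<close> of \<open>(n - c) ^ 2\<close> is at most
    \<open>\<epsilon> * n ^ 2\<close>.\<close>
  define n0 where "n0 = max (5 * k + 3) (nat \<lceil>2 * c / \<epsilon>\<rceil>)"
  show "\<forall>\<^sub>F n::nat in sequentially. \<forall>(M :: 'a topology) \<A>.
      pl_manifold (2 * k) M \<A> \<and> pl_embeds (simplex_skeleton n k) M \<A> \<longrightarrow>
      ereal ((1 - \<epsilon>) * ((real n)^2 / (2 ^ k * (real k + 1)^2))) \<le> ereal_of_enat (mod2_betti k M)"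
  proof (rule eventually_sequentiallyI [of n0], intro allI impI)
    fix n :: nat and M :: "'a topology" and \<A>
    assume n: "n0 \<le> n" and M: "pl_manifold (2 * k) M \<A> \<and> pl_embeds (simplex_skeleton n k) M \<A>"
    have "2 * c / \<epsilon> \<le> real n"
      using n by (simp add: n0_def)
    then have "2 * c \<le> \<epsilon> * real n"
      using \<epsilon> by (simp add: pos_divide_le_eq mult.commute)
    then have "2 * c * real n \<le> \<epsilon> * real n * real n"
      by (intro mult_right_mono) auto
    moreover have "(real n - c) ^ 2 = real n ^ 2 - 2 * c * real n + c ^ 2" "(1 - \<epsilon>) * real n ^ 2 = real n ^ 2 - \<epsilon> * real n * real n"
      by (simp_all add: power2_eq_square algebra_simps)
    ultimately have "(1 - \<epsilon>) * real n ^ 2 \<le> (real n - c) ^ 2"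
      using zero_le_power2 [of c] by linarith
    then have "(1 - \<epsilon>) * (real n ^ 2 / (2 ^ k * (real k + 1) ^ 2)) \<le> (real n - 4 * real k - 2) ^ 2 / (2 ^ k * (real k + 1) ^ 2)"
      unfolding times_divide_eq_right by (intro divide_right_mono) (auto simp: c_def algebra_simps)
    moreover have "ereal ((real n - 4 * real k - 2) ^ 2 / (2 ^ k * (real k + 1) ^ 2)) \<le> ereal_of_enat (mod2_betti k M)"
      using n M by (intro betti_lower_bound assms) (auto simp: n0_def)
    ultimately show "ereal ((1 - \<epsilon>) * (real n ^ 2 / (2 ^ k * (real k + 1) ^ 2))) \<le> ereal_of_enat (mod2_betti k M)"
      by (meson ereal_less_eq(3) order_trans)
  qed
qed

end
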